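(* Let $p,q\ge1$. If random matrices $X_1,\dots,X_{p+q}:\Omega\to M_{N\times N}(\mathbb{C})$ have a real second-order limit distribution $x_1,\dots,x_{p+q}$, then $$\lim_{N\to\infty}N^2K_{p,q}(X_1,\dots,X_{p+q})=\kappa_{p,q}(x_1,\dots,x_{p+q}),$$ where $K_{p,q}$ is the two-vertex cumulant and $\kappa_{p,q}$ is the real second-order free cumulant.
   Context: Random matrices have entries with finite moments of all orders; they are sequences indexed by dimension $N$ ranging over an infinite set of positive integers. $\mathrm{tr}=\frac1N\mathrm{Tr}$. $[n]=\{1,\dots,n\}$, $[m,n]=\{m,\dots,n\}$. $\#$ denotes the number of cycles of a permutation or blocks of a partition. Partitions are ordered by $\mathcal U\preceq\mathcal V$ if every block of $\mathcal U$ is contained in a block of $\mathcal V$, with join $\vee$. Limit distribution. A real second-order noncommutative probability space is a unital complex algebra $A$ with a linear involution $x\mapsto x^t$ satisfying $(xy)^t=y^tx^t$, a linear tracial $\varphi_1:A\to\mathbb{C}$ with $\varphi_1(1)=1$, $\varphi_1(x^t)=\varphi_1(x)$, and a symmetric bilinear $\varphi_2:A\times A\to\mathbb{C}$, tracial in each argument, vanishing when either argument is $1$, and unchanged when either argument $x$ is replaced by $x^t$. $X_1,\dots,X_n$ have real second-order limit distribution $x_1,\dots,x_n\in A$ if, with $X_{-k}=X_k^T$ and $x_{-k}=x_k^t$, for all words $W,W_1,W_2$ in the $X_{\pm k}$ and the same words $w,w_1,w_2$ in the $x_{\pm k}$, $\lim_N\mathbb E(\mathrm{tr}(W))=\varphi_1(w)$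 and $\lim_NN^2k_2(\mathrm{tr}(W_1),\mathrm{tr}(W_2))=\varphi_2(w_1,w_2)$, and for all $s>2$ and $Y_1,\dots,Y_s$ in the algebra generated by the $X_{\pm k}$, $\lim_NN^sk_s(\mathrm{tr}(Y_1),\dots,\mathrm{tr}(Y_s))=0$; here $k_s$ is the classical (joint) cumulant. Two-vertex cumulants. Let $\delta:k\mapsto-k$. For a finite set $I$ of positive integers, $\mathit{PM}(I)$ is the set of permutations $\pi$ of $I\cup(-I)$ with $\pi(k)=-\pi^{-1}(-k)$ and with no $k$ in the same cycle as $-k$. The cycles of $\pi$ come in pairs, each obtained from the other by reversing order and all signs; $\#(\pi)$ counts all cycles; $\Pi(\pi)$ is the partition of $I$ with one block for each pair of cycles, consisting of the absolute values of its elements. $\pi_+$ is the product of the cycles obtained by choosing from each pair the one in which the element of smallest absolute value is positive (extended by the identity), $\pi_-=\delta\pi_+^{-1}\delta$. For $\pi,\rho\in\mathit{PM}(I)$, $\mathrm{Kr}_\rho(\pi)=\rho_-^{-1}\pi^{-1}\rho_+\in\mathit{PM}(I)$ and $\chi_\rho(\pi)=\#(\rho)/2+\#(\pi)/2+\#(\mathrm{Kr}_\rho(\pi))/2-|I|$. $\mathrm{tr}_\pi(X_1,\dots,X_n)=\prod_{(c_1,\dots,c_r)}\mathrm{tr}(X_{c_1}\cdots X_{c_r})$ over the cycles of $\pi_+$. For a partition $\mathcal U$ of a set of size $n\le N$, choose pairings $\mathcal U_1,\mathcal U_2$ of $[2n]$ such that the blocks of $\mathcal U_1\vee\mathcal U_2$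 correspond bijectively to blocks of $\mathcal U$ with half as many elements; $\mathrm{Wg}(\mathcal U)$ is the $(\mathcal U_1,\mathcal U_2)$ entry of the inverse of the matrix $[N^{\#(\mathcal V_1\vee\mathcal V_2)}]_{\mathcal V_1,\mathcal V_2}$ indexed by pairings of $[2n]$ (independent of the choice), and $\mathrm{wg}(\mathcal U)=N^{2n-\#(\mathcal U)}\mathrm{Wg}(\mathcal U)$. For $\rho\in\mathit{PM}(I)$ the matrix cumulant is $c_\rho=\sum_{\pi\in\mathit{PM}(I)}N^{\chi_\rho(\pi)-\#(\rho)}\mathrm{wg}(\Pi(\mathrm{Kr}_\rho(\pi)))\,\mathbb E(\mathrm{tr}_\pi(X_1,X_2,\dots))$. For a permutation $\sigma$ of $I$, $c_\sigma$ means $c_{\sigma\delta\sigma^{-1}\delta}$. Then (for $N\ge p+q$) $$K_{p,q}(X_1,\dots,X_{p+q})=c_{(1,\dots,p)(p+1,\dots,p+q)}-c_{(1,\dots,p)}\,c_{(p+1,\dots,p+q)},$$ all evaluated at $X_1,\dots,X_{p+q}$. It is a known result (Collins, Śniady) that for partitions $\mathcal U\preceq\mathcal W$, $\sum_{\mathcal U\preceq\mathcal X\preceq\mathcal W}\mu_{\mathcal P}(\mathcal X,\mathcal W)\prod_{X\in\mathcal X}\mathrm{wg}(\mathcal U|_X)=\gamma_{\mathcal U,\mathcal W}N^{-2(\#(\mathcal U)-\#(\mathcal W))}+O(N^{-2(\#(\mathcal U)-\#(\mathcal W))-1})$, where $\mathcal U|_X$ is the restriction of $\mathcal U$ to $X$,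 $\mu_{\mathcal P}$ is the Möbius function of the partition lattice and $\gamma_{\mathcal U,\mathcal V}=\prod_{V\in\mathcal V}(-1)^{|V|-\#(\mathcal U|_V)}\frac{2^{2\#(\mathcal U|_V)-1}(2|V|+\#(\mathcal U|_V)-3)!}{(2|V|)!}\prod_{U\in\mathcal U|_V}\frac{(2|U|-1)!}{((|U|-1)!)^2}$. Real second-order free cumulants. For a permutation $\pi$ of a subset of $[n]$, $\Pi(\pi)$ is its cycle partition. Let $\tau_n=(1,\dots,n)$ and $\tau_{p,q}=(1,\dots,p)(p+1,\dots,p+q)$. - $S_{\mathrm{nc}}(n)$: permutations $\pi$ of $[n]$ with $\#(\pi)+\#(\pi^{-1}\tau_n)=n+1$. - $S_{\mathrm{disc-nc}}(p,q)$: permutations $\pi$ of $[p+q]$ with $\Pi(\pi)\preceq\Pi(\tau_{p,q})$ and $\#(\pi)+\#(\pi^{-1}\tau_{p,q})=p+q+2$. - $S_{\mathrm{ann-nc}}(p,q)$: permutations $\pi$ of $[p+q]$ such that some cycle of $\pi$ meets both $[p]$ and $[p+1,p+q]$, and $\#(\pi)+\#(\pi^{-1}\tau_{p,q})=p+q$. - $\mathit{PS}'(p,q)$: pairs $(\mathcal U,\pi)$ with $\pi\in S_{\mathrm{disc-nc}}(p,q)$ and $\mathcal U\succeq\Pi(\pi)$ a partition of $[p+q]$ each of whose blocks is a single cycle of $\pi$, except for one block $U$ (the nontrivial block) which is the union of exactly two cycles of $\pi$, one in $[p]$ and the other in $[p+1,p+q]$. The free cumulants $\kappa_n:A^n\to\mathbb{C}$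 are determined recursively by $\varphi_1(x_1\cdots x_n)=\sum_{\pi\in S_{\mathrm{nc}}(n)}\kappa_\pi(x_1,\dots,x_n)$, where $\kappa_\pi(x_1,\dots,x_n)=\prod_{(c_1,\dots,c_k)}\kappa_k(x_{c_1},\dots,x_{c_k})$ over the cycles of $\pi$, each written starting from its smallest element. The real second-order free cumulants $\kappa_{p,q}:A^{p+q}\to\mathbb{C}$ are the multilinear functionals determined recursively by $$\varphi_2(x_1\cdots x_p,\,y_1\cdots y_q)=\sum_{\pi\in S_{\mathrm{ann-nc}}(p,q)}\kappa_\pi(x_1,\dots,x_p,y_1,\dots,y_q)+\sum_{\pi\in S_{\mathrm{ann-nc}}(p,q)}\kappa_\pi(x_1,\dots,x_p,y_q^t,\dots,y_1^t)+\sum_{(\mathcal U,\pi)\in\mathit{PS}'(p,q)}\kappa_{(\mathcal U,\pi)}(x_1,\dots,x_p,y_1,\dots,y_q),$$ where, if $U$ is the nontrivial block of $\mathcal U$ and $\pi|_U=(c_1,\dots,c_r)(p+d_1,\dots,p+d_s)$ (cycles starting from smallest elements), $\kappa_{(\mathcal U,\pi)}(x_1,\dots,x_p,y_1,\dots,y_q)=\kappa_{\pi|_{[p+q]\setminus U}}(x_1,\dots,x_p,y_1,\dots,y_q)\,\kappa_{r,s}(x_{c_1},\dots,x_{c_r},y_{d_1},\dots,y_{d_s})$.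
   Formalization: The stated π₋=δπ₊⁻¹δ makes Kr_ρ(π)=ρ₋⁻¹π⁻¹ρ₊ fall outside PM(I), e.g. for ρ=π=(1,2,3)(−3,−2,−1), so the matrix cumulants are ill-defined; here π₋=δπ₊δ is used, giving Kr_ρ(π)=δρ₊⁻¹δπ⁻¹ρ₊, which lies in PM(I). *)

theory Defs
  imports
    "HOL-Probability.Probability"
    "HOL-Combinatorics.Orbits"
    "HOL-Combinatorics.Cycles"
    "Jordan_Normal_Form.Matrix"
begin

text \<open>
  Index sets are sets of integers, so that \<open>[n]\<close> is \<open>{1..int n}\<close> and the map \<open>\<delta>\<close> is \<open>uminus\<close>.
  Permutations are functions that are the identity off their domain and are composed from right
  to left. Since a fixed point of the permutation is a cycle, the domain \<open>S\<close> is a parameter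
  wherever cycles are counted or listed.
\<close>

section \<open>Permutations and partitions\<close>

definition cycle_blocks :: "'a set \<Rightarrow> ('a \<Rightarrow> 'a) \<Rightarrow> 'a set set" where
  "cycle_blocks S \<pi> = orbit \<pi> ` S"

definition num_cycles :: "'a set \<Rightarrow> ('a \<Rightarrow> 'a) \<Rightarrow> nat" where
  "num_cycles S \<pi> = card (cycle_blocks S \<pi>)"

definition tau1 :: "nat \<Rightarrow> int \<Rightarrow> int" where
  "tau1 n = cycle_of_list [1..int n]"

definition tau2 :: "nat \<Rightarrow> nat \<Rightarrow> int \<Rightarrow> int" where
  "tau2 p q = cycle_of_list [1..int p] \<circ> cycle_of_list [int p + 1..int (p + q)]"

text \<open>The join is the meet of all common upper bounds.\<close>

definition partition_join :: "'a set \<Rightarrow> 'a set set \<Rightarrow> 'a set set \<Rightarrow> 'a set set" where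
  "partition_join A U V = common_refinement {W. refines A U W \<and> refines A V W}"

definition pairings :: "nat \<Rightarrow> nat set set set" where
  "pairings m = {V. partition_on {1..m} V \<and> (\<forall>B\<in>V. card B = 2)}"


section \<open>The Weingarten function\<close>

definition matrix_inverse_on :: "'i set \<Rightarrow> ('i \<Rightarrow> 'i \<Rightarrow> real) \<Rightarrow> 'i \<Rightarrow> 'i \<Rightarrow> real" where
  "matrix_inverse_on S G = (THE H.
     (\<forall>i\<in>S. \<forall>j\<in>S. (\<Sum>k\<in>S. H i k * G k j) = of_bool (i = j) \<and>
                  (\<Sum>k\<in>S. G i k * H k j) = of_bool (i = j)) \<and>
     (\<forall>i j. i \<notin> S \<or> j \<notin> S \<longrightarrow> H i j = 0))"

definition Weingarten :: "nat \<Rightarrow> 'a set set \<Rightarrow> real" where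
  "Weingarten N \<U> =
     (let m = 2 * card (\<Union>\<U>);
          (V\<^sub>1, V\<^sub>2) = (SOME (V\<^sub>1, V\<^sub>2). V\<^sub>1 \<in> pairings m \<and> V\<^sub>2 \<in> pairings m \<and>
             (\<exists>b. bij_betw b (partition_join {1..m} V\<^sub>1 V\<^sub>2) \<U> \<and>
                  (\<forall>B\<in>partition_join {1..m} V\<^sub>1 V\<^sub>2. card B = 2 * card (b B))))
      in matrix_inverse_on (pairings m)
           (\<lambda>W\<^sub>1 W\<^sub>2. real N ^ card (partition_join {1..m} W\<^sub>1 W\<^sub>2)) V\<^sub>1 V\<^sub>2)"

definition wg :: "nat \<Rightarrow> 'a set set \<Rightarrow> real" where
  "wg N \<U> = real N ^ (2 * card (\<Union>\<U>) - card \<U>) * Weingarten N \<U>"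


section \<open>Premaps\<close>

definition signed_set :: "int set \<Rightarrow> int set" where
  "signed_set I = I \<union> uminus ` I"

definition PM :: "int set \<Rightarrow> (int \<Rightarrow> int) set" where
  "PM I = {\<pi>. \<pi> permutes signed_set I \<and>
               (\<forall>k\<in>signed_set I. \<pi> k = - inv_into UNIV \<pi> (- k) \<and> - k \<notin> orbit \<pi> k)}"

definition abs_partition :: "int set \<Rightarrow> (int \<Rightarrow> int) \<Rightarrow> int set set" where
  "abs_partition I \<pi> = (\<lambda>B. abs ` B) ` cycle_blocks (signed_set I) \<pi>"

text \<open>From each pair of cycles, the one whose element of smallest absolute value is positive.\<close>

definition pos_cycles :: "int set \<Rightarrow> (int \<Rightarrow> int) \<Rightarrow> int set set" where
  "pos_cycles I \<pi> = {B \<in> cycle_blocks (signed_set I) \<pi>. Min (abs ` B) \<in> B}"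

definition plus_part :: "int set \<Rightarrow> (int \<Rightarrow> int) \<Rightarrow> int \<Rightarrow> int" where
  "plus_part I \<pi> = perm_restrict \<pi> (\<Union>(pos_cycles I \<pi>))"

text \<open>
  Conventions for \<open>\<pi>\<^sub>-\<close> vary. In \<open>Kr\<^sub>\<rho>(\<pi>) = \<rho>\<^sub>-\<inverse> \<pi>\<inverse> \<rho>\<^sub>+\<close> it must be \<open>\<delta> \<pi>\<^sub>+ \<delta>\<close>, so that
  \<open>\<pi> = \<pi>\<^sub>+ \<pi>\<^sub>-\<inverse>\<close>; with \<open>\<pi>\<^sub>- = \<delta> \<pi>\<^sub>+\<inverse> \<delta>\<close> the same permutation is \<open>\<rho>\<^sub>- \<pi>\<inverse> \<rho>\<^sub>+\<close>. This is what makes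
  \<open>Kr\<close> take values in \<open>PM I\<close> (\<open>Kr_in_PM\<close> below): combining \<open>\<rho>\<^sub>-\<inverse> \<pi>\<inverse> \<rho>\<^sub>+\<close> with
  \<open>\<pi>\<^sub>- = \<delta> \<pi>\<^sub>+\<inverse> \<delta>\<close> fails already for \<open>\<rho> = \<pi> = (1,2,3)(-3,-2,-1)\<close>.
\<close>

definition minus_part :: "int set \<Rightarrow> (int \<Rightarrow> int) \<Rightarrow> int \<Rightarrow> int" where
  "minus_part I \<pi> = uminus \<circ> plus_part I \<pi> \<circ> uminus"

definition Kr :: "int set \<Rightarrow> (int \<Rightarrow> int) \<Rightarrow> (int \<Rightarrow> int) \<Rightarrow> int \<Rightarrow> int" where
  "Kr I \<rho> \<pi> = inv_into UNIV (minus_part I \<rho>) \<circ> inv_into UNIV \<pi> \<circ> plus_part I \<rho>"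

text \<open>The divisions are exact on \<open>PM I\<close>, where cycles come in pairs.\<close>

definition chi :: "int set \<Rightarrow> (int \<Rightarrow> int) \<Rightarrow> (int \<Rightarrow> int) \<Rightarrow> int" where
  "chi I \<rho> \<pi> = int (num_cycles (signed_set I) \<rho> div 2) + int (num_cycles (signed_set I) \<pi> div 2)
     + int (num_cycles (signed_set I) (Kr I \<rho> \<pi>) div 2) - int (card I)"


section \<open>Random matrices and matrix cumulants\<close>

text \<open>The family \<open>x\<^sub>1, x\<^sub>2, \<dots>\<close> extended to negative indices by \<open>x\<^sub>-\<^sub>k = t x\<^sub>k\<close>.\<close>

definition signed :: "('b \<Rightarrow> 'b) \<Rightarrow> (nat \<Rightarrow> 'b) \<Rightarrow> int \<Rightarrow> 'b" where
  "signed t x k = (if k < 0 then t (x (nat (- k))) else x (nat k))"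

definition ntr :: "complex mat \<Rightarrow> complex" where
  "ntr A = (\<Sum>i<dim_row A. A $$ (i, i)) / of_nat (dim_row A)"

definition word_mat :: "nat \<Rightarrow> (int \<Rightarrow> complex mat) \<Rightarrow> int list \<Rightarrow> complex mat" where
  "word_mat N Z w = foldr (\<lambda>k A. Z k * A) w (1\<^sub>m N)"

definition random_matrix :: "'w measure \<Rightarrow> nat \<Rightarrow> ('w \<Rightarrow> complex mat) \<Rightarrow> bool" where
  "random_matrix M N Y \<longleftrightarrow>
     (\<forall>\<omega>\<in>space M. Y \<omega> \<in> carrier_mat N N) \<and>
     (\<forall>i<N. \<forall>j<N. (\<lambda>\<omega>. Y \<omega> $$ (i, j)) \<in> borel_measurable M \<and>
        (\<forall>m::nat. integrable M (\<lambda>\<omega>. norm (Y \<omega> $$ (i, j)) ^ m)))"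

definition tr_perm :: "nat \<Rightarrow> int set \<Rightarrow> (int \<Rightarrow> int) \<Rightarrow> (nat \<Rightarrow> complex mat) \<Rightarrow> complex" where
  "tr_perm N I \<pi> Y =
     (\<Prod>B\<in>pos_cycles I \<pi>. ntr (word_mat N (signed transpose_mat Y) (support \<pi> (Min (abs ` B)))))"

definition matrix_cumulant ::
  "'w measure \<Rightarrow> nat \<Rightarrow> int set \<Rightarrow> (int \<Rightarrow> int) \<Rightarrow> (nat \<Rightarrow> 'w \<Rightarrow> complex mat) \<Rightarrow> complex" where
  "matrix_cumulant M N I \<rho> Y =
     (\<Sum>\<pi>\<in>PM I. of_real (real N powi (chi I \<rho> \<pi> - int (num_cycles (signed_set I) \<rho>))
                        * wg N (abs_partition I (Kr I \<rho> \<pi>)))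
              * (LINT \<omega>|M. tr_perm N I \<pi> (\<lambda>k. Y k \<omega>)))"

definition matrix_cumulant_perm ::
  "'w measure \<Rightarrow> nat \<Rightarrow> int set \<Rightarrow> (int \<Rightarrow> int) \<Rightarrow> (nat \<Rightarrow> 'w \<Rightarrow> complex mat) \<Rightarrow> complex" where
  "matrix_cumulant_perm M N I \<sigma> =
     matrix_cumulant M N I (\<sigma> \<circ> uminus \<circ> inv_into UNIV \<sigma> \<circ> uminus)"

definition two_vertex_cumulant ::
  "'w measure \<Rightarrow> nat \<Rightarrow> nat \<Rightarrow> nat \<Rightarrow> (nat \<Rightarrow> 'w \<Rightarrow> complex mat) \<Rightarrow> complex" where
  "two_vertex_cumulant M N p q Y =
     matrix_cumulant_perm M N {1..int (p + q)} (tau2 p q) Y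
     - matrix_cumulant_perm M N {1..int p} (tau1 p) Y
       * matrix_cumulant_perm M N {int p + 1..int (p + q)}
           (cycle_of_list [int p + 1..int (p + q)]) Y"


section \<open>Second-order limit distributions\<close>

locale real_second_order_ncps = vector_space scale
  for scale :: "complex \<Rightarrow> 'a::ring_1 \<Rightarrow> 'a" +
  fixes tp :: "'a \<Rightarrow> 'a"
    and \<phi>\<^sub>1 :: "'a \<Rightarrow> complex"
    and \<phi>\<^sub>2 :: "'a \<Rightarrow> 'a \<Rightarrow> complex"
  assumes scale_mult_left: "scale r a * b = scale r (a * b)"
    and scale_mult_right: "a * scale r b = scale r (a * b)"
    and tp_linear: "Vector_Spaces.linear scale scale tp"
    and tp_tp: "tp (tp a) = a"
    and tp_mult: "tp (a * b) = tp b * tp a"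
    and phi1_linear: "Vector_Spaces.linear scale (*) \<phi>\<^sub>1"
    and phi1_tracial: "\<phi>\<^sub>1 (a * b) = \<phi>\<^sub>1 (b * a)"
    and phi1_one: "\<phi>\<^sub>1 1 = 1"
    and phi1_tp: "\<phi>\<^sub>1 (tp a) = \<phi>\<^sub>1 a"
    and phi2_sym: "\<phi>\<^sub>2 a b = \<phi>\<^sub>2 b a"
    and phi2_linear_left: "Vector_Spaces.linear scale (*) (\<lambda>a. \<phi>\<^sub>2 a b)"
    and phi2_linear_right: "Vector_Spaces.linear scale (*) (\<lambda>b. \<phi>\<^sub>2 a b)"
    and phi2_tracial_left: "\<phi>\<^sub>2 (a * b) c = \<phi>\<^sub>2 (b * a) c"
    and phi2_tracial_right: "\<phi>\<^sub>2 c (a * b) = \<phi>\<^sub>2 c (b * a)"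
    and phi2_one_left: "\<phi>\<^sub>2 1 b = 0"
    and phi2_one_right: "\<phi>\<^sub>2 a 1 = 0"
    and phi2_tp_left: "\<phi>\<^sub>2 (tp a) b = \<phi>\<^sub>2 a b"
    and phi2_tp_right: "\<phi>\<^sub>2 a (tp b) = \<phi>\<^sub>2 a b"

definition joint_cumulant :: "'w measure \<Rightarrow> ('w \<Rightarrow> complex) list \<Rightarrow> complex" where
  "joint_cumulant M Ys =
     (\<Sum>P | partition_on {..<length Ys} P.
        (- 1) ^ (card P - 1) * fact (card P - 1) * (\<Prod>B\<in>P. LINT \<omega>|M. (\<Prod>i\<in>B. (Ys ! i) \<omega>)))"

text \<open>
  Elements of the algebra generated by random matrices are sequences indexed by the dimension,
  with the same noncommutative polynomial in every dimension.
\<close>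

inductive_set generated_algebra ::
  "(nat \<Rightarrow> 'w \<Rightarrow> complex mat) set \<Rightarrow> (nat \<Rightarrow> 'w \<Rightarrow> complex mat) set"
  for G :: "(nat \<Rightarrow> 'w \<Rightarrow> complex mat) set" where
  gen: "Y \<in> G \<Longrightarrow> Y \<in> generated_algebra G"
| one: "(\<lambda>N \<omega>. 1\<^sub>m N) \<in> generated_algebra G"
| add: "Y \<in> generated_algebra G \<Longrightarrow> Z \<in> generated_algebra G \<Longrightarrow>
        (\<lambda>N \<omega>. Y N \<omega> + Z N \<omega>) \<in> generated_algebra G"
| mult: "Y \<in> generated_algebra G \<Longrightarrow> Z \<in> generated_algebra G \<Longrightarrow>
         (\<lambda>N \<omega>. Y N \<omega> * Z N \<omega>) \<in> generated_algebra G"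
| scale: "Y \<in> generated_algebra G \<Longrightarrow> (\<lambda>N \<omega>. c \<cdot>\<^sub>m Y N \<omega>) \<in> generated_algebra G"

abbreviation along :: "nat set \<Rightarrow> nat filter" where
  "along D \<equiv> inf sequentially (principal D)"

text \<open>
  \<open>X k N\<close> is the matrix \<open>X\<^sub>k\<close> in dimension \<open>N \<in> D\<close>, a random variable on the
  probability space \<open>M N\<close>.
\<close>

definition has_real_second_order_limit ::
  "nat set \<Rightarrow> (nat \<Rightarrow> 'w measure) \<Rightarrow> nat \<Rightarrow> (nat \<Rightarrow> nat \<Rightarrow> 'w \<Rightarrow> complex mat) \<Rightarrow>
   ('a::monoid_mult \<Rightarrow> 'a) \<Rightarrow> ('a \<Rightarrow> complex) \<Rightarrow> ('a \<Rightarrow> 'a \<Rightarrow> complex) \<Rightarrow> (nat \<Rightarrow> 'a) \<Rightarrow> bool" where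
  "has_real_second_order_limit D M n X tp \<phi>\<^sub>1 \<phi>\<^sub>2 x \<longleftrightarrow>
     (let L = signed_set {1..int n};
          X' = (\<lambda>k N \<omega>. signed transpose_mat (\<lambda>j. X j N \<omega>) k);
          W = (\<lambda>w N \<omega>. ntr (word_mat N (\<lambda>k. X' k N \<omega>) w));
          ev = (\<lambda>w. prod_list (map (signed tp x) w))
      in (\<forall>w\<in>lists L. ((\<lambda>N. LINT \<omega>|M N. W w N \<omega>) \<longlongrightarrow> \<phi>\<^sub>1 (ev w)) (along D)) \<and>
         (\<forall>w\<^sub>1\<in>lists L. \<forall>w\<^sub>2\<in>lists L.
            ((\<lambda>N. of_nat N ^ 2 * joint_cumulant (M N) [W w\<^sub>1 N, W w\<^sub>2 N])
               \<longlongrightarrow> \<phi>\<^sub>2 (ev w\<^sub>1) (ev w\<^sub>2)) (along D)) \<and>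
         (\<forall>Ys\<in>lists (generated_algebra (X' ` L)). length Ys > 2 \<longrightarrow>
            ((\<lambda>N. of_nat N ^ length Ys * joint_cumulant (M N) (map (\<lambda>Y \<omega>. ntr (Y N \<omega>)) Ys))
               \<longlongrightarrow> 0) (along D)))"


section \<open>Noncrossing permutations\<close>

definition S_nc :: "nat \<Rightarrow> (int \<Rightarrow> int) set" where
  "S_nc n = {\<pi>. \<pi> permutes {1..int n} \<and>
     num_cycles {1..int n} \<pi> + num_cycles {1..int n} (inv_into UNIV \<pi> \<circ> tau1 n) = n + 1}"

definition S_disc_nc :: "nat \<Rightarrow> nat \<Rightarrow> (int \<Rightarrow> int) set" where
  "S_disc_nc p q = {\<pi>. \<pi> permutes {1..int (p + q)} \<and>
     refines {1..int (p + q)} (cycle_blocks {1..int (p + q)} \<pi>)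
       (cycle_blocks {1..int (p + q)} (tau2 p q)) \<and>
     num_cycles {1..int (p + q)} \<pi>
       + num_cycles {1..int (p + q)} (inv_into UNIV \<pi> \<circ> tau2 p q) = p + q + 2}"

definition S_ann_nc :: "nat \<Rightarrow> nat \<Rightarrow> (int \<Rightarrow> int) set" where
  "S_ann_nc p q = {\<pi>. \<pi> permutes {1..int (p + q)} \<and>
     (\<exists>C\<in>cycle_blocks {1..int (p + q)} \<pi>.
        C \<inter> {1..int p} \<noteq> {} \<and> C \<inter> {int p + 1..int (p + q)} \<noteq> {}) \<and>
     num_cycles {1..int (p + q)} \<pi>
       + num_cycles {1..int (p + q)} (inv_into UNIV \<pi> \<circ> tau2 p q) = p + q}"

definition PS' :: "nat \<Rightarrow> nat \<Rightarrow> (int set set \<times> (int \<Rightarrow> int)) set" where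
  "PS' p q = {(\<U>, \<pi>). \<pi> \<in> S_disc_nc p q \<and>
     refines {1..int (p + q)} (cycle_blocks {1..int (p + q)} \<pi>) \<U> \<and>
     (\<exists>C\<in>cycle_blocks {1..int (p + q)} \<pi>. \<exists>D\<in>cycle_blocks {1..int (p + q)} \<pi>.
        C \<subseteq> {1..int p} \<and> D \<subseteq> {int p + 1..int (p + q)} \<and>
        C \<union> D \<in> \<U> \<and> \<U> - {C \<union> D} \<subseteq> cycle_blocks {1..int (p + q)} \<pi>)}"

definition nontrivial_block :: "int set set \<Rightarrow> (int \<Rightarrow> int) \<Rightarrow> int set" where
  "nontrivial_block \<U> \<pi> = (THE U. U \<in> \<U> \<and> U \<notin> cycle_blocks (\<Union>\<U>) \<pi>)"


section \<open>Cycles of noncrossing permutations\<close>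

lemma length_support:
  assumes "permutation \<pi>"
  shows "length (support \<pi> a) = card (orbit \<pi> a)"
proof -
  have "set (support \<pi> a) = orbit \<pi> a"
    using support_set[OF assms] orbit_altdef_permutation[OF assms] by (auto simp: image_def)
  then show ?thesis
    using distinct_card[OF cycle_of_permutation[OF assms, of a]] by simp
qed

lemma cycle_blocks_block:
  assumes "\<pi> permutes S" "permutation \<pi>" "finite S" "C \<in> cycle_blocks S \<pi>"
  shows "C \<subseteq> S" "C \<noteq> {}" "finite C" "c \<in> C \<Longrightarrow> orbit \<pi> c = C"
proof -
  obtain a where a: "a \<in> S" "C = orbit \<pi> a"
    using assms(4) by (auto simp: cycle_blocks_def)
  have cyc: "cyclic_on \<pi> C"
    unfolding a(2) using assms(2) by (rule cyclic_on_orbit')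
  show "C \<subseteq> S" using a permutes_orbit_subset[OF assms(1)] by blast
  then show "finite C" using assms(3) finite_subset by blast
  show "C \<noteq> {}" using a permutation_self_in_orbit[OF assms(2)] by blast
  show "c \<in> C \<Longrightarrow> orbit \<pi> c = C"
    using orbit_cyclic_eq3[OF cyc] .
qed

lemma length_support_Min:
  assumes "\<pi> permutes S" "finite S" "C \<in> cycle_blocks S (\<pi> :: int \<Rightarrow> int)"
  shows "length (support \<pi> (Min C)) = card C"
proof -
  have p: "permutation \<pi>" using assms permutation_permutes by blast
  have "Min C \<in> C"
    using cycle_blocks_block[OF assms(1) p assms(2,3)] by simp
  then show ?thesis
    using length_support[OF p, of "Min C"] cycle_blocks_block(4)[OF assms(1) p assms(2,3)] by simp
qed

lemma partition_on_cycle_blocks: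
  assumes "\<pi> permutes S" "finite S"
  shows "partition_on S (cycle_blocks S \<pi>)"
proof -
  have p: "permutation \<pi>" using assms permutation_permutes by blast
  note * = cycle_blocks_block[OF assms(1) p assms(2)]
  show ?thesis
  proof (rule partition_onI)
    show "\<Union>(cycle_blocks S \<pi>) = S"
    proof
      show "\<Union>(cycle_blocks S \<pi>) \<subseteq> S" using *(1) by blast
      show "S \<subseteq> \<Union>(cycle_blocks S \<pi>)"
        using permutation_self_in_orbit[OF p] by (auto simp: cycle_blocks_def)
    qed
    show "disjnt C D" if "C \<in> cycle_blocks S \<pi>" "D \<in> cycle_blocks S \<pi>" "C \<noteq> D" for C D
      using *(4)[OF that(1)] *(4)[OF that(2)] that(3) by (auto simp: disjnt_iff)
    show "{} \<notin> cycle_blocks S \<pi>" using *(2) by blast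
  qed
qed

lemma num_cycles_eq_card_imp_id:
  assumes "\<pi> permutes S" "finite S" "num_cycles S \<pi> = card S"
  shows "\<pi> = id"
proof
  fix x
  have p: "permutation \<pi>" using assms permutation_permutes by blast
  have inj: "inj_on (orbit \<pi>) S"
    using assms(2,3) unfolding num_cycles_def cycle_blocks_def by (simp add: eq_card_imp_inj_on)
  show "\<pi> x = id x"
  proof (cases "x \<in> S")
    case True
    moreover have "\<pi> x \<in> S" using True assms(1) by (simp add: permutes_in_image)
    moreover have "orbit \<pi> (\<pi> x) = orbit \<pi> x"
      using permutation_orbit_step[OF p] .
    ultimately show ?thesis using inj by (auto dest: inj_onD)
  next
    case False
    then show ?thesis using assms(1) by (simp add: permutes_not_in)
  qed
qed

lemma complement_full_imp_eq:
  assumes "\<pi> permutes S" "\<tau> permutes S" "finite S"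
    and "num_cycles S (inv_into UNIV \<pi> \<circ> \<tau>) = card S"
  shows "\<pi> = \<tau>"
proof -
  have "inv_into UNIV \<pi> \<circ> \<tau> permutes S"
    by (rule permutes_compose[OF assms(2) permutes_inv[OF assms(1)]])
  then have "inv_into UNIV \<pi> \<circ> \<tau> = id"
    using num_cycles_eq_card_imp_id assms(3,4) by blast
  then have "\<pi> \<circ> (inv_into UNIV \<pi> \<circ> \<tau>) = \<pi>" by simp
  then show ?thesis
    using permutes_inv_o(1)[OF assms(1)] by (simp add: o_assoc)
qed

lemma tau1_permutes: "tau1 n permutes {1..int n}"
  using cycle_permutes[of "[1..int n]"] by (simp add: tau1_def)

lemma tau2_permutes: "tau2 p q permutes {1..int (p + q)}"
proof -
  have 1: "cycle_of_list [1..int p] permutes {1..int (p + q)}"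
    by (rule permutes_subset[OF cycle_permutes]) auto
  have 2: "cycle_of_list [int p + 1..int (p + q)] permutes {1..int (p + q)}"
    by (rule permutes_subset[OF cycle_permutes]) auto
  show ?thesis unfolding tau2_def by (rule permutes_compose[OF 2 1])
qed

lemma S_nc_cycle_length:
  assumes "\<pi> \<in> S_nc n - {tau1 n}" "C \<in> cycle_blocks {1..int n} \<pi>"
  shows "length (support \<pi> (Min C)) < n"
proof -
  have perm: "\<pi> permutes {1..int n}" using assms by (auto simp: S_nc_def)
  have p: "permutation \<pi>" using perm permutation_permutes by blast
  note bl = cycle_blocks_block[OF perm p _ assms(2)]
  have "card C \<noteq> n"
  proof
    assume n: "card C = n"
    then have C: "C = {1..int n}" using bl(1) card_subset_eq[of "{1..int n}" C] by simp
    have "n \<noteq> 0" using C bl(2) by auto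
    then have "cycle_blocks {1..int n} \<pi> = {C}"
      using bl(4) C unfolding cycle_blocks_def by (auto simp: image_constant_conv)
    then have "num_cycles {1..int n} (inv_into UNIV \<pi> \<circ> tau1 n) = n"
      using assms(1) by (auto simp: S_nc_def num_cycles_def)
    then have "\<pi> = tau1 n"
      by (intro complement_full_imp_eq[OF perm tau1_permutes]) auto
    then show False using assms(1) by simp
  qed
  moreover have "card C \<le> n" using card_mono[OF _ bl(1)] by simp
  ultimately show ?thesis using length_support_Min[OF perm _ assms(2)] by simp
qed

lemma nontrivial_block_PS':
  assumes "(\<U>, \<pi>) \<in> PS' p q"
  obtains C D where "C \<in> cycle_blocks {1..int (p + q)} \<pi>" "D \<in> cycle_blocks {1..int (p + q)} \<pi>"
    "nontrivial_block \<U> \<pi> = C \<union> D"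
    "nontrivial_block \<U> \<pi> \<inter> {1..int p} = C"
    "nontrivial_block \<U> \<pi> \<inter> {int p + 1..int (p + q)} = D"
    "C \<subseteq> {1..int p}" "D \<subseteq> {int p + 1..int (p + q)}" "C \<union> D \<in> \<U>"
proof -
  let ?S = "{1..int (p + q)}"
  have perm: "\<pi> permutes ?S" using assms by (auto simp: PS'_def S_disc_nc_def)
  have p: "permutation \<pi>" using perm permutation_permutes by blast
  have part: "partition_on ?S \<U>" using assms by (auto simp: PS'_def refines_def)
  obtain C D where CD: "C \<in> cycle_blocks ?S \<pi>" "D \<in> cycle_blocks ?S \<pi>"
      "C \<subseteq> {1..int p}" "D \<subseteq> {int p + 1..int (p + q)}"
      "C \<union> D \<in> \<U>" "\<U> - {C \<union> D} \<subseteq> cycle_blocks ?S \<pi>"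
    using assms unfolding PS'_def by blast
  note bl = cycle_blocks_block[OF perm p]
  have "C \<union> D \<notin> cycle_blocks ?S \<pi>"
  proof
    assume "C \<union> D \<in> cycle_blocks ?S \<pi>"
    moreover obtain c d where "c \<in> C" "d \<in> D" using bl(2) CD(1,2) by fastforce
    ultimately have "C \<union> D = C" "C \<union> D = D"
      using bl(4)[of "C \<union> D" c] bl(4)[of "C \<union> D" d] bl(4)[of C c] bl(4)[of D d] CD(1,2) by simp_all
    then have "C = D" by blast
    moreover have "C \<noteq> {}" using bl(2) CD(1) by simp
    moreover have "C \<inter> D = {}" using CD(3,4) by fastforce
    ultimately show False by blast
  qed
  moreover have "\<Union>\<U> = ?S" using part by (simp add: partition_on_def)
  ultimately have nb: "nontrivial_block \<U> \<pi> = C \<union> D"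
    unfolding nontrivial_block_def using CD(5,6) by (intro the_equality) auto
  show thesis
    by (rule that[OF CD(1,2) nb _ _ CD(3,4,5)]) (use CD(3,4) nb in fastforce)+
qed

lemma PS'_cycle_length:
  assumes "(\<U>, \<pi>) \<in> PS' p q - {({{1..int (p + q)}}, tau2 p q)}"
  defines "U \<equiv> nontrivial_block \<U> \<pi>"
  shows "length (support \<pi> (Min (U \<inter> {1..int p})))
         + length (support \<pi> (Min (U \<inter> {int p + 1..int (p + q)}))) < p + q"
proof -
  let ?S = "{1..int (p + q)}"
  have PS: "(\<U>, \<pi>) \<in> PS' p q" using assms(1) by simp
  have perm: "\<pi> permutes ?S" using PS by (auto simp: PS'_def S_disc_nc_def)
  have p: "permutation \<pi>" using perm permutation_permutes by blast
  have part: "partition_on ?S \<U>" using PS by (auto simp: PS'_def refines_def)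
  obtain C D where CD: "C \<in> cycle_blocks ?S \<pi>" "D \<in> cycle_blocks ?S \<pi>"
      "U = C \<union> D" "U \<inter> {1..int p} = C" "U \<inter> {int p + 1..int (p + q)} = D"
      "C \<subseteq> {1..int p}" "D \<subseteq> {int p + 1..int (p + q)}" "C \<union> D \<in> \<U>"
    using nontrivial_block_PS'[OF PS] unfolding U_def by metis
  have le: "card C \<le> p" "card D \<le> q"
    using card_mono[OF _ CD(6)] card_mono[OF _ CD(7)] by simp_all
  have "\<not> (card C = p \<and> card D = q)"
  proof
    assume "card C = p \<and> card D = q"
    then have C: "C = {1..int p}" and D: "D = {int p + 1..int (p + q)}"
      using CD(6,7) card_subset_eq[of "{1..int p}" C]
        card_subset_eq[of "{int p + 1..int (p + q)}" D] by simp_all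
    then have S: "C \<union> D = ?S" by auto
    have orb: "orbit \<pi> c = C" if "c \<in> C" for c
      using cycle_blocks_block(4)[OF perm p _ CD(1) that] by simp
    have orb': "orbit \<pi> c = D" if "c \<in> D" for c
      using cycle_blocks_block(4)[OF perm p _ CD(2) that] by simp
    have "cycle_blocks ?S \<pi> = {C, D}"
      using CD(1,2) orb orb' unfolding S[symmetric] cycle_blocks_def by auto
    moreover have "C \<noteq> D"
      using C D cycle_blocks_block(2)[OF perm p _ CD(1)] by fastforce
    ultimately have "num_cycles ?S \<pi> = 2" by (simp add: num_cycles_def)
    then have "num_cycles ?S (inv_into UNIV \<pi> \<circ> tau2 p q) = p + q"
      using PS by (auto simp: PS'_def S_disc_nc_def)
    then have "\<pi> = tau2 p q"
      by (intro complement_full_imp_eq[OF perm tau2_permutes]) auto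
    moreover have "\<U> = {?S}"
    proof -
      have "?S \<in> \<U>" using CD(8) S by simp
      moreover have "V = ?S" if "V \<in> \<U>" for V
      proof (rule ccontr)
        assume "V \<noteq> ?S"
        then have "disjnt V ?S"
          using part that \<open>?S \<in> \<U>\<close> by (auto simp: partition_on_def pairwise_def)
        moreover have "V \<subseteq> ?S" "V \<noteq> {}" using part that by (auto simp: partition_on_def)
        ultimately show False by (auto simp: disjnt_def)
      qed
      ultimately show ?thesis by blast
    qed
    ultimately show False using assms(1) by simp
  qed
  then have "card C + card D < p + q" using le by linarith
  then show ?thesis
    using length_support_Min[OF perm _ CD(1)] length_support_Min[OF perm _ CD(2)] CD(4,5) by simp
qed


section \<open>Free cumulants of first and second order\<close>

definition entry :: "'a list \<Rightarrow> int \<Rightarrow> 'a" where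
  "entry xs i = xs ! nat (i - 1)"

text \<open>
  The moment-cumulant relations, solved for the term of the one-block (respectively top) index;
  \<open>moment_free_cumulant\<close> and \<open>moment_second_order_free_cumulant\<close> below recover them.
\<close>

function free_cumulant :: "('a::monoid_mult \<Rightarrow> complex) \<Rightarrow> 'a list \<Rightarrow> complex" where
  "free_cumulant \<phi>\<^sub>1 xs = \<phi>\<^sub>1 (prod_list xs)
     - (\<Sum>\<pi>\<in>S_nc (length xs) - {tau1 (length xs)}.
          \<Prod>C\<in>cycle_blocks {1..int (length xs)} \<pi>.
            free_cumulant \<phi>\<^sub>1 (map (entry xs) (support \<pi> (Min C))))"
  by auto
termination
proof (relation "Wellfounded.measure (\<lambda>(\<phi>\<^sub>1, xs). length xs)", goal_cases)
  case 1
  then show ?case by (rule wf_measure)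
next
  case (2 \<phi>\<^sub>1 xs \<pi> C)
  then show ?case
    unfolding in_measure prod.case length_map[of "entry xs"] by (rule S_nc_cycle_length)
qed

declare free_cumulant.simps [simp del]

definition free_cumulant_perm ::
  "('a::monoid_mult \<Rightarrow> complex) \<Rightarrow> int set \<Rightarrow> (int \<Rightarrow> int) \<Rightarrow> 'a list \<Rightarrow> complex" where
  "free_cumulant_perm \<phi>\<^sub>1 S \<pi> xs =
     (\<Prod>C\<in>cycle_blocks S \<pi>. free_cumulant \<phi>\<^sub>1 (map (entry xs) (support \<pi> (Min C))))"

function second_order_free_cumulant ::
  "('a::monoid_mult \<Rightarrow> complex) \<Rightarrow> ('a \<Rightarrow> 'a) \<Rightarrow> ('a \<Rightarrow> 'a \<Rightarrow> complex) \<Rightarrow>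
   'a list \<Rightarrow> 'a list \<Rightarrow> complex" where
  "second_order_free_cumulant \<phi>\<^sub>1 tp \<phi>\<^sub>2 xs ys =
     (let p = length xs; q = length ys; S = {1..int (p + q)}
      in \<phi>\<^sub>2 (prod_list xs) (prod_list ys)
         - (\<Sum>\<pi>\<in>S_ann_nc p q. free_cumulant_perm \<phi>\<^sub>1 S \<pi> (xs @ ys))
         - (\<Sum>\<pi>\<in>S_ann_nc p q. free_cumulant_perm \<phi>\<^sub>1 S \<pi> (xs @ rev (map tp ys)))
         - (\<Sum>(\<U>, \<pi>)\<in>PS' p q - {({S}, tau2 p q)}.
              free_cumulant_perm \<phi>\<^sub>1 (S - nontrivial_block \<U> \<pi>) \<pi> (xs @ ys)
              * second_order_free_cumulant \<phi>\<^sub>1 tp \<phi>\<^sub>2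
                  (map (entry (xs @ ys))
                    (support \<pi> (Min (nontrivial_block \<U> \<pi> \<inter> {1..int p}))))
                  (map (entry (xs @ ys))
                    (support \<pi> (Min (nontrivial_block \<U> \<pi> \<inter> {int p + 1..int (p + q)}))))))"
  by auto
termination
proof (relation "Wellfounded.measure (\<lambda>(\<phi>\<^sub>1, tp, \<phi>\<^sub>2, xs, ys). length xs + length ys)", goal_cases)
  case 1
  then show ?case by (rule wf_measure)
next
  case (2 \<phi>\<^sub>1 tp \<phi>\<^sub>2 xs ys p q S z \<U> \<pi>)
  from 2(4,5) have "(\<U>, \<pi>) \<in> PS' p q - {({{1..int (p + q)}}, tau2 p q)}"
    unfolding 2(3) by simp
  from PS'_cycle_length[OF this] show ?case
    unfolding in_measure prod.case length_map[of "entry (xs @ ys)"] 2(1,2) .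
qed

declare second_order_free_cumulant.simps [simp del]

lemma cycle_of_list_cycle:
  assumes "distinct cs" "cs \<noteq> []" and p: "permutation h"
    and h: "\<And>x. x \<in> set cs \<Longrightarrow> h x = cycle_of_list cs x"
  shows "orbit h (hd cs) = set cs" "support h (hd cs) = cs"
proof -
  let ?f = "cycle_of_list cs"
  have f_pow: "(?f ^^ n) (hd cs) = cs ! (n mod length cs)" for n
  proof -
    have "(?f ^^ n) (hd cs) = map (?f ^^ n) cs ! 0" using assms(2) by (simp add: hd_conv_nth)
    also have "\<dots> = rotate n cs ! 0" using cyclic_rotation[OF assms(1)] by simp
    finally show ?thesis using assms(2) by (simp add: nth_rotate)
  qed
  have pow: "(h ^^ n) (hd cs) = cs ! (n mod length cs)" for n
  proof (induction n)
    case 0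
    then show ?case using assms(2) by (simp add: hd_conv_nth)
  next
    case (Suc n)
    have "cs ! (n mod length cs) \<in> set cs" using assms(2) by simp
    then have "(h ^^ Suc n) (hd cs) = ?f ((?f ^^ n) (hd cs))" using Suc h f_pow by simp
    also have "\<dots> = (?f ^^ Suc n) (hd cs)" by simp
    finally show ?case unfolding f_pow .
  qed
  show orb: "orbit h (hd cs) = set cs"
  proof -
    have "orbit h (hd cs) = {cs ! (n mod length cs) | n. True}"
      by (simp add: orbit_altdef_permutation[OF p] pow)
    also have "\<dots> = set cs"
    proof (intro equalityI subsetI)
      show "y \<in> set cs" if "y \<in> {cs ! (n mod length cs) | n. True}" for y
        using that assms(2) by auto
      fix y assume y: "y \<in> set cs"
      obtain i where "i < length cs" "y = cs ! i" using y by (auto simp: in_set_conv_nth)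
      then have "y = cs ! (i mod length cs)" by simp
      then show "y \<in> {cs ! (n mod length cs) | n. True}" by blast
    qed
    finally show ?thesis .
  qed
  have "least_power h (hd cs) = length cs"
    using length_support[OF p, of "hd cs"] orb distinct_card[OF assms(1)] by simp
  then show "support h (hd cs) = cs"
    by (intro nth_equalityI) (simp_all add: pow)
qed

lemma num_cycles_id: "num_cycles S id = card S"
proof -
  have "orbit id x = {x}" for x :: 'a by (simp add: orbit_eq_singleton_iff)
  then show ?thesis by (simp add: num_cycles_def cycle_blocks_def card_image inj_on_def)
qed

lemma map_entry: "map (entry xs) [1..int (length xs)] = xs"
  by (intro nth_equalityI) (simp_all add: entry_def)

lemma tau1_in_S_nc:
  assumes "n \<ge> 1"
  shows "tau1 n \<in> S_nc n" "cycle_blocks {1..int n} (tau1 n) = {{1..int n}}"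
    "support (tau1 n) 1 = [1..int n]"
proof -
  have p: "permutation (tau1 n)" using tau1_permutes permutation_permutes by blast
  have ne: "[1..int n] \<noteq> []" "hd [1..int n] = 1" using assms by (auto simp: upto.simps)
  have orb: "orbit (tau1 n) 1 = {1..int n}" and "support (tau1 n) 1 = [1..int n]"
    using cycle_of_list_cycle[of "[1..int n]", OF _ _ p] ne by (simp_all add: tau1_def)
  then show "support (tau1 n) 1 = [1..int n]" by simp
  have bl: "{1..int n} \<in> cycle_blocks {1..int n} (tau1 n)"
    using orb assms by (force simp: cycle_blocks_def)
  show eq: "cycle_blocks {1..int n} (tau1 n) = {{1..int n}}"
    using cycle_blocks_block(4)[OF tau1_permutes p _ bl] assms
    by (auto simp: cycle_blocks_def image_constant_conv)
  show "tau1 n \<in> S_nc n"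
    using tau1_permutes[of n] eq
    by (simp add: S_nc_def num_cycles_id permutes_inv_o(2)[OF tau1_permutes])
      (simp add: num_cycles_def)
qed

lemma finite_S_nc: "finite (S_nc n)"
  by (rule finite_subset[OF _ finite_permutations[of "{1..int n}"]]) (auto simp: S_nc_def)

theorem moment_free_cumulant:
  assumes "xs \<noteq> []"
  shows "\<phi>\<^sub>1 (prod_list xs) =
    (\<Sum>\<pi>\<in>S_nc (length xs). free_cumulant_perm \<phi>\<^sub>1 {1..int (length xs)} \<pi> xs)"
proof -
  let ?n = "length xs"
  have n: "?n \<ge> 1" using assms by (simp add: Suc_leI)
  have "Min {1..int ?n} = 1" using n by (intro Min_eqI) auto
  then have "free_cumulant_perm \<phi>\<^sub>1 {1..int ?n} (tau1 ?n) xs = free_cumulant \<phi>\<^sub>1 xs"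
    by (simp only: free_cumulant_perm_def tau1_in_S_nc[OF n] map_entry) (simp add: tau1_in_S_nc[OF n] map_entry)
  then have "(\<Sum>\<pi>\<in>S_nc ?n. free_cumulant_perm \<phi>\<^sub>1 {1..int ?n} \<pi> xs) = free_cumulant \<phi>\<^sub>1 xs
     + (\<Sum>\<pi>\<in>S_nc ?n - {tau1 ?n}. free_cumulant_perm \<phi>\<^sub>1 {1..int ?n} \<pi> xs)"
    by (simp only: sum.remove[OF finite_S_nc tau1_in_S_nc(1)[OF n]])
  also have "\<dots> = \<phi>\<^sub>1 (prod_list xs)"
    by (simp add: free_cumulant.simps[of \<phi>\<^sub>1 xs] free_cumulant_perm_def)
  finally show ?thesis by simp
qed

lemma tau2_cycles:
  assumes "p \<ge> 1" "q \<ge> 1"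
  shows "support (tau2 p q) 1 = [1..int p]"
    "support (tau2 p q) (int p + 1) = [int p + 1..int (p + q)]"
    "cycle_blocks {1..int (p + q)} (tau2 p q) = {{1..int p}, {int p + 1..int (p + q)}}"
proof -
  have p: "permutation (tau2 p q)" using tau2_permutes permutation_permutes by blast
  have ne: "[1..int p] \<noteq> []" "hd [1..int p] = 1" "[int p + 1..int (p + q)] \<noteq> []"
    "hd [int p + 1..int (p + q)] = int p + 1"
    using assms by (auto simp: upto.simps)
  have 1: "tau2 p q x = cycle_of_list [1..int p] x" if "x \<in> set [1..int p]" for x
    using that id_outside_supp[of x "[int p + 1..int (p + q)]"] by (simp add: tau2_def)
  have 2: "tau2 p q x = cycle_of_list [int p + 1..int (p + q)] x"
    if "x \<in> set [int p + 1..int (p + q)]" for x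
  proof -
    have "cycle_of_list [int p + 1..int (p + q)] x \<in> set [int p + 1..int (p + q)]"
      using that permutes_in_image[OF cycle_permutes] by metis
    then show ?thesis
      using id_outside_supp[of _ "[1..int p]"] by (simp add: tau2_def)
  qed
  have orb: "orbit (tau2 p q) 1 = {1..int p}" "support (tau2 p q) 1 = [1..int p]"
    using cycle_of_list_cycle[of "[1..int p]", OF _ ne(1) p 1] ne(2) by simp_all
  have orb': "orbit (tau2 p q) (int p + 1) = {int p + 1..int (p + q)}"
    "support (tau2 p q) (int p + 1) = [int p + 1..int (p + q)]"
    using cycle_of_list_cycle[of "[int p + 1..int (p + q)]", OF _ ne(3) p 2] ne(4) by simp_all
  show "support (tau2 p q) 1 = [1..int p]"
    "support (tau2 p q) (int p + 1) = [int p + 1..int (p + q)]"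
    using orb orb' by simp_all
  have cyc: "cyclic_on (tau2 p q) {1..int p}" "cyclic_on (tau2 p q) {int p + 1..int (p + q)}"
    using cyclic_on_orbit'[OF p, of 1] cyclic_on_orbit'[OF p, of "int p + 1"] orb orb' by simp_all
  have eq: "{1..int (p + q)} = {1..int p} \<union> {int p + 1..int (p + q)}" by auto
  have img: "orbit (tau2 p q) ` {1..int p} = {{1..int p}}"
    "orbit (tau2 p q) ` {int p + 1..int (p + q)} = {{int p + 1..int (p + q)}}"
    using orbit_cyclic_eq3[OF cyc(1)] orbit_cyclic_eq3[OF cyc(2)] assms
    by (auto simp: image_constant_conv)
  show "cycle_blocks {1..int (p + q)} (tau2 p q) = {{1..int p}, {int p + 1..int (p + q)}}"
    unfolding cycle_blocks_def eq image_Un img by auto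
qed

lemma tau2_in_PS':
  assumes "p \<ge> 1" "q \<ge> 1"
  shows "({{1..int (p + q)}}, tau2 p q) \<in> PS' p q"
    "nontrivial_block {{1..int (p + q)}} (tau2 p q) = {1..int (p + q)}"
proof -
  note bl = tau2_cycles(3)[OF assms]
  have part: "partition_on {1..int (p + q)} (cycle_blocks {1..int (p + q)} (tau2 p q))"
    by (intro partition_on_cycle_blocks tau2_permutes) simp
  have ne: "{1..int p} \<noteq> {int p + 1..int (p + q)}" using assms by auto
  have "tau2 p q \<in> S_disc_nc p q"
    using tau2_permutes[of p q] refines_refl[OF part] ne
    by (simp add: S_disc_nc_def num_cycles_id permutes_inv_o(2)[OF tau2_permutes] del: of_nat_add)
      (simp add: num_cycles_def bl del: of_nat_add)
  moreover have un: "{1..int p} \<union> {int p + 1..int (p + q)} = {1..int (p + q)}" by auto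
  moreover have "refines {1..int (p + q)} {{1..int p}, {int p + 1..int (p + q)}} {{1..int (p + q)}}"
  proof -
    have "partition_on {1..int (p + q)} {{1..int (p + q)}}"
      using assms by (intro partition_on_space) auto
    moreover have "{1..int p} \<subseteq> {1..int (p + q)}" "{int p + 1..int (p + q)} \<subseteq> {1..int (p + q)}"
      by auto
    ultimately show ?thesis using part unfolding refines_def bl by blast
  qed
  ultimately show "({{1..int (p + q)}}, tau2 p q) \<in> PS' p q"
    unfolding PS'_def mem_Collect_eq prod.case bl
    by (intro conjI bexI[of _ "{1..int p}"] bexI[of _ "{int p + 1..int (p + q)}"]) simp_all
  have "1 \<in> {1..int (p + q)}" "1 \<notin> {int p + 1..int (p + q)}"
    "int p + 1 \<in> {1..int (p + q)}" "int p + 1 \<notin> {1..int p}" using assms by simp_all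
  then have "{1..int (p + q)} \<notin> {{1..int p}, {int p + 1..int (p + q)}}" by blast
  then show "nontrivial_block {{1..int (p + q)}} (tau2 p q) = {1..int (p + q)}"
    unfolding nontrivial_block_def by (intro the_equality) (auto simp: bl simp del: of_nat_add)
qed

lemma finite_PS': "finite (PS' p q)"
proof (rule finite_subset)
  show "PS' p q \<subseteq> Pow (Pow {1..int (p + q)}) \<times> {\<pi>. \<pi> permutes {1..int (p + q)}}"
    by (auto simp: PS'_def S_disc_nc_def refines_def partition_on_def simp del: of_nat_add)
  show "finite (Pow (Pow {1..int (p + q)}) \<times> {\<pi>. \<pi> permutes {1..int (p + q)}})"
    by (simp add: finite_permutations)
qed

definition second_order_free_cumulant_pair ::
  "('a::monoid_mult \<Rightarrow> complex) \<Rightarrow> ('a \<Rightarrow> 'a) \<Rightarrow> ('a \<Rightarrow> 'a \<Rightarrow> complex) \<Rightarrow>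
   int set set \<Rightarrow> (int \<Rightarrow> int) \<Rightarrow> 'a list \<Rightarrow> 'a list \<Rightarrow> complex" where
  "second_order_free_cumulant_pair \<phi>\<^sub>1 tp \<phi>\<^sub>2 \<U> \<pi> xs ys =
     (let p = length xs; q = length ys; U = nontrivial_block \<U> \<pi>
      in free_cumulant_perm \<phi>\<^sub>1 ({1..int (p + q)} - U) \<pi> (xs @ ys)
         * second_order_free_cumulant \<phi>\<^sub>1 tp \<phi>\<^sub>2
             (map (entry (xs @ ys)) (support \<pi> (Min (U \<inter> {1..int p}))))
             (map (entry (xs @ ys)) (support \<pi> (Min (U \<inter> {int p + 1..int (p + q)})))))"

theorem moment_second_order_free_cumulant:
  assumes "xs \<noteq> []" "ys \<noteq> []"
  defines "p \<equiv> length xs" and "q \<equiv> length ys"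
  shows "\<phi>\<^sub>2 (prod_list xs) (prod_list ys) =
      (\<Sum>\<pi>\<in>S_ann_nc p q. free_cumulant_perm \<phi>\<^sub>1 {1..int (p + q)} \<pi> (xs @ ys))
    + (\<Sum>\<pi>\<in>S_ann_nc p q. free_cumulant_perm \<phi>\<^sub>1 {1..int (p + q)} \<pi> (xs @ rev (map tp ys)))
    + (\<Sum>(\<U>, \<pi>)\<in>PS' p q. second_order_free_cumulant_pair \<phi>\<^sub>1 tp \<phi>\<^sub>2 \<U> \<pi> xs ys)"
proof -
  let ?S = "{1..int (p + q)}"
  let ?t = "({?S}, tau2 p q)"
  let ?k = "\<lambda>(\<U>, \<pi>). second_order_free_cumulant_pair \<phi>\<^sub>1 tp \<phi>\<^sub>2 \<U> \<pi> xs ys"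
  have pq: "p \<ge> 1" "q \<ge> 1" using assms by (simp_all add: Suc_leI)
  have len: "length xs = p" "length ys = q" by (simp_all add: p_def q_def)
  have eq: "?S \<inter> {1..int p} = {1..int p}" "?S \<inter> {int p + 1..int (p + q)} = {int p + 1..int (p + q)}"
    by auto
  have Min: "Min {1..int p} = 1" "Min {int p + 1..int (p + q)} = int p + 1"
    using pq by (auto intro!: Min_eqI)
  have "map (entry (xs @ ys)) [1..int p] = xs"
    by (intro nth_equalityI) (simp_all add: entry_def p_def nth_append)
  moreover have "map (entry (xs @ ys)) [int p + 1..int (p + q)] = ys"
    by (intro nth_equalityI) (simp_all add: entry_def p_def q_def nth_append nat_add_distrib)
  ultimately have top: "?k ?t = second_order_free_cumulant \<phi>\<^sub>1 tp \<phi>\<^sub>2 xs ys"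
    unfolding second_order_free_cumulant_pair_def prod.case len Let_def tau2_in_PS'(2)[OF pq] eq Min
      tau2_cycles(1,2)[OF pq]
    by (simp add: free_cumulant_perm_def cycle_blocks_def)
  have "second_order_free_cumulant \<phi>\<^sub>1 tp \<phi>\<^sub>2 xs ys = \<phi>\<^sub>2 (prod_list xs) (prod_list ys)
     - (\<Sum>\<pi>\<in>S_ann_nc p q. free_cumulant_perm \<phi>\<^sub>1 ?S \<pi> (xs @ ys))
     - (\<Sum>\<pi>\<in>S_ann_nc p q. free_cumulant_perm \<phi>\<^sub>1 ?S \<pi> (xs @ rev (map tp ys)))
     - sum ?k (PS' p q - {?t})"
    by (subst second_order_free_cumulant.simps)
      (simp only: second_order_free_cumulant_pair_def len Let_def)
  moreover have "sum ?k (PS' p q) = ?k ?t + sum ?k (PS' p q - {?t})"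
    by (rule sum.remove[OF finite_PS' tau2_in_PS'(1)[OF pq]])
  ultimately show ?thesis unfolding top by simp
qed


section \<open>The complement of a premap\<close>

lemma plus_part_permutes:
  assumes "finite I" "\<pi> permutes signed_set I"
  shows "plus_part I \<pi> permutes signed_set I"
proof -
  let ?U = "\<Union>(pos_cycles I \<pi>)"
  have fin: "finite (signed_set I)" using assms(1) by (simp add: signed_set_def)
  then have p: "permutation \<pi>" using assms(2) permutation_permutes by blast
  note bl = cycle_blocks_block[OF assms(2) p fin]
  have U: "?U \<subseteq> signed_set I" using bl(1) by (auto simp: pos_cycles_def)
  have finU: "finite ?U" using U fin by (rule finite_subset)
  have im: "\<pi> ` ?U \<subseteq> ?U"
  proof (intro image_subsetI)
    fix x assume "x \<in> ?U"
    then obtain B where B: "B \<in> pos_cycles I \<pi>" "x \<in> B" by blast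
    then have "\<pi> x \<in> B" using bl(4)[of B x] orbit.base[of \<pi> x] by (simp add: pos_cycles_def)
    with B show "\<pi> x \<in> ?U" by blast
  qed
  have inj: "inj_on \<pi> ?U" using permutes_inj[OF assms(2)] by (rule inj_on_subset) simp
  have "bij_betw \<pi> ?U ?U"
    using inj endo_inj_surj[OF finU im inj] by (simp add: bij_betw_def)
  then have "bij_betw (plus_part I \<pi>) ?U ?U"
    by (rule bij_betw_cong[THEN iffD1, rotated]) (simp add: plus_part_def perm_restrict_def)
  then have "plus_part I \<pi> permutes ?U"
    by (rule bij_imp_permutes) (simp only: plus_part_def perm_restrict_def if_False)
  then show ?thesis using U by (rule permutes_subset)
qed

lemma Kr_in_PM:
  assumes "finite I" "\<pi> \<in> PM I" "\<rho> \<in> PM I"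
  shows "Kr I \<rho> \<pi> \<in> PM I"
proof -
  let ?S = "signed_set I" and ?K = "Kr I \<rho> \<pi>" and ?r = "plus_part I \<rho>"
  let ?ri = "inv_into UNIV ?r" and ?pi = "inv_into UNIV \<pi>"
  have \<pi>: "\<pi> permutes ?S" "\<And>k. k \<in> ?S \<Longrightarrow> \<pi> k = - ?pi (- k)" "\<And>k. k \<in> ?S \<Longrightarrow> - k \<notin> orbit \<pi> k"
    and \<rho>: "\<rho> permutes ?S"
    using assms(2,3) by (auto simp: PM_def)
  have r: "?r permutes ?S" by (rule plus_part_permutes[OF assms(1) \<rho>])
  have neg: "- x \<in> ?S \<longleftrightarrow> x \<in> ?S" for x
    by (force simp: signed_set_def image_iff)
  have nz: "x \<noteq> 0" if "x \<in> ?S" for x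
    using \<pi>(3)[OF that] permutation_self_in_orbit[of \<pi> x] \<pi>(1) assms(1) permutation_permutes
    by (fastforce simp: signed_set_def)
  have minus: "inv_into UNIV (minus_part I \<rho>) = (\<lambda>x. - ?ri (- x))"
    by (rule inv_unique_comp)
      (simp_all add: fun_eq_iff minus_part_def permutes_inverses[OF r])
  have K: "?K x = - ?ri (- ?pi (?r x))" for x
    by (simp add: Kr_def minus)
  have ri: "?ri permutes ?S" and pinv: "?pi permutes ?S"
    using r \<pi>(1) by (auto intro: permutes_inv)
  have Kin: "?K x \<in> ?S" if "x \<in> ?S" for x
    unfolding K using that neg permutes_in_image[OF r] permutes_in_image[OF ri]
      permutes_in_image[OF pinv] by simp
  have inj: "inj ?K"
    unfolding K[abs_def] using permutes_inj[OF r] permutes_inj[OF ri] permutes_inj[OF pinv]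
    by (intro injI) (simp add: inj_eq)
  have Kout: "?K x = x" if "x \<notin> ?S" for x
    unfolding K using that neg permutes_not_in[OF r] permutes_not_in[OF ri] permutes_not_in[OF pinv]
    by simp
  have fin: "finite ?S" using assms(1) by (simp add: signed_set_def)
  have perm: "?K permutes ?S"
  proof (rule bij_imp_permutes)
    show "bij_betw ?K ?S ?S"
      using endo_inj_surj[OF fin, of ?K] Kin inj
      by (auto simp: bij_betw_def intro: inj_on_subset)
  qed (rule Kout)
  have twist: "?K (- ?K x) = - x" if "x \<in> ?S" for x
  proof -
    have "?r x \<in> ?S" using that permutes_in_image[OF r] by simp
    then have "\<pi> (- ?r x) = - ?pi (?r x)" using \<pi>(2)[of "- ?r x"] neg by simp
    then have "?pi (- ?pi (?r x)) = - ?r x"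
      using permutes_inverses(2)[OF \<pi>(1)] by metis
    then show ?thesis unfolding K by (simp add: permutes_inverses[OF r])
  qed
  have powin: "(?K ^^ n) x \<in> ?S" if "x \<in> ?S" for x n
    using that by (induction n) (auto intro: Kin)
  have twist_pow: "(?K ^^ n) (- (?K ^^ n) x) = - x" if "x \<in> ?S" for x n
  proof (induction n)
    case (Suc n)
    have "(?K ^^ Suc n) (- (?K ^^ Suc n) x) = (?K ^^ n) (?K (- ?K ((?K ^^ n) x)))"
      by (simp add: funpow_swap1)
    then show ?case using Suc twist[OF powin[OF that]] by simp
  qed simp
  have no_flip: "?K u \<noteq> - u" if "u \<in> ?S" for u
  proof
    assume "?K u = - u"
    then have "?ri (- ?pi (?r u)) = u" by (simp add: K)
    then have "- ?pi (?r u) = ?r u" using permutes_inverses(1)[OF r] by metis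
    then have "\<pi> (- ?r u) = ?r u" using permutes_inverses(1)[OF \<pi>(1)] by (metis minus_minus)
    then have "- (- ?r u) \<in> orbit \<pi> (- ?r u)" using orbit.base[of \<pi> "- ?r u"] by simp
    moreover have "- ?r u \<in> ?S" using that neg permutes_in_image[OF r] by simp
    ultimately show False using \<pi>(3) by blast
  qed
  have "- k \<notin> orbit ?K k" if k: "k \<in> ?S" for k
  proof
    assume "- k \<in> orbit ?K k"
    then obtain m where m: "(?K ^^ m) k = - k" by (auto simp: orbit_altdef)
    define j where "j = m div 2"
    define u where "u = (?K ^^ j) k"
    have u: "u \<in> ?S" "(?K ^^ j) (- u) = - k"
      using powin[OF k] twist_pow[OF k] by (simp_all add: u_def)
    have injp: "inj (?K ^^ j)" using inj by (rule inj_fn)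
    show False
    proof (cases "even m")
      case True
      then have "m = j + j" by (auto simp: j_def)
      then have "(?K ^^ j) u = (?K ^^ j) (- u)" using m u(2) by (simp add: u_def funpow_add)
      then have "u = - u" using injp by (rule injD[rotated])
      then show False using nz[OF u(1)] by simp
    next
      case False
      then have "m = j + (1 + j)" unfolding j_def by presburger
      then have "(?K ^^ j) (?K u) = (?K ^^ j) (- u)"
        using m u(2) by (simp add: u_def funpow_add funpow_swap1)
      then have "?K u = - u" using injp by (rule injD[rotated])
      then show False using no_flip[OF u(1)] by simp
    qed
  qed
  moreover have "?K k = - inv_into UNIV ?K (- k)" if "k \<in> ?S" for k
    using twist[OF that] permutes_inverses(2)[OF perm] by (metis minus_minus)
  ultimately show ?thesis using perm by (simp add: PM_def)
qed

end

theory Submission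
 imports Defs "Jordan_Normal_Form.Determinant"
begin

text \<open>
 The Weingarten function is the inverse of the Gram matrix \<open>N ^ loops\<close> on premaps, so the moments
 are recovered from the matrix cumulants: \<open>E tr\<^sub>\<pi>\<close> is the sum of \<open>N ^ - defect \<pi> \<rho> * c\<^sub>\<rho>\<close> over all
 premaps \<open>\<rho>\<close>, where the defect is a nonnegative Euler-characteristic deficiency. As \<open>N\<close> grows this
 system becomes unitriangular with respect to the number of cycles. Bounds on moments, covariances
 and third cumulants therefore pass to the \<open>c\<^sub>\<rho>\<close> without any asymptotics of the Weingarten function:
 cumulants over disjoint index sets factorize up to \<open>N\<^sup>-\<^sup>2\<close>, and \<open>N\<^sup>2 K\<close> is in the limit a derivation
 in either argument. A premap connecting the two faces has defect at least \<open>2\<close>. The premaps of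
 defect \<open>0\<close> are the disc-noncrossing permutations; those of defect \<open>2\<close> connecting the faces are the
 annular noncrossing ones, for each of the two relative orientations of the faces. Hence the limiting
 relations are the moment-cumulant relations defining the free cumulants of both orders.
\<close>


section \<open>Components of a relation and the genus inequality\<close>

text \<open>Write h for half the number of cycles. Up to powers of N, c_\<rho> is the inverse Gram
  matrix applied to the moments, and undoing this gives c_\<rho> in E tr_\<pi> the weight N^(loops +
  h(\<rho>) - h(\<pi>) - |I|); the defect is minus this exponent. The genus inequality on signed
  points bounds it below by the number of cycles of \<pi> lost in the joint orbits of \<pi> and
  \<rho>. Cycles come in mirrored pairs, so joining two faces costs at least 2 and joining three at
  least 4.

  The obstacle is that two kinds of terms in the covariance relation have the same order: N^2 K for
  premaps preserving the faces, and cumulants of joining premaps, whose weight N^(-2) is compensated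
  by N^2. The second kind gives the annular sums. For the first kind the derivation rule leaves one
  marked cycle in each face, which is the nontrivial block of \<open>PS'\<close>, while the other
  cycles contribute first-order cumulants. Third moments serve to prove that rule; premaps joining
  all three faces have weight at most N^(-4) and drop out. Signed cycles are compared with the
  standard circles by odd relabellings.\<close>

definition linked :: "('a \<times> 'a) set => ('a \<times> 'a) set" where
 "linked R = (R \<union> R\<inverse>)\<^sup>*"

definition components :: "'a set => ('a \<times> 'a) set => 'a set set" where
 "components S R = (\<lambda>x. linked R `` {x}) ` S"

definition graph :: "('a => 'a) => ('a \<times> 'a) set" where
 "graph f = {(x, f x) | x. True}"

lemma linked_refl [simp]: "(x, x) \<in> linked R"
 by (simp add: linked_def)

lemma linked_sym: "(x, y) \<in> linked R ==> (y, x) \<in> linked R"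
 unfolding linked_def by (rule symD[OF sym_rtrancl[OF sym_Un_converse]])

lemma linked_trans: "(x, y) \<in> linked R ==> (y, z) \<in> linked R ==> (x, z) \<in> linked R"
 unfolding linked_def by (rule rtrancl_trans)

lemma linked_base: "(x, y) \<in> R ==> (x, y) \<in> linked R"
 unfolding linked_def by blast

lemma linked_graph [simp]: "(x, f x) \<in> linked (graph f)"
 by (rule linked_base) (auto simp: graph_def)

lemma linked_subset:
 assumes "R \<subseteq> linked R'" shows "linked R \<subseteq> linked R'"
proof -
 have "(x, y) \<in> linked R'" if "(x, y) \<in> R \<union> R\<inverse>" for x y using that assms linked_sym[of y x R'] by auto
 hence "R \<union> R\<inverse> \<subseteq> linked R'" by auto
 hence "(R \<union> R\<inverse>)\<^sup>* \<subseteq> (linked R')\<^sup>*" by (rule rtrancl_mono)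
 thus ?thesis by (simp add: linked_def)
qed

lemma linked_mono: "R \<subseteq> R' ==> linked R \<subseteq> linked R'"
 by (rule linked_subset) (auto intro: linked_base)

lemma linked_eqI: "R \<subseteq> linked R' ==> R' \<subseteq> linked R ==> linked R = linked R'"
 by (intro equalityI linked_subset)

lemma linked_class_eq: "(x, y) \<in> linked R \<longleftrightarrow> linked R `` {x} = linked R `` {y}"
proof
 assume xy: "(x, y) \<in> linked R"
 show "linked R `` {x} = linked R `` {y}" using linked_trans[OF xy] linked_trans[OF linked_sym[OF xy]] by auto
next
 assume "linked R `` {x} = linked R `` {y}"
 hence "y \<in> linked R `` {x}" by simp
 thus "(x, y) \<in> linked R" by simp
qed

text \<open>A path can be shortened until it crosses the new edge at most once, in one of the two
  directions.\<close>

lemma linked_insert: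
 "(x, y) \<in> linked (insert (a, b) R) \<longleftrightarrow>
   (x, y) \<in> linked R \<or> (x, a) \<in> linked R \<and> (b, y) \<in> linked R \<or> (x, b) \<in> linked R \<and> (a, y) \<in> linked R"
 (is "_ \<longleftrightarrow> ?P y")
proof
 assume "(x, y) \<in> linked (insert (a, b) R)"
 hence "(x, y) \<in> (insert (a, b) R \<union> (insert (a, b) R)\<inverse>)\<^sup>*" by (simp only: linked_def)
 thus "?P y" proof induction
  case (step y z)
  from step.hyps(2) consider "(y, z) \<in> linked R" | "y = a" "z = b" | "y = b" "z = a"
   using linked_base[of y z R] linked_sym[OF linked_base[of z y R]] by blast
  thus ?case proof cases
   case 1
   have t: "(c, z) \<in> linked R" if "(c, y) \<in> linked R" for c using linked_trans[OF that 1] .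
   show ?thesis using step.IH t[of x] t[of a] t[of b] by blast
  next
   case 2
   thus ?thesis using step.IH linked_refl[of b R] by blast
  next
   case 3
   thus ?thesis using step.IH linked_refl[of a R] by blast
  qed
 qed simp
next
 have m: "linked R \<subseteq> linked (insert (a, b) R)" by (rule linked_mono) auto
 have ab: "(a, b) \<in> linked (insert (a, b) R)" by (rule linked_base) simp
 assume "?P y"
 thus "(x, y) \<in> linked (insert (a, b) R)" proof (elim disjE conjE)
  assume "(x, y) \<in> linked R"
  thus ?thesis using m by blast
 next
  assume *: "(x, a) \<in> linked R" "(b, y) \<in> linked R"
  show ?thesis by (rule linked_trans[OF linked_trans[OF subsetD[OF m *(1)] ab] subsetD[OF m *(2)]])
 next
  assume *: "(x, b) \<in> linked R" "(a, y) \<in> linked R"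
  show ?thesis by (rule linked_trans[OF linked_trans[OF subsetD[OF m *(1)] linked_sym[OF ab]] subsetD[OF m *(2)]])
 qed
qed

text \<open>The edge merges the classes of a and b and touches no other class, so the count drops by
  one exactly when they were different. Written as a sum, this needs no natural subtraction.\<close>

lemma card_components_insert:
 assumes "finite S" "a \<in> S" "b \<in> S"
 shows "card (components S (insert (a, b) R)) + of_bool ((a, b) \<notin> linked R) = card (components S R)"
proof (cases "(a, b) \<in> linked R")
 case True
 hence "linked (insert (a, b) R) = linked R" by (intro linked_eqI) (auto intro: linked_base)
 thus ?thesis using True by (simp add: components_def)
next
 case False
 let ?c = "\<lambda>x. linked R `` {x}"
 let ?X = "components S R - {?c a, ?c b}"
 have ne: "?c a \<noteq> ?c b" using False linked_class_eq[of a b R] by blast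
 have cl: "linked (insert (a, b) R) `` {x} = (if (x, a) \<in> linked R \<or> (x, b) \<in> linked R then ?c a \<union> ?c b else ?c x)" for x
 proof -
  have *: "linked (insert (a, b) R) `` {x} = {y. (x, y) \<in> linked R \<or> (x, a) \<in> linked R \<and> (b, y) \<in> linked R \<or> (x, b) \<in> linked R \<and> (a, y) \<in> linked R}"
   using linked_insert[of x _ a b R] by blast
  consider "(x, a) \<in> linked R" | "(x, b) \<in> linked R" | "(x, a) \<notin> linked R" "(x, b) \<notin> linked R" by blast
  thus ?thesis proof cases
   case 1
   hence "?c x = ?c a" "(x, b) \<notin> linked R"
    using linked_class_eq[of x a R] linked_trans[OF linked_sym[OF 1], of b] False by blast+
   thus ?thesis unfolding * using 1 by auto
  next
   case 2
   hence "?c x = ?c b" "(x, a) \<notin> linked R"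
    using linked_class_eq[of x b R] linked_trans[OF linked_sym, of x a R b] 2 False by blast+
   thus ?thesis unfolding * using 2 by auto
  qed (auto simp: *)
 qed
 have "components S (insert (a, b) R) = insert (?c a \<union> ?c b) ?X" proof (intro equalityI subsetI)
  fix B assume "B \<in> components S (insert (a, b) R)"
  then obtain x where x: "x \<in> S" "B = linked (insert (a, b) R) `` {x}" by (auto simp: components_def)
  show "B \<in> insert (?c a \<union> ?c b) ?X" proof (cases "(x, a) \<in> linked R \<or> (x, b) \<in> linked R")
   case True
   thus ?thesis unfolding x(2) cl by simp
  next
   case False
   hence "?c x \<noteq> ?c a" "?c x \<noteq> ?c b" using linked_class_eq[of x a R] linked_class_eq[of x b R] by blast+
   thus ?thesis using False x(1) unfolding x(2) cl by (simp add: components_def)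
  qed
 next
  fix B assume B: "B \<in> insert (?c a \<union> ?c b) ?X"
  show "B \<in> components S (insert (a, b) R)" proof (cases "B = ?c a \<union> ?c b")
   case True
   thus ?thesis unfolding components_def cl using assms(2) by (intro image_eqI[of _ _ a]) auto
  next
   case False
   then obtain x where x: "x \<in> S" "B = ?c x" "?c x \<noteq> ?c a" "?c x \<noteq> ?c b" using B by (auto simp: components_def)
   hence "(x, a) \<notin> linked R" "(x, b) \<notin> linked R" using linked_class_eq[of x a R] linked_class_eq[of x b R] by blast+
   thus ?thesis unfolding components_def cl using x by (intro image_eqI[of _ _ x]) auto
  qed
 qed
 moreover have "?c a \<union> ?c b \<notin> ?X" proof
  assume "?c a \<union> ?c b \<in> ?X"
  then obtain x where "?c a \<union> ?c b = ?c x" by (auto simp: components_def)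
  moreover have "a \<in> ?c a \<union> ?c b" "b \<in> ?c a \<union> ?c b" by simp_all
  ultimately have "(x, a) \<in> linked R" "(x, b) \<in> linked R" by blast+
  thus False using False linked_trans[OF linked_sym, of x a R b] by blast
 qed
 moreover have fin: "finite (components S R)" using assms(1) by (simp add: components_def)
 moreover have "?c a \<in> components S R" "?c b \<in> components S R" using assms by (auto simp: components_def)
 hence "{?c a, ?c b} \<subseteq> components S R" by simp
 hence "card ?X + card {?c a, ?c b} = card (components S R)" using fin card_mono[OF fin] by (simp add: card_Diff_subset)
 hence "card ?X + 2 = card (components S R)" using ne by simp
 ultimately show ?thesis using False by simp
qed

section \<open>Cycles as components, and the effect of a transposition on their number\<close>

lemma orbit_eq_linked:
 assumes "permutation f" shows "orbit f x = linked (graph f) `` {x}"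
proof (intro equalityI subsetI)
 fix y assume "y \<in> orbit f x"
 hence "(x, y) \<in> linked (graph f)" proof induction
  case (step y)
  show ?case by (rule linked_trans[OF step.IH linked_graph])
 qed simp
 thus "y \<in> linked (graph f) `` {x}" by simp
next
 fix y assume "y \<in> linked (graph f) `` {x}"
 hence "(x, y) \<in> (graph f \<union> (graph f)\<inverse>)\<^sup>*" by (simp add: linked_def)
 hence "orbit f y = orbit f x" proof induction
  case (step y z)
  then consider "z = f y" | "y = f z" by (auto simp: graph_def)
  hence "orbit f z = orbit f y" using permutation_orbit_step[OF assms, of y] permutation_orbit_step[OF assms, of z] by cases auto
  thus ?case using step.IH by (rule trans)
 qed simp
 thus "y \<in> orbit f x" using permutation_self_in_orbit[OF assms] by metis
qed

lemma perm_perm: "f permutes S ==> finite S ==> permutation f"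
 using permutation_permutes by blast

lemma cycle_blocks_eq_components:
 assumes "permutation f" shows "cycle_blocks S f = components S (graph f)"
 unfolding cycle_blocks_def components_def orbit_eq_linked[OF assms] by simp

text \<open>Once a and b are linked, precomposition with the transposition only exchanges the arrows
  leaving two points of one class. The extra relation R makes room for the second permutation in the
  genus bound.\<close>

lemma linked_graph_transpose:
 "linked (insert (a, b) (R \<union> graph (f \<circ> Transposition.transpose a b))) = linked (insert (a, b) (R \<union> graph f))"
 (is "linked ?A = linked ?B")
proof -
 have step: "(x, f (Transposition.transpose a b x)) \<in> linked (insert (a, b) (R \<union> graph f))"
  for x and f :: "'a => 'a"
 proof -
  have "(x, Transposition.transpose a b x) \<in> linked (insert (a, b) (R \<union> graph f))" proof -
   have ab: "(a, b) \<in> linked (insert (a, b) (R \<union> graph f))" by (rule linked_base) simp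
   consider "x = a" | "x = b" | "x \<noteq> a" "x \<noteq> b" by blast
   thus ?thesis using ab linked_sym[OF ab] by cases simp_all
  qed
  moreover have "(Transposition.transpose a b x, f (Transposition.transpose a b x)) \<in> linked (insert (a, b) (R \<union> graph f))"
   by (rule linked_base) (auto simp: graph_def)
  ultimately show ?thesis by (rule linked_trans)
 qed
 have "R \<subseteq> linked ?A" "R \<subseteq> linked ?B" "(a, b) \<in> linked ?A" "(a, b) \<in> linked ?B"
  using linked_base[of _ _ ?A] linked_base[of _ _ ?B] by (simp_all add: subset_iff)
 moreover have "graph (f \<circ> Transposition.transpose a b) \<subseteq> linked ?B"
  using step[of _ f] by (auto simp only: graph_def comp_apply)
 moreover have "graph f \<subseteq> linked ?A" using step[of _ "f \<circ> Transposition.transpose a b"]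
  by (auto simp only: graph_def comp_apply transpose_involutory)
 ultimately show ?thesis by (intro linked_eqI) auto
qed

text \<open>Different orbits are merged: from a the new permutation goes to f b and then follows the
  orbit of b, which never meets a, until it arrives at b.\<close>

lemma linked_transpose_compose:
 assumes "permutation f" "(a, b) \<notin> linked (graph f)" shows "(a, b) \<in> linked (graph (f \<circ> Transposition.transpose a b))"
proof -
 let ?g = "f \<circ> Transposition.transpose a b"
 have g: "permutation ?g" using assms(1) by (simp add: permutation_compose permutation_swap_id)
 have na: "a \<notin> orbit f b" unfolding orbit_eq_linked[OF assms(1)] using assms(2) linked_sym by fast
 have ga: "?g a = f b" by simp
 have "orbit f b \<subseteq> orbit ?g a" proof
  fix y assume y: "y \<in> orbit f b"
  thus "y \<in> orbit ?g a" proof (induction)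
   case base
   show ?case unfolding ga[symmetric] by (rule orbit.base)
  next
   case (step y)
   show ?case proof (cases "y = b")
    case True
    show ?thesis unfolding True ga[symmetric] by (rule orbit.base)
   next
    case False
    moreover have "y \<noteq> a" using step na by auto
    ultimately show ?thesis using orbit.step[OF step.IH] by simp
   qed
  qed
 qed
 thus ?thesis using permutation_self_in_orbit[OF assms(1), of b] orbit_eq_linked[OF g] by auto
qed

text \<open>Adding the edge between a and b gives the same components for f and for its product with
  the transposition, so both cycle counts are compared with that common number.\<close>

lemma num_cycles_transpose:
 assumes "f permutes S" "finite S" "a \<in> S" "b \<in> S"
 shows "num_cycles S (f \<circ> Transposition.transpose a b) + of_bool ((a, b) \<notin> linked (graph f))
  = num_cycles S f + of_bool ((a, b) \<notin> linked (graph (f \<circ> Transposition.transpose a b)))"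
proof -
 let ?g = "f \<circ> Transposition.transpose a b"
 have "Transposition.transpose a b permutes S" using assms permutes_swap_id by metis
 hence "?g permutes S" using assms(1) permutes_compose by blast
 hence p: "permutation f" "permutation ?g" using assms perm_perm by blast+
 show ?thesis using card_components_insert[OF assms(2-4), of "graph f"]
   card_components_insert[OF assms(2-4), of "graph ?g"] linked_graph_transpose[of a b "{}" f]
  by (simp add: num_cycles_def cycle_blocks_eq_components p components_def)
qed

lemma num_cycles_transpose_merge:
 assumes "f permutes S" "finite S" "a \<in> S" "b \<in> S" "(a, b) \<notin> linked (graph f)"
 shows "num_cycles S (f \<circ> Transposition.transpose a b) + 1 = num_cycles S f" using num_cycles_transpose[OF assms(1-4)] assms(5)
  linked_transpose_compose[OF perm_perm[OF assms(1,2)] assms(5)] by simp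

text \<open>The surface glued from two permutations and their product has nonnegative genus.\<close>

theorem genus_inequality:
 assumes "finite S" "A permutes S" "B permutes S" shows "num_cycles S A + num_cycles S B + num_cycles S (A \<circ> B)
  \<le> card S + 2 * card (components S (graph A \<union> graph B))" using assms(3)
proof (induction "card {x. B x \<noteq> x}" arbitrary: B rule: less_induct)
 case less
 have pa: "permutation A" using perm_perm assms by blast
 show ?case proof (cases "B = id")
  case True
  have "linked (graph A \<union> graph id) = linked (graph A)" by (intro linked_eqI) (auto simp: graph_def intro: linked_base)
  hence "card (components S (graph A \<union> graph id)) = num_cycles S A"
   by (simp add: num_cycles_def cycle_blocks_eq_components[OF pa] components_def)
  thus ?thesis using True by (simp add: num_cycles_id)
 next
  case False
  then obtain a where a: "B a \<noteq> a" by fastforce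
  \<comment> \<open>The point b is the predecessor of a under B, so B composed with the
    transposition of a and b fixes a and moves fewer points.\<close>
  define b where "b = inv_into UNIV B a"
  have Bb: "B b = a" using permutes_inverses(1)[OF less.prems] by (simp add: b_def)
  have ab: "a \<noteq> b" using a Bb by auto
  have inS: "a \<in> S" "b \<in> S" using a Bb ab permutes_not_in[OF less.prems] by metis+
  let ?t = "Transposition.transpose a b"
  define B' where "B' = B \<circ> ?t"
  have t: "?t permutes S" using inS permutes_swap_id by metis
  have B': "B' permutes S" unfolding B'_def using t less.prems permutes_compose by blast
  have tt: "B' \<circ> ?t = B" by (auto simp: B'_def fun_eq_iff)
  have fin: "finite {x. B x \<noteq> x}" using assms(1) permutes_not_in[OF less.prems] by (auto intro: finite_subset[of _ S])
  have fix_a: "B' a = a" using Bb by (simp add: B'_def)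
  have "{x. B' x \<noteq> x} \<subset> {x. B x \<noteq> x}" proof
   show "{x. B' x \<noteq> x} \<subseteq> {x. B x \<noteq> x}" proof
    fix x assume x: "x \<in> {x. B' x \<noteq> x}"
    hence "x \<noteq> a" using fix_a by auto
    thus "x \<in> {x. B x \<noteq> x}" using x Bb ab by (cases "x = b") (auto simp: B'_def)
   qed
   show "{x. B' x \<noteq> x} \<noteq> {x. B x \<noteq> x}" using a fix_a by auto
  qed
  hence "card {x. B' x \<noteq> x} < card {x. B x \<noteq> x}" using fin psubset_card_mono by blast
  note IH = less.hyps[OF this B']
  have pb: "permutation B'" using perm_perm assms B' by blast
  have "orbit B' a = {a}" using fix_a by (simp add: orbit_eq_singleton_iff)
  hence "(a, b) \<notin> linked (graph B')" using ab orbit_eq_linked[OF pb, of a] by auto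
  hence c1: "num_cycles S B + 1 = num_cycles S B'" using num_cycles_transpose_merge[OF B' assms(1) inS] tt by simp
  have ab': "A \<circ> B' permutes S" using assms(2) B' permutes_compose by blast
  have "linked (graph (A \<circ> B')) \<subseteq> linked (graph A \<union> graph B')" proof (rule linked_subset, rule subrelI)
   fix x y assume "(x, y) \<in> graph (A \<circ> B')"
   hence "y = A (B' x)" by (auto simp: graph_def)
   moreover have "(x, B' x) \<in> linked (graph A \<union> graph B')"
    "(B' x, A (B' x)) \<in> linked (graph A \<union> graph B')" by (auto intro!: linked_base simp: graph_def)
   ultimately show "(x, y) \<in> linked (graph A \<union> graph B')" using linked_trans by metis
  qed
  hence sub: "(a, b) \<notin> linked (graph (A \<circ> B'))"
   if "(a, b) \<notin> linked (graph A \<union> graph B')" using that by blast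
  have e: "(A \<circ> B') \<circ> ?t = A \<circ> B" by (simp only: comp_assoc tt)
  \<comment> \<open>If a and b lie in different joint classes, the transposition merges two cycles
    of the product, a change of -1 where otherwise +1 is allowed. These two units pay for the lost
    component, which counts twice.\<close>
  have c2: "num_cycles S (A \<circ> B) + 2 * of_bool ((a, b) \<notin> linked (graph A \<union> graph B'))
    \<le> num_cycles S (A \<circ> B') + 1"
  proof (cases "(a, b) \<in> linked (graph A \<union> graph B')")
   case True
   thus ?thesis using num_cycles_transpose[OF ab' assms(1) inS] unfolding e of_bool_def by (simp split: if_splits)
  next
   case False
   thus ?thesis using num_cycles_transpose_merge[OF ab' assms(1) inS sub[OF False]] unfolding e by simp
  qed
  have "(a, b) \<in> linked (graph A \<union> graph B)"
   by (rule linked_sym, rule linked_base) (use Bb in \<open>auto simp: graph_def\<close>)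
  hence "linked (insert (a, b) (graph A \<union> graph B)) = linked (graph A \<union> graph B)"
   by (intro linked_eqI) (auto intro: linked_base)
  hence "linked (insert (a, b) (graph A \<union> graph B')) = linked (graph A \<union> graph B)"
   using linked_graph_transpose[of a b "graph A" B] by (simp add: B'_def)
  hence c3: "card (components S (graph A \<union> graph B))
    + of_bool ((a, b) \<notin> linked (graph A \<union> graph B'))
    = card (components S (graph A \<union> graph B'))" using card_components_insert[OF assms(1) inS, of "graph A \<union> graph B'"]
   by (simp add: components_def)
  show ?thesis using IH c1 c2 c3 by (cases "(a, b) \<in> linked (graph A \<union> graph B')") simp_all
 qed
qed

section \<open>Cycle counts\<close>

abbreviation pinv :: "('a => 'a) => 'a => 'a" where
 "pinv f \<equiv> inv_into UNIV f"

lemma orbit_map: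
 assumes "\<And>y. g (h y) = h (f y)" shows "orbit g (h x) = h ` orbit f x"
proof -
 have "(g ^^ n) (h x) = h ((f ^^ n) x)" for n by (induction n) (simp_all add: assms)
 thus ?thesis unfolding orbit_altdef by auto
qed

lemma cycle_blocks_map:
 assumes "\<And>y. g (h y) = h (f y)" shows "cycle_blocks (h ` S) g = (`) h ` cycle_blocks S f"
 unfolding cycle_blocks_def image_image by (simp add: orbit_map[of g h f, OF assms])

lemma num_cycles_map:
 assumes "\<And>y. g (h y) = h (f y)" "inj h" shows "num_cycles (h ` S) g = num_cycles S f"
 unfolding num_cycles_def cycle_blocks_map[of g h f, OF assms(1)]
 by (intro card_image inj_on_subset[OF inj_on_image_Pow[of h UNIV]]) (simp_all add: assms(2))

lemma num_cycles_inv: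
 assumes "permutation f" shows "num_cycles S (pinv f) = num_cycles S f"
 unfolding num_cycles_def cycle_blocks_def orbit_inv_eq[OF assms] ..

text \<open>The first product is the conjugate of the second by f.\<close>

lemma num_cycles_comp_commute:
 assumes "f permutes S" shows "num_cycles S (f \<circ> g) = num_cycles S (g \<circ> f)"
proof -
 have "num_cycles (f ` S) (f \<circ> g) = num_cycles S (g \<circ> f)" by (rule num_cycles_map) (simp_all add: permutes_inj[OF assms])
 thus ?thesis by (simp add: permutes_image[OF assms])
qed

lemma num_cycles_le:
 assumes "finite S" shows "num_cycles S f \<le> card S" unfolding num_cycles_def cycle_blocks_def using card_image_le[OF assms] .

section \<open>Stable sets\<close>

text \<open>Only an inclusion is required. For an injective map and a finite set it amounts to
  equality (\<open>stable_iff\<close>), which gives stability under the inverse.\<close>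

definition stable :: "'a set => ('a => 'a) => bool" where
 "stable A f \<longleftrightarrow> f ` A \<subseteq> A"

lemma stableD: "stable A f ==> x \<in> A ==> f x \<in> A"
 unfolding stable_def by blast

lemma stable_orbit: "stable A f ==> x \<in> A ==> orbit f x \<subseteq> A"
proof
 fix y assume "stable A f" "x \<in> A" "y \<in> orbit f x"
 from this(3,1,2) show "y \<in> A" by induction (simp_all add: stableD)
qed

lemma stable_iff:
 assumes "stable A f" "inj f" "finite A" shows "f x \<in> A \<longleftrightarrow> x \<in> A"
proof -
 have "f ` A = A" using assms by (intro endo_inj_surj) (auto simp: stable_def intro: inj_on_subset)
 thus ?thesis using assms(2) by (metis inj_image_mem_iff)
qed

lemma stable_pinv:
 assumes "stable A f" "bij f" "finite A" shows "stable A (pinv f)" unfolding stable_def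
proof (intro image_subsetI)
 fix x assume "x \<in> A"
 hence "f (pinv f x) \<in> A" using bij_is_surj[OF assms(2)] by (simp add: surj_f_inv_f)
 thus "pinv f x \<in> A" using stable_iff[OF assms(1) bij_is_inj[OF assms(2)] assms(3)] by simp
qed

lemma stable_comp: "stable A f ==> stable A g ==> stable A (f \<circ> g)"
 unfolding stable_def by auto

lemma perm_restrict_permutes:
 assumes "stable A f" "inj f" "finite A" shows "perm_restrict f A permutes A"
proof (rule bij_imp_permutes)
 have "inj_on f A" using assms(2) by (rule inj_on_subset) simp
 hence "bij_betw f A A" using endo_inj_surj[OF assms(3), of f] assms(1) by (auto simp: bij_betw_def stable_def)
 thus "bij_betw (perm_restrict f A) A A" by (rule bij_betw_cong[THEN iffD1, rotated]) (simp add: perm_restrict_def)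
qed (simp add: perm_restrict_def)

lemma orbit_perm_restrict:
 assumes "stable A f" "x \<in> A" shows "orbit (perm_restrict f A) x = orbit f x" by (rule orbit_cong0[where A = A])
  (use assms in \<open>auto simp: perm_restrict_def stable_def\<close>)

lemma cycle_blocks_perm_restrict:
 assumes "stable A f" "B \<subseteq> A" shows "cycle_blocks B (perm_restrict f A) = cycle_blocks B f" unfolding cycle_blocks_def
 by (intro image_cong refl orbit_perm_restrict[OF assms(1)]) (use assms(2) in blast)

lemma num_cycles_perm_restrict:
 assumes "stable A f" shows "num_cycles A (perm_restrict f A) = num_cycles A f"
 unfolding num_cycles_def by (simp add: cycle_blocks_perm_restrict[OF assms])

lemma funpow_cong_stable:
 assumes "\<And>y. y \<in> A ==> f y = g y" "stable A f" "x \<in> A" shows "(f ^^ n) x = (g ^^ n) x"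
proof -
 have "(f ^^ n) x = (g ^^ n) x \<and> (f ^^ n) x \<in> A" proof (induction n)
  case (Suc n)
  hence "(g ^^ n) x \<in> A" by metis
  thus ?case using Suc stableD[OF assms(2), of "(g ^^ n) x"] assms(1)[of "(g ^^ n) x"] by simp
 qed (simp add: assms(3))
 thus ?thesis ..
qed

lemma support_cong:
 assumes "\<And>y. y \<in> A ==> f y = g y" "stable A f" "x \<in> A" shows "support f x = support g x"
 using funpow_cong_stable[OF assms] by (simp add: least_power_def)

lemma support_map:
 assumes "\<And>y. g (h y) = h (f y)" "inj h" shows "support g (h x) = map h (support f x)"
proof -
 have p: "(g ^^ n) (h x) = h ((f ^^ n) x)" for n by (induction n) (simp_all add: assms(1))
 hence "least_power g (h x) = least_power f x" unfolding least_power_def using assms(2) by (simp add: inj_eq)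
 thus ?thesis using p by simp
qed

lemma perm_restrict_comp_stable:
 assumes "stable A g" shows "perm_restrict (f \<circ> g) A = perm_restrict f A \<circ> perm_restrict g A"
 using assms by (auto simp: perm_restrict_def fun_eq_iff stable_def)

lemma pinv_perm_restrict:
 assumes "stable A f" "bij f" "finite A" shows "pinv (perm_restrict f A) = perm_restrict (pinv f) A"
proof (rule inv_unique_comp)
 have s: "stable A (pinv f)" using stable_pinv[OF assms] .
 have e: "f \<circ> pinv f = id" "pinv f \<circ> f = id"
  using assms(2) by (simp_all add: surj_iff[symmetric] bij_is_surj inj_iff[symmetric] bij_is_inj)
 have i: "perm_restrict id A = id" by (auto simp: perm_restrict_def fun_eq_iff)
 show "perm_restrict f A \<circ> perm_restrict (pinv f) A = id" unfolding perm_restrict_comp_stable[OF s, symmetric] e i ..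
 show "perm_restrict (pinv f) A \<circ> perm_restrict f A = id" unfolding perm_restrict_comp_stable[OF assms(1), symmetric] e i ..
qed

lemma num_cycles_Un:
 assumes "stable A f" "stable B f" "A \<inter> B = {}" "finite A" "finite B" "permutation f"
 shows "num_cycles (A \<union> B) f = num_cycles A f + num_cycles B f" proof -
 have "cycle_blocks A f \<inter> cycle_blocks B f = {}"
  using stable_orbit[OF assms(1)] stable_orbit[OF assms(2)] assms(3) orbit_nonempty[of f] unfolding cycle_blocks_def by blast
 thus ?thesis unfolding num_cycles_def using assms(4,5) by (simp add: cycle_blocks_def image_Un card_Un_disjoint)
qed

section \<open>Premaps and their defect\<close>

text \<open>Positivity separates the indices from their negatives: \<open>pm I\<close> has twice as
  many points as I, and membership in it can be read off the absolute value.\<close>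

definition ix_set :: "int set => bool" where
 "ix_set I \<longleftrightarrow> finite I \<and> (\<forall>i\<in>I. 0 < i)"

lemma ix_finite: "ix_set I ==> finite I"
 by (simp add: ix_set_def)

lemma ix_subset: "ix_set I ==> J \<subseteq> I ==> ix_set J"
 unfolding ix_set_def using finite_subset by blast

lemma index_set_Un [simp]: "ix_set (I \<union> J) \<longleftrightarrow> ix_set I \<and> ix_set J"
 by (auto simp: ix_set_def)

abbreviation pm :: "int set => int set" where
 "pm \<equiv> signed_set"

abbreviation sstable :: "int set => (int => int) => bool" where
 "sstable I \<equiv> stable (signed_set I)"

lemma neg_in_signed_set [simp]: "- x \<in> signed_set I \<longleftrightarrow> x \<in> signed_set I"
 by (force simp: signed_set_def image_iff)

lemma in_signed_set:
 assumes "ix_set I" shows "x \<in> pm I \<longleftrightarrow> \<bar>x\<bar> \<in> I"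
proof
 assume "x \<in> pm I"
 thus "\<bar>x\<bar> \<in> I" using assms by (auto simp: signed_set_def ix_set_def)
next
 assume "\<bar>x\<bar> \<in> I"
 thus "x \<in> pm I" unfolding signed_set_def by (cases "0 \<le> x") (auto simp: image_iff intro: bexI[of _ "- x"])
qed

lemma finite_pm: "ix_set I ==> finite (pm I)"
 by (simp add: signed_set_def ix_set_def)

lemma zero_notin_signed_set: "ix_set I ==> 0 \<notin> pm I"
 by (auto simp: signed_set_def ix_set_def)

lemma card_signed_set:
 assumes "ix_set I" shows "card (pm I) = 2 * card I"
proof -
 have "I \<inter> uminus ` I = {}" proof (rule ccontr)
  assume "I \<inter> uminus ` I \<noteq> {}"
  then obtain i where "i \<in> I" "- i \<in> I" by auto
  hence "0 < i" "0 < - i" using assms unfolding ix_set_def by blast+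
  thus False by simp
 qed
 thus ?thesis using assms by (simp add: signed_set_def ix_set_def card_Un_disjoint card_image)
qed

lemma signed_set_Un: "pm (I \<union> J) = pm I \<union> pm J"
 by (auto simp: signed_set_def)

lemma signed_set_mono: "I \<subseteq> J ==> pm I \<subseteq> pm J"
 by (auto simp: signed_set_def)

lemma signed_set_disjoint:
 assumes "ix_set I" "ix_set J" "I \<inter> J = {}" shows "pm I \<inter> pm J = {}" using assms in_signed_set by auto

lemma PM_permutes: "\<pi> \<in> PM I ==> \<pi> permutes pm I"
 by (simp add: PM_def)

lemma PM_perm: "\<pi> \<in> PM I ==> ix_set I ==> permutation \<pi>"
 using PM_permutes finite_pm perm_perm by blast

lemma PM_bij: "\<pi> \<in> PM I ==> bij \<pi>"
 using PM_permutes permutes_bij by blast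

lemma PM_no_flip: "\<pi> \<in> PM I ==> x \<in> pm I ==> - x \<notin> orbit \<pi> x"
 by (simp add: PM_def)

lemma PM_in: "\<pi> \<in> PM I ==> \<pi> x \<in> pm I \<longleftrightarrow> x \<in> pm I"
 using PM_permutes permutes_in_image by metis

lemma finite_PM: "ix_set I ==> finite (PM I)"
 by (rule finite_subset[OF _ finite_permutations[OF finite_pm]]) (auto simp: PM_def)

text \<open>The defining relation without the inverse: x \<mapsto> \<pi>(-x) is an involution. Off
  the signed set \<pi> is the identity, so this holds for every integer.\<close>

lemma PM_neg:
 assumes "\<pi> \<in> PM I" shows "\<pi> (- \<pi> (- k)) = k"
proof (cases "k \<in> pm I")
 case True
 hence "\<pi> (- k) = - pinv \<pi> (- (- k))" using assms neg_in_signed_set[of k I] unfolding PM_def by blast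
 hence "- \<pi> (- k) = pinv \<pi> k" by simp
 thus ?thesis using permutes_inverses(1)[OF PM_permutes[OF assms]] by simp
next
 case False
 hence "\<pi> (- k) = - k" "\<pi> k = k" using permutes_not_in[OF PM_permutes[OF assms]] neg_in_signed_set[of k I] by blast+
 thus ?thesis by simp
qed

lemma PM_pinv:
 assumes "\<pi> \<in> PM I" shows "pinv \<pi> k = - \<pi> (- k)"
proof -
 have "pinv \<pi> (\<pi> (- \<pi> (- k))) = - \<pi> (- k)" using permutes_inverses(2)[OF PM_permutes[OF assms]] .
 thus ?thesis unfolding PM_neg[OF assms] .
qed

lemma PM_I:
 assumes "\<pi> permutes pm I" "\<And>k. \<pi> (- \<pi> (- k)) = k"
  and "\<And>k. k \<in> pm I ==> - k \<notin> orbit \<pi> k" shows "\<pi> \<in> PM I"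
proof -
 have "\<pi> k = - pinv \<pi> (- k)" for k proof -
  have "pinv \<pi> (\<pi> (- \<pi> k)) = - \<pi> k" using permutes_inverses(2)[OF assms(1)] .
  moreover have "\<pi> (- \<pi> k) = - k" using assms(2)[of "- k"] by simp
  ultimately show ?thesis by simp
 qed
 thus ?thesis using assms(1,3) unfolding PM_def by blast
qed

text \<open>Negation conjugates \<pi> to its inverse, and a permutation has the same orbits as its
  inverse.\<close>

lemma PM_orbit_neg:
 assumes "\<pi> \<in> PM I" "ix_set I" shows "orbit \<pi> (- x) = uminus ` orbit \<pi> x"
proof -
 have "\<pi> (- y) = - pinv \<pi> y" for y using PM_pinv[OF assms(1), of y] by simp
 hence "orbit \<pi> (- x) = uminus ` orbit (pinv \<pi>) x" by (rule orbit_map)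
 thus ?thesis unfolding orbit_inv_eq[OF PM_perm[OF assms]] .
qed

lemma PM_cycle_blocks_neg:
 assumes "\<pi> \<in> PM I" "ix_set I" "B \<in> cycle_blocks (pm I) \<pi>"
 shows "uminus ` B \<in> cycle_blocks (pm I) \<pi>" "B \<inter> uminus ` B = {}" proof -
 obtain x where x: "x \<in> pm I" "B = orbit \<pi> x" using assms(3) by (auto simp: cycle_blocks_def)
 have m: "uminus ` B = orbit \<pi> (- x)" using PM_orbit_neg[OF assms(1,2)] x(2) by simp
 thus "uminus ` B \<in> cycle_blocks (pm I) \<pi>" using x(1) by (simp add: cycle_blocks_def)
 note bl = cycle_blocks_block[OF PM_permutes[OF assms(1)] PM_perm[OF assms(1,2)] finite_pm[OF assms(2)] assms(3)]
 show "B \<inter> uminus ` B = {}" proof (rule ccontr)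
  assume "B \<inter> uminus ` B \<noteq> {}"
  then obtain y where "y \<in> B" "- y \<in> B" by auto
  hence "- y \<in> orbit \<pi> y" "y \<in> pm I" using bl(4)[of y] bl(1) by auto
  thus False using PM_no_flip[OF assms(1)] by blast
 qed
qed

lemma abs_image_uminus: "abs ` uminus ` B = abs ` (B :: int set)"
 by (simp add: image_image)

text \<open>A cycle and its mirror image are disjoint, so the smallest absolute value itself belongs
  to exactly one of the two.\<close>

lemma pos_cycles_cases:
 assumes "\<pi> \<in> PM I" "ix_set I" "B \<in> cycle_blocks (pm I) \<pi>"
 shows "B \<in> pos_cycles I \<pi> \<longleftrightarrow> uminus ` B \<notin> pos_cycles I \<pi>" proof -
 note bl = cycle_blocks_block[OF PM_permutes[OF assms(1)] PM_perm[OF assms(1,2)] finite_pm[OF assms(2)] assms(3)]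
 note ng = PM_cycle_blocks_neg[OF assms]
 let ?m = "Min (abs ` B)"
 have "?m \<in> abs ` B" using bl(2,3) by simp
 then obtain y where y: "y \<in> B" "?m = \<bar>y\<bar>" by auto
 hence "?m \<in> B \<or> ?m \<in> uminus ` B" by (cases "0 \<le> y") auto
 hence "?m \<in> B \<longleftrightarrow> ?m \<notin> uminus ` B" using ng(2) by blast
 thus ?thesis using ng(1) assms(3) unfolding pos_cycles_def abs_image_uminus mem_Collect_eq by blast
qed

lemma pos_cycles_neg_disjoint:
 assumes "\<pi> \<in> PM I" "ix_set I" shows "cycle_blocks (pm I) \<pi> = pos_cycles I \<pi> \<union> (`) uminus ` pos_cycles I \<pi>"
  "pos_cycles I \<pi> \<inter> (`) uminus ` pos_cycles I \<pi> = {}"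
proof -
 have mm: "uminus ` uminus ` B = (B :: int set)" for B by (simp add: image_image)
 have sub: "pos_cycles I \<pi> \<subseteq> cycle_blocks (pm I) \<pi>" by (auto simp: pos_cycles_def)
 show "cycle_blocks (pm I) \<pi> = pos_cycles I \<pi> \<union> (`) uminus ` pos_cycles I \<pi>" proof (intro equalityI subsetI)
  fix B assume B: "B \<in> cycle_blocks (pm I) \<pi>"
  show "B \<in> pos_cycles I \<pi> \<union> (`) uminus ` pos_cycles I \<pi>" proof (cases "B \<in> pos_cycles I \<pi>")
   case False
   hence "uminus ` B \<in> pos_cycles I \<pi>" using pos_cycles_cases[OF assms B] by blast
   hence "uminus ` uminus ` B \<in> (`) uminus ` pos_cycles I \<pi>" by (rule imageI)
   thus ?thesis unfolding mm by blast
  qed blast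
 next
  fix B assume "B \<in> pos_cycles I \<pi> \<union> (`) uminus ` pos_cycles I \<pi>"
  thus "B \<in> cycle_blocks (pm I) \<pi>" using sub PM_cycle_blocks_neg(1)[OF assms] by blast
 qed
 show "pos_cycles I \<pi> \<inter> (`) uminus ` pos_cycles I \<pi> = {}" using pos_cycles_cases[OF assms] sub by blast
qed

lemma finite_cycle_blocks: "ix_set I ==> finite (cycle_blocks (pm I) \<pi>)"
 by (simp add: cycle_blocks_def finite_pm)

lemma finite_pos_cycles: "ix_set I ==> finite (pos_cycles I \<pi>)"
 by (simp add: pos_cycles_def finite_cycle_blocks)

lemma num_cycles_PM:
 assumes "\<pi> \<in> PM I" "ix_set I" shows "num_cycles (pm I) \<pi> = 2 * card (pos_cycles I \<pi>)"
proof -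
 have "inj ((`) (uminus :: int => int))" by (rule injI) (simp add: inj_image_eq_iff)
 hence "card ((`) uminus ` pos_cycles I \<pi>) = card (pos_cycles I \<pi>)" using card_image inj_on_subset[OF _ subset_UNIV] by blast
 thus ?thesis unfolding num_cycles_def pos_cycles_neg_disjoint(1)[OF assms]
  using pos_cycles_neg_disjoint(2)[OF assms] finite_pos_cycles[OF assms(2)] by (simp add: card_Un_disjoint)
qed

text \<open>Equivalent to factoring R as its positive part times the inverse of its negative part:
  the positive part moves the selected cycles, the other factor their mirror images. The set
  \<open>?U\<close> contains exactly one of x and -x for each signed index x.\<close>

lemma plus_part_inverse:
 assumes "R \<in> PM I" "ix_set I" shows "pinv (minus_part I R) = pinv (plus_part I R) \<circ> R"
proof -
 let ?U = "\<Union>(pos_cycles I R)" and ?r = "plus_part I R"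
 have r: "?r permutes pm I" using plus_part_permutes[OF ix_finite[OF assms(2)] PM_permutes[OF assms(1)]] .
 note bl = cycle_blocks_block[OF PM_permutes[OF assms(1)] PM_perm[OF assms] finite_pm[OF assms(2)]]
 have U: "R x \<in> ?U" if "x \<in> ?U" for x proof -
  obtain B where B: "B \<in> pos_cycles I R" "x \<in> B" using \<open>x \<in> ?U\<close> by blast
  hence "R x \<in> B" using bl(4)[of B x] orbit.base[of R x] by (simp add: pos_cycles_def)
  thus ?thesis using B by blast
 qed
 have neg: "- x \<in> ?U \<longleftrightarrow> x \<notin> ?U" if "x \<in> pm I" for x proof -
  have xo: "x \<in> orbit R x" using permutation_self_in_orbit[OF PM_perm[OF assms]] .
  have o: "orbit R x \<in> cycle_blocks (pm I) R" using that by (simp add: cycle_blocks_def)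
  have xU: "x \<in> ?U \<longleftrightarrow> orbit R x \<in> pos_cycles I R" using xo bl(4) by (auto simp: pos_cycles_def)
  have o': "orbit R (- x) = uminus ` orbit R x" using PM_orbit_neg[OF assms] .
  have mxo: "- x \<in> orbit R (- x)" using permutation_self_in_orbit[OF PM_perm[OF assms]] .
  have "- x \<in> ?U \<longleftrightarrow> orbit R (- x) \<in> pos_cycles I R" using mxo bl(4) by (auto simp: pos_cycles_def)
  thus ?thesis using xU pos_cycles_cases[OF assms o] unfolding o' by blast
 qed
 have rx: "?r x = (if x \<in> ?U then R x else x)" for x by (simp add: plus_part_def perm_restrict_def)
 have "?r (- pinv ?r (- x)) = R x" for x proof (cases "x \<in> pm I")
  case False
  hence "pinv ?r (- x) = - x" "?r x = x" "R x = x" using permutes_not_in[OF permutes_inv[OF r], of "- x"] permutes_not_in[OF r, of x]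
    permutes_not_in[OF PM_permutes[OF assms(1)], of x] by simp_all
  thus ?thesis by simp
 next
  case True
  show ?thesis proof (cases "x \<in> ?U")
   case xU: True
   hence "?r (- x) = - x" using neg[OF True] rx by simp
   hence "pinv ?r (- x) = - x" using permutes_inverses(2)[OF r] by metis
   thus ?thesis using rx xU by simp
  next
   case xU: False
   have in': "R x \<in> pm I" using True PM_in[OF assms(1)] by blast
   have e: "R (- R x) = - x" using PM_neg[OF assms(1), of "- x"] by simp
   have nU: "R x \<notin> ?U" proof
    assume "R x \<in> ?U"
    hence "\<not> - R x \<in> ?U" using neg[OF in'] by blast
    have "- x \<in> ?U" using neg[OF True] xU by blast
    then obtain B where B: "B \<in> pos_cycles I R" "- x \<in> B" by blast
    hence "B = orbit R (- x)" using bl(4)[of B "- x"] by (simp add: pos_cycles_def)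
    also have "... = uminus ` orbit R x" using PM_orbit_neg[OF assms] .
    finally have "- R x \<in> B" using orbit.base[of R x] by simp
    thus False using B \<open>\<not> - R x \<in> ?U\<close> by blast
   qed
   hence "?r (- R x) = - x" using neg[OF in'] rx e by simp
   hence "pinv ?r (- x) = - R x" using permutes_inverses(2)[OF r] by metis
   thus ?thesis using rx nU by simp
  qed
 qed
 hence e: "- pinv ?r (- x) = pinv ?r (R x)" for x using permutes_inverses(2)[OF r] by metis
 have "pinv (minus_part I R) = (\<lambda>x. - pinv ?r (- x))"
  by (rule inv_unique_comp) (simp_all add: fun_eq_iff minus_part_def permutes_inverses[OF r])
 thus ?thesis using e by (simp add: fun_eq_iff)
qed

section \<open>Loop counts, the defect and the genus bound\<close>

lemma Kr_conj:
 assumes "r \<in> PM I" "ix_set I" shows "Kr I r \<pi> = pinv (plus_part I r) \<circ> (r \<circ> pinv \<pi>) \<circ> plus_part I r"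
 unfolding Kr_def plus_part_inverse[OF assms] by (simp add: comp_assoc)

text \<open>The complement is conjugate to R \<pi>^(-1) by the positive part of R, so its cycle
  count does not see which cycles were called positive.\<close>

lemma num_cycles_Kr:
 assumes "R \<in> PM I" "ix_set I" shows "num_cycles (pm I) (Kr I R \<pi>) = num_cycles (pm I) (R \<circ> pinv \<pi>)"
proof -
 have r: "plus_part I R permutes pm I" using plus_part_permutes[OF ix_finite[OF assms(2)] PM_permutes[OF assms(1)]] .
 have "num_cycles (plus_part I R ` pm I) (R \<circ> pinv \<pi>) = num_cycles (pm I) (Kr I R \<pi>)" by (rule num_cycles_map)
   (simp_all add: Kr_conj[OF assms] permutes_inverses[OF r] permutes_inj[OF r])
 thus ?thesis by (simp add: permutes_image[OF r])
qed

text \<open>The exponent of N in the Gram matrix of pairings. The cycles of \<pi> \<rho>^(-1) are as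
  many as those of a premap, the complement, so the division is exact on premaps
  (\<open>two_loops\<close>).\<close>

definition loops :: "int set => (int => int) => (int => int) => nat" where
 "loops I \<pi> \<rho> = num_cycles (pm I) (\<pi> \<circ> pinv \<rho>) div 2"

lemma two_loops:
 assumes "\<pi> \<in> PM I" "r \<in> PM I" "ix_set I" shows "2 * loops I \<pi> r = num_cycles (pm I) (\<pi> \<circ> pinv r)"
 using num_cycles_PM[OF Kr_in_PM[OF ix_finite[OF assms(3)] assms(2,1)] assms(3)] by (simp add: loops_def num_cycles_Kr[OF assms(1,3)])

text \<open>The exponent left when the Gram entry N^loops is divided by N^|I| and rescaled by the
  cycle counts of both arguments. On premaps the natural subtractions never truncate
  (\<open>defect_eq\<close>).\<close>

definition defect :: "int set => (int => int) => (int => int) => nat" where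
 "defect I \<pi> \<rho> = card I + card (pos_cycles I \<pi>) - loops I \<pi> \<rho> - card (pos_cycles I \<rho>)"

definition joint_orbits :: "int set => (int => int) => (int => int) => int set set" where
 "joint_orbits I \<pi> \<rho> = components (pm I) (graph \<pi> \<union> graph \<rho>)"

lemma linked_orbit:
 assumes "permutation f" shows "linked (graph f \<union> R) `` orbit f x = linked (graph f \<union> R) `` {x}"
proof
 have "orbit f x \<subseteq> linked (graph f \<union> R) `` {x}" unfolding orbit_eq_linked[OF assms]
  using linked_mono[of "graph f" "graph f \<union> R"] by blast
 thus "linked (graph f \<union> R) `` orbit f x \<subseteq> linked (graph f \<union> R) `` {x}"
  using linked_trans[of x _ "graph f \<union> R"] by blast
 show "linked (graph f \<union> R) `` {x} \<subseteq> linked (graph f \<union> R) `` orbit f x"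
  using permutation_self_in_orbit[OF assms, of x] by blast
qed

lemma joint_orbits_eq_image:
 assumes "\<pi> \<in> PM I" "ix_set I"
 shows "joint_orbits I \<pi> r = (\<lambda>B. linked (graph \<pi> \<union> graph r) `` B) ` cycle_blocks (pm I) \<pi>"
 unfolding joint_orbits_def components_def cycle_blocks_def image_image
  linked_orbit[OF PM_perm[OF assms]] ..

text \<open>The genus inequality for \<pi> R^(-1) and R, whose product is \<pi>, on 2|I| points. The
  three cycle counts are even and joint orbits enter with factor two, so everything is
  halved.\<close>

lemma genus_PM:
 assumes "\<pi> \<in> PM I" "R \<in> PM I" "ix_set I"
 shows "loops I \<pi> R + card (pos_cycles I R) + card (pos_cycles I \<pi>) \<le> card I + card (joint_orbits I \<pi> R)" proof -
 let ?S = "pm I"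
 have p: "\<pi> permutes ?S" "R permutes ?S" using PM_permutes assms by blast+
 have e: "(\<pi> \<circ> pinv R) \<circ> R = \<pi>" using permutes_inv_o(2)[OF p(2)] by (simp add: comp_assoc)
 \<comment> \<open>Replacing \<pi> by \<pi> R^(-1) does not change the group generated together with
   R, hence not the joint orbits.\<close>
 have L: "linked (graph (\<pi> \<circ> pinv R) \<union> graph R) = linked (graph \<pi> \<union> graph R)" proof (rule linked_eqI)
  let ?A = "graph (\<pi> \<circ> pinv R) \<union> graph R" and ?B = "graph \<pi> \<union> graph R"
  have r: "(x, R x) \<in> linked ?A" "(x, R x) \<in> linked ?B" for x by (rule linked_base, simp add: graph_def)+
  have "(x, \<pi> (pinv R x)) \<in> linked ?B" for x proof (rule linked_trans)
   show "(x, pinv R x) \<in> linked ?B" using linked_sym[OF r(2)[of "pinv R x"]] permutes_inverses(1)[OF p(2)] by simp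
   show "(pinv R x, \<pi> (pinv R x)) \<in> linked ?B" by (rule linked_base) (simp add: graph_def)
  qed
  hence 1: "graph (\<pi> \<circ> pinv R) \<subseteq> linked ?B" by (auto simp add: graph_def)
  have "(x, \<pi> x) \<in> linked ?A" for x proof (rule linked_trans[OF r(1)])
   have "(R x, (\<pi> \<circ> pinv R) (R x)) \<in> linked ?A" by (rule linked_base) (simp add: graph_def)
   thus "(R x, \<pi> x) \<in> linked ?A" by (simp add: permutes_inverses(2)[OF p(2)])
  qed
  hence 2: "graph \<pi> \<subseteq> linked ?A" by (auto simp add: graph_def)
  have 3: "graph R \<subseteq> linked ?A" "graph R \<subseteq> linked ?B" using r by (auto simp add: graph_def)
  show "?A \<subseteq> linked ?B" using 1 3 by blast
  show "?B \<subseteq> linked ?A" using 2 3 by blast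
 qed
 have "\<pi> \<circ> pinv R permutes ?S" using p permutes_inv permutes_compose by blast
 from genus_inequality[OF finite_pm[OF assms(3)] this p(2)]
 show ?thesis unfolding e components_def L
  using two_loops[OF assms] num_cycles_PM[OF assms(1,3)] num_cycles_PM[OF assms(2,3)] card_signed_set[OF assms(3)]
  by (simp add: joint_orbits_def components_def)
qed

lemma card_joint_orbits_le:
 assumes "\<pi> \<in> PM I" "ix_set I" shows "card (joint_orbits I \<pi> r) \<le> 2 * card (pos_cycles I \<pi>)"
 unfolding joint_orbits_eq_image[OF assms] num_cycles_PM[OF assms, symmetric] num_cycles_def
 by (rule card_image_le[OF finite_cycle_blocks[OF assms(2)]])

lemma defect_eq:
 assumes "\<pi> \<in> PM I" "r \<in> PM I" "ix_set I"
 shows "defect I \<pi> r + loops I \<pi> r + card (pos_cycles I r) = card I + card (pos_cycles I \<pi>)"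
 using genus_PM[OF assms] card_joint_orbits_le[OF assms(1,3), of r] by (simp add: defect_def)

text \<open>The defect is at least the number of cycles of \<pi> that are lost by merging into joint
  orbits; the later lower bounds count such cycles.\<close>

lemma defect_ge:
 assumes "\<pi> \<in> PM I" "r \<in> PM I" "ix_set I"
 shows "2 * card (pos_cycles I \<pi>) \<le> defect I \<pi> r + card (joint_orbits I \<pi> r)"
 using genus_PM[OF assms] defect_eq[OF assms] by simp

lemma defect_self:
 assumes "\<pi> \<in> PM I" "ix_set I" shows "defect I \<pi> \<pi> = 0"
proof -
 have "\<pi> \<circ> pinv \<pi> = id" using permutes_inv_o(1)[OF PM_permutes[OF assms(1)]] .
 thus ?thesis by (simp add: defect_def loops_def num_cycles_id card_signed_set[OF assms(2)])
qed

text \<open>Unless r = \<pi> some loop is missing, and with defect zero the balance in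
  \<open>defect_eq\<close> turns this into extra cycles of r. The cycle count is therefore a rank
  for back substitution.\<close>

lemma defect_zero_card:
 assumes "\<pi> \<in> PM I" "r \<in> PM I" "ix_set I" "defect I \<pi> r = 0" "r \<noteq> \<pi>"
 shows "card (pos_cycles I \<pi>) < card (pos_cycles I r)" proof -
 let ?S = "pm I"
 have p: "\<pi> permutes ?S" "r permutes ?S" using PM_permutes assms by blast+
 have c: "\<pi> \<circ> pinv r permutes ?S" using p permutes_inv permutes_compose by blast
 have "num_cycles ?S (\<pi> \<circ> pinv r) \<noteq> card ?S" proof
  assume "num_cycles ?S (\<pi> \<circ> pinv r) = card ?S"
  hence "\<pi> \<circ> pinv r = id" using num_cycles_eq_card_imp_id[OF c finite_pm[OF assms(3)]] by blast
  hence "\<pi> \<circ> (pinv r \<circ> r) = r" by (simp add: comp_assoc[symmetric])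
  thus False using permutes_inv_o(2)[OF p(2)] assms(5) by simp
 qed
 hence "2 * loops I \<pi> r < 2 * card I" using num_cycles_le[OF finite_pm[OF assms(3)], of "\<pi> \<circ> pinv r"]
   two_loops[OF assms(1-3)] card_signed_set[OF assms(3)] by linarith
 thus ?thesis using defect_eq[OF assms(1-3)] assms(4) by simp
qed

text \<open>With defect zero there are as many joint orbits as cycles of \<pi>. So no two cycles of
  \<pi> merge, and r cannot leave a cycle of \<pi>.\<close>

lemma defect_zero_refines:
 assumes "\<pi> \<in> PM I" "r \<in> PM I" "ix_set I" "defect I \<pi> r = 0" shows "r x \<in> orbit \<pi> x"
proof (cases "x \<in> pm I")
 case False
 hence "r x = x" using permutes_not_in[OF PM_permutes[OF assms(2)]] by blast
 thus ?thesis using permutation_self_in_orbit[OF PM_perm[OF assms(1,3)]] by simp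
next
 case True
 let ?L = "linked (graph \<pi> \<union> graph r)" and ?C = "cycle_blocks (pm I) \<pi>"
 have "card ((``) ?L ` ?C) = card ?C" using defect_ge[OF assms(1-3)] card_joint_orbits_le[OF assms(1,3), of r] assms(4)
  unfolding joint_orbits_eq_image[OF assms(1,3)] num_cycles_PM[OF assms(1,3), symmetric] num_cycles_def by simp
 hence inj: "inj_on ((``) ?L) ?C" using finite_cycle_blocks[OF assms(3)] by (rule eq_card_imp_inj_on[rotated])
 have L: "?L `` orbit \<pi> y = ?L `` {y}" for y by (rule linked_orbit[OF PM_perm[OF assms(1,3)]])
 have "(x, r x) \<in> ?L" by (rule linked_base) (simp add: graph_def)
 hence "?L `` orbit \<pi> x = ?L `` orbit \<pi> (r x)" unfolding L linked_class_eq .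
 moreover have "orbit \<pi> x \<in> ?C" "orbit \<pi> (r x) \<in> ?C" using True PM_in[OF assms(2)] by (simp_all add: cycle_blocks_def)
 ultimately have "orbit \<pi> x = orbit \<pi> (r x)" using inj_onD[OF inj] by blast
 thus ?thesis using permutation_self_in_orbit[OF PM_perm[OF assms(1,3)], of "r x"] by simp
qed

section \<open>Lower bounds for the defect\<close>

text \<open>If every cycle in T shares its joint orbit with a cycle outside T, the cycles outside T
  already produce all joint orbits, and at least card T cycles are lost.\<close>

lemma defect_ge_card:
 assumes "\<pi> \<in> PM I" "r \<in> PM I" "ix_set I" "T \<subseteq> cycle_blocks (pm I) \<pi>"
  and "\<And>B. B \<in> T ==> \<exists>C\<in>cycle_blocks (pm I) \<pi> - T.
   linked (graph \<pi> \<union> graph r) `` B = linked (graph \<pi> \<union> graph r) `` C" shows "card T \<le> defect I \<pi> r"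
proof -
 let ?f = "(``) (linked (graph \<pi> \<union> graph r))" and ?C = "cycle_blocks (pm I) \<pi>"
 have fin: "finite ?C" by (rule finite_cycle_blocks[OF assms(3)])
 have "?f ` ?C \<subseteq> ?f ` (?C - T)" proof (intro image_subsetI)
  fix B assume "B \<in> ?C"
  thus "?f B \<in> ?f ` (?C - T)" using assms(5)[of B] by (cases "B \<in> T") auto
 qed
 hence "card (?f ` ?C) \<le> card (?f ` (?C - T))" using fin by (intro card_mono) auto
 also have "... \<le> card (?C - T)" using fin by (intro card_image_le) auto
 also have "... = card ?C - card T" using fin assms(4) by (simp add: card_Diff_subset finite_subset)
 finally have "card (joint_orbits I \<pi> r) \<le> card ?C - card T" unfolding joint_orbits_eq_image[OF assms(1,3)] .
 moreover have "card T \<le> card ?C" using fin assms(4) by (rule card_mono)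
 moreover have "card ?C = 2 * card (pos_cycles I \<pi>)" using num_cycles_PM[OF assms(1,3)] by (simp add: num_cycles_def)
 ultimately show ?thesis using defect_ge[OF assms(1-3)] by linarith
qed

definition joined :: "(int => int) => int set => int set => bool" where
 "joined \<rho> J K \<longleftrightarrow> (\<exists>x\<in>pm J. \<exists>y\<in>pm K. (x, y) \<in> linked (graph \<rho>))"

lemma joined_sym: "joined r J K ==> joined r K J"
proof -
 assume "joined r J K"
 then obtain x y where "x \<in> pm J" "y \<in> pm K" "(x, y) \<in> linked (graph r)" by (auto simp: joined_def)
 thus "joined r K J" unfolding joined_def using linked_sym[of x y "graph r"] by blast
qed

lemma linked_neg:
 assumes "r \<in> PM I" "ix_set I" "(x, y) \<in> linked (graph r)" shows "(- x, - y) \<in> linked (graph r)"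
proof -
 have "y \<in> orbit r x" unfolding orbit_eq_linked[OF PM_perm[OF assms(1,2)]] using assms(3) by simp
 hence "- y \<in> orbit r (- x)" unfolding PM_orbit_neg[OF assms(1,2)] by (rule imageI)
 thus ?thesis unfolding orbit_eq_linked[OF PM_perm[OF assms(1,2)]] by simp
qed

text \<open>A link from J to y is mirrored by a link to -y, so the cycle of y and its mirror image
  both fall into joint orbits of cycles inside J.\<close>

lemma joined_cycles:
 assumes "\<pi> \<in> PM I" "r \<in> PM I" "ix_set I" "J \<subseteq> I" "sstable J \<pi>"
  and "x \<in> pm J" "(x, y) \<in> linked (graph r)" "B \<in> {orbit \<pi> y, orbit \<pi> (- y)}"
 shows "\<exists>C\<in>cycle_blocks (pm I) \<pi>. C \<subseteq> pm J \<and>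
   linked (graph \<pi> \<union> graph r) `` B = linked (graph \<pi> \<union> graph r) `` C"
proof -
 let ?L = "linked (graph \<pi> \<union> graph r)"
 have L: "?L `` orbit \<pi> y = ?L `` {y}" for y by (rule linked_orbit[OF PM_perm[OF assms(1,3)]])
 have "linked (graph r) \<subseteq> ?L" by (rule linked_mono) blast
 hence "(x, y) \<in> ?L" "(- x, - y) \<in> ?L" using assms(7) linked_neg[OF assms(2,3,7)] by blast+
 hence "?L `` orbit \<pi> y = ?L `` orbit \<pi> x" "?L `` orbit \<pi> (- y) = ?L `` orbit \<pi> (- x)"
  unfolding L using linked_class_eq by metis+
 moreover have "orbit \<pi> x \<subseteq> pm J" "orbit \<pi> (- x) \<subseteq> pm J"
  using stable_orbit[OF assms(5)] assms(6) by simp_all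
 moreover have "x \<in> pm I" using assms(4,6) signed_set_mono by blast
 hence "orbit \<pi> x \<in> cycle_blocks (pm I) \<pi>" "orbit \<pi> (- x) \<in> cycle_blocks (pm I) \<pi>"
  by (simp_all add: cycle_blocks_def)
 ultimately show ?thesis using assms(8) by blast
qed

lemma orbit_pair:
 assumes "\<pi> \<in> PM I" "ix_set I" "J \<subseteq> I" "sstable J \<pi>" "y \<in> pm J"
 shows "{orbit \<pi> y, orbit \<pi> (- y)} \<subseteq> cycle_blocks (pm I) \<pi>"
  "card {orbit \<pi> y, orbit \<pi> (- y)} = 2"
  "\<And>B. B \<in> {orbit \<pi> y, orbit \<pi> (- y)} ==> B \<subseteq> pm J \<and> B \<noteq> {}"
proof -
 have y: "y \<in> pm I" using assms(3,5) signed_set_mono by blast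
 thus "{orbit \<pi> y, orbit \<pi> (- y)} \<subseteq> cycle_blocks (pm I) \<pi>" by (simp add: cycle_blocks_def)
 have "- y \<in> orbit \<pi> (- y)" using permutation_self_in_orbit[OF PM_perm[OF assms(1,2)]] .
 hence "orbit \<pi> y \<noteq> orbit \<pi> (- y)" using PM_no_flip[OF assms(1) y] by blast
 thus "card {orbit \<pi> y, orbit \<pi> (- y)} = 2" by simp
 show "B \<subseteq> pm J \<and> B \<noteq> {}" if "B \<in> {orbit \<pi> y, orbit \<pi> (- y)}" for B
  using that stable_orbit[OF assms(4), of y] stable_orbit[OF assms(4), of "- y"] assms(5)
   orbit_nonempty[of \<pi>] by auto
qed

text \<open>The two mirrored cycles of \<pi> through a linked point of K are absorbed by cycles in
  J, which gives the 2.\<close>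

lemma defect_joined:
 assumes "\<pi> \<in> PM I" "r \<in> PM I" "ix_set I" "J \<subseteq> I" "K \<subseteq> I" "J \<inter> K = {}"
  and "sstable J \<pi>" "sstable K \<pi>" "joined r J K" shows "2 \<le> defect I \<pi> r"
proof -
 obtain x y where xy: "x \<in> pm J" "y \<in> pm K" "(x, y) \<in> linked (graph r)" using assms(9) by (auto simp: joined_def)
 have disj: "pm J \<inter> pm K = {}" using assms(3-6) ix_subset by (intro signed_set_disjoint) blast+
 let ?T = "{orbit \<pi> y, orbit \<pi> (- y)}"
 note T = orbit_pair[OF assms(1,3,5,8) xy(2)]
 have "card ?T \<le> defect I \<pi> r" proof (rule defect_ge_card[OF assms(1-3) T(1)])
  fix B assume B: "B \<in> ?T"
  obtain C where C: "C \<in> cycle_blocks (pm I) \<pi>" "C \<subseteq> pm J"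
   "linked (graph \<pi> \<union> graph r) `` B = linked (graph \<pi> \<union> graph r) `` C"
   using joined_cycles[OF assms(1-4,7) xy(1,3) B] by blast
  have "C \<notin> ?T" using T(3)[of C] C(2) disj by blast
  thus "\<exists>C\<in>cycle_blocks (pm I) \<pi> - ?T.
    linked (graph \<pi> \<union> graph r) `` B = linked (graph \<pi> \<union> graph r) `` C" using C by blast
 qed
 thus ?thesis unfolding T(2) .
qed

text \<open>Two mirrored cycles in K and two in L are absorbed by cycles in J; disjointness of K and
  L makes them four different cycles.\<close>

lemma defect_joined2:
 assumes "\<pi> \<in> PM I" "r \<in> PM I" "ix_set I" "J \<subseteq> I" "K \<subseteq> I" "L \<subseteq> I"
  and "J \<inter> K = {}" "J \<inter> L = {}" "K \<inter> L = {}" and "sstable J \<pi>" "sstable K \<pi>" "sstable L \<pi>"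
  and "joined r J K" "joined r J L" shows "4 \<le> defect I \<pi> r"
proof -
 obtain x y where xy: "x \<in> pm J" "y \<in> pm K" "(x, y) \<in> linked (graph r)" using assms(13) by (auto simp: joined_def)
 obtain w z where wz: "w \<in> pm J" "z \<in> pm L" "(w, z) \<in> linked (graph r)" using assms(14) by (auto simp: joined_def)
 have ix: "ix_set J" "ix_set K" "ix_set L" using assms(3-6) ix_subset by blast+
 note disj = signed_set_disjoint[OF ix(1,2) assms(7)] signed_set_disjoint[OF ix(1,3) assms(8)]
  signed_set_disjoint[OF ix(2,3) assms(9)]
 let ?T = "{orbit \<pi> y, orbit \<pi> (- y)}" and ?U = "{orbit \<pi> z, orbit \<pi> (- z)}"
 note T = orbit_pair[OF assms(1,3,5,11) xy(2)]
 note U = orbit_pair[OF assms(1,3,6,12) wz(2)]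
 have TU: "?T \<inter> ?U = {}" proof (rule ccontr)
  assume "?T \<inter> ?U \<noteq> {}"
  then obtain B where B: "B \<in> ?T" "B \<in> ?U" by blast
  show False using T(3)[OF B(1)] U(3)[OF B(2)] disj(3) by blast
 qed
 have "card (?T \<union> ?U) \<le> defect I \<pi> r" proof (rule defect_ge_card[OF assms(1-3)])
  show "?T \<union> ?U \<subseteq> cycle_blocks (pm I) \<pi>" using T(1) U(1) by (rule Un_least)
  fix B assume "B \<in> ?T \<union> ?U"
  hence "\<exists>C\<in>cycle_blocks (pm I) \<pi>. C \<subseteq> pm J \<and>
   linked (graph \<pi> \<union> graph r) `` B = linked (graph \<pi> \<union> graph r) `` C"
   using joined_cycles[OF assms(1-4,10) xy(1,3), of B] joined_cycles[OF assms(1-4,10) wz(1,3), of B] by blast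
  then obtain C where C: "C \<in> cycle_blocks (pm I) \<pi>" "C \<subseteq> pm J"
   "linked (graph \<pi> \<union> graph r) `` B = linked (graph \<pi> \<union> graph r) `` C" by blast
  have "C \<notin> ?T" using T(3)[of C] C(2) disj(1) by blast
  moreover have "C \<notin> ?U" using U(3)[of C] C(2) disj(2) by blast
  ultimately show "\<exists>C\<in>cycle_blocks (pm I) \<pi> - (?T \<union> ?U).
    linked (graph \<pi> \<union> graph r) `` B = linked (graph \<pi> \<union> graph r) `` C" using C by blast
 qed
 also have "card (?T \<union> ?U) = card ?T + card ?U" using TU by (intro card_Un_disjoint) auto
 finally show ?thesis unfolding T(2) U(2) by simp
qed

section \<open>Gluing premaps on disjoint index sets\<close>

definition res :: "int set => (int => int) => int => int" where
 "res J \<pi> = perm_restrict \<pi> (pm J)"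

lemma res_apply: "res J \<pi> x = (if x \<in> pm J then \<pi> x else x)"
 by (simp add: res_def perm_restrict_def)

lemma res_self: "\<pi> \<in> PM I ==> res I \<pi> = \<pi>"
 unfolding res_def using PM_permutes by (rule perm_restrict_id)

lemma res_res: "J \<subseteq> K ==> res J (res K \<pi>) = res J \<pi>"
 using signed_set_mono[of J K] by (auto simp: res_apply fun_eq_iff)

lemma stable_res: "sstable J (res K \<pi>) \<longleftrightarrow> sstable J \<pi>" if "J \<subseteq> K"
proof -
 have "res K \<pi> x = \<pi> x" if "x \<in> pm J" for x
  using that signed_set_mono[OF \<open>J \<subseteq> K\<close>] by (auto simp: res_apply)
 thus ?thesis by (simp add: stable_def)
qed

lemma orbit_res: "sstable J \<pi> ==> x \<in> pm J ==> orbit (res J \<pi>) x = orbit \<pi> x"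
 unfolding res_def by (rule orbit_perm_restrict)

lemma res_PM:
 assumes "\<pi> \<in> PM I" "ix_set I" "J \<subseteq> I" "sstable J \<pi>" shows "res J \<pi> \<in> PM J"
proof (rule PM_I)
 have ix: "ix_set J" using assms ix_subset by blast
 have inj: "inj \<pi>" using PM_bij[OF assms(1)] bij_is_inj by blast
 show "res J \<pi> permutes pm J" unfolding res_def by (rule perm_restrict_permutes[OF assms(4) inj finite_pm[OF ix]])
 show "res J \<pi> (- res J \<pi> (- k)) = k" for k
  using stableD[OF assms(4), of "- k"] PM_neg[OF assms(1), of k] by (simp add: res_apply)
 show "- k \<notin> orbit (res J \<pi>) k" if "k \<in> pm J" for k
  using that PM_no_flip[OF assms(1)] signed_set_mono[OF assms(3)] orbit_res[OF assms(4) that] by auto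
qed

text \<open>An injective map that preserves the finite set \<open>pm J\<close> cannot enter it from
  outside.\<close>

lemma stable_other:
 assumes "\<pi> \<in> PM (J \<union> K)" "ix_set (J \<union> K)" "J \<inter> K = {}" "sstable J \<pi>" shows "sstable K \<pi>"
 unfolding stable_def
proof (intro image_subsetI)
 have ix: "ix_set J" "ix_set K" using assms(2) by simp_all
 note disj = signed_set_disjoint[OF ix assms(3)]
 fix x assume x: "x \<in> pm K"
 hence "\<pi> x \<in> pm (J \<union> K)" using PM_in[OF assms(1)] by (simp add: signed_set_Un)
 moreover have "\<pi> x \<notin> pm J"
  using stable_iff[OF assms(4) bij_is_inj[OF PM_bij[OF assms(1)]] finite_pm[OF ix(1)]] x disj by blast
 ultimately show "\<pi> x \<in> pm K" by (simp add: signed_set_Un)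
qed

lemma not_stable_joined:
 assumes "r \<in> PM (J \<union> K)" "\<not> sstable J r" shows "joined r J K"
proof -
 obtain x where x: "x \<in> pm J" "r x \<notin> pm J" using assms(2) by (auto simp: stable_def)
 moreover have "r x \<in> pm (J \<union> K)" using PM_in[OF assms(1)] x(1) by (simp add: signed_set_Un)
 ultimately have "r x \<in> pm K" by (simp add: signed_set_Un)
 thus ?thesis using x(1) linked_graph[of x r] unfolding joined_def by blast
qed

lemma joined_Un: "joined r J (K \<union> L) \<longleftrightarrow> joined r J K \<or> joined r J L"
 unfolding joined_def signed_set_Un by blast

lemma glue_PM:
 assumes "\<pi> \<in> PM J" "s \<in> PM K" "ix_set (J \<union> K)" "J \<inter> K = {}"
 shows "\<pi> \<circ> s \<in> PM (J \<union> K)" "sstable J (\<pi> \<circ> s)"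
  "res J (\<pi> \<circ> s) = \<pi>" "res K (\<pi> \<circ> s) = s"
proof -
 let ?J = "pm J" and ?K = "pm K"
 have ix: "ix_set J" "ix_set K" using assms(3) by simp_all
 note disj = signed_set_disjoint[OF ix assms(4)]
 have off: "\<pi> x = x" if "x \<notin> ?J" for x using permutes_not_in[OF PM_permutes[OF assms(1)] that] .
 have off': "s x = x" if "x \<notin> ?K" for x using permutes_not_in[OF PM_permutes[OF assms(2)] that] .
 have in': "\<pi> x \<in> ?J" if "x \<in> ?J" for x using that PM_in[OF assms(1)] by blast
 have in'': "s x \<in> ?K" if "x \<in> ?K" for x using that PM_in[OF assms(2)] by blast
 have vJ: "(\<pi> \<circ> s) x = \<pi> x" if "x \<in> ?J" for x proof -
  have "x \<notin> ?K" using that disj by blast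
  thus ?thesis using off' by simp
 qed
 have vK: "(\<pi> \<circ> s) x = s x" if "x \<in> ?K" for x proof -
  have "s x \<notin> ?J" using in''[OF that] disj by blast
  thus ?thesis using off by simp
 qed
 have v: "(\<pi> \<circ> s) x = x" if "x \<notin> ?J" "x \<notin> ?K" for x using that off off' by simp
 show st: "stable ?J (\<pi> \<circ> s)" unfolding stable_def using vJ in' by auto
 have st': "stable ?K (\<pi> \<circ> s)" unfolding stable_def using vK in'' by auto
 show "res J (\<pi> \<circ> s) = \<pi>" using vJ off by (auto simp: res_apply fun_eq_iff)
 show "res K (\<pi> \<circ> s) = s" using vK off' by (auto simp: res_apply fun_eq_iff)
 show "\<pi> \<circ> s \<in> PM (J \<union> K)" proof (rule PM_I)
  show "\<pi> \<circ> s permutes pm (J \<union> K)" unfolding signed_set_Un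
   by (rule permutes_compose[OF permutes_subset[OF PM_permutes[OF assms(2)]] permutes_subset[OF PM_permutes[OF assms(1)]]]) auto
  show "(\<pi> \<circ> s) (- (\<pi> \<circ> s) (- k)) = k" for k proof -
   consider "k \<in> ?J" | "k \<in> ?K" | "k \<notin> ?J" "k \<notin> ?K" by blast
   thus ?thesis proof cases
    case 1
    hence "(\<pi> \<circ> s) (- k) = \<pi> (- k)" "- \<pi> (- k) \<in> ?J" using vJ in' by simp_all
    thus ?thesis using vJ PM_neg[OF assms(1), of k] by simp
   next
    case 2
    hence "(\<pi> \<circ> s) (- k) = s (- k)" "- s (- k) \<in> ?K" using vK in'' by simp_all
    moreover have "(\<pi> \<circ> s) (- s (- k)) = s (- s (- k))" using vK calculation(2) by blast
    ultimately show ?thesis using PM_neg[OF assms(2), of k] by simp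
   next
    case 3
    thus ?thesis using v by simp
   qed
  qed
  show "- k \<notin> orbit (\<pi> \<circ> s) k" if "k \<in> pm (J \<union> K)" for k proof (cases "k \<in> ?J")
   case True
   have "orbit (\<pi> \<circ> s) k = orbit \<pi> k" by (rule orbit_cong0[OF True]) (use stableD[OF st] vJ in auto)
   thus ?thesis using PM_no_flip[OF assms(1) True] by simp
  next
   case False
   hence k: "k \<in> ?K" using that by (simp add: signed_set_Un)
   have "orbit (\<pi> \<circ> s) k = orbit s k" by (rule orbit_cong0[OF k]) (use stableD[OF st'] vK in auto)
   thus ?thesis using PM_no_flip[OF assms(2) k] by simp
  qed
 qed
qed

lemma res_glue:
 assumes "\<pi> \<in> PM (J \<union> K)" "ix_set (J \<union> K)" "J \<inter> K = {}" "sstable J \<pi>"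
 shows "res J \<pi> \<circ> res K \<pi> = \<pi>" proof
 fix x
 have ix: "ix_set J" "ix_set K" using assms(2) by simp_all
 note disj = signed_set_disjoint[OF ix assms(3)]
 have "\<pi> x \<in> pm K" if "x \<in> pm K" using that stableD[OF stable_other[OF assms]] by blast
 moreover have "\<pi> x = x" if "x \<notin> pm J" "x \<notin> pm K"
  using that permutes_not_in[OF PM_permutes[OF assms(1)]] by (simp add: signed_set_Un)
 ultimately show "(res J \<pi> \<circ> res K \<pi>) x = \<pi> x" using disj by (auto simp: res_apply)
qed

text \<open>A premap preserving J preserves K as well and is the product of its two restrictions, so
  such premaps are pairs of premaps on J and K. This merges double sums into sums over the
  union.\<close>

lemma bij_betw_res:
 assumes "ix_set (J \<union> K)" "J \<inter> K = {}"
 shows "bij_betw (\<lambda>\<pi>. (res J \<pi>, res K \<pi>)) {\<pi> \<in> PM (J \<union> K). sstable J \<pi>} (PM J \<times> PM K)"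
proof (rule bij_betwI[where g = "\<lambda>(\<pi>, s). \<pi> \<circ> s"])
 show "(\<lambda>\<pi>. (res J \<pi>, res K \<pi>)) \<in> {\<pi> \<in> PM (J \<union> K). sstable J \<pi>} \<rightarrow> PM J \<times> PM K"
  using res_PM[OF _ assms(1)] stable_other[OF _ assms] by auto
 show "(\<lambda>(\<pi>, s). \<pi> \<circ> s) \<in> PM J \<times> PM K \<rightarrow> {\<pi> \<in> PM (J \<union> K). sstable J \<pi>}"
  using glue_PM[OF _ _ assms] by auto
 show "(case (res J \<pi>, res K \<pi>) of (\<pi>, s) => \<pi> \<circ> s) = \<pi>"
  if "\<pi> \<in> {\<pi> \<in> PM (J \<union> K). sstable J \<pi>}" for \<pi> using that res_glue[OF _ assms] by simp
 show "(res J (case z of (\<pi>, s) => \<pi> \<circ> s), res K (case z of (\<pi>, s) => \<pi> \<circ> s)) = z"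
  if "z \<in> PM J \<times> PM K" for z using that glue_PM(3,4)[OF _ _ assms] by (cases z) simp
qed

lemma sum_PM_prod:
 assumes "ix_set (J \<union> K)" "J \<inter> K = {}" shows "(\<Sum>\<pi>\<in>PM J. \<Sum>s\<in>PM K. g \<pi> s)
  = (\<Sum>\<pi> | \<pi> \<in> PM (J \<union> K) \<and> sstable J \<pi>. g (res J \<pi>) (res K \<pi>))"
 using sum.reindex_bij_betw[OF bij_betw_res[OF assms], of "\<lambda>(\<pi>, s). g \<pi> s"] by (simp add: sum.cartesian_product)

lemma cycle_blocks_res:
 assumes "sstable J \<pi>" shows "cycle_blocks (pm J) (res J \<pi>) = cycle_blocks (pm J) \<pi>"
 unfolding res_def by (rule cycle_blocks_perm_restrict[OF assms subset_refl])

lemma pos_cycles_Un: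
 assumes "\<pi> \<in> PM (J \<union> K)" "ix_set (J \<union> K)" "J \<inter> K = {}" "sstable J \<pi>"
 shows "pos_cycles (J \<union> K) \<pi> = pos_cycles J (res J \<pi>) \<union> pos_cycles K (res K \<pi>)"
  "pos_cycles J (res J \<pi>) \<inter> pos_cycles K (res K \<pi>) = {}"
proof -
 have ix: "ix_set J" "ix_set K" using assms(2) by simp_all
 note disj = signed_set_disjoint[OF ix assms(3)]
 note st' = stable_other[OF assms]
 have "cycle_blocks (pm J) \<pi> \<inter> cycle_blocks (pm K) \<pi> = {}"
  using stable_orbit[OF assms(4)] stable_orbit[OF st'] disj orbit_nonempty[of \<pi>] unfolding cycle_blocks_def by blast
 thus "pos_cycles J (res J \<pi>) \<inter> pos_cycles K (res K \<pi>) = {}"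
  unfolding pos_cycles_def cycle_blocks_res[OF assms(4)] cycle_blocks_res[OF st'] by blast
 show "pos_cycles (J \<union> K) \<pi> = pos_cycles J (res J \<pi>) \<union> pos_cycles K (res K \<pi>)"
  unfolding pos_cycles_def cycle_blocks_res[OF assms(4)] cycle_blocks_res[OF st'] signed_set_Un by (auto simp: cycle_blocks_def)
qed

lemma loops_Un:
 assumes "\<pi> \<in> PM (J \<union> K)" "r \<in> PM (J \<union> K)" "ix_set (J \<union> K)" "J \<inter> K = {}"
  and "sstable J \<pi>" "sstable J r"
 shows "loops (J \<union> K) \<pi> r = loops J (res J \<pi>) (res J r) + loops K (res K \<pi>) (res K r)" proof -
 have ix: "ix_set J" "ix_set K" using assms(3) by simp_all
 note disj = signed_set_disjoint[OF ix assms(4)]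
 note st = stable_other[OF assms(1,3,4,5)] stable_other[OF assms(2,3,4,6)]
 have part: "num_cycles (pm L) (res L \<pi> \<circ> pinv (res L r)) = num_cycles (pm L) (\<pi> \<circ> pinv r)"
  "sstable L (\<pi> \<circ> pinv r)" if "sstable L \<pi>" "sstable L r" "ix_set L" for L
 proof -
  have s: "sstable L (pinv r)" by (rule stable_pinv[OF that(2) PM_bij[OF assms(2)] finite_pm[OF that(3)]])
  thus s': "sstable L (\<pi> \<circ> pinv r)" using stable_comp that(1) by blast
  have "res L \<pi> \<circ> pinv (res L r) = perm_restrict (\<pi> \<circ> pinv r) (pm L)"
   unfolding res_def pinv_perm_restrict[OF that(2) PM_bij[OF assms(2)] finite_pm[OF that(3)]]
    perm_restrict_comp_stable[OF s] ..
  thus "num_cycles (pm L) (res L \<pi> \<circ> pinv (res L r)) = num_cycles (pm L) (\<pi> \<circ> pinv r)"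
   using num_cycles_perm_restrict[OF s'] by simp
 qed
 have "permutation (\<pi> \<circ> pinv r)" using PM_perm[OF assms(1,3)] permutation_inverse[OF PM_perm[OF assms(2,3)]]
  by (rule permutation_compose)
 from num_cycles_Un[OF part(2)[OF assms(5,6) ix(1)] part(2)[OF st ix(2)] disj
   finite_pm[OF ix(1)] finite_pm[OF ix(2)] this]
 have "num_cycles (pm (J \<union> K)) (\<pi> \<circ> pinv r)
  = num_cycles (pm J) (res J \<pi> \<circ> pinv (res J r)) + num_cycles (pm K) (res K \<pi> \<circ> pinv (res K r))"
  unfolding signed_set_Un part(1)[OF assms(5,6) ix(1)] part(1)[OF st ix(2)] .
 moreover have "res J \<pi> \<in> PM J" "res J r \<in> PM J" "res K \<pi> \<in> PM K" "res K r \<in> PM K"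
  using assms st res_PM[OF _ assms(3)] by simp_all
 ultimately have "2 * loops (J \<union> K) \<pi> r = 2 * loops J (res J \<pi>) (res J r) + 2 * loops K (res K \<pi>) (res K r)"
  using two_loops[OF assms(1-3)] two_loops[OF _ _ ix(1)] two_loops[OF _ _ ix(2)] by simp
 thus ?thesis by simp
qed

text \<open>Every term of \<open>defect_eq\<close> is additive over blocks that both premaps
  preserve.\<close>

lemma defect_Un:
 assumes "\<pi> \<in> PM (J \<union> K)" "R \<in> PM (J \<union> K)" "ix_set (J \<union> K)" "J \<inter> K = {}"
  and "sstable J \<pi>" "sstable J R"
 shows "defect (J \<union> K) \<pi> R = defect J (res J \<pi>) (res J R) + defect K (res K \<pi>) (res K R)" proof -
 have ix: "ix_set J" "ix_set K" using assms(3) by simp_all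
 note st = stable_other[OF assms(1,3,4,5)] stable_other[OF assms(2,3,4,6)]
 have r: "res J \<pi> \<in> PM J" "res J R \<in> PM J" "res K \<pi> \<in> PM K" "res K R \<in> PM K"
  using assms st res_PM[OF _ assms(3)] by simp_all
 have c: "card (pos_cycles (J \<union> K) y) = card (pos_cycles J (res J y)) + card (pos_cycles K (res K y))"
  if "y \<in> PM (J \<union> K)" "sstable J y" for y
  using pos_cycles_Un[OF that(1) assms(3,4) that(2)] finite_pos_cycles ix by (simp add: card_Un_disjoint)
 have "card (J \<union> K) = card J + card K" using ix assms(4) by (simp add: card_Un_disjoint ix_set_def)
 thus ?thesis using defect_eq[OF assms(1-3)] defect_eq[OF r(1,2) ix(1)] defect_eq[OF r(3,4) ix(2)]
   c[OF assms(1,5)] c[OF assms(2,6)] loops_Un[OF assms] by linarith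
qed

section \<open>Unitriangular systems with perturbed coefficients\<close>

text \<open>The rank replaces a total order on S: nonzero off-diagonal coefficients lead only to
  larger rank, so back substitution starts at the maximal rank.\<close>

definition unitriangular :: "'s set => ('s => 's => complex) => bool" where
 "unitriangular S a \<longleftrightarrow> finite S \<and> (\<forall>s\<in>S. a s s = 1) \<and>
   (\<exists>r :: 's => nat. \<forall>s\<in>S. \<forall>t\<in>S. t \<noteq> s \<and> a s t \<noteq> 0 \<longrightarrow> r s < r t)"

text \<open>Back substitution, by induction on the distance of the rank from its maximum. The
  constant is fixed before the vector u, which later allows u to depend on N.\<close>

lemma unitriangular_bound:
 fixes a :: "'s => 's => complex" and r :: "'s => nat"
 assumes "finite S" "\<And>s. s \<in> S ==> a s s = 1"
  and "\<And>s t. s \<in> S ==> t \<in> S ==> t \<noteq> s ==> a s t \<noteq> 0 ==> r s < r t"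
  and "s \<in> S" shows "\<exists>K\<ge>0. \<forall>u. norm (u s) \<le> K * (\<Sum>t\<in>S. norm (\<Sum>t'\<in>S. a t t' * u t'))"
 using assms(4)
proof (induction "Max (r ` S) - r s" arbitrary: s rule: less_induct)
 case less
 have le: "r t \<le> Max (r ` S)" if "t \<in> S" for t using assms(1) that by simp
 have "\<forall>t\<in>{t \<in> S. r s < r t}. \<exists>K. 0 \<le> K \<and> (\<forall>u. norm (u t) \<le> K * (\<Sum>t\<in>S. norm (\<Sum>t'\<in>S. a t t' * u t')))"
 proof
  fix t assume t: "t \<in> {t \<in> S. r s < r t}"
  hence ts: "t \<in> S" "r s < r t" by simp_all
  hence "Max (r ` S) - r t < Max (r ` S) - r s" using le[of t] by linarith
  from less.hyps[OF this ts(1)]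
  show "\<exists>K. 0 \<le> K \<and> (\<forall>u. norm (u t) \<le> K * (\<Sum>t\<in>S. norm (\<Sum>t'\<in>S. a t t' * u t')))" .
 qed
 from bchoice[OF this] obtain K where K0: "\<forall>t\<in>{t \<in> S. r s < r t}. 0 \<le> K t \<and>
   (\<forall>u. norm (u t) \<le> K t * (\<Sum>t\<in>S. norm (\<Sum>t'\<in>S. a t t' * u t')))" ..
 have K: "0 \<le> K t" "norm (u t) \<le> K t * (\<Sum>t\<in>S. norm (\<Sum>t'\<in>S. a t t' * u t'))"
  if "t \<in> S" "r s < r t" for t u using bspec[OF K0, of t] that by simp_all
 let ?T = "{t \<in> S - {s}. a s t \<noteq> 0}"
 have T: "t \<in> S" "r s < r t" if "t \<in> ?T" for t using that assms(3)[OF less.prems, of t] by auto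
 \<comment> \<open>The 1 pays for the equation of index s itself, the sum for the unknowns of larger
   rank substituted into it.\<close>
 define C where "C = 1 + (\<Sum>t\<in>?T. norm (a s t) * K t)"
 have "0 \<le> norm (a s t) * K t" if "t \<in> ?T" for t using K(1)[OF T[OF that]] by simp
 hence "0 \<le> (\<Sum>t\<in>?T. norm (a s t) * K t)" by (rule sum_nonneg)
 hence "0 \<le> C" by (simp add: C_def)
 moreover have "norm (u s) \<le> C * (\<Sum>t\<in>S. norm (\<Sum>t'\<in>S. a t t' * u t'))" for u proof -
  let ?v = "\<lambda>t. \<Sum>t'\<in>S. a t t' * u t'" and ?V = "\<Sum>t\<in>S. norm (\<Sum>t'\<in>S. a t t' * u t')"
  have "?v s = a s s * u s + (\<Sum>t\<in>S - {s}. a s t * u t)" by (rule sum.remove[OF assms(1) less.prems])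
  also have "(\<Sum>t\<in>S - {s}. a s t * u t) = (\<Sum>t\<in>?T. a s t * u t)"
   by (rule sum.mono_neutral_right) (use assms(1) in auto)
  finally have "u s = ?v s - (\<Sum>t\<in>?T. a s t * u t)" using assms(2)[OF less.prems] by simp
  hence "norm (u s) \<le> norm (?v s) + norm (\<Sum>t\<in>?T. a s t * u t)"
   using norm_triangle_ineq4[of "?v s" "\<Sum>t\<in>?T. a s t * u t"] by simp
  also have "norm (?v s) \<le> ?V" using less.prems by (intro member_le_sum[of s S "\<lambda>t. norm (?v t)"]) (simp_all add: assms(1))
  also have "norm (\<Sum>t\<in>?T. a s t * u t) \<le> (\<Sum>t\<in>?T. norm (a s t) * (K t * ?V))"
  proof (rule order_trans[OF norm_sum sum_mono])
   fix t assume "t \<in> ?T"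
   from K(2)[OF T[OF this]] show "norm (a s t * u t) \<le> norm (a s t) * (K t * ?V)" unfolding norm_mult by (rule mult_left_mono) simp
  qed
  also have "?V + (\<Sum>t\<in>?T. norm (a s t) * (K t * ?V)) = C * ?V" by (simp add: C_def distrib_right sum_distrib_right mult.assoc)
  finally show ?thesis by simp
 qed
 ultimately show ?case by (intro exI[of _ C]) simp
qed

text \<open>The perturbation changes the right-hand sides by a small multiple of U, the sum of the
  norms of all unknowns. Below the threshold 1/2 half of U is absorbed on the left, whence the
  factor 2.\<close>

lemma perturbed_bound_step:
 fixes a b :: "'s => 's => complex" and u :: "'s => complex" and K :: "'s => real"
 assumes fin: "finite S" and C: "0 \<le> sum K S"
  and K: "\<And>s. s \<in> S ==> norm (u s) \<le> K s * (\<Sum>t\<in>S. norm (\<Sum>t'\<in>S. a t t' * u t'))"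
  and n: "sum K S * (\<Sum>t\<in>S. \<Sum>t'\<in>S. norm (a t t' - b t t')) < 1 / 2" and s: "s \<in> S"
 shows "norm (u s) \<le> 2 * sum K S * (\<Sum>t\<in>S. norm (\<Sum>t'\<in>S. b t t' * u t'))" proof -
  define U where "U = (\<Sum>s\<in>S. norm (u s))"
  define v where "v = (\<lambda>t. norm (\<Sum>t'\<in>S. b t t' * u t'))"
  define w where "w = (\<lambda>t. norm (\<Sum>t'\<in>S. a t t' * u t'))"
  define d where "d = (\<lambda>t. \<Sum>t'\<in>S. norm (a t t' - b t t'))"
  have U0: "0 \<le> U" unfolding U_def by (rule sum_nonneg) simp
  have us: "norm (u t) \<le> U" if "t \<in> S" for t
   unfolding U_def using that by (intro member_le_sum[of t S "\<lambda>t. norm (u t)"]) (simp_all add: fin)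
  have wt: "w t \<le> v t + d t * U" for t proof -
   define y where "y = (\<Sum>t'\<in>S. (a t t' - b t t') * u t')"
   have "(\<Sum>t'\<in>S. a t t' * u t') = (\<Sum>t'\<in>S. b t t' * u t') + y"
    unfolding y_def sum.distrib[symmetric] by (intro sum.cong refl) (simp add: algebra_simps)
   hence 1: "w t \<le> v t + norm y" unfolding w_def v_def by (simp add: norm_triangle_ineq)
   have "norm ((a t t' - b t t') * u t') \<le> norm (a t t' - b t t') * U" if "t' \<in> S" for t'
    unfolding norm_mult by (rule mult_left_mono[OF us[OF that]]) simp
   hence "norm y \<le> (\<Sum>t'\<in>S. norm (a t t' - b t t') * U)" unfolding y_def by (rule sum_norm_le)
   hence "norm y \<le> d t * U" unfolding d_def by (simp only: sum_distrib_right)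
   thus ?thesis using 1 by simp
  qed
  have "sum w S \<le> (\<Sum>t\<in>S. v t + d t * U)" by (rule sum_mono) (rule wt)
  moreover have "(\<Sum>t\<in>S. v t + d t * U) = sum v S + sum d S * U" unfolding sum.distrib sum_distrib_right ..
  ultimately have W: "sum w S \<le> sum v S + sum d S * U" by simp
  have "norm (u s) \<le> K s * sum w S" if "s \<in> S" for s using K[OF that] unfolding w_def .
  hence "U \<le> (\<Sum>s\<in>S. K s * sum w S)" unfolding U_def by (rule sum_mono)
  hence 1: "U \<le> sum K S * sum w S" by (simp only: sum_distrib_right)
  have 2: "sum K S * sum w S \<le> sum K S * (sum v S + sum d S * U)" by (rule mult_left_mono[OF W C])
  have 3: "sum K S * (sum v S + sum d S * U) = sum K S * sum v S + (sum K S * sum d S) * U" by (simp add: algebra_simps)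
  have 4: "(sum K S * sum d S) * U \<le> 1 / 2 * U" by (rule mult_right_mono[OF less_imp_le[OF n[folded d_def]] U0])
  have "U \<le> 2 * sum K S * sum v S" using 1 2 3 4 by linarith
  thus ?thesis using us[OF s] unfolding v_def by linarith
qed

text \<open>The constant is uniform in the right-hand side, so the same estimate gives boundedness,
 convergence and injectivity.\<close>

lemma perturbed_unitriangular_bound:
 fixes a :: "'s => 's => complex" and b :: "'n => 's => 's => complex"
 assumes tri: "unitriangular S a"
  and lim: "\<And>s t. s \<in> S ==> t \<in> S ==> ((\<lambda>n. b n s t) \<longlongrightarrow> a s t) F"
 shows "\<exists>K\<ge>0. eventually (\<lambda>n. \<forall>u. \<forall>s\<in>S. norm (u s) \<le> K * (\<Sum>t\<in>S. norm (\<Sum>t'\<in>S. b n t t' * u t'))) F"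
proof -
 have fin: "finite S" and one: "\<And>s. s \<in> S ==> a s s = 1"
  and "\<exists>r :: 's => nat. \<forall>s\<in>S. \<forall>t\<in>S. t \<noteq> s \<and> a s t \<noteq> 0 \<longrightarrow> r s < r t"
  using tri by (simp_all add: unitriangular_def)
 from this(3) obtain r :: "'s => nat" where "\<forall>s\<in>S. \<forall>t\<in>S. t \<noteq> s \<and> a s t \<noteq> 0 \<longrightarrow> r s < r t" ..
 hence r: "\<And>s t. s \<in> S ==> t \<in> S ==> t \<noteq> s ==> a s t \<noteq> 0 ==> r s < r t" by simp
 have "\<forall>s\<in>S. \<exists>K. K \<ge> 0 \<and> (\<forall>u. norm (u s) \<le> K * (\<Sum>t\<in>S. norm (\<Sum>t'\<in>S. a t t' * u t')))"
 proof
  fix s assume "s \<in> S"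
  from unitriangular_bound[where a = a and r = r, OF fin one r this]
  show "\<exists>K. K \<ge> 0 \<and> (\<forall>u. norm (u s) \<le> K * (\<Sum>t\<in>S. norm (\<Sum>t'\<in>S. a t t' * u t')))" by simp
 qed
 from bchoice[OF this] obtain K where K0: "\<forall>s\<in>S. K s \<ge> 0 \<and> (\<forall>u. norm (u s) \<le> K s * (\<Sum>t\<in>S. norm (\<Sum>t'\<in>S. a t t' * u t')))" ..
 have K: "K s \<ge> 0" "norm (u s) \<le> K s * (\<Sum>t\<in>S. norm (\<Sum>t'\<in>S. a t t' * u t'))" if "s \<in> S" for s u
  using bspec[OF K0 that] by simp_all
 define C where "C = (\<Sum>s\<in>S. K s)"
 have C: "0 \<le> C" unfolding C_def by (intro sum_nonneg K)
 define e where "e = (\<lambda>n. \<Sum>t\<in>S. \<Sum>t'\<in>S. norm (a t t' - b n t t'))"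
 have "(e \<longlongrightarrow> (\<Sum>t\<in>S. \<Sum>t'\<in>S. norm (a t t' - a t t'))) F"
  unfolding e_def by (intro tendsto_sum tendsto_norm tendsto_diff tendsto_const lim)
 hence "(e \<longlongrightarrow> 0) F" by simp
 hence "((\<lambda>n. C * e n) \<longlongrightarrow> 0) F" by (rule tendsto_mult_right_zero)
 hence ev: "eventually (\<lambda>n. C * e n < 1 / 2) F" by (rule order_tendstoD) simp
 have main: "norm (u s) \<le> 2 * C * (\<Sum>t\<in>S. norm (\<Sum>t'\<in>S. b n t t' * u t'))"
  if n: "C * e n < 1 / 2" and s: "s \<in> S" for n u s
  using perturbed_bound_step[where a = a and b = "b n" and u = u and K = K, OF fin C[unfolded C_def] K(2) n[unfolded C_def e_def] s]
  unfolding C_def .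
 have "0 \<le> 2 * C" using C by simp
 moreover have "eventually (\<lambda>n. \<forall>u. \<forall>s\<in>S. norm (u s) \<le> 2 * C * (\<Sum>t\<in>S. norm (\<Sum>t'\<in>S. b n t t' * u t'))) F"
  using ev
 proof eventually_elim
  case (elim n)
  thus ?case by (intro allI ballI main)
 qed
 ultimately show ?thesis by (rule exI[of _ "2 * C", OF conjI])
qed

lemma perturbed_unitriangular_tendsto_zero:
 fixes a :: "'s => 's => complex" and b :: "'n => 's => 's => complex"
 assumes tri: "unitriangular S a"
  and "\<And>s t. s \<in> S ==> t \<in> S ==> ((\<lambda>n. b n s t) \<longlongrightarrow> a s t) F"
  and "\<And>t. t \<in> S ==> ((\<lambda>n. \<Sum>t'\<in>S. b n t t' * u n t') \<longlongrightarrow> 0) F" "s \<in> S"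
 shows "((\<lambda>n. u n s) \<longlongrightarrow> 0) F" proof -
 obtain K where K: "eventually (\<lambda>n. \<forall>u. \<forall>s\<in>S. norm (u s) \<le> K * (\<Sum>t\<in>S. norm (\<Sum>t'\<in>S. b n t t' * u t'))) F"
  using perturbed_unitriangular_bound[where a = a and b = b, OF assms(1,2)] by blast
 have "((\<lambda>n. K * (\<Sum>t\<in>S. norm (\<Sum>t'\<in>S. b n t t' * u n t'))) \<longlongrightarrow> K * (\<Sum>t\<in>S. norm (0::complex))) F"
  by (intro tendsto_intros assms(3))
 hence lim: "((\<lambda>n. K * (\<Sum>t\<in>S. norm (\<Sum>t'\<in>S. b n t t' * u n t'))) \<longlongrightarrow> 0) F" by simp
 have "eventually (\<lambda>n. norm (u n s) \<le> K * (\<Sum>t\<in>S. norm (\<Sum>t'\<in>S. b n t t' * u n t'))) F"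
  using K by eventually_elim (use assms(4) in blast)
 thus ?thesis using lim by (rule Lim_null_comparison)
qed

definition bdd :: "'n filter => ('n => complex) => bool" where
 "bdd F f \<longleftrightarrow> (\<exists>K. eventually (\<lambda>n. norm (f n) \<le> K) F)"

lemma perturbed_unitriangular_bdd:
 fixes a :: "'s => 's => complex" and b :: "'n => 's => 's => complex"
 assumes tri: "unitriangular S a"
  and "\<And>s t. s \<in> S ==> t \<in> S ==> ((\<lambda>n. b n s t) \<longlongrightarrow> a s t) F"
  and "\<And>t. t \<in> S ==> bdd F (\<lambda>n. \<Sum>t'\<in>S. b n t t' * u n t')" "s \<in> S"
 shows "bdd F (\<lambda>n. u n s)" proof -
 have fin: "finite S" using tri by (simp add: unitriangular_def)
 obtain K where K: "0 \<le> K" "eventually (\<lambda>n. \<forall>u. \<forall>s\<in>S. norm (u s) \<le> K * (\<Sum>t\<in>S. norm (\<Sum>t'\<in>S. b n t t' * u t'))) F"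
  using perturbed_unitriangular_bound[where a = a and b = b, OF assms(1,2)] by blast
 have "\<exists>B. \<forall>t\<in>S. eventually (\<lambda>n. norm (\<Sum>t'\<in>S. b n t t' * u n t') \<le> B t) F"
  by (rule bchoice) (use assms(3) in \<open>simp add: bdd_def\<close>)
 then obtain B where B: "\<And>t. t \<in> S ==> eventually (\<lambda>n. norm (\<Sum>t'\<in>S. b n t t' * u n t') \<le> B t) F" by blast
 have "eventually (\<lambda>n. \<forall>t\<in>S. norm (\<Sum>t'\<in>S. b n t t' * u n t') \<le> B t) F"
  by (rule eventually_ball_finite[OF fin]) (use B in blast)
 hence "eventually (\<lambda>n. norm (u n s) \<le> K * (\<Sum>t\<in>S. B t)) F" using K(2) proof eventually_elim
  case (elim n)
  hence "norm (u n s) \<le> K * (\<Sum>t\<in>S. norm (\<Sum>t'\<in>S. b n t t' * u n t'))" using assms(4) by blast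
  also have "... \<le> K * (\<Sum>t\<in>S. B t)" using elim K(1) by (intro mult_left_mono sum_mono) blast+
  finally show ?case .
 qed
 thus ?thesis unfolding bdd_def by blast
qed

lemma bdd_tendsto: "(f \<longlongrightarrow> l) F ==> bdd F f"
proof -
 assume "(f \<longlongrightarrow> l) F"
 hence "((\<lambda>n. norm (f n)) \<longlongrightarrow> norm l) F" by (rule tendsto_norm)
 hence "eventually (\<lambda>n. norm (f n) < norm l + 1) F" by (rule order_tendstoD) simp
 hence "eventually (\<lambda>n. norm (f n) \<le> norm l + 1) F" by eventually_elim simp
 thus ?thesis unfolding bdd_def by blast
qed

lemma bdd_cong:
 assumes "eventually (\<lambda>n. f n = g n) F" "bdd F f" shows "bdd F g"
proof -
 obtain K where "eventually (\<lambda>n. norm (f n) \<le> K) F" using assms(2) by (auto simp: bdd_def)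
 hence "eventually (\<lambda>n. norm (g n) \<le> K) F" using assms(1) by eventually_elim simp
 thus ?thesis unfolding bdd_def by blast
qed

lemma bdd_add: "bdd F f ==> bdd F g ==> bdd F (\<lambda>n. f n + g n)"
proof -
 assume "bdd F f" "bdd F g"
 then obtain K L where "eventually (\<lambda>n. norm (f n) \<le> K) F" "eventually (\<lambda>n. norm (g n) \<le> L) F"
  by (auto simp: bdd_def)
 hence "eventually (\<lambda>n. norm (f n + g n) \<le> K + L) F" by eventually_elim (rule norm_triangle_mono)
 thus ?thesis unfolding bdd_def by blast
qed

lemma bdd_minus: "bdd F f ==> bdd F (\<lambda>n. - f n)"
 unfolding bdd_def by simp

lemma bdd_diff: "bdd F f ==> bdd F g ==> bdd F (\<lambda>n. f n - g n)"
 using bdd_add[of F f "\<lambda>n. - g n"] bdd_minus[of F g] by simp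

lemma bdd_mult: "bdd F f ==> bdd F g ==> bdd F (\<lambda>n. f n * g n)"
proof -
 assume "bdd F f" "bdd F g"
 then obtain K L where "eventually (\<lambda>n. norm (f n) \<le> K) F" "eventually (\<lambda>n. norm (g n) \<le> L) F"
  by (auto simp: bdd_def)
 hence "eventually (\<lambda>n. norm (f n * g n) \<le> K * L) F" proof eventually_elim
  case (elim n)
  thus ?case unfolding norm_mult using norm_ge_zero[of "f n"] norm_ge_zero[of "g n"] by (intro mult_mono) linarith+
 qed
 thus ?thesis unfolding bdd_def by blast
qed

lemma bdd_sum:
 assumes "\<And>s. s \<in> S ==> bdd F (f s)" shows "bdd F (\<lambda>n. \<Sum>s\<in>S. f s n)" using assms
proof (induction S rule: infinite_finite_induct)
 case (insert s S)
 thus ?case using bdd_add[of F "f s" "\<lambda>n. \<Sum>s\<in>S. f s n"] by simp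
qed (simp_all add: bdd_tendsto[OF tendsto_const])

lemma tendsto_zero_mult_bdd:
 assumes "(f \<longlongrightarrow> 0) F" "bdd F g" shows "((\<lambda>n. f n * g n) \<longlongrightarrow> 0) F"
proof -
 obtain K where K: "eventually (\<lambda>n. norm (g n) \<le> K) F" using assms(2) by (auto simp: bdd_def)
 have "((\<lambda>n. norm (f n) * K) \<longlongrightarrow> 0) F" using tendsto_mult_left_zero[OF tendsto_norm_zero[OF assms(1)]] .
 moreover have "eventually (\<lambda>n. norm (f n * g n) \<le> norm (f n) * K) F"
  using K by eventually_elim (simp add: norm_mult mult_left_mono)
 ultimately show ?thesis by (rule Lim_null_comparison[rotated])
qed

section \<open>Premaps and pairings\<close>

text \<open>It suffices that x \<mapsto> \<pi>(-x) has no fixed point among the signed indices. If k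
  reached -k after m steps, the path would be its own mirror image, and its middle would give u = -u
  for even m or \<pi> u = -u for odd m.\<close>

lemma PM_I_fixed_point_free:
 assumes ix: "ix_set I" and id: "\<And>x. x \<notin> pm I ==> \<pi> x = x"
  and in': "\<And>x. x \<in> pm I ==> \<pi> x \<in> pm I"
  and neg: "\<And>k. \<pi> (- \<pi> (- k)) = k" and ne: "\<And>k. k \<in> pm I ==> \<pi> k \<noteq> - k"
 shows "\<pi> \<in> PM I" proof (rule PM_I)
 let ?S = "pm I"
 have neg': "\<pi> (- \<pi> k) = - k" for k using neg[of "- k"] by simp
 have inj: "inj \<pi>" proof (rule injI)
  fix x y assume "\<pi> x = \<pi> y"
  hence "\<pi> (- \<pi> x) = \<pi> (- \<pi> y)" by simp
  thus "x = y" unfolding neg' by simp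
 qed
 show "\<pi> permutes ?S" proof (rule bij_imp_permutes)
  have inj': "inj_on \<pi> ?S" using inj by (rule inj_on_subset) simp
  moreover have "\<pi> ` ?S \<subseteq> ?S" using in' by blast
  ultimately show "bij_betw \<pi> ?S ?S" using endo_inj_surj[OF finite_pm[OF ix]] by (simp add: bij_betw_def)
 qed (rule id)
 show "\<pi> (- \<pi> (- k)) = k" for k by (rule neg)
 have pw: "(\<pi> ^^ n) x \<in> ?S" if "x \<in> ?S" for x n using that by (induction n) (simp_all add: in')
 have twist: "(\<pi> ^^ n) (- (\<pi> ^^ n) x) = - x" for x n proof (induction n)
  case (Suc n)
  have "(\<pi> ^^ Suc n) (- (\<pi> ^^ Suc n) x) = (\<pi> ^^ n) (\<pi> (- \<pi> ((\<pi> ^^ n) x)))" by (simp add: funpow_swap1)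
  thus ?case using Suc unfolding neg' by simp
 qed simp
 show "- k \<notin> orbit \<pi> k" if k: "k \<in> ?S" for k proof
  assume "- k \<in> orbit \<pi> k"
  then obtain m where m: "(\<pi> ^^ m) k = - k" by (auto simp: orbit_altdef)
  define j where "j = m div 2"
  define u where "u = (\<pi> ^^ j) k"
  have u: "u \<in> ?S" "(\<pi> ^^ j) (- u) = - k" using pw[OF k] twist by (simp_all add: u_def)
  have injp: "inj (\<pi> ^^ j)" using inj by (rule inj_fn)
  show False proof (cases "even m")
   case True
   hence "m = j + j" by (auto simp: j_def)
   hence "(\<pi> ^^ j) u = (\<pi> ^^ j) (- u)" using m u(2) by (simp add: u_def funpow_add)
   hence "u = - u" using injp by (rule injD[rotated])
   hence "u = 0" by simp
   thus False using u(1) zero_notin_signed_set[OF ix] by simp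
  next
   case False
   hence "m = j + (1 + j)" unfolding j_def by presburger
   hence "(\<pi> ^^ j) (\<pi> u) = (\<pi> ^^ j) (- u)" using m u(2) by (simp add: u_def funpow_add funpow_swap1)
   hence "\<pi> u = - u" using injp by (rule injD[rotated])
   thus False using ne[OF u(1)] by simp
  qed
 qed
qed

lemma PM_ne: "\<pi> \<in> PM I ==> x \<in> pm I ==> \<pi> (- x) \<noteq> x"
 using PM_no_flip[of \<pi> I "- x"] orbit.base[of \<pi> "- x"] by auto

text \<open>On a premap the pairs are the orbits of the fixed-point free involution x \<mapsto>
  \<pi>(-x), transported by a labelling h of the signed indices.\<close>

definition pairs_of :: "int set => (int => nat) => (int => int) => nat set set" where
 "pairs_of I h \<pi> = (\<lambda>x. {h x, h (\<pi> (- x))}) ` pm I"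

lemma pairing_of_block:
 assumes "\<pi> \<in> PM I" "bij_betw h (pm I) A" "x \<in> pm I" "B \<in> pairs_of I h \<pi>" "h x \<in> B"
 shows "B = {h x, h (\<pi> (- x))}" proof -
 have inj: "inj_on h (pm I)" using assms(2) by (rule bij_betw_imp_inj_on)
 obtain y where y: "y \<in> pm I" "B = {h y, h (\<pi> (- y))}" using assms(4) by (auto simp: pairs_of_def)
 have py: "\<pi> (- y) \<in> pm I" using y(1) PM_in[OF assms(1)] by simp
 from assms(5) y(2) consider "h x = h y" | "h x = h (\<pi> (- y))" by blast
 thus ?thesis proof cases
  case 1
  hence "x = y" using inj_onD[OF inj _ assms(3) y(1)] by blast
  thus ?thesis using y(2) by simp
 next
  case 2
  hence x: "x = \<pi> (- y)" using inj_onD[OF inj _ assms(3) py] by blast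
  have "\<pi> (- x) = y" unfolding x by (rule PM_neg[OF assms(1)])
  have "B = {h y, h x}" unfolding y(2) x ..
  thus ?thesis unfolding \<open>\<pi> (- x) = y\<close> by (simp add: insert_commute)
 qed
qed

lemma pairing_of_in_pairings:
 assumes "\<pi> \<in> PM I" "bij_betw h (pm I) {1..m}" shows "pairs_of I h \<pi> \<in> pairings m"
proof -
 have inj: "inj_on h (pm I)" and im: "h ` pm I = {1..m}" using assms(2) by (auto simp: bij_betw_def)
 have 2: "card B = 2" if B: "B \<in> pairs_of I h \<pi>" for B proof -
  obtain y where y: "y \<in> pm I" "B = {h y, h (\<pi> (- y))}" using B by (auto simp: pairs_of_def)
  have "\<pi> (- y) \<in> pm I" using y(1) PM_in[OF assms(1)] by simp
  hence "h y \<noteq> h (\<pi> (- y))" using inj_onD[OF inj _ y(1)] PM_ne[OF assms(1) y(1)] by metis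
  thus ?thesis using y(2) by simp
 qed
 moreover have "partition_on {1..m} (pairs_of I h \<pi>)" proof (rule partition_onI)
  have "\<pi> (- y) \<in> pm I" if "y \<in> pm I" for y using that PM_in[OF assms(1)] by simp
  thus "\<Union>(pairs_of I h \<pi>) = {1..m}" unfolding im[symmetric] pairs_of_def by blast
  show "{} \<notin> pairs_of I h \<pi>" by (auto simp: pairs_of_def)
  fix B C assume BC: "B \<in> pairs_of I h \<pi>" "C \<in> pairs_of I h \<pi>" "B \<noteq> C"
  show "disjnt B C" proof (rule ccontr)
   assume "\<not> disjnt B C"
   then obtain a where a: "a \<in> B" "a \<in> C" by (auto simp: disjnt_def)
   have "a \<in> h ` pm I" using a(1) BC(1) PM_in[OF assms(1)] by (auto simp: pairs_of_def)
   then obtain x where "x \<in> pm I" "a = h x" by blast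
   thus False using pairing_of_block[OF assms(1,2)] a BC by metis
  qed
 qed
 ultimately show ?thesis by (simp add: pairings_def)
qed

text \<open>A pairing gives every signed index a partner; the partner map composed with negation is
  the only premap with these pairs.\<close>

lemma bij_betw_pairing_of:
 assumes "ix_set I" "bij_betw h (pm I) {1..m}" shows "bij_betw (pairs_of I h) (PM I) (pairings m)"
proof (rule bij_betw_imageI)
 let ?S = "pm I"
 have inj: "inj_on h ?S" and im: "h ` ?S = {1..m}" using assms(2) by (auto simp: bij_betw_def)
 show "inj_on (pairs_of I h) (PM I)" proof (rule inj_onI)
  fix \<pi> r assume *: "\<pi> \<in> PM I" "r \<in> PM I" "pairs_of I h \<pi> = pairs_of I h r"
  have e: "\<pi> (- x) = r (- x)" if x: "x \<in> ?S" for x proof -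
   have "{h x, h (\<pi> (- x))} \<in> pairs_of I h r" using x *(3) by (auto simp: pairs_of_def)
   hence "{h x, h (\<pi> (- x))} = {h x, h (r (- x))}" using pairing_of_block[OF *(2) assms(2) x] by blast
   moreover have in': "\<pi> (- x) \<in> ?S" "r (- x) \<in> ?S" using x PM_in[OF *(1)] PM_in[OF *(2)] by simp_all
   ultimately have "h (\<pi> (- x)) = h (r (- x))" unfolding doubleton_eq_iff by metis
   thus ?thesis by (rule inj_onD[OF inj _ in'])
  qed
  show "\<pi> = r" proof
   fix x
   show "\<pi> x = r x" using e[of "- x"] permutes_not_in[OF PM_permutes[OF *(1)], of x]
     permutes_not_in[OF PM_permutes[OF *(2)], of x] by (cases "x \<in> ?S") simp_all
  qed
 qed
 show "pairs_of I h ` PM I = pairings m" proof (intro equalityI subsetI)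
  fix V assume "V \<in> pairs_of I h ` PM I"
  thus "V \<in> pairings m" using pairing_of_in_pairings[OF _ assms(2)] by blast
 next
  fix V assume "V \<in> pairings m"
  hence part: "partition_on {1..m} V" and two: "\<And>B. B \<in> V ==> card B = 2" by (auto simp: pairings_def)
  have "\<forall>x\<in>?S. \<exists>y. y \<in> ?S \<and> y \<noteq> x \<and> {h x, h y} \<in> V" proof
   fix x assume x: "x \<in> ?S"
   hence "h x \<in> \<Union>V" using part im by (auto simp: partition_on_def)
   then obtain B where B: "B \<in> V" "h x \<in> B" by blast
   then obtain a where a: "B = {h x, a}" "a \<noteq> h x" using two[OF B(1)] unfolding card_2_iff by auto
   have "a \<in> {1..m}" using a(1) B(1) part by (auto simp: partition_on_def)
   then obtain y where "y \<in> ?S" "a = h y" using im by blast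
   thus "\<exists>y. y \<in> ?S \<and> y \<noteq> x \<and> {h x, h y} \<in> V" using a B(1) by blast
  qed
  from bchoice[OF this] obtain \<epsilon> where \<epsilon>: "\<forall>x\<in>?S. \<epsilon> x \<in> ?S \<and> \<epsilon> x \<noteq> x \<and> {h x, h (\<epsilon> x)} \<in> V" ..
  have \<epsilon>1: "\<epsilon> x \<in> ?S" and \<epsilon>2: "\<epsilon> x \<noteq> x" and \<epsilon>3: "{h x, h (\<epsilon> x)} \<in> V" if "x \<in> ?S" for x
   using bspec[OF \<epsilon> that] by blast+
  have uniq: "B = C" if "B \<in> V" "C \<in> V" "a \<in> B" "a \<in> C" for B C a
   using that part unfolding partition_on_def disjoint_def by blast
  have ee: "\<epsilon> (\<epsilon> x) = x" if x: "x \<in> ?S" for x proof -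
   note 1 = \<epsilon>1[OF x] \<epsilon>2[OF x] \<epsilon>3[OF x]
   note 2 = \<epsilon>1[OF 1(1)] \<epsilon>2[OF 1(1)] \<epsilon>3[OF 1(1)]
   have "{h x, h (\<epsilon> x)} = {h (\<epsilon> x), h (\<epsilon> (\<epsilon> x))}" by (rule uniq[OF 1(3) 2(3), of "h (\<epsilon> x)"]) simp_all
   hence "h x = h (\<epsilon> (\<epsilon> x)) \<or> h x = h (\<epsilon> x)" unfolding doubleton_eq_iff by blast
   thus ?thesis proof
    assume "h x = h (\<epsilon> (\<epsilon> x))"
    from inj_onD[OF inj this x 2(1)] show ?thesis by simp
   next
    assume "h x = h (\<epsilon> x)"
    from inj_onD[OF inj this x 1(1)] show ?thesis using 1(2) by simp
   qed
  qed
  \<comment> \<open>The partner map has to reappear as x \<mapsto> \<pi>(-x), hence the sign in the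
    argument.\<close>
  define \<pi> where "\<pi> = (\<lambda>x. if x \<in> ?S then \<epsilon> (- x) else x)"
  have \<pi>: "\<pi> (- x) = \<epsilon> x" if "x \<in> ?S" for x using that by (simp add: \<pi>_def)
  have "\<pi> \<in> PM I" proof (rule PM_I_fixed_point_free[OF assms(1)])
   show "\<pi> x = x" if "x \<notin> ?S" for x using that by (simp add: \<pi>_def)
   show "\<pi> x \<in> ?S" if "x \<in> ?S" for x using that \<epsilon>1[of "- x"] by (simp add: \<pi>_def)
   show "\<pi> (- \<pi> (- k)) = k" for k proof (cases "k \<in> ?S")
    case True
    thus ?thesis using \<pi>[OF True] \<pi>[OF \<epsilon>1[OF True]] ee[OF True] by simp
   qed (simp add: \<pi>_def)
   show "\<pi> k \<noteq> - k" if "k \<in> ?S" for k proof -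
    have "- k \<in> ?S" using that by simp
    hence "\<epsilon> (- k) \<noteq> - k" by (rule \<epsilon>2)
    thus ?thesis using that by (simp add: \<pi>_def)
   qed
  qed
  moreover have "pairs_of I h \<pi> = V" proof (intro equalityI subsetI)
   fix B assume "B \<in> pairs_of I h \<pi>"
   then obtain x where "x \<in> ?S" "B = {h x, h (\<pi> (- x))}" by (auto simp: pairs_of_def)
   thus "B \<in> V" using \<epsilon>3[of x] \<pi>[of x] by simp
  next
   fix B assume B: "B \<in> V"
   hence "B \<noteq> {}" "B \<subseteq> h ` ?S" using part unfolding partition_on_def im by blast+
   then obtain x where x: "x \<in> ?S" "h x \<in> B" by blast
   have "B = {h x, h (\<epsilon> x)}" by (rule uniq[OF B \<epsilon>3[OF x(1)] x(2)]) simp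
   hence "B = {h x, h (\<pi> (- x))}" using \<pi>[OF x(1)] by simp
   thus "B \<in> pairs_of I h \<pi>" unfolding pairs_of_def using x(1) by blast
  qed
  ultimately show "V \<in> pairs_of I h ` PM I" by blast
 qed
qed

section \<open>Joins of pairings as joint orbits of two involutions\<close>

lemma partition_join_eqI:
 assumes "refines A U W" "refines A V W"
  and "\<And>W'. refines A U W' ==> refines A V W' ==> refines A W W'" shows "partition_join A U V = W"
proof -
 let ?P = "{W. refines A U W \<and> refines A V W}"
 have P: "partition_on A X" if "X \<in> ?P" for X using that by (simp add: refines_def)
 have W: "W \<in> ?P" using assms(1,2) by simp
 have "refines A (common_refinement ?P) W" by (rule refines_common_refinement[OF P W])
 moreover have "refines A W (common_refinement ?P)" by (rule common_refinement_coarsest[OF P P[OF W]]) (use assms(3) W in auto)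
 ultimately show ?thesis unfolding partition_join_def by (rule refines_asym)
qed

lemma linked_map:
 fixes r e f e' f' :: "'a => 'a"
 assumes "\<And>x. e' (r x) = r (e x)" "\<And>x. f' (r x) = r (f x)" "bij r"
 shows "linked (graph e' \<union> graph f') `` {r x} = r ` (linked (graph e \<union> graph f) `` {x})" proof -
 \<comment> \<open>Stated for arbitrary maps, so that it applies to r and again to its
   inverse.\<close>
 have fwd: "(r x, r y) \<in> linked (graph e' \<union> graph f')" if "(x, y) \<in> linked (graph e \<union> graph f)"
   "\<And>x. e' (r x) = r (e x)" "\<And>x. f' (r x) = r (f x)" for e e' f f' r :: "'a => 'a" and x y
  using that(1) unfolding linked_def[of "graph e \<union> graph f"]
 proof induction
  case (step y z)
  then consider "z = e y \<or> z = f y" | "y = e z \<or> y = f z" by (auto simp: graph_def)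
  hence "(r y, r z) \<in> linked (graph e' \<union> graph f')" proof cases
   case 1
   hence "r z = e' (r y) \<or> r z = f' (r y)" using that(2)[of y] that(3)[of y] by auto
   hence "(r y, r z) \<in> graph e' \<union> graph f'" by (simp add: graph_def)
   thus ?thesis by (rule linked_base)
  next
   case 2
   hence "r y = e' (r z) \<or> r y = f' (r z)" using that(2)[of z] that(3)[of z] by auto
   hence "(r z, r y) \<in> graph e' \<union> graph f'" by (simp add: graph_def)
   thus ?thesis by (rule linked_sym[OF linked_base])
  qed
  thus ?case by (rule linked_trans[OF step.IH])
 qed simp
 show ?thesis proof (intro equalityI subsetI)
  fix y assume y: "y \<in> linked (graph e' \<union> graph f') `` {r x}"
  let ?i = "pinv r"
  have i: "?i (r z) = z" "r (?i z) = z" for z using bij_is_inj[OF assms(3)] bij_is_surj[OF assms(3)] by (simp_all add: surj_f_inv_f)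
  have "e (?i z) = ?i (e' z)" "f (?i z) = ?i (f' z)" for z
   using assms(1)[of "?i z"] assms(2)[of "?i z"] i(1)[of "e (?i z)"] i(1)[of "f (?i z)"] i(2)[of z] by simp_all
  moreover have "(r x, y) \<in> linked (graph e' \<union> graph f')" using y by simp
  ultimately have "(?i (r x), ?i y) \<in> linked (graph e \<union> graph f)"
   by (intro fwd[where e = e' and f = f' and e' = e and f' = f and r = "pinv r"])
  thus "y \<in> r ` (linked (graph e \<union> graph f) `` {x})" unfolding i(1) using i(2)[of y]
   by (intro image_eqI[of y r "?i y"]) simp_all
 next
  fix y assume "y \<in> r ` (linked (graph e \<union> graph f) `` {x})"
  then obtain z where z: "(x, z) \<in> linked (graph e \<union> graph f)" "y = r z" by blast
  have "(r x, r z) \<in> linked (graph e' \<union> graph f')"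
   by (rule fwd[where e = e and f = f and e' = e' and f' = f' and r = r, OF z(1) assms(1,2)])
  thus "y \<in> linked (graph e' \<union> graph f') `` {r x}" unfolding z(2) by simp
 qed
qed

text \<open>The blocks of the join are the classes generated by the two involutions. A common
  coarsening cannot be finer, since no single step of either involution leaves one of its
  blocks.\<close>

lemma partition_join_pairing_of:
 assumes "\<pi> \<in> PM I" "r \<in> PM I" "bij_betw h (pm I) {1..m}"
 shows "partition_join {1..m} (pairs_of I h \<pi>) (pairs_of I h r)
  = (\<lambda>x. h ` (linked (graph (\<pi> \<circ> uminus) \<union> graph (r \<circ> uminus)) `` {x})) ` pm I"
  (is "_ = ?W")
proof (rule partition_join_eqI)
 let ?S = "pm I" and ?L = "linked (graph (\<pi> \<circ> uminus) \<union> graph (r \<circ> uminus))"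
 have inj: "inj_on h ?S" and im: "h ` ?S = {1..m}" using assms(3) by (auto simp: bij_betw_def)
 have clS: "y \<in> ?S" if "x \<in> ?S" "(x, y) \<in> ?L" for x y using that(2) that(1) unfolding linked_def proof induction
  case (step y z)
  hence "z = \<pi> (- y) \<or> z = r (- y) \<or> y = \<pi> (- z) \<or> y = r (- z)" by (auto simp: graph_def)
  moreover have "y \<in> ?S" using step.IH step.prems by blast
  ultimately show ?case using PM_in[OF assms(1), of "- y"] PM_in[OF assms(2), of "- y"]
    PM_in[OF assms(1), of "- z"] PM_in[OF assms(2), of "- z"] unfolding neg_in_signed_set by metis
 qed
 have cl: "?L `` {x} \<subseteq> ?S" if "x \<in> ?S" for x using clS[OF that] by blast
 have pW: "partition_on {1..m} ?W" proof (rule partition_onI)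
  show "\<Union> ?W = {1..m}" proof
   show "\<Union> ?W \<subseteq> {1..m}" proof
    fix a assume "a \<in> \<Union> ?W"
    then obtain x where "x \<in> ?S" "a \<in> h ` (?L `` {x})" by blast
    hence "a \<in> h ` ?S" using cl[of x] by blast
    thus "a \<in> {1..m}" unfolding im .
   qed
   show "{1..m} \<subseteq> \<Union> ?W" proof
    fix a assume "a \<in> {1..m}"
    then obtain x where "x \<in> ?S" "a = h x" unfolding im[symmetric] by blast
    hence "a \<in> h ` (?L `` {x})" using linked_refl[of x "graph (\<pi> \<circ> uminus) \<union> graph (r \<circ> uminus)"] by simp
    thus "a \<in> \<Union> ?W" using \<open>x \<in> ?S\<close> by blast
   qed
  qed
  have "?L `` {x} \<noteq> {}" for x using linked_refl[of x "graph (\<pi> \<circ> uminus) \<union> graph (r \<circ> uminus)"] by blast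
  thus "{} \<notin> ?W" by auto
  fix B C assume "B \<in> ?W" "C \<in> ?W" "B \<noteq> C"
  then obtain x y where x: "x \<in> ?S" "B = h ` (?L `` {x})" and y: "y \<in> ?S" "C = h ` (?L `` {y})" by blast
  show "disjnt B C" proof (rule ccontr)
   assume "\<not> disjnt B C"
   hence "\<not> disjnt (h ` (?L `` {x})) (h ` (?L `` {y}))" unfolding x(2) y(2) .
   then obtain u v where uv: "(x, u) \<in> ?L" "(y, v) \<in> ?L" "h u = h v" unfolding disjnt_def by blast
   have "u = v" by (rule inj_onD[OF inj uv(3) clS[OF x(1) uv(1)] clS[OF y(1) uv(2)]])
   hence "?L `` {x} = ?L `` {y}" using iffD1[OF linked_class_eq uv(1)] iffD1[OF linked_class_eq uv(2)] by simp
   thus False using \<open>B \<noteq> C\<close> x(2) y(2) by simp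
  qed
 qed
 have ref: "refines {1..m} (pairs_of I h \<xi>) ?W" if "\<xi> \<in> PM I" "graph (\<xi> \<circ> uminus) \<subseteq> ?L" for \<xi>
  unfolding refines_def
 proof (intro conjI ballI)
  show "partition_on {1..m} (pairs_of I h \<xi>)" using pairing_of_in_pairings[OF that(1) assms(3)] by (simp add: pairings_def)
  fix B assume "B \<in> pairs_of I h \<xi>"
  then obtain x where x: "x \<in> ?S" "B = {h x, h (\<xi> (- x))}" by (auto simp: pairs_of_def)
  have "(x, \<xi> (- x)) \<in> graph (\<xi> \<circ> uminus)" by (simp add: graph_def)
  hence "(x, \<xi> (- x)) \<in> ?L" using that(2) by blast
  hence "B \<subseteq> h ` (?L `` {x})" unfolding x(2) by simp
  thus "\<exists>Y\<in>?W. B \<subseteq> Y" using x(1) by blast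
 qed (rule pW)
 have g: "graph (\<pi> \<circ> uminus) \<subseteq> ?L" "graph (r \<circ> uminus) \<subseteq> ?L"
  by (rule subrelI, rule linked_base, simp)+
 show "refines {1..m} (pairs_of I h \<pi>) ?W" by (rule ref[OF assms(1) g(1)])
 show "refines {1..m} (pairs_of I h r) ?W" by (rule ref[OF assms(2) g(2)])
 fix W' assume W': "refines {1..m} (pairs_of I h \<pi>) W'" "refines {1..m} (pairs_of I h r) W'"
 have p': "partition_on {1..m} W'" using W'(1) by (simp add: refines_def)
 have same: "h y \<in> Y \<longleftrightarrow> h (\<xi> (- y)) \<in> Y"
  if \<xi>: "\<xi> \<in> PM I" "refines {1..m} (pairs_of I h \<xi>) W'" "y \<in> ?S" "Y \<in> W'" for \<xi> y Y
 proof -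
  have "{h y, h (\<xi> (- y))} \<in> pairs_of I h \<xi>" unfolding pairs_of_def using \<xi>(3) by (rule imageI)
  then obtain Z where Z: "Z \<in> W'" "{h y, h (\<xi> (- y))} \<subseteq> Z" using \<xi>(2) unfolding refines_def by blast
  have "Z = Y" if "a \<in> Z" "a \<in> Y" for a using that Z(1) \<xi>(4) p' unfolding partition_on_def disjoint_def by blast
  thus ?thesis using Z(2) by blast
 qed
 have "h y \<in> Y" if "x \<in> ?S" "(x, y) \<in> ?L" "h x \<in> Y" "Y \<in> W'" for x y Y
  using that(2) that(1,3,4) unfolding linked_def
 proof induction
  case (step y z)
  hence yz: "(x, y) \<in> ?L" "(x, z) \<in> ?L" unfolding linked_def using rtrancl_into_rtrancl[OF step.hyps] by simp_all
  have S: "y \<in> ?S" "z \<in> ?S" using clS[OF step.prems(1) yz(1)] clS[OF step.prems(1) yz(2)] .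
  from step.hyps(2) have "z = \<pi> (- y) \<or> z = r (- y) \<or> y = \<pi> (- z) \<or> y = r (- z)" by (auto simp: graph_def)
  thus ?case using step.IH[OF step.prems] same[OF assms(1) W'(1) S(1) step.prems(3)] same[OF assms(2) W'(2) S(1) step.prems(3)]
    same[OF assms(1) W'(1) S(2) step.prems(3)] same[OF assms(2) W'(2) S(2) step.prems(3)] by metis
 qed simp
 note inY = this
 show "refines {1..m} ?W W'" unfolding refines_def proof (intro conjI ballI pW p')
  fix B assume "B \<in> ?W"
  then obtain x where x: "x \<in> ?S" "B = h ` (?L `` {x})" by blast
  have "h x \<in> {1..m}" unfolding im[symmetric] using x(1) by (rule imageI)
  hence "h x \<in> \<Union>W'" using p' unfolding partition_on_def by simp
  then obtain Y where Y: "Y \<in> W'" "h x \<in> Y" by blast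
  have "h y \<in> Y" if "y \<in> ?L `` {x}" for y using inY[OF x(1) _ Y(2,1), of y] that by simp
  hence "B \<subseteq> Y" unfolding x(2) by (rule image_subsetI)
  thus "\<exists>Y\<in>W'. B \<subseteq> Y" using Y(1) by blast
 qed
qed

text \<open>The positive part of R conjugates negation to x \<mapsto> R(-x): in the coordinates it
  provides, the pairing of R matches k with -k.\<close>

lemma plus_part_neg:
 assumes "R \<in> PM I" "ix_set I" shows "R (- plus_part I R y) = plus_part I R (- y)"
proof -
 let ?r = "plus_part I R"
 have r: "?r permutes pm I" using plus_part_permutes[OF ix_finite[OF assms(2)] PM_permutes[OF assms(1)]] .
 have "pinv (minus_part I R) = (\<lambda>x. - pinv ?r (- x))"
  by (rule inv_unique_comp) (simp_all add: fun_eq_iff minus_part_def permutes_inverses[OF r])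
 hence "pinv ?r (R (- ?r y)) = - pinv ?r (- (- ?r y))" using fun_cong[OF plus_part_inverse[OF assms], of "- ?r y"] by simp
 hence "pinv ?r (R (- ?r y)) = - y" using permutes_inverses(2)[OF r] by simp
 thus ?thesis using permutes_inverses(1)[OF r] by metis
qed

text \<open>In the same coordinates the involution of \<pi> becomes the negated complement. This is
  why the complement governs the join of the two pairings.\<close>

lemma plus_part_Kr:
 assumes "R \<in> PM I" "\<pi> \<in> PM I" "ix_set I" shows "plus_part I R (- Kr I R \<pi> y) = \<pi> (- plus_part I R y)"
proof -
 let ?r = "plus_part I R"
 have r: "?r permutes pm I" using plus_part_permutes[OF ix_finite[OF assms(3)] PM_permutes[OF assms(1)]] .
 have "?r (Kr I R \<pi> y) = R (pinv \<pi> (?r y))" unfolding Kr_conj[OF assms(1,3)] by (simp add: permutes_inverses(1)[OF r])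
 hence "?r (- Kr I R \<pi> y) = R (- R (pinv \<pi> (?r y)))" using plus_part_neg[OF assms(1,3), of "Kr I R \<pi> y"] by simp
 also have "... = - pinv \<pi> (?r y)" using PM_neg[OF assms(1), of "- pinv \<pi> (?r y)"] by simp
 also have "... = \<pi> (- ?r y)" using PM_pinv[OF assms(2)] by simp
 finally show ?thesis .
qed

text \<open>Negation and x \<mapsto> -k(x) compose to k, so together they sweep out one cycle of k
  and its mirror image.\<close>

lemma linked_neg_PM:
 assumes "k \<in> PM I" "ix_set I"
 shows "linked (graph uminus \<union> graph (uminus \<circ> k)) `` {x} = orbit k x \<union> uminus ` orbit k x"
  (is "?L `` {x} = ?O")
proof (intro equalityI subsetI)
 have p: "permutation k" using PM_perm[OF assms] .
 have n: "k (- k z) = - z" for z using PM_neg[OF assms(1), of "- z"] by simp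
 have on: "uminus ` orbit k z = orbit k (- z)" for z using PM_orbit_neg[OF assms] by simp
 have self: "z \<in> orbit k z" for z using permutation_self_in_orbit[OF p] .
 have eqO: "orbit k z \<union> orbit k (- z) = orbit k y \<union> orbit k (- y)" if "z = - y \<or> z = - k y" for y z proof -
  have "orbit k (k y) = orbit k y" using permutation_orbit_step[OF p] .
  moreover have "orbit k (- k y) = orbit k (- y)" using permutation_orbit_step[OF p, of "- k y"] unfolding n by simp
  ultimately show ?thesis using that by auto
 qed
 {
  fix y assume "y \<in> ?L `` {x}"
  hence "(x, y) \<in> ?L" by simp
  hence "orbit k y \<union> orbit k (- y) = orbit k x \<union> orbit k (- x)" unfolding linked_def proof induction
   case (step y z)
   from step.hyps(2) consider "z = - y \<or> z = - k y" | "y = - z \<or> y = - k z" by (auto simp: graph_def)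
   hence "orbit k z \<union> orbit k (- z) = orbit k y \<union> orbit k (- y)" using eqO[of z y] eqO[of y z] by cases simp_all
   thus ?case using step.IH by simp
  qed simp
  thus "y \<in> ?O" unfolding on using self[of y] by blast
 }
 have 1: "(z, - z) \<in> ?L" for z by (rule linked_base) (simp add: graph_def)
 have 2: "(z, k z) \<in> ?L" for z proof -
  have "(z, - k z) \<in> ?L" by (rule linked_base) (simp add: graph_def)
  thus ?thesis using linked_trans[OF _ 1[of "- k z"], of z] by simp
 qed
 have 3: "(x, y) \<in> ?L" if "y \<in> orbit k x" for y using that proof induction
  case base
  show ?case by (rule 2)
 next
  case (step y)
  show ?case by (rule linked_trans[OF step.IH 2])
 qed
 fix y assume "y \<in> ?O"
 then consider "y \<in> orbit k x" | z where "z \<in> orbit k x" "y = - z" by blast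
 thus "y \<in> ?L `` {x}" proof cases
  case 1
  thus ?thesis using 3 by simp
 next
  case 2
  thus ?thesis using linked_trans[OF 3[OF 2(1)] 1[of z]] by simp
 qed
qed

text \<open>Transporting \<open>linked_neg_PM\<close> by the positive part and then by h matches
  blocks of the join with mirrored pairs of cycles of the complement. Each pair is represented by
  its positive cycle, which has half the size.\<close>

lemma partition_join_Kr:
 assumes "R \<in> PM I" "\<pi> \<in> PM I" "ix_set I" "bij_betw h (pm I) {1..m}"
 shows "bij_betw (\<lambda>B. h ` plus_part I R ` (B \<union> uminus ` B)) (pos_cycles I (Kr I R \<pi>))
   (partition_join {1..m} (pairs_of I h R) (pairs_of I h \<pi>))"
  "B \<in> pos_cycles I (Kr I R \<pi>) ==> card (h ` plus_part I R ` (B \<union> uminus ` B)) = 2 * card B"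
proof -
 let ?S = "pm I" and ?r = "plus_part I R" and ?k = "Kr I R \<pi>"
 let ?f = "\<lambda>B. h ` ?r ` (B \<union> uminus ` B)"
 have k: "?k \<in> PM I" using Kr_in_PM[OF ix_finite[OF assms(3)] assms(2,1)] .
 have r: "?r permutes ?S" using plus_part_permutes[OF ix_finite[OF assms(3)] PM_permutes[OF assms(1)]] .
 have inj: "inj_on h ?S" using assms(4) by (auto simp: bij_betw_def)
 note bl = cycle_blocks_block[OF PM_permutes[OF k] PM_perm[OF k assms(3)] finite_pm[OF assms(3)]]
 have pc: "B \<in> cycle_blocks ?S ?k" if "B \<in> pos_cycles I ?k" for B using that by (simp add: pos_cycles_def)
 have sub: "B \<union> uminus ` B \<subseteq> ?S" if "B \<in> cycle_blocks ?S ?k" for B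
  using bl(1)[OF that] bl(1)[OF PM_cycle_blocks_neg(1)[OF k assms(3) that]] by blast
 have rS: "?r ` X \<subseteq> ?S" if "X \<subseteq> ?S" for X using that permutes_in_image[OF r] by blast
 have fi: "X = Y" if "h ` ?r ` X = h ` ?r ` Y" "X \<subseteq> ?S" "Y \<subseteq> ?S" for X Y proof -
  have "?r ` X = ?r ` Y" using inj_on_image_eq_iff[OF inj rS[OF that(2)] rS[OF that(3)]] that(1) by blast
  thus ?thesis using inj_image_eq_iff[OF permutes_inj[OF r]] by blast
 qed
 have L: "linked (graph (R \<circ> uminus) \<union> graph (\<pi> \<circ> uminus)) `` {?r x} = ?r ` (orbit ?k x \<union> uminus ` orbit ?k x)" for x
  unfolding linked_neg_PM[OF k assms(3), symmetric] by (rule linked_map)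
   (simp_all add: plus_part_neg[OF assms(1,3)] plus_part_Kr[OF assms(1-3)] permutes_bij[OF r])
 have "partition_join {1..m} (pairs_of I h R) (pairs_of I h \<pi>)
  = (\<lambda>x. h ` (linked (graph (R \<circ> uminus) \<union> graph (\<pi> \<circ> uminus)) `` {x})) ` ?r ` ?S"
  unfolding partition_join_pairing_of[OF assms(1,2,4)] permutes_image[OF r] ..
 also have "... = ?f ` cycle_blocks ?S ?k" unfolding image_image L cycle_blocks_def ..
 also have "... = ?f ` pos_cycles I ?k" proof -
  have "?f (uminus ` B) = ?f B" for B by (simp add: image_image image_Un Un_commute)
  hence "?f ` (`) uminus ` pos_cycles I ?k = ?f ` pos_cycles I ?k" unfolding image_image[of ?f] by simp
  thus ?thesis unfolding pos_cycles_neg_disjoint(1)[OF k assms(3)] image_Un by simp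
 qed
 finally have im: "?f ` pos_cycles I ?k = partition_join {1..m} (pairs_of I h R) (pairs_of I h \<pi>)" by simp
 have "inj_on ?f (pos_cycles I ?k)" proof (rule inj_onI)
  fix B C assume BC: "B \<in> pos_cycles I ?k" "C \<in> pos_cycles I ?k" "?f B = ?f C"
  have e: "B \<union> uminus ` B = C \<union> uminus ` C" by (rule fi[OF BC(3) sub[OF pc[OF BC(1)]] sub[OF pc[OF BC(2)]]])
  obtain x where x: "x \<in> B" using bl(2)[OF pc[OF BC(1)]] by blast
  hence "x \<in> C \<or> x \<in> uminus ` C" using e by blast
  thus "B = C" proof
   assume "x \<in> C"
   thus ?thesis using bl(4)[OF pc[OF BC(1)] x] bl(4)[OF pc[OF BC(2)]] by simp
  next
   assume xC: "x \<in> uminus ` C"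
   hence "uminus ` C = B" using bl(4)[OF pc[OF BC(1)] x] bl(4)[OF PM_cycle_blocks_neg(1)[OF k assms(3) pc[OF BC(2)]]] by simp
   thus ?thesis using pos_cycles_cases[OF k assms(3) pc[OF BC(2)]] BC(1,2) by simp
  qed
 qed
 thus "bij_betw ?f (pos_cycles I ?k) (partition_join {1..m} (pairs_of I h R) (pairs_of I h \<pi>))"
  using im by (simp add: bij_betw_def)
 assume B: "B \<in> pos_cycles I ?k"
 have "card (?f B) = card (?r ` (B \<union> uminus ` B))" by (rule card_image[OF inj_on_subset[OF inj rS[OF sub[OF pc[OF B]]]]])
 also have "... = card (B \<union> uminus ` B)" by (rule card_image[OF inj_on_subset[OF permutes_inj[OF r]]]) simp
 also have "... = card B + card (uminus ` B)"
  using PM_cycle_blocks_neg(2)[OF k assms(3) pc[OF B]] bl(3)[OF pc[OF B]] by (intro card_Un_disjoint) simp_all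
 also have "card (uminus ` B) = card B" by (rule card_image) simp
 finally show "card (?f B) = 2 * card B" by simp
qed

lemma card_partition_join_pairing_of:
 assumes "r \<in> PM I" "\<pi> \<in> PM I" "ix_set I" "bij_betw h (pm I) {1..m}"
 shows "card (partition_join {1..m} (pairs_of I h r) (pairs_of I h \<pi>)) = loops I r \<pi>" proof -
 have k: "Kr I r \<pi> \<in> PM I" using Kr_in_PM[OF ix_finite[OF assms(3)] assms(2,1)] .
 have "2 * card (pos_cycles I (Kr I r \<pi>)) = 2 * loops I r \<pi>"
  unfolding two_loops[OF assms(1-3)] num_cycles_PM[OF k assms(3), symmetric] num_cycles_Kr[OF assms(1,3)] ..
 thus ?thesis using bij_betw_same_card[OF partition_join_Kr(1)[OF assms]] by simp
qed

text \<open>No cycle contains an element together with its negative, so absolute values are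
  injective on it. A block in turn determines its positive cycle, through the smallest absolute
  value.\<close>

lemma abs_partition_pos_cycles:
 assumes "k \<in> PM I" "ix_set I" shows "bij_betw ((`) abs) (pos_cycles I k) (abs_partition I k)"
  "B \<in> pos_cycles I k ==> card (abs ` B) = card B"
  "\<Union>(abs_partition I k) = I"
proof -
 let ?S = "pm I"
 note bl = cycle_blocks_block[OF PM_permutes[OF assms(1)] PM_perm[OF assms] finite_pm[OF assms(2)]]
 have im: "(`) abs ` pos_cycles I k = abs_partition I k" unfolding abs_partition_def pos_cycles_neg_disjoint(1)[OF assms] image_Un
  by (simp add: image_image)
 have "inj_on ((`) abs) (pos_cycles I k)" proof (rule inj_onI)
  fix B C assume BC: "B \<in> pos_cycles I k" "C \<in> pos_cycles I k" "abs ` B = abs ` C"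
  hence "Min (abs ` B) \<in> B" "Min (abs ` B) \<in> C" by (auto simp: pos_cycles_def)
  thus "B = C" using BC(1,2) bl(4)[of B "Min (abs ` B)"] bl(4)[of C "Min (abs ` B)"] by (simp add: pos_cycles_def)
 qed
 thus "bij_betw ((`) abs) (pos_cycles I k) (abs_partition I k)" using im by (simp add: bij_betw_def)
 show "card (abs ` B) = card B" if "B \<in> pos_cycles I k" proof (rule card_image, rule inj_onI)
  have B: "B \<in> cycle_blocks ?S k" using that by (simp add: pos_cycles_def)
  fix x y assume "x \<in> B" "y \<in> B" "\<bar>x\<bar> = \<bar>y\<bar>"
  thus "x = y" using PM_cycle_blocks_neg(2)[OF assms B] by (auto simp: abs_eq_iff)
 qed
 have "\<Union>(cycle_blocks ?S k) = ?S" using partition_on_cycle_blocks[OF PM_permutes[OF assms(1)] finite_pm[OF assms(2)]]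
  by (simp add: partition_on_def)
 hence "\<Union>(abs_partition I k) = abs ` ?S" unfolding abs_partition_def by blast
 also have "... = I" proof -
  have "abs ` I = I" using assms(2) by (force simp: ix_set_def)
  thus ?thesis by (simp add: signed_set_def image_Un image_image)
 qed
 finally show "\<Union>(abs_partition I k) = I" .
qed

section \<open>Premaps with equal cycle lengths are conjugate\<close>

lemma funpow_eq_iff_mod:
 assumes "permutation f" shows "(f ^^ m) a = (f ^^ n) a \<longleftrightarrow> m mod card (orbit f a) = n mod card (orbit f a)"
proof -
 let ?l = "least_power f a"
 have l: "?l = card (orbit f a)" using length_support[OF assms, of a] by simp
 have per: "(f ^^ ?l) a = a" "?l > 0" using least_power_of_permutation[OF assms] by simp_all
 define L where "L = support f a"
 have md: "(f ^^ k) a = L ! (k mod ?l)" for k using funpow_mod_eq[OF per(1), of k] per(2) by (simp add: L_def)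
 have "distinct L" unfolding L_def by (rule cycle_of_permutation[OF assms])
 moreover have "length L = ?l" by (simp add: L_def)
 ultimately have "L ! (m mod ?l) = L ! (n mod ?l) \<longleftrightarrow> m mod ?l = n mod ?l"
  using per(2) by (intro nth_eq_iff_index_eq) simp_all
 thus ?thesis unfolding md l .
qed

lemma orbit_funpow_obtain:
 assumes "permutation f" "y \<in> orbit f x"
 obtains n where "y = (f ^^ n) x" using assms(2) unfolding orbit_altdef_permutation[OF assms(1)] by blast

text \<open>Positive cycles of equal length are matched by counting steps from base points. The
  mirror cycles are filled in by oddness, and the premap relation gives the intertwining there
  too.\<close>

lemma PM_conjugate:
 assumes "k \<in> PM I" "k' \<in> PM I" "ix_set I" and c: "bij_betw c (pos_cycles I k) (pos_cycles I k')"
  and card: "\<And>B. B \<in> pos_cycles I k ==> card (c B) = card B"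
 obtains f where "bij_betw f (pm I) (pm I)"
  "\<And>x. x \<in> pm I ==> f (- x) = - f x"
  "\<And>x. x \<in> pm I ==> f (k x) = k' (f x)"
proof -
 let ?S = "pm I" and ?P = "pos_cycles I k" and ?P' = "pos_cycles I k'"
 have p: "permutation k" "permutation k'" using PM_perm assms by blast+
 have fin: "finite ?S" using finite_pm[OF assms(3)] .
 note bl = cycle_blocks_block[OF PM_permutes[OF assms(1)] p(1) fin]
 note bl' = cycle_blocks_block[OF PM_permutes[OF assms(2)] p(2) fin]
 have P: "B \<in> cycle_blocks ?S k" if "B \<in> ?P" for B using that by (simp add: pos_cycles_def)
 have P': "B \<in> cycle_blocks ?S k'" if "B \<in> ?P'" for B using that by (simp add: pos_cycles_def)
 have cP: "c B \<in> ?P'" if "B \<in> ?P" for B using bij_betwE[OF c] that by blast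
 define b where "b = (\<lambda>B. Min (B :: int set))"
 have b: "b B \<in> B" if "B \<in> cycle_blocks ?S k \<or> B \<in> cycle_blocks ?S k'" for B
  unfolding b_def using that bl(2,3)[of B] bl'(2,3)[of B] by (intro Min_in) blast+
 \<comment> \<open>The exponent is the least number of steps from the base point to x; since matched
   cycles have equal length, any other number of steps gives the same value.\<close>
 define g where "g = (\<lambda>x. (k' ^^ (LEAST n. (k ^^ n) (b (orbit k x)) = x)) (b (c (orbit k x))))"
 have g: "g ((k ^^ n) (b B)) = (k' ^^ n) (b (c B))" if B: "B \<in> ?P" for B n proof -
  let ?x = "(k ^^ n) (b B)" and ?m = "LEAST m. (k ^^ m) (b B) = (k ^^ n) (b B)"
  have bB: "b B \<in> B" using b P[OF B] by blast
  have oB: "orbit k (b B) = B" using bl(4)[OF P[OF B] bB] .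
  have "?x \<in> orbit k (b B)" unfolding orbit_altdef_permutation[OF p(1)] by blast
  hence "?x \<in> B" unfolding oB .
  hence ox: "orbit k ?x = B" using bl(4)[OF P[OF B]] by blast
  have "(k ^^ ?m) (b B) = ?x" by (rule LeastI[of _ n]) simp
  hence "?m mod card B = n mod card B" unfolding funpow_eq_iff_mod[OF p(1)] oB .
  moreover have "orbit k' (b (c B)) = c B" using bl'(4)[OF P'[OF cP[OF B]]] b P'[OF cP[OF B]] by blast
  ultimately have "(k' ^^ ?m) (b (c B)) = (k' ^^ n) (b (c B))" unfolding funpow_eq_iff_mod[OF p(2)] by (simp add: card[OF B])
  thus ?thesis unfolding g_def ox .
 qed
 define f where "f = (\<lambda>x. if orbit k x \<in> ?P then g x else - g (- x))"
 have rep: "\<exists>B n. B \<in> ?P \<and> x = (k ^^ n) (b B)" if x: "orbit k x \<in> ?P" for x proof -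
  have "x \<in> orbit k x" using permutation_self_in_orbit[OF p(1)] .
  moreover have "orbit k (b (orbit k x)) = orbit k x" using bl(4)[OF P[OF x]] b P[OF x] by blast
  ultimately obtain n where "x = (k ^^ n) (b (orbit k x))" using orbit_funpow_obtain[OF p(1), of x "b (orbit k x)"] by metis
  thus ?thesis using x by blast
 qed
 have cases: "orbit k (- x) \<in> ?P \<longleftrightarrow> orbit k x \<notin> ?P" if "x \<in> ?S" for x
  using pos_cycles_cases[OF assms(1,3), of "orbit k x"] that unfolding PM_orbit_neg[OF assms(1,3)] by (simp add: cycle_blocks_def)
 have neg: "f (- x) = - f x" if "x \<in> ?S" for x using cases[OF that] unfolding f_def by simp
 have kin: "k x \<in> ?S" if "x \<in> ?S" for x using that PM_in[OF assms(1)] by blast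
 have fpos: "f (k x) = k' (f x)" if x: "orbit k x \<in> ?P" for x proof -
  obtain B n where B: "B \<in> ?P" "x = (k ^^ n) (b B)" using rep[OF x] by blast
  have "orbit k (k x) = orbit k x" using permutation_orbit_step[OF p(1)] .
  hence "f (k x) = g ((k ^^ Suc n) (b B))" using x B(2) by (simp add: f_def)
  also have "... = k' ((k' ^^ n) (b (c B)))" unfolding g[OF B(1)] by simp
  also have "... = k' (f x)" using x g[OF B(1), of n] B(2) by (simp add: f_def)
  finally show ?thesis .
 qed
 have com: "f (k x) = k' (f x)" if x: "x \<in> ?S" for x proof (cases "orbit k x \<in> ?P")
  case True
  thus ?thesis by (rule fpos)
 next
  case False
  let ?y = "- k x"
  have y: "?y \<in> ?S" using kin[OF x] by simp
  have ky: "k ?y = - x" using PM_neg[OF assms(1), of "- x"] by simp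
  have "orbit k ?y = orbit k (- x)" using permutation_orbit_step[OF p(1), of ?y] unfolding ky by simp
  hence "orbit k ?y \<in> ?P" using cases[OF x] False by simp
  from fpos[OF this] have "f (- x) = k' (f ?y)" unfolding ky .
  hence "- f x = k' (- f (k x))" using neg[OF x] neg[OF kin[OF x]] by simp
  hence "f x = - k' (- f (k x))" by (simp add: minus_equation_iff)
  hence "k' (f x) = k' (- k' (- f (k x)))" by (rule arg_cong)
  thus ?thesis unfolding PM_neg[OF assms(2)] by (rule sym)
 qed
 have sub: "?S \<subseteq> f ` ?S" proof
  have pos: "y \<in> f ` ?S" if y: "orbit k' y \<in> ?P'" for y proof -
   have "orbit k' y \<in> c ` ?P" using y bij_betw_imp_surj_on[OF c] by simp
   then obtain B where B: "B \<in> ?P" "c B = orbit k' y" by blast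
   have "b (c B) \<in> c B" using b P'[OF cP[OF B(1)]] by blast
   hence "orbit k' (b (c B)) = c B" using bl'(4)[OF P'[OF cP[OF B(1)]]] by blast
   moreover have "y \<in> c B" unfolding B(2) using permutation_self_in_orbit[OF p(2)] .
   ultimately obtain n where n: "y = (k' ^^ n) (b (c B))" using orbit_funpow_obtain[OF p(2), of y "b (c B)"] by metis
   let ?x = "(k ^^ n) (b B)"
   have bB: "b B \<in> B" using b P[OF B(1)] by blast
   have "?x \<in> orbit k (b B)" unfolding orbit_altdef_permutation[OF p(1)] by blast
   hence xB: "?x \<in> B" unfolding bl(4)[OF P[OF B(1)] bB] .
   have "orbit k ?x = B" using bl(4)[OF P[OF B(1)] xB] .
   hence "f ?x = y" using B(1) g[OF B(1)] n by (simp add: f_def)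
   moreover have "?x \<in> ?S" using xB bl(1)[OF P[OF B(1)]] by blast
   ultimately show ?thesis by blast
  qed
  fix y assume y: "y \<in> ?S"
  show "y \<in> f ` ?S" proof (cases "orbit k' y \<in> ?P'")
   case True
   thus ?thesis by (rule pos)
  next
   case False
   hence "orbit k' (- y) \<in> ?P'" using pos_cycles_cases[OF assms(2,3), of "orbit k' y"] y
    unfolding PM_orbit_neg[OF assms(2,3)] by (simp add: cycle_blocks_def)
   then obtain x where x: "x \<in> ?S" "- y = f x" using pos by blast
   hence "f (- x) = y" using neg by simp
   moreover have "- x \<in> ?S" using x(1) by simp
   ultimately show ?thesis by blast
  qed
 qed
 have inj: "inj_on f ?S" by (rule finite_surj_inj[OF fin sub])
 have "card (f ` ?S) = card ?S" using inj by (rule card_image)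
 hence "f ` ?S = ?S" using card_subset_eq[of "f ` ?S" ?S] sub fin by simp
 hence "bij_betw f ?S ?S" using inj by (simp add: bij_betw_def)
 thus ?thesis using that neg com by blast
qed

section \<open>The Weingarten function as an inverse Gram matrix on premaps\<close>

text \<open>After numbering S, a trivial kernel forces a nonzero determinant, which makes the matrix
  a unit.\<close>

lemma matrix_inverse_exists:
 fixes G :: "'i => 'i => real"
 assumes "finite S"
  and inj: "\<And>u. (\<And>i. i \<in> S ==> (\<Sum>j\<in>S. G i j * u j) = 0) ==> \<forall>j\<in>S. u j = 0"
 shows "\<exists>H. \<forall>i\<in>S. \<forall>j\<in>S. (\<Sum>k\<in>S. H i k * G k j) = of_bool (i = j) \<and> (\<Sum>k\<in>S. G i k * H k j) = of_bool (i = j)"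
proof -
 let ?n = "card S"
 obtain b where b: "bij_betw b {0..<?n} S" using ex_bij_betw_nat_finite[OF assms(1)] by blast
 have bS: "b i \<in> S" if "i < ?n" for i using bij_betwE[OF b] that by simp
 define d where "d = inv_into {0..<?n} b"
 have d: "d s < ?n" "b (d s) = s" if "s \<in> S" for s
  using bij_betw_inv_into_right[OF b that] bij_betwE[OF bij_betw_inv_into[OF b]] that by (auto simp: d_def)
 have db: "d (b i) = i" if "i < ?n" for i using bij_betw_inv_into_left[OF b, of i] that by (simp add: d_def)
 have sums: "(\<Sum>k = 0..<?n. F (b k)) = (\<Sum>s\<in>S. F s)" for F :: "'i => real"
  using sum.reindex_bij_betw[OF b, of F] .
 define A where "A = mat ?n ?n (\<lambda>(i, j). G (b i) (b j))"
 have A: "A \<in> carrier_mat ?n ?n" by (simp add: A_def)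
 have "det A \<noteq> 0" proof
  assume "det A = 0"
  then obtain v where v: "v \<in> carrier_vec ?n" "v \<noteq> 0\<^sub>v ?n" "A *\<^sub>v v = 0\<^sub>v ?n"
   unfolding det_0_iff_vec_prod_zero_field[OF A] by blast
  have "\<forall>j\<in>S. v $ d j = 0" proof (rule inj)
   fix s assume s: "s \<in> S"
   have "(\<Sum>j\<in>S. G s j * v $ d j) = (\<Sum>k = 0..<?n. G s (b k) * v $ d (b k))" by (rule sums[symmetric])
   also have "... = (\<Sum>k = 0..<?n. G s (b k) * v $ k)" by (intro sum.cong refl) (simp add: db)
   also have "... = (A *\<^sub>v v) $ d s" using d[OF s] v(1) by (simp add: A_def scalar_prod_def)
   also have "... = 0" using v(3) d(1)[OF s] by simp
   finally show "(\<Sum>j\<in>S. G s j * v $ d j) = 0" .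
  qed
  hence "v $ i = 0" if "i < ?n" for i using bS[OF that] db[OF that] by force
  hence "v = 0\<^sub>v ?n" using v(1) by (intro eq_vecI) auto
  thus False using v(2) by simp
 qed
 then obtain B where B: "B \<in> carrier_mat ?n ?n" "B * A = 1\<^sub>m ?n" "A * B = 1\<^sub>m ?n"
  using det_non_zero_imp_unit[OF A] unfolding Units_def by (auto simp: ring_mat_def)
 define H where "H = (\<lambda>i j. B $$ (d i, d j))"
 have "(\<Sum>k\<in>S. H i k * G k j) = of_bool (i = j) \<and> (\<Sum>k\<in>S. G i k * H k j) = of_bool (i = j)"
  if i: "i \<in> S" and j: "j \<in> S" for i j
 proof
  have eq: "(d i = d j) = (i = j)" using d(2)[OF i] d(2)[OF j] by metis
  have "(\<Sum>k\<in>S. H i k * G k j) = (\<Sum>k = 0..<?n. B $$ (d i, d (b k)) * G (b k) j)" unfolding H_def by (rule sums[symmetric])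
  also have "... = (\<Sum>k = 0..<?n. B $$ (d i, k) * A $$ (k, d j))" using d[OF j] by (intro sum.cong refl) (simp add: db A_def)
  also have "... = (B * A) $$ (d i, d j)" using d[OF i] d[OF j] A B(1) by (simp add: scalar_prod_def)
  finally show "(\<Sum>k\<in>S. H i k * G k j) = of_bool (i = j)" using B(2) d[OF i] d[OF j] eq by simp
  have "(\<Sum>k\<in>S. G i k * H k j) = (\<Sum>k = 0..<?n. G i (b k) * B $$ (d (b k), d j))" unfolding H_def by (rule sums[symmetric])
  also have "... = (\<Sum>k = 0..<?n. A $$ (d i, k) * B $$ (k, d j))" using d[OF i] by (intro sum.cong refl) (simp add: db A_def)
  also have "... = (A * B) $$ (d i, d j)" using d[OF i] d[OF j] A B(1) by (simp add: scalar_prod_def)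
  finally show "(\<Sum>k\<in>S. G i k * H k j) = of_bool (i = j)" using B(3) d[OF i] d[OF j] eq by simp
 qed
 thus ?thesis by blast
qed

text \<open>A left inverse equals a right inverse. The two are allowed to have different origins,
  which later compares different labellings of the same matrix.\<close>

lemma matrix_inverse_unique:
 fixes G :: "'i => 'i => real"
 assumes "finite S"
  and H: "\<And>i j. i \<in> S ==> j \<in> S ==> (\<Sum>k\<in>S. H i k * G k j) = of_bool (i = j)"
  and H': "\<And>i j. i \<in> S ==> j \<in> S ==> (\<Sum>k\<in>S. G i k * H' k j) = of_bool (i = j)"
  and i: "i \<in> S" and j: "j \<in> S" shows "H i j = H' i j"
proof -
 have ob: "of_bool P * x = (if P then x else 0)" "x * of_bool P = (if P then x else 0)" for P and x :: real by simp_all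
 have "H i j = (\<Sum>l\<in>S. H i l * of_bool (l = j))" using assms(1) j by (simp only: ob sum.delta) simp
 also have "... = (\<Sum>l\<in>S. H i l * (\<Sum>k\<in>S. G l k * H' k j))" by (intro sum.cong refl) (simp only: H'[OF _ j])
 also have "... = (\<Sum>k\<in>S. \<Sum>l\<in>S. H i l * (G l k * H' k j))" unfolding sum_distrib_left by (rule sum.swap)
 also have "... = (\<Sum>k\<in>S. (\<Sum>l\<in>S. H i l * G l k) * H' k j)" unfolding sum_distrib_right by (simp only: mult.assoc)
 also have "... = (\<Sum>k\<in>S. of_bool (i = k) * H' k j)" by (intro sum.cong refl) (simp only: H[OF i])
 also have "... = H' i j" using assms(1) i by (simp only: ob sum.delta') simp
 finally show ?thesis .
qed

text \<open>The zero values demanded off S make the description unique, so it denotes the inverse as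
  soon as the kernel is trivial.\<close>

lemma matrix_inverse_on_spec:
 fixes G :: "'i => 'i => real"
 assumes fin: "finite S"
  and inj: "\<And>u. (\<And>i. i \<in> S ==> (\<Sum>j\<in>S. G i j * u j) = 0) ==> \<forall>j\<in>S. u j = 0"
  and i: "i \<in> S" and j: "j \<in> S" shows "(\<Sum>k\<in>S. matrix_inverse_on S G i k * G k j) = of_bool (i = j)"
  "(\<Sum>k\<in>S. G i k * matrix_inverse_on S G k j) = of_bool (i = j)"
proof -
 let ?Q = "\<lambda>H. (\<forall>i\<in>S. \<forall>j\<in>S. (\<Sum>k\<in>S. H i k * G k j) = of_bool (i = j) \<and>
   (\<Sum>k\<in>S. G i k * H k j) = of_bool (i = j)) \<and> (\<forall>i j. i \<notin> S \<or> j \<notin> S \<longrightarrow> H i j = 0)"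
 obtain H0 where H0: "\<forall>i\<in>S. \<forall>j\<in>S. (\<Sum>k\<in>S. H0 i k * G k j) = of_bool (i = j) \<and>
   (\<Sum>k\<in>S. G i k * H0 k j) = of_bool (i = j)" using matrix_inverse_exists[OF fin inj] ..
 define H where "H = (\<lambda>i j. if i \<in> S \<and> j \<in> S then H0 i j else 0)"
 have 1: "(\<Sum>k\<in>S. H i k * G k j) = (\<Sum>k\<in>S. H0 i k * G k j)" "(\<Sum>k\<in>S. G i k * H k j) = (\<Sum>k\<in>S. G i k * H0 k j)"
  if "i \<in> S" "j \<in> S" for i j using that by (auto simp: H_def intro!: sum.cong)
 have Q: "?Q H" using H0 1 by (simp add: H_def)
 have u: "H' = H" if Q': "?Q H'" for H' proof (intro ext)
  fix i j
  show "H' i j = H i j" proof (cases "i \<in> S \<and> j \<in> S")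
   case True
   show ?thesis by (rule matrix_inverse_unique[where G = G and S = S, OF fin]) (use True Q Q' in blast)+
  next
   case False
   thus ?thesis using Q Q' by simp
  qed
 qed
 have "matrix_inverse_on S G = H" unfolding matrix_inverse_on_def by (rule the_equality[of ?Q, OF Q u])
 thus "(\<Sum>k\<in>S. matrix_inverse_on S G i k * G k j) = of_bool (i = j)"
  "(\<Sum>k\<in>S. G i k * matrix_inverse_on S G k j) = of_bool (i = j)" using Q i j by simp_all
qed

text \<open>These coefficients are the limits of N^(-defect): 1 at defect zero and 0 otherwise. The
  number of positive cycles serves as rank.\<close>

lemma unitriangular_defect:
 assumes "ix_set I" "S \<subseteq> PM I" shows "unitriangular S (\<lambda>\<pi> r. 0 ^ defect I \<pi> r)" unfolding unitriangular_def
proof (intro conjI ballI exI[of _ "\<lambda>\<pi>. card (pos_cycles I \<pi>)"] impI)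
 show "finite S" using finite_subset[OF assms(2) finite_PM[OF assms(1)]] .
 show "(0 :: complex) ^ defect I \<pi> \<pi> = 1" if "\<pi> \<in> S" for \<pi> using defect_self[of \<pi> I] assms that by auto
 fix \<pi> r assume "\<pi> \<in> S" "r \<in> S" "r \<noteq> \<pi> \<and> (0 :: complex) ^ defect I \<pi> r \<noteq> 0"
 thus "card (pos_cycles I \<pi>) < card (pos_cycles I r)"
  using defect_zero_card[of \<pi> I r] assms by (auto simp: power_0_left split: if_splits)
qed

lemma inverse_power_tendsto:
 "((\<lambda>N. inverse (of_nat N) ^ d) \<longlongrightarrow> (0 :: complex) ^ d) sequentially" by (intro tendsto_power lim_inverse_n)

text \<open>Dividing the unknown of index r by N to its number of positive cycles, and each row by a
  power of N, turns N^loops into N^(-defect). The uniform bound for the perturbed system then leaves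
  only the zero vector in the kernel.\<close>

lemma eventually_loops_matrix_injective:
 assumes "ix_set I"
 shows "eventually (\<lambda>N. \<forall>u :: (int => int) => real. (\<forall>\<pi>\<in>PM I. (\<Sum>r\<in>PM I. real N ^ loops I \<pi> r * u r) = 0)
   \<longrightarrow> (\<forall>r\<in>PM I. u r = 0)) sequentially"
proof -
 obtain K where "eventually (\<lambda>N. \<forall>u. \<forall>s\<in>PM I. norm (u s) \<le> K *
   (\<Sum>t\<in>PM I. norm (\<Sum>t'\<in>PM I. inverse (of_nat N) ^ defect I t t' * (u t' :: complex)))) sequentially"
  using perturbed_unitriangular_bound[where F = sequentially and S = "PM I" and a = "\<lambda>\<pi> r. 0 ^ defect I \<pi> r" and
    b = "\<lambda>N \<pi> r. inverse (of_nat N) ^ defect I \<pi> r",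
    OF unitriangular_defect[OF assms subset_refl] inverse_power_tendsto] by blast
 thus ?thesis using eventually_gt_at_top[of 0] proof eventually_elim
  case (elim N)
  show ?case proof (intro allI impI ballI)
   fix u :: "(int => int) => real" and r
   assume u: "\<forall>\<pi>\<in>PM I. (\<Sum>r\<in>PM I. real N ^ loops I \<pi> r * u r) = 0" and r: "r \<in> PM I"
   define w where "w = (\<lambda>r. complex_of_real (u r / real N ^ card (pos_cycles I r)))"
   have "(\<Sum>t'\<in>PM I. inverse (of_nat N) ^ defect I t t' * w t') = 0" if t: "t \<in> PM I" for t proof -
    have "inverse (of_nat N) ^ defect I t t' * w t'
      = of_real (real N ^ loops I t t' * u t') * (inverse (of_nat N) ^ (card I + card (pos_cycles I t)))" if t': "t' \<in> PM I" for t'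
    proof -
     have e: "card I + card (pos_cycles I t) = defect I t t' + loops I t t' + card (pos_cycles I t')"
      using defect_eq[OF t t' assms] by simp
     show ?thesis unfolding e w_def using elim(2) by (simp add: power_add field_simps)
    qed
    hence "(\<Sum>t'\<in>PM I. inverse (of_nat N) ^ defect I t t' * w t')
      = (\<Sum>t'\<in>PM I. of_real (real N ^ loops I t t' * u t') * (inverse (of_nat N) ^ (card I + card (pos_cycles I t))))"
     by (rule sum.cong[OF refl])
    also have "... = of_real (\<Sum>t'\<in>PM I. real N ^ loops I t t' * u t') * (inverse (of_nat N) ^ (card I + card (pos_cycles I t)))"
     unfolding of_real_sum sum_distrib_right ..
    also have "... = 0" using u t by simp
    finally show ?thesis .
   qed
   hence "(\<Sum>t\<in>PM I. norm (\<Sum>t'\<in>PM I. inverse (of_nat N) ^ defect I t t' * w t')) = 0"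
    by (intro sum.neutral ballI) simp
   hence "norm (w r) \<le> K * 0" using spec[OF elim(1), of w] r by fastforce
   thus "u r = 0" using elim(2) by (simp add: w_def)
  qed
 qed
qed

text \<open>\<open>Weingarten\<close> selects some pair of pairings whose join has the block sizes
  of the complement. They come from premaps R' and v' whose complement has the same cycle lengths,
  so an odd conjugation turns one complement into the other. The relabelling built from it carries
  the pairings of R and v to the selected ones, and the inverse Gram matrix does not depend on the
  labelling.\<close>

lemma Weingarten_abs_partition_Kr:
 assumes ix: "ix_set I" and R: "R \<in> PM I" and v: "v \<in> PM I" and h: "bij_betw h (pm I) {1..2 * card I}"
  and inj: "\<And>u :: (int => int) => real. (\<And>\<pi>. \<pi> \<in> PM I ==> (\<Sum>R\<in>PM I. real N ^ loops I \<pi> R * u R) = 0)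
   ==> \<forall>R\<in>PM I. u R = 0"
 defines "m \<equiv> 2 * card I"
 defines "H \<equiv> matrix_inverse_on (pairings m) (\<lambda>W\<^sub>1 W\<^sub>2. real N ^ card (partition_join {1..m} W\<^sub>1 W\<^sub>2))"
 shows "Weingarten N (abs_partition I (Kr I R v)) = H (pairs_of I h R) (pairs_of I h v)"
  "\<pi> \<in> PM I ==> (\<Sum>R\<in>PM I. real N ^ loops I \<pi> R * H (pairs_of I h R) (pairs_of I h v)) = of_bool (\<pi> = v)"
proof -
 let ?S = "pm I" and ?G = "\<lambda>W\<^sub>1 W\<^sub>2. real N ^ card (partition_join {1..m} W\<^sub>1 W\<^sub>2)"
 have h': "bij_betw h ?S {1..m}" using h by (simp add: m_def)
 have gram: "?G (pairs_of I k \<pi>) (pairs_of I k \<xi>) = real N ^ loops I \<pi> \<xi>"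
  if "\<pi> \<in> PM I" "\<xi> \<in> PM I" "bij_betw k ?S {1..m}" for \<pi> \<xi> k
  unfolding card_partition_join_pairing_of[OF that(1,2) ix that(3)] ..
 have bij: "bij_betw (pairs_of I k) (PM I) (pairings m)" if "bij_betw k ?S {1..m}" for k by (rule bij_betw_pairing_of[OF ix that])
 have sums: "(\<Sum>V\<in>pairings m. F V) = (\<Sum>\<pi>\<in>PM I. F (pairs_of I k \<pi>))"
  if "bij_betw k ?S {1..m}" for k and F :: "nat set set => real" using sum.reindex_bij_betw[OF bij[OF that], of F] by simp
 have inV: "pairs_of I k \<pi> \<in> pairings m" if "\<pi> \<in> PM I" "bij_betw k ?S {1..m}" for k \<pi>
  using bij_betwE[OF bij[OF that(2)]] that(1) by blast
 have finV: "finite (pairings m)" using bij_betw_finite[OF bij[OF h']] finite_PM[OF ix] by blast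
 have injV: "\<forall>j\<in>pairings m. u j = 0"
  if u: "\<And>i. i \<in> pairings m ==> (\<Sum>j\<in>pairings m. ?G i j * u j) = 0" for u
 proof -
  have "\<forall>R\<in>PM I. u (pairs_of I h R) = 0" proof (rule inj)
   fix \<pi> assume \<pi>: "\<pi> \<in> PM I"
   have "(\<Sum>R\<in>PM I. real N ^ loops I \<pi> R * u (pairs_of I h R))
     = (\<Sum>R\<in>PM I. ?G (pairs_of I h \<pi>) (pairs_of I h R) * u (pairs_of I h R))"
    by (intro sum.cong refl) (simp only: gram[OF \<pi> _ h'])
   also have "... = (\<Sum>j\<in>pairings m. ?G (pairs_of I h \<pi>) j * u j)" by (rule sums[OF h', symmetric])
   also have "... = 0" by (rule u[OF inV[OF \<pi> h']])
   finally show "(\<Sum>R\<in>PM I. real N ^ loops I \<pi> R * u (pairs_of I h R)) = 0" .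
  qed
  moreover have "pairings m = pairs_of I h ` PM I" using bij[OF h'] by (simp add: bij_betw_def)
  ultimately show ?thesis by simp
 qed
 note spec = matrix_inverse_on_spec[where G = ?G, OF finV injV]
 have left: "(\<Sum>\<xi>\<in>PM I. H (pairs_of I k \<pi>) (pairs_of I k \<xi>) * real N ^ loops I \<xi> \<pi>') = of_bool (\<pi> = \<pi>')"
  and right: "(\<Sum>\<xi>\<in>PM I. real N ^ loops I \<pi> \<xi> * H (pairs_of I k \<xi>) (pairs_of I k \<pi>')) = of_bool (\<pi> = \<pi>')"
  if \<pi>: "\<pi> \<in> PM I" and \<pi>': "\<pi>' \<in> PM I" and k: "bij_betw k ?S {1..m}" for k \<pi> \<pi>'
 proof -
  have eq: "(pairs_of I k \<pi> = pairs_of I k \<pi>') = (\<pi> = \<pi>')"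
   using bij_betw_imp_inj_on[OF bij[OF k]] \<pi> \<pi>' by (auto dest: inj_onD)
  have "(\<Sum>\<xi>\<in>PM I. H (pairs_of I k \<pi>) (pairs_of I k \<xi>) * real N ^ loops I \<xi> \<pi>')
    = (\<Sum>\<xi>\<in>PM I. H (pairs_of I k \<pi>) (pairs_of I k \<xi>) * ?G (pairs_of I k \<xi>) (pairs_of I k \<pi>'))"
   by (intro sum.cong refl) (simp only: gram[OF _ \<pi>' k])
  also have "... = (\<Sum>V\<in>pairings m. H (pairs_of I k \<pi>) V * ?G V (pairs_of I k \<pi>'))" by (rule sums[OF k, symmetric])
  also have "... = of_bool (pairs_of I k \<pi> = pairs_of I k \<pi>')"
   unfolding H_def by (rule spec(1)[OF _ inV[OF \<pi> k] inV[OF \<pi>' k]])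
  finally show "(\<Sum>\<xi>\<in>PM I. H (pairs_of I k \<pi>) (pairs_of I k \<xi>) * real N ^ loops I \<xi> \<pi>') = of_bool (\<pi> = \<pi>')"
   unfolding eq .
  have "(\<Sum>\<xi>\<in>PM I. real N ^ loops I \<pi> \<xi> * H (pairs_of I k \<xi>) (pairs_of I k \<pi>'))
    = (\<Sum>\<xi>\<in>PM I. ?G (pairs_of I k \<pi>) (pairs_of I k \<xi>) * H (pairs_of I k \<xi>) (pairs_of I k \<pi>'))"
   by (intro sum.cong refl) (simp only: gram[OF \<pi> _ k])
  also have "... = (\<Sum>V\<in>pairings m. ?G (pairs_of I k \<pi>) V * H V (pairs_of I k \<pi>'))" by (rule sums[OF k, symmetric])
  also have "... = of_bool (pairs_of I k \<pi> = pairs_of I k \<pi>')"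
   unfolding H_def by (rule spec(2)[OF _ inV[OF \<pi> k] inV[OF \<pi>' k]])
  finally show "(\<Sum>\<xi>\<in>PM I. real N ^ loops I \<pi> \<xi> * H (pairs_of I k \<xi>) (pairs_of I k \<pi>')) = of_bool (\<pi> = \<pi>')"
   unfolding eq .
 qed
 show "\<pi> \<in> PM I ==> (\<Sum>R\<in>PM I. real N ^ loops I \<pi> R * H (pairs_of I h R) (pairs_of I h v)) = of_bool (\<pi> = v)"
  by (rule right[OF _ v h'])
 \<comment> \<open>Under every labelling the entries invert the same matrix N^loops on premaps, so a
   left inverse for one labelling equals a right inverse for the other.\<close>
 have indep: "H (pairs_of I k \<pi>) (pairs_of I k \<xi>) = H (pairs_of I l \<pi>) (pairs_of I l \<xi>)"
  if "\<pi> \<in> PM I" "\<xi> \<in> PM I" "bij_betw k ?S {1..m}" "bij_betw l ?S {1..m}" for \<pi> \<xi> k l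
  by (rule matrix_inverse_unique[where S = "PM I" and G = "\<lambda>\<pi> R. real N ^ loops I \<pi> R" and
     H = "\<lambda>\<pi> \<xi>. H (pairs_of I k \<pi>) (pairs_of I k \<xi>)" and
     H' = "\<lambda>\<pi> \<xi>. H (pairs_of I l \<pi>) (pairs_of I l \<xi>)",
     OF finite_PM[OF ix] left[OF _ _ that(3)] right[OF _ _ that(4)] that(1,2)])
 define U where "U = abs_partition I (Kr I R v)"
 have kap: "Kr I R v \<in> PM I" using Kr_in_PM[OF ix_finite[OF ix] v R] .
 have cU: "card (\<Union>U) = card I" unfolding U_def abs_partition_pos_cycles(3)[OF kap ix] ..
 define Q where "Q = (\<lambda>(V\<^sub>1, V\<^sub>2). V\<^sub>1 \<in> pairings m \<and> V\<^sub>2 \<in> pairings m \<and>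
   (\<exists>b. bij_betw b (partition_join {1..m} V\<^sub>1 V\<^sub>2) U \<and>
    (\<forall>B\<in>partition_join {1..m} V\<^sub>1 V\<^sub>2. card B = 2 * card (b B))))"
 have W: "Weingarten N U = (case (SOME z. Q z) of (V\<^sub>1, V\<^sub>2) => H V\<^sub>1 V\<^sub>2)"
  unfolding Weingarten_def Let_def cU m_def[symmetric] H_def Q_def ..
 have bijU: "bij_betw ((`) abs) (pos_cycles I (Kr I R v)) U" unfolding U_def by (rule abs_partition_pos_cycles(1)[OF kap ix])
 note cardU = abs_partition_pos_cycles(2)[OF kap ix]
 note join = partition_join_Kr[OF _ _ ix h']
 have "Q (pairs_of I h R, pairs_of I h v)" proof -
  let ?f = "\<lambda>B. h ` plus_part I R ` (B \<union> uminus ` B)" and ?P = "pos_cycles I (Kr I R v)"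
  let ?J = "partition_join {1..m} (pairs_of I h R) (pairs_of I h v)"
  let ?b = "(`) abs \<circ> inv_into ?P ?f"
  have f: "bij_betw ?f ?P ?J" by (rule join(1)[OF R v])
  have "bij_betw ?b ?J U" by (rule bij_betw_trans[OF bij_betw_inv_into[OF f] bijU])
  moreover have "card B = 2 * card (?b B)" if B: "B \<in> ?J" for B proof -
   have i: "inv_into ?P ?f B \<in> ?P" using bij_betwE[OF bij_betw_inv_into[OF f]] B by blast
   have "card (?f (inv_into ?P ?f B)) = 2 * card (inv_into ?P ?f B)" by (rule join(2)[OF R v i])
   thus ?thesis unfolding bij_betw_inv_into_right[OF f B] using cardU[OF i] by simp
  qed
  ultimately show ?thesis unfolding Q_def using inV[OF R h'] inV[OF v h'] by blast
 qed
 hence Qs: "Q (SOME z. Q z)" by (rule someI)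
 obtain W1 W2 where SW: "(SOME z. Q z) = (W1, W2)" by (cases "SOME z. Q z")
 have "Q (W1, W2)" using Qs unfolding SW .
 then obtain b where WV: "W1 \<in> pairings m" "W2 \<in> pairings m" and b: "bij_betw b (partition_join {1..m} W1 W2) U"
  and cb: "\<And>B. B \<in> partition_join {1..m} W1 W2 ==> card B = 2 * card (b B)" unfolding Q_def by auto
 have "W1 \<in> pairs_of I h ` PM I" "W2 \<in> pairs_of I h ` PM I" using WV bij[OF h'] by (simp_all add: bij_betw_def)
 then obtain R' v' where r': "R' \<in> PM I" "W1 = pairs_of I h R'" and s': "v' \<in> PM I" "W2 = pairs_of I h v'" by blast
 have kap': "Kr I R' v' \<in> PM I" using Kr_in_PM[OF ix_finite[OF ix] s'(1) r'(1)] .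
 let ?P = "pos_cycles I (Kr I R v)" and ?P' = "pos_cycles I (Kr I R' v')"
 let ?f' = "\<lambda>B. h ` plus_part I R' ` (B \<union> uminus ` B)"
 have f': "bij_betw ?f' ?P' (partition_join {1..m} W1 W2)" unfolding r'(2) s'(2) by (rule join(1)[OF r'(1) s'(1)])
 have bf: "bij_betw (b \<circ> ?f') ?P' U" by (rule bij_betw_trans[OF f' b])
 \<comment> \<open>Cycles of the two complements are matched through the common set U of blocks: by
   absolute values on one side, by the selected bijection b on the other.\<close>
 define c where "c = inv_into ?P' (b \<circ> ?f') \<circ> (`) abs"
 have c: "bij_betw c ?P ?P'" unfolding c_def by (rule bij_betw_trans[OF bijU bij_betw_inv_into[OF bf]])
 have cc: "card (c B) = card B" if B: "B \<in> ?P" for B proof -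
  have cB: "c B \<in> ?P'" using bij_betwE[OF c] B by blast
  have aU: "abs ` B \<in> U" using bij_betwE[OF bijU] B by blast
  have "b (?f' (c B)) = abs ` B" using bij_betw_inv_into_right[OF bf aU] by (simp add: c_def)
  moreover have "?f' (c B) \<in> partition_join {1..m} W1 W2" using bij_betwE[OF f'] cB by blast
  ultimately have "card (?f' (c B)) = 2 * card (abs ` B)" using cb by metis
  moreover have "card (?f' (c B)) = 2 * card (c B)" by (rule join(2)[OF r'(1) s'(1) cB])
  ultimately show ?thesis using cardU[OF B] by simp
 qed
 obtain f where f: "bij_betw f ?S ?S" "\<And>x. x \<in> ?S ==> f (- x) = - f x"
  "\<And>x. x \<in> ?S ==> f (Kr I R v x) = Kr I R' v' (f x)"
  by (rule PM_conjugate[OF kap kap' ix c cc], assumption, rule that)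
 let ?r = "plus_part I R" and ?r' = "plus_part I R'"
 have r: "?r permutes ?S" "?r' permutes ?S" using plus_part_permutes[OF ix_finite[OF ix]] PM_permutes R r'(1) by blast+
 \<comment> \<open>This labelling passes from the coordinates given by the positive part of R to
   those given by R'. In both, the two pairings are negation and the negated complement, which f
   intertwines.\<close>
 define k where "k = h \<circ> ?r' \<circ> f \<circ> pinv ?r"
 note b1 = bij_betw_trans[OF permutes_imp_bij[OF permutes_inv[OF r(1)]] f(1)]
 note b2 = bij_betw_trans[OF b1 permutes_imp_bij[OF r(2)]]
 have k: "bij_betw k ?S {1..m}" using bij_betw_trans[OF b2 h'] unfolding k_def comp_assoc .
 have kr: "k (?r y) = h (?r' (f y))" for y by (simp add: k_def permutes_inverses(2)[OF r(1)])
 have img: "pairs_of I k \<pi> = (\<lambda>y. {k (?r y), k (\<pi> (- ?r y))}) ` ?S" for \<pi>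
  using permutes_image[OF r(1)] image_image[of "\<lambda>x. {k x, k (\<pi> (- x))}" ?r ?S] by (simp add: pairs_of_def)
 have img': "pairs_of I h \<pi> = (\<lambda>y. {h (?r' (f y)), h (\<pi> (- ?r' (f y)))}) ` ?S" for \<pi> proof -
  have "?S = (\<lambda>y. ?r' (f y)) ` ?S" using permutes_image[OF r(2)] f(1) image_image[of ?r' f ?S] by (simp add: bij_betw_def)
  hence "(\<lambda>x. {h x, h (\<pi> (- x))}) ` ?S = (\<lambda>x. {h x, h (\<pi> (- x))}) ` (\<lambda>y. ?r' (f y)) ` ?S" by simp
  thus ?thesis unfolding pairs_of_def image_image .
 qed
 have kin: "Kr I R v y \<in> ?S" if "y \<in> ?S" for y using that PM_in[OF kap] by blast
 have "pairs_of I k R = pairs_of I h R'" unfolding img img' by (intro image_cong refl)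
   (simp only: kr plus_part_neg[OF R ix] plus_part_neg[OF r'(1) ix] f(2))
 moreover have "pairs_of I k v = pairs_of I h v'" unfolding img img' by (intro image_cong refl)
   (simp only: kr plus_part_Kr[OF R v ix, symmetric] plus_part_Kr[OF r'(1) s'(1) ix, symmetric] f(2)[OF kin] f(3))
 ultimately have "H W1 W2 = H (pairs_of I h R) (pairs_of I h v)" unfolding r'(2) s'(2) using indep[OF R v k h'] by simp
 thus "Weingarten N (abs_partition I (Kr I R v)) = H (pairs_of I h R) (pairs_of I h v)" unfolding U_def[symmetric] W SW by simp
qed

text \<open>The cumulants are the inverse Gram matrix applied to the moments, with powers of N on
  both sides. The weight N^(-defect) is the one for which these powers combine to N^loops, so that
  the Gram matrix meets its inverse.\<close>

lemma moment_eq_sum_matrix_cumulant: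
 assumes ix: "ix_set I" and N: "N > 0"
  and inj: "\<And>u :: (int => int) => real. (\<And>\<pi>. \<pi> \<in> PM I ==> (\<Sum>r\<in>PM I. real N ^ loops I \<pi> r * u r) = 0)
   ==> \<forall>r\<in>PM I. u r = 0" and \<pi>: "\<pi> \<in> PM I"
 shows "(LINT \<omega>|M. tr_perm N I \<pi> (\<lambda>k. Y k \<omega>))
  = (\<Sum>r\<in>PM I. inverse (of_nat N) ^ defect I \<pi> r * matrix_cumulant M N I r Y)"
proof -
 define E where "E = (\<lambda>\<pi>. LINT \<omega>|M. tr_perm N I \<pi> (\<lambda>k. Y k \<omega>))"
 define W where "W = (\<lambda>r s. Weingarten N (abs_partition I (Kr I r s)))"
 define z where "z = complex_of_nat N"
 have z: "z \<noteq> 0" using N by (simp add: z_def)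
 let ?p = "\<lambda>\<pi>. card (pos_cycles I \<pi>)"
 have cS: "card (pm I) = card {1..2 * card I}" by (simp add: card_signed_set[OF ix])
 obtain h where h: "bij_betw h (pm I) {1..2 * card I}" using finite_same_card_bij[OF finite_pm[OF ix] _ cS] by blast
 have inv: "(\<Sum>r\<in>PM I. real N ^ loops I \<pi> r * W r s) = of_bool (\<pi> = s)" if s: "s \<in> PM I" for s proof -
  note w = Weingarten_abs_partition_Kr[OF ix _ s h inj]
  have "(\<Sum>r\<in>PM I. real N ^ loops I \<pi> r * W r s) = (\<Sum>r\<in>PM I. real N ^ loops I \<pi> r *
    matrix_inverse_on (pairings (2 * card I)) (\<lambda>W\<^sub>1 W\<^sub>2. real N ^ card (partition_join {1..2 * card I} W\<^sub>1 W\<^sub>2)) (pairs_of I h r) (pairs_of I h s))"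
   unfolding W_def by (intro sum.cong refl) (simp only: w(1))
  thus ?thesis using w(2)[OF s _ \<pi>] by simp
 qed
 \<comment> \<open>The loop number cancels between \<open>chi\<close> and the normalisation of
   \<open>wg\<close>, leaving |I| plus the positive cycles of s minus those of r.\<close>
 have coeff: "complex_of_real (real N powi (chi I r s - int (num_cycles (pm I) r)) * wg N (abs_partition I (Kr I r s)))
   = z ^ (card I + ?p s) * inverse z ^ ?p r * of_real (W r s)" if r: "r \<in> PM I" and s: "s \<in> PM I" for r s
 proof -
  have kap: "Kr I r s \<in> PM I" using Kr_in_PM[OF ix_finite[OF ix] s r] .
  have l: "num_cycles (pm I) (Kr I r s) = 2 * loops I r s" unfolding num_cycles_Kr[OF r ix] two_loops[OF r s ix] ..
  have cU: "card (abs_partition I (Kr I r s)) = loops I r s"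
   using bij_betw_same_card[OF abs_partition_pos_cycles(1)[OF kap ix]] num_cycles_PM[OF kap ix] l by simp
  \<comment> \<open>This bound makes the natural subtraction in the exponent of \<open>wg\<close> a
    genuine difference.\<close>
  have "loops I r s \<le> card I" using num_cycles_le[OF finite_pm[OF ix], of "Kr I r s"] unfolding l card_signed_set[OF ix] by simp
  hence le: "int (2 * card I - loops I r s) = 2 * int (card I) - int (loops I r s)" by simp
  have chi: "chi I r s - int (num_cycles (pm I) r) + int (2 * card I - loops I r s)
    = int (card I + ?p s) - int (?p r)" unfolding chi_def l num_cycles_PM[OF r ix] num_cycles_PM[OF s ix] le by simp
  have "real N powi (chi I r s - int (num_cycles (pm I) r)) * real N ^ (2 * card I - loops I r s)
    = real N powi (int (card I + ?p s) - int (?p r))" unfolding chi[symmetric] using N by (simp add: power_int_add del: of_nat_diff)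
  also have "... = real N ^ (card I + ?p s) * inverse (real N) ^ ?p r"
   using N by (simp add: power_int_diff power_int_add power_add field_simps)
  finally have "real N powi (chi I r s - int (num_cycles (pm I) r)) * wg N (abs_partition I (Kr I r s))
    = real N ^ (card I + ?p s) * inverse (real N) ^ ?p r * W r s"
   unfolding wg_def abs_partition_pos_cycles(3)[OF kap ix] cU W_def by (simp add: mult.assoc[symmetric])
  thus ?thesis by (simp add: z_def)
 qed
 have mc: "matrix_cumulant M N I r Y = (\<Sum>s\<in>PM I. z ^ (card I + ?p s) * inverse z ^ ?p r * of_real (W r s) * E s)"
  if "r \<in> PM I" for r unfolding matrix_cumulant_def E_def by (intro sum.cong refl) (simp only: coeff[OF that])
 have ex: "inverse z ^ defect I \<pi> r * (z ^ (card I + ?p s) * inverse z ^ ?p r * of_real (W r s) * E s)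
   = z ^ ?p s * inverse z ^ ?p \<pi> * E s * of_real (real N ^ loops I \<pi> r * W r s)" if r: "r \<in> PM I" for r s
 proof -
  have "z ^ (card I + ?p \<pi>) = z ^ (defect I \<pi> r + loops I \<pi> r + ?p r)" using defect_eq[OF \<pi> r ix] by simp
  hence "inverse z ^ defect I \<pi> r * z ^ card I * inverse z ^ ?p r = inverse z ^ ?p \<pi> * z ^ loops I \<pi> r"
   using z by (simp add: power_add field_simps)
  hence "inverse z ^ defect I \<pi> r * z ^ card I * inverse z ^ ?p r * (z ^ ?p s * of_real (W r s) * E s)
    = inverse z ^ ?p \<pi> * z ^ loops I \<pi> r * (z ^ ?p s * of_real (W r s) * E s)" by simp
  thus ?thesis by (simp add: power_add z_def mult_ac)
 qed
 have "(\<Sum>r\<in>PM I. inverse z ^ defect I \<pi> r * matrix_cumulant M N I r Y)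
   = (\<Sum>r\<in>PM I. \<Sum>s\<in>PM I. z ^ ?p s * inverse z ^ ?p \<pi> * E s * of_real (real N ^ loops I \<pi> r * W r s))"
  by (intro sum.cong refl) (simp only: mc sum_distrib_left ex)
 also have "... = (\<Sum>s\<in>PM I. \<Sum>r\<in>PM I. z ^ ?p s * inverse z ^ ?p \<pi> * E s * of_real (real N ^ loops I \<pi> r * W r s))"
  by (rule sum.swap)
 also have "... = (\<Sum>s\<in>PM I. z ^ ?p s * inverse z ^ ?p \<pi> * E s * of_bool (\<pi> = s))" proof (intro sum.cong refl)
  fix s assume s: "s \<in> PM I"
  have "(\<Sum>r\<in>PM I. z ^ ?p s * inverse z ^ ?p \<pi> * E s * of_real (real N ^ loops I \<pi> r * W r s))
    = z ^ ?p s * inverse z ^ ?p \<pi> * E s * of_real (\<Sum>r\<in>PM I. real N ^ loops I \<pi> r * W r s)"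
   by (simp only: sum_distrib_left of_real_sum)
  thus "(\<Sum>r\<in>PM I. z ^ ?p s * inverse z ^ ?p \<pi> * E s * of_real (real N ^ loops I \<pi> r * W r s))
    = z ^ ?p s * inverse z ^ ?p \<pi> * E s * of_bool (\<pi> = s)"
   unfolding inv[OF s] by (simp only: of_bool_def of_real_eq_1_iff if_distrib[of of_real] of_real_0 of_real_1)
 qed
 also have "... = (\<Sum>s\<in>PM I. if s = \<pi> then z ^ ?p \<pi> * inverse z ^ ?p \<pi> * E \<pi> else 0)"
  by (intro sum.cong refl) auto
 also have "... = z ^ ?p \<pi> * inverse z ^ ?p \<pi> * E \<pi>" using \<pi> finite_PM[OF ix] by simp
 also have "... = E \<pi>" using z by (simp add: power_inverse)
 finally show ?thesis by (simp add: E_def z_def)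
qed

section \<open>Moments of products from joint cumulants\<close>

text \<open>Joint cumulants for a moment function on sets: the factors of a moment are indexed by
  cycles and not by positions in a list.\<close>

definition set_cumulant :: "'i set => ('i set => complex) => complex" where
 "set_cumulant A m = (\<Sum>P | partition_on A P. (- 1) ^ (card P - 1) * fact (card P - 1) * (\<Prod>B\<in>P. m B))"

lemma partition_on_image:
 assumes "partition_on X P" "inj_on f X" shows "partition_on (f ` X) ((`) f ` P)"
proof (rule partition_onI)
 have U: "\<Union>P = X" and ne: "{} \<notin> P" using assms(1) by (simp_all add: partition_on_def)
 show "\<Union>((`) f ` P) = f ` X" unfolding U[symmetric] by blast
 show "{} \<notin> (`) f ` P" using ne by auto
 fix B C assume "B \<in> (`) f ` P" "C \<in> (`) f ` P" "B \<noteq> C"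
 then obtain B' C' where BC: "B' \<in> P" "C' \<in> P" "B = f ` B'" "C = f ` C'" "B' \<noteq> C'" by blast
 have "disjnt B' C'" using assms(1) BC(1,2,5) by (auto simp: partition_on_def pairwise_def)
 moreover have "B' \<subseteq> X" "C' \<subseteq> X" using BC(1,2) U by blast+
 ultimately show "disjnt B C" unfolding BC(3,4) disjnt_def using inj_on_image_Int[OF assms(2), of B' C'] by simp
qed

lemma bij_betw_partitions:
 assumes "bij_betw f X Y" shows "bij_betw ((`) ((`) f)) {P. partition_on X P} {P. partition_on Y P}"
proof -
 have inj: "inj_on f X" and im: "f ` X = Y" using assms by (auto simp: bij_betw_def)
 let ?g = "inv_into X f"
 have g: "bij_betw ?g Y X" by (rule bij_betw_inv_into[OF assms])
 have gf: "(`) ?g ` (`) f ` P = P" if "partition_on X P" for P proof -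
  have "?g ` f ` B = B" if "B \<in> P" for B proof -
   have "B \<subseteq> X" using that \<open>partition_on X P\<close> by (auto simp: partition_on_def)
   thus ?thesis using inj by (rule inv_into_image_cancel[rotated])
  qed
  thus ?thesis by (simp add: image_image)
 qed
 have fg: "(`) f ` (`) ?g ` P = P" if "partition_on Y P" for P proof -
  have "f ` ?g ` B = B" if "B \<in> P" for B proof -
   have "B \<subseteq> Y" using that \<open>partition_on Y P\<close> by (auto simp: partition_on_def)
   thus ?thesis using im by (rule image_inv_into_cancel[rotated])
  qed
  thus ?thesis by (simp add: image_image)
 qed
 show ?thesis proof (rule bij_betwI[where g = "(`) ((`) ?g)"])
  show "(`) ((`) f) \<in> {P. partition_on X P} \<rightarrow> {P. partition_on Y P}" using partition_on_image[OF _ inj] im by auto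
  show "(`) ((`) ?g) \<in> {P. partition_on Y P} \<rightarrow> {P. partition_on X P}"
   using partition_on_image[of Y _ ?g] g by (auto simp: bij_betw_def)
 qed (use gf fg in auto)
qed

lemma joint_cumulant_eq_set_cumulant:
 assumes "distinct xs" shows "joint_cumulant M (map T xs) = set_cumulant (set xs) (\<lambda>B. LINT w|M. (\<Prod>i\<in>B. T i w))"
proof -
 let ?n = "length xs" and ?f = "(!) xs"
 have f: "bij_betw ?f {..<?n} (set xs)" by (rule bij_betw_nth[OF assms]) simp_all
 have inj: "inj_on ?f {..<?n}" using f by (simp add: bij_betw_def)
 let ?h = "\<lambda>P. (- 1) ^ (card P - 1) * fact (card P - 1) * (\<Prod>B\<in>P. LINT w|M. (\<Prod>i\<in>B. T i w))"
 have "set_cumulant (set xs) (\<lambda>B. LINT w|M. (\<Prod>i\<in>B. T i w))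
   = (\<Sum>P | partition_on {..<?n} P. ?h ((`) ?f ` P))"
  unfolding set_cumulant_def by (rule sum.reindex_bij_betw[OF bij_betw_partitions[OF f], symmetric])
 also have "... = joint_cumulant M (map T xs)" unfolding joint_cumulant_def length_map proof (intro sum.cong refl)
  fix P assume "P \<in> {P. partition_on {..<?n} P}"
  hence P: "partition_on {..<?n} P" by simp
  have sub: "B \<subseteq> {..<?n}" if "B \<in> P" for B using P that by (auto simp: partition_on_def)
  have injP: "inj_on ((`) ?f) P" using inj_on_image_Pow[OF inj] by (rule inj_on_subset) (use sub in blast)
  have "(\<Prod>i\<in>?f ` B. T i w) = (\<Prod>i\<in>B. (map T xs ! i) w)" if "B \<in> P" for B w proof -
   have "(\<Prod>i\<in>?f ` B. T i w) = (\<Prod>i\<in>B. T (xs ! i) w)"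
    using prod.reindex[OF inj_on_subset[OF inj sub[OF that]], of "\<lambda>i. T i w"] by simp
   also have "... = (\<Prod>i\<in>B. (map T xs ! i) w)" by (intro prod.cong refl) (use sub[OF that] in auto)
   finally show ?thesis .
  qed
  hence "(\<Prod>B\<in>(`) ?f ` P. LINT w|M. (\<Prod>i\<in>B. T i w)) = (\<Prod>B\<in>P. LINT w|M. (\<Prod>i\<in>B. (map T xs ! i) w))"
   unfolding prod.reindex[OF injP] comp_def by (intro prod.cong refl) simp
  thus "?h ((`) ?f ` P) = (- 1) ^ (card P - 1) * fact (card P - 1) * (\<Prod>B\<in>P. LINT w|M. (\<Prod>i\<in>B. (map T xs ! i) w))"
   unfolding card_image[OF injP] by simp
 qed
 finally show ?thesis by simp
qed

text \<open>A partition of the larger set is a partition Q of A together with a block to receive a;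
  the empty set stands for a new singleton block.\<close>

lemma bij_betw_partition_insert:
 assumes "a \<notin> A" shows "bij_betw (\<lambda>(Q, B). insert (insert a B) (Q - {B})) (SIGMA Q : {Q. partition_on A Q}. insert {} Q)
   {P. partition_on (insert a A) P}"
proof (rule bij_betwI[where g = "\<lambda>P. let C = (THE C. C \<in> P \<and> a \<in> C) in (insert (C - {a}) (P - {C}) - {{}}, C - {a})"])
 let ?F = "\<lambda>(Q, B). insert (insert a B) (Q - {B})"
 have the: "(THE C. C \<in> P \<and> a \<in> C) = C" if "disjoint P" "C \<in> P" "a \<in> C" for P C
  using that by (intro the_equality) (auto simp: disjoint_def)
 have F: "partition_on (insert a A) (insert (insert a B) (Q - {B}))" if Q: "partition_on A Q" and B: "B \<in> insert {} Q" for Q B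
 proof (rule partition_onI)
  have UQ: "\<Union>Q = A" and neQ: "{} \<notin> Q" using Q by (simp_all add: partition_on_def)
  have dQ: "disjnt C D" if "C \<in> Q" "D \<in> Q" "C \<noteq> D" for C D using Q that by (auto simp: partition_on_def pairwise_def)
  show "\<Union>(insert (insert a B) (Q - {B})) = insert a A" using B unfolding UQ[symmetric] by blast
  show "{} \<notin> insert (insert a B) (Q - {B})" using neQ by blast
  have aC: "a \<notin> C" if "C \<in> Q" for C using that UQ assms by blast
  have dB: "disjnt (insert a B) C" if "C \<in> Q - {B}" for C using that aC[of C] B dQ[of B C] by (auto simp: disjnt_def)
  fix C D assume CD: "C \<in> insert (insert a B) (Q - {B})" "D \<in> insert (insert a B) (Q - {B})" "C \<noteq> D"
  then consider "C = insert a B" "D \<in> Q - {B}" | "D = insert a B" "C \<in> Q - {B}" | "C \<in> Q" "D \<in> Q" by blast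
  thus "disjnt C D" using dB[of D] dB[of C] dQ[of C D] CD(3) by cases (auto simp: disjnt_sym)
 qed
 show "?F \<in> (SIGMA Q : {Q. partition_on A Q}. insert {} Q) \<rightarrow> {P. partition_on (insert a A) P}" using F by auto
 show "(\<lambda>P. let C = (THE C. C \<in> P \<and> a \<in> C) in (insert (C - {a}) (P - {C}) - {{}}, C - {a}))
  \<in> {P. partition_on (insert a A) P} \<rightarrow> (SIGMA Q : {Q. partition_on A Q}. insert {} Q)"
 proof
  fix P assume "P \<in> {P. partition_on (insert a A) P}"
  hence P: "\<Union>P = insert a A" "disjoint P" "{} \<notin> P" by (auto simp: partition_on_def)
  then obtain C where C: "C \<in> P" "a \<in> C" by blast
  have dP: "D \<inter> D' = {}" if "D \<in> P" "D' \<in> P" "D \<noteq> D'" for D D' using P(2) that by (auto simp: disjoint_def)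
  have "partition_on A (insert (C - {a}) (P - {C}) - {{}})" proof (rule partition_onI)
   have "x \<in> \<Union>(insert (C - {a}) (P - {C}) - {{}}) \<longleftrightarrow> x \<in> A" for x proof
    assume "x \<in> \<Union>(insert (C - {a}) (P - {C}) - {{}})"
    then consider "x \<in> C - {a}" | D where "D \<in> P" "D \<noteq> C" "x \<in> D" by blast
    thus "x \<in> A" proof cases
     case 1
     thus ?thesis using C(1) P(1) by blast
    next
     case 2
     hence "x \<noteq> a" using dP[OF 2(1) C(1) 2(2)] C(2) by blast
     thus ?thesis using 2 P(1) by blast
    qed
   next
    assume x: "x \<in> A"
    then obtain D where D: "D \<in> P" "x \<in> D" using P(1) by blast
    have "x \<noteq> a" using x assms by blast
    thus "x \<in> \<Union>(insert (C - {a}) (P - {C}) - {{}})" using D by blast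
   qed
   from Set.set_eqI[OF this] show "\<Union>(insert (C - {a}) (P - {C}) - {{}}) = A" .
   fix D D' assume "D \<in> insert (C - {a}) (P - {C}) - {{}}" "D' \<in> insert (C - {a}) (P - {C}) - {{}}" "D \<noteq> D'"
   then consider "D = C - {a}" "D' \<in> P" "D' \<noteq> C" | "D' = C - {a}" "D \<in> P" "D \<noteq> C" | "D \<in> P" "D' \<in> P" by blast
   thus "disjnt D D'" using \<open>D \<noteq> D'\<close> dP[OF C(1), of D'] dP[OF C(1), of D] dP[of D D']
    unfolding disjnt_def by cases blast+
  qed simp
  moreover have "C - {a} \<in> insert {} (insert (C - {a}) (P - {C}) - {{}})" by blast
  ultimately show "(let C = (THE C. C \<in> P \<and> a \<in> C) in (insert (C - {a}) (P - {C}) - {{}}, C - {a}))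
    \<in> (SIGMA Q : {Q. partition_on A Q}. insert {} Q)" unfolding the[OF P(2) C] Let_def by blast
 qed
 show "(let C = (THE C. C \<in> ?F z \<and> a \<in> C) in (insert (C - {a}) (?F z - {C}) - {{}}, C - {a})) = z"
  if z: "z \<in> (SIGMA Q : {Q. partition_on A Q}. insert {} Q)" for z
 proof -
  obtain Q B where QB: "z = (Q, B)" "partition_on A Q" "B \<in> insert {} Q" using z by blast
  have UQ: "\<Union>Q = A" and neQ: "{} \<notin> Q" using QB(2) by (simp_all add: partition_on_def)
  have aC: "a \<notin> C" if "C \<in> Q" for C using that UQ assms by blast
  have aB: "a \<notin> B" using QB(3) aC by blast
  have "disjoint (insert (insert a B) (Q - {B}))" using F[OF QB(2,3)] by (simp add: partition_on_def)
  hence C: "(THE C. C \<in> insert (insert a B) (Q - {B}) \<and> a \<in> C) = insert a B" by (rule the) simp_all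
  have 1: "insert a B - {a} = B" using aB by blast
  have "insert a B \<notin> Q" using aC by blast
  hence 2: "insert (insert a B) (Q - {B}) - {insert a B} = Q - {B}" by blast
  have "insert B (Q - {B}) - {{}} = Q" proof (cases "B = {}")
   case True
   thus ?thesis using neQ by simp
  next
   case False
   hence "B \<in> Q" using QB(3) by simp
   hence "insert B (Q - {B}) = Q" by (rule insert_Diff)
   thus ?thesis using neQ by simp
  qed
  hence "insert B (insert (insert a B) (Q - {B}) - {insert a B}) - {{}} = Q" unfolding 2 .
  thus ?thesis unfolding QB(1) prod.case C Let_def 1 by simp
 qed
 show "?F (let C = (THE C. C \<in> P \<and> a \<in> C) in (insert (C - {a}) (P - {C}) - {{}}, C - {a})) = P"
  if "P \<in> {P. partition_on (insert a A) P}" for P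
 proof -
  have P: "\<Union>P = insert a A" "disjoint P" "{} \<notin> P" using that by (auto simp: partition_on_def)
  then obtain C where C: "C \<in> P" "a \<in> C" by blast
  have dP: "D \<inter> D' = {}" if "D \<in> P" "D' \<in> P" "D \<noteq> D'" for D D' using P(2) that by (auto simp: disjoint_def)
  have i: "insert a (C - {a}) = C" using C(2) by blast
  define X where "X = C - {a}"
  have X: "X \<notin> P - {C} \<or> X = {}" proof (cases "X \<in> P - {C}")
   case True
   hence "C \<inter> X = {}" by (intro dP[OF C(1)]) auto
   thus ?thesis unfolding X_def by blast
  qed simp
  have ne: "{} \<notin> P - {C}" using P(3) by simp
  have "insert X (P - {C}) - {{}} - {X} = P - {C}" using X proof
   assume "X \<notin> P - {C}"
   thus ?thesis using ne by auto
  next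
   assume "X = {}"
   thus ?thesis using ne by auto
  qed
  thus ?thesis unfolding the[OF P(2) C] Let_def prod.case X_def[symmetric] i[folded X_def] using insert_Diff[OF C(1)] by simp
 qed
qed

lemma finite_partitions: "finite A ==> finite {P. partition_on A P}"
 by (rule finite_subset[of _ "Pow (Pow A)"]) (auto simp: partition_on_def)

lemma finite_partition: "finite A ==> partition_on A P ==> finite P"
 by (rule finite_elements)

text \<open>A sum of Moebius values \<mu>(P, 1) over the partitions keeping T together. For a
  outside T, a partition of the other points with k blocks extends in k ways with k blocks and in
  one way with k + 1 blocks, and these weights cancel.\<close>

lemma sum_moebius_refining:
 assumes "finite A" "T \<subset> A" "T \<noteq> {}"
 shows "(\<Sum>P | partition_on A P. (- 1) ^ (card P - 1) * fact (card P - 1) * of_bool (\<exists>B\<in>P. T \<subseteq> B)) = (0 :: complex)"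
proof -
 obtain a where a: "a \<in> A" "a \<notin> T" using assms(2) by blast
 define A' where "A' = A - {a}"
 have A: "A = insert a A'" "a \<notin> A'" "finite A'" "T \<subseteq> A'" using a assms(1,2) by (auto simp: A'_def)
 let ?m = "\<lambda>n. (- 1) ^ (n - 1) * fact (n - 1) :: complex"
 let ?g = "\<lambda>P. ?m (card P) * of_bool (\<exists>B\<in>P. T \<subseteq> B)"
 let ?F = "\<lambda>Q B. insert (insert a B) (Q - {B})"
 have "sum ?g {P. partition_on A P} = (\<Sum>z\<in>(SIGMA Q : {Q. partition_on A' Q}. insert {} Q). ?g (case z of (Q, B) => ?F Q B))"
  unfolding A(1) by (rule sum.reindex_bij_betw[OF bij_betw_partition_insert[OF A(2)], symmetric])
 also have "... = (\<Sum>(Q, B)\<in>(SIGMA Q : {Q. partition_on A' Q}. insert {} Q). ?g (?F Q B))"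
  by (intro sum.cong refl) (simp only: case_prod_beta)
 also have "... = (\<Sum>Q | partition_on A' Q. \<Sum>B\<in>insert {} Q. ?g (?F Q B))" proof (rule sum.Sigma[symmetric])
  show "\<forall>Q\<in>{Q. partition_on A' Q}. finite (insert {} Q)" using finite_partition[OF A(3)] by simp
 qed (rule finite_partitions[OF A(3)])
 also have "... = 0" proof (rule sum.neutral, rule ballI)
  fix Q assume "Q \<in> {Q. partition_on A' Q}"
  hence Q: "partition_on A' Q" by simp
  have UQ: "\<Union>Q = A'" and neQ: "{} \<notin> Q" using Q by (simp_all add: partition_on_def)
  have fQ: "finite Q" using finite_partition[OF A(3) Q] .
  have aC: "a \<notin> C" if "C \<in> Q" for C using that UQ A(2) by blast
  have "Q \<noteq> {}" using UQ A(4) assms(3) by blast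
  hence k: "card Q > 0" using fQ by (simp add: card_gt_0_iff)
  have iff: "(\<exists>C\<in>?F Q B. T \<subseteq> C) \<longleftrightarrow> (\<exists>C\<in>Q. T \<subseteq> C)" if "B \<in> insert {} Q" for B
  proof -
   have T: "T \<subseteq> insert a B \<longleftrightarrow> T \<subseteq> B" using a(2) by blast
   have e: "(\<exists>C\<in>?F Q B. T \<subseteq> C) \<longleftrightarrow> T \<subseteq> B \<or> (\<exists>C\<in>Q - {B}. T \<subseteq> C)" unfolding T[symmetric] by simp
   show ?thesis proof (cases "B = {}")
    case True
    hence "\<not> T \<subseteq> B" using assms(3) by simp
    moreover have "Q - {B} = Q" using neQ True by simp
    ultimately show ?thesis unfolding e by simp
   next
    case False
    hence "B \<in> Q" using that by simp
    thus ?thesis unfolding e by blast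
   qed
  qed
  have nin: "insert a B \<notin> Q - {B}" for B using aC by blast
  have c0: "card (?F Q {}) = Suc (card Q)" using neQ nin[of "{}"] fQ by simp
  have c1: "card (?F Q B) = card Q" if "B \<in> Q" for B using card_Suc_Diff1[OF fQ that] nin[of B] fQ by simp
  let ?t = "of_bool (\<exists>B\<in>Q. T \<subseteq> B) :: complex"
  have "(\<Sum>B\<in>insert {} Q. ?g (?F Q B)) = (\<Sum>B\<in>insert {} Q. ?m (card (?F Q B)) * ?t)"
   by (intro sum.cong refl) (simp only: iff)
  also have "... = ?m (card (?F Q {})) * ?t + (\<Sum>B\<in>Q. ?m (card (?F Q B)) * ?t)" by (rule sum.insert[OF fQ neQ])
  also have "... = ?m (Suc (card Q)) * ?t + (\<Sum>B\<in>Q. ?m (card Q) * ?t)" unfolding c0 by (simp only: c1 cong: sum.cong)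
  also have "... = (?m (Suc (card Q)) + of_nat (card Q) * ?m (card Q)) * ?t" by (simp add: algebra_simps)
  also have "?m (Suc (card Q)) + of_nat (card Q) * ?m (card Q) = 0" proof -
   obtain n where n: "card Q = Suc n" using k by (cases "card Q") auto
   show ?thesis unfolding n by (simp add: algebra_simps)
  qed
  finally show "(\<Sum>B\<in>insert {} Q. ?g (?F Q B)) = 0" by simp
 qed
 finally show ?thesis .
qed

text \<open>The Leibniz rule, by telescoping one factor at a time; c is a common scale.\<close>

lemma scaled_prod_diff_tendsto:
 fixes c :: "'n => complex"
 assumes "finite P" and "\<And>b. b \<in> P ==> ((\<lambda>n. c n * (u b n - v b n)) \<longlongrightarrow> w b) F"
  and "\<And>b. b \<in> P ==> (u b \<longlongrightarrow> U b) F" "\<And>b. b \<in> P ==> (v b \<longlongrightarrow> U b) F"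
 shows "((\<lambda>n. c n * ((\<Prod>b\<in>P. u b n) - (\<Prod>b\<in>P. v b n))) \<longlongrightarrow> (\<Sum>b\<in>P. w b * (\<Prod>b'\<in>P - {b}. U b'))) F"
 using assms
proof (induction P)
 case (insert x P)
 have e: "c n * ((\<Prod>b\<in>insert x P. u b n) - (\<Prod>b\<in>insert x P. v b n))
   = c n * (u x n - v x n) * (\<Prod>b\<in>P. u b n) + v x n * (c n * ((\<Prod>b\<in>P. u b n) - (\<Prod>b\<in>P. v b n)))" for n
  using insert.hyps by (simp add: algebra_simps)
 have ih: "((\<lambda>n. c n * ((\<Prod>b\<in>P. u b n) - (\<Prod>b\<in>P. v b n))) \<longlongrightarrow> (\<Sum>b\<in>P. w b * (\<Prod>b'\<in>P - {b}. U b'))) F"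
  by (rule insert.IH) (use insert.prems in simp_all)
 have "((\<lambda>n. c n * (u x n - v x n) * (\<Prod>b\<in>P. u b n) + v x n * (c n * ((\<Prod>b\<in>P. u b n) - (\<Prod>b\<in>P. v b n))))
   \<longlongrightarrow> w x * (\<Prod>b\<in>P. U b) + U x * (\<Sum>b\<in>P. w b * (\<Prod>b'\<in>P - {b}. U b'))) F"
  by (intro tendsto_add tendsto_mult tendsto_prod ih insert.prems) simp_all
 moreover have "w x * (\<Prod>b\<in>P. U b) + U x * (\<Sum>b\<in>P. w b * (\<Prod>b'\<in>P - {b}. U b'))
   = (\<Sum>b\<in>insert x P. w b * (\<Prod>b'\<in>insert x P - {b}. U b'))"
 proof -
  have "insert x P - {x} = P" using insert.hyps by blast
  moreover have "(\<Prod>b'\<in>insert x P - {b}. U b') = U x * (\<Prod>b'\<in>P - {b}. U b')" if "b \<in> P" for b proof -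
   have "insert x P - {b} = insert x (P - {b})" using insert.hyps that by blast
   thus ?thesis using insert.hyps by simp
  qed
  hence "(\<Sum>b\<in>P. w b * (\<Prod>b'\<in>insert x P - {b}. U b')) = (\<Sum>b\<in>P. U x * (w b * (\<Prod>b'\<in>P - {b}. U b')))"
   by (intro sum.cong refl) simp
  ultimately show ?thesis using insert.hyps by (simp add: sum_distrib_left)
 qed
 ultimately show ?case unfolding e by simp
qed simp

section \<open>Corrections to a product of means by a single covariance\<close>

definition pairs_in :: "'i set => 'i set set" where
 "pairs_in B = {T. T \<subseteq> B \<and> card T = 2}"

lemma finite_pairs_in: "finite B ==> finite (pairs_in B)"
 by (rule finite_subset[of _ "Pow B"]) (auto simp: pairs_in_def)

text \<open>The leading correction to a product of means: one pair T of factors is replaced by its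
  limiting covariance q T, the other factors by their limits E.\<close>

definition pterm :: "('i set => complex) => ('i => complex) => 'i set => complex" where
 "pterm q E B = (\<Sum>T\<in>pairs_in B. q T * (\<Prod>i\<in>B - T. E i))"

text \<open>Indicators put the corrections of different subsets over one set of pairs, so that they
  can be added coefficient by coefficient.\<close>

lemma pair_term_mult:
 assumes "finite Y" "X \<subseteq> Y"
 shows "pterm q E X * (\<Prod>i\<in>Y - X. E i) = (\<Sum>T\<in>pairs_in Y. of_bool (T \<subseteq> X) * (q T * (\<Prod>i\<in>Y - T. E i)))"
proof -
 have fX: "finite X" using assms finite_subset by blast
 have "pterm q E X * (\<Prod>i\<in>Y - X. E i) = (\<Sum>T\<in>pairs_in X. q T * (\<Prod>i\<in>Y - T. E i))"
  unfolding pterm_def sum_distrib_right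
 proof (intro sum.cong refl)
  fix T assume "T \<in> pairs_in X"
  hence T: "T \<subseteq> X" by (simp add: pairs_in_def)
  have "Y - T = (X - T) \<union> (Y - X)" "(X - T) \<inter> (Y - X) = {}" using T assms(2) by blast+
  hence "(\<Prod>i\<in>Y - T. E i) = (\<Prod>i\<in>X - T. E i) * (\<Prod>i\<in>Y - X. E i)"
   using fX assms(1) by (simp add: prod.union_disjoint)
  thus "q T * (\<Prod>i\<in>X - T. E i) * (\<Prod>i\<in>Y - X. E i) = q T * (\<Prod>i\<in>Y - T. E i)" by simp
 qed
 also have "... = (\<Sum>T\<in>pairs_in X. of_bool (T \<subseteq> X) * (q T * (\<Prod>i\<in>Y - T. E i)))"
  by (intro sum.cong refl) (simp add: pairs_in_def)
 also have "... = (\<Sum>T\<in>pairs_in Y. of_bool (T \<subseteq> X) * (q T * (\<Prod>i\<in>Y - T. E i)))"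
  by (rule sum.mono_neutral_left[OF finite_pairs_in[OF assms(1)]]) (use assms(2) in \<open>auto simp: pairs_in_def\<close>)
 finally show ?thesis .
qed

text \<open>After exchanging sums, the coefficient of a pair T is the sum of
  \<open>sum_moebius_refining\<close>. It vanishes unless T is all of B, where only the one-block
  partition remains.\<close>

lemma sum_partition_pair_terms:
 assumes "finite B" "card B \<ge> 2"
 shows "(\<Sum>P | partition_on B P. (- 1) ^ (card P - 1) * fact (card P - 1) * (\<Sum>b\<in>P. pterm q E b * (\<Prod>i\<in>B - b. E i)))
  = (if card B = 2 then q B else 0)"
proof -
 let ?m = "\<lambda>P. (- 1) ^ (card P - 1) * fact (card P - 1) :: complex"
 let ?z = "\<lambda>T. q T * (\<Prod>i\<in>B - T. E i)"
 have inner: "(\<Sum>b\<in>P. pterm q E b * (\<Prod>i\<in>B - b. E i)) = (\<Sum>T\<in>pairs_in B. of_bool (\<exists>b\<in>P. T \<subseteq> b) * ?z T)"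
  if P: "partition_on B P" for P
 proof -
  have fP: "finite P" using finite_partition[OF assms(1) P] .
  have sub: "b \<subseteq> B" if "b \<in> P" for b using P that by (auto simp: partition_on_def)
  have "(\<Sum>b\<in>P. pterm q E b * (\<Prod>i\<in>B - b. E i)) = (\<Sum>b\<in>P. \<Sum>T\<in>pairs_in B. of_bool (T \<subseteq> b) * ?z T)"
   by (intro sum.cong refl pair_term_mult[OF assms(1) sub])
  also have "... = (\<Sum>T\<in>pairs_in B. \<Sum>b\<in>P. of_bool (T \<subseteq> b) * ?z T)" by (rule sum.swap)
  also have "... = (\<Sum>T\<in>pairs_in B. of_bool (\<exists>b\<in>P. T \<subseteq> b) * ?z T)" proof (intro sum.cong refl)
   fix T assume "T \<in> pairs_in B"
   hence "T \<noteq> {}" by (auto simp: pairs_in_def)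
   have uniq: "b = b'" if "b \<in> P" "b' \<in> P" "T \<subseteq> b" "T \<subseteq> b'" for b b' proof (rule ccontr)
    assume "b \<noteq> b'"
    hence "b \<inter> b' = {}" using P that(1,2) by (auto simp: partition_on_def disjoint_def)
    thus False using that(3,4) \<open>T \<noteq> {}\<close> by blast
   qed
   have "(\<Sum>b\<in>P. of_bool (T \<subseteq> b)) = (of_bool (\<exists>b\<in>P. T \<subseteq> b) :: complex)"
   proof (cases "\<exists>b\<in>P. T \<subseteq> b")
    case True
    then obtain b where b: "b \<in> P" "T \<subseteq> b" by blast
    have "(\<Sum>b'\<in>P. of_bool (T \<subseteq> b')) = (\<Sum>b'\<in>P. if b' = b then 1 else (0 :: complex))"
     by (intro sum.cong refl) (use b uniq in auto)
    thus ?thesis using True fP b(1) by simp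
   qed auto
   thus "(\<Sum>b\<in>P. of_bool (T \<subseteq> b) * ?z T) = of_bool (\<exists>b\<in>P. T \<subseteq> b) * ?z T"
    by (simp only: sum_distrib_right[symmetric])
  qed
  finally show ?thesis .
 qed
 have "(\<Sum>P | partition_on B P. ?m P * (\<Sum>b\<in>P. pterm q E b * (\<Prod>i\<in>B - b. E i)))
  = (\<Sum>P | partition_on B P. \<Sum>T\<in>pairs_in B. ?m P * of_bool (\<exists>b\<in>P. T \<subseteq> b) * ?z T)"
  by (intro sum.cong refl) (simp add: inner sum_distrib_left mult.assoc)
 also have "... = (\<Sum>T\<in>pairs_in B. (\<Sum>P | partition_on B P. ?m P * of_bool (\<exists>b\<in>P. T \<subseteq> b)) * ?z T)"
  unfolding sum_distrib_right by (rule sum.swap)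
 also have "... = (\<Sum>T\<in>pairs_in B. if T = B then q B else 0)" proof (intro sum.cong refl)
  fix T assume T: "T \<in> pairs_in B"
  hence sub: "T \<subseteq> B" and ne: "T \<noteq> {}" by (auto simp: pairs_in_def)
  show "(\<Sum>P | partition_on B P. ?m P * of_bool (\<exists>b\<in>P. T \<subseteq> b)) * ?z T = (if T = B then q B else 0)"
  proof (cases "T = B")
   case True
   have "B \<noteq> {}" using ne True by simp
   have "(\<exists>b\<in>P. B \<subseteq> b) \<longleftrightarrow> P = {B}" if P: "partition_on B P" for P proof
    assume "\<exists>b\<in>P. B \<subseteq> b"
    then obtain b where b: "b \<in> P" "B \<subseteq> b" by blast
    hence "b = B" using P by (auto simp: partition_on_def)
    have "b' = B" if "b' \<in> P" for b' proof (rule ccontr)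
     assume "b' \<noteq> B"
     hence "b' \<inter> B = {}" using P that b(1) \<open>b = B\<close> by (auto simp: partition_on_def disjoint_def)
     moreover have "b' \<subseteq> B" "b' \<noteq> {}" using P that by (auto simp: partition_on_def)
     ultimately show False by blast
    qed
    thus "P = {B}" using b(1) \<open>b = B\<close> by blast
   qed blast
   hence "(\<Sum>P | partition_on B P. ?m P * of_bool (\<exists>b\<in>P. T \<subseteq> b)) = (\<Sum>P | partition_on B P. if P = {B} then 1 else 0)"
    unfolding True by (intro sum.cong refl) auto
   also have "... = 1" using finite_partitions[OF assms(1)] partition_on_space[OF \<open>B \<noteq> {}\<close>] by simp
   finally show ?thesis using True by simp
  next
   case False
   hence "T \<subset> B" using sub by blast
   thus ?thesis using sum_moebius_refining[OF assms(1) _ ne] False by simp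
  qed
 qed
 also have "... = (if card B = 2 then q B else 0)" using finite_pairs_in[OF assms(1)] by (auto simp: pairs_in_def)
 finally show ?thesis .
qed

text \<open>At scale c only covariances survive. In the cumulant of B the one-block partition
  isolates the moment of B; the other partitions have smaller blocks, to which the induction
  hypothesis and the Leibniz rule apply, and their Moebius sum is again a pair correction.\<close>

theorem moment_expansion:
 fixes m :: "'n => 'i set => complex" and c :: "'n => complex"
 assumes fin: "finite A"
  and c0: "((\<lambda>n. inverse (c n)) \<longlongrightarrow> 0) F" and cne: "eventually (\<lambda>n. c n \<noteq> 0) F"
  and m0: "eventually (\<lambda>n. m n {} = 1) F"
  and H1: "\<And>i. i \<in> A ==> ((\<lambda>n. m n {i}) \<longlongrightarrow> E i) F"
  and H2: "\<And>T. T \<subseteq> A ==> card T = 2 ==> ((\<lambda>n. c n * set_cumulant T (m n)) \<longlongrightarrow> q T) F"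
  and H3: "\<And>T. T \<subseteq> A ==> card T > 2 ==> ((\<lambda>n. c n * set_cumulant T (m n)) \<longlongrightarrow> 0) F"
  and BA: "B \<subseteq> A" shows "((\<lambda>n. c n * (m n B - (\<Prod>i\<in>B. m n {i}))) \<longlongrightarrow> pterm q E B) F"
 using BA
proof (induction "card B" arbitrary: B rule: less_induct)
 case less
 have fB: "finite B" using fin less.prems finite_subset by blast
 have limE: "((\<lambda>n. \<Prod>i\<in>b. m n {i}) \<longlongrightarrow> (\<Prod>i\<in>b. E i)) F" if "b \<subseteq> B" for b
  by (intro tendsto_prod H1) (use that less.prems in blast)
 show ?case proof (cases "card B \<ge> 2")
  \<comment> \<open>A set with at most one element contains no pair, so the limit must be 0; for the
    empty set this is the normalisation of the moments.\<close>
  case False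
  then consider "B = {}" | x where "B = {x}" using fB by (metis One_nat_def card_0_eq card_1_singletonE less_2_cases not_less)
  thus ?thesis proof cases
   case 1
   have p: "pairs_in ({} :: 'i set) = {}" by (auto simp: pairs_in_def)
   have "eventually (\<lambda>n. c n * (m n B - (\<Prod>i\<in>B. m n {i})) = 0) F" using m0 by eventually_elim (simp add: 1)
   thus ?thesis unfolding 1 pterm_def p by (simp add: tendsto_eventually)
  next
   case 2
   have "T \<notin> pairs_in {x}" for T proof
    assume "T \<in> pairs_in {x}"
    hence "T \<subseteq> {x}" "card T = 2" by (auto simp: pairs_in_def)
    thus False using card_mono[of "{x}" T] by simp
   qed
   hence p: "pairs_in {x} = {}" by blast
   show ?thesis unfolding 2 pterm_def p by simp
  qed
 next
  case True
  hence ne: "B \<noteq> {}" by auto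
  let ?Q = "{P. partition_on B P}" and ?m = "\<lambda>P. (- 1) ^ (card P - 1) * fact (card P - 1) :: complex"
  let ?e = "\<lambda>n b. \<Prod>i\<in>b. m n {i}"
  let ?l = "\<lambda>P. \<Sum>b\<in>P. pterm q E b * (\<Prod>i\<in>B - b. E i)"
  have finQ: "finite ?Q" by (rule finite_partitions[OF fB])
  have topQ: "{B} \<in> ?Q" using partition_on_space[OF ne] by simp
  have small: "card b < card B" "b \<subseteq> B" if P: "P \<in> ?Q - {{B}}" and b: "b \<in> P" for P b proof -
   show sub: "b \<subseteq> B" using P b by (auto simp: partition_on_def)
   have "b \<noteq> B" proof
    assume "b = B"
    have "b' = B" if "b' \<in> P" for b' proof (rule ccontr)
     assume "b' \<noteq> B"
     hence "b' \<inter> B = {}" using P that b \<open>b = B\<close> by (auto simp: partition_on_def disjoint_def)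
     moreover have "b' \<subseteq> B" "b' \<noteq> {}" using P that by (auto simp: partition_on_def)
     ultimately show False by blast
    qed
    thus False using P b \<open>b = B\<close> by blast
   qed
   thus "card b < card B" using psubset_card_mono[OF fB] sub by blast
  qed
  have eprod: "(\<Prod>b\<in>P. ?e n b) = ?e n B" and Eprod: "(\<Prod>b'\<in>P - {b}. \<Prod>i\<in>b'. E i) = (\<Prod>i\<in>B - b. E i)"
   if P: "P \<in> ?Q" and b: "b \<in> P" for P n b
  proof -
   have part: "partition_on B P" using P by simp
   have fb: "finite b'" if "b' \<in> P" for b' proof -
    have "b' \<subseteq> B" using that part by (auto simp: partition_on_def)
    thus ?thesis using fB by (rule finite_subset)
   qed
   have d: "b1 \<inter> b2 = {}" if "b1 \<in> P" "b2 \<in> P" "b1 \<noteq> b2" for b1 b2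
    using that part by (auto simp: partition_on_def disjoint_def)
   have U: "\<Union>P = B" using part by (simp add: partition_on_def)
   show "(\<Prod>b\<in>P. ?e n b) = ?e n B" unfolding U[symmetric] using fb d by (subst prod.Union_disjoint) auto
   have "\<Union>(P - {b}) = B - b" using d b unfolding U[symmetric] by blast
   moreover have "prod E (\<Union>(P - {b})) = (\<Prod>b'\<in>P - {b}. \<Prod>i\<in>b'. E i)"
    using fb d by (subst prod.Union_disjoint) auto
   ultimately show "(\<Prod>b'\<in>P - {b}. \<Prod>i\<in>b'. E i) = (\<Prod>i\<in>B - b. E i)" by simp
  qed
  have nonempty: "\<exists>b. b \<in> P" if "P \<in> ?Q" for P using that ne by (auto simp: partition_on_def)
  \<comment> \<open>A product of means has zero cumulant on two or more factors, because the Moebius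
    weights sum to zero. This is the case of a singleton T, which every partition keeps
    together.\<close>
  have ez: "(\<Sum>P\<in>?Q. ?m P * (\<Prod>b\<in>P. ?e n b)) = 0" for n proof -
   obtain x where x: "x \<in> B" using ne by blast
   have "{x} \<subset> B" using x True by (metis card.empty card_insert_disjoint empty_iff finite.emptyI insert_subset empty_subsetI not_less_eq_eq numeral_2_eq_2 psubsetI le_refl)
   hence "(\<Sum>P\<in>?Q. ?m P * of_bool (\<exists>b\<in>P. {x} \<subseteq> b)) = 0" by (intro sum_moebius_refining[OF fB]) simp_all
   moreover have "(\<exists>b\<in>P. {x} \<subseteq> b)" if "P \<in> ?Q" for P using that x by (auto simp: partition_on_def)
   hence "(\<Sum>P\<in>?Q. ?m P * of_bool (\<exists>b\<in>P. {x} \<subseteq> b)) = (\<Sum>P\<in>?Q. ?m P)" by (intro sum.cong refl) simp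
   ultimately have "(\<Sum>P\<in>?Q. ?m P) = 0" by simp
   moreover have "(\<Prod>b\<in>P. ?e n b) = ?e n B" if "P \<in> ?Q" for P using nonempty[OF that] eprod[OF that] by blast
   hence "(\<Sum>P\<in>?Q. ?m P * (\<Prod>b\<in>P. ?e n b)) = (\<Sum>P\<in>?Q. ?m P) * ?e n B"
    unfolding sum_distrib_right by (intro sum.cong refl) simp
   ultimately show ?thesis by simp
  qed
  have lim: "((\<lambda>n. c n * ((\<Prod>b\<in>P. m n b) - (\<Prod>b\<in>P. ?e n b))) \<longlongrightarrow> ?l P) F" if P: "P \<in> ?Q - {{B}}" for P
  proof -
   have fP: "finite P" using P finite_partition[OF fB] by blast
   have 1: "((\<lambda>n. c n * (m n b - ?e n b)) \<longlongrightarrow> pterm q E b) F" if b: "b \<in> P" for b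
    using less.hyps[OF small(1)[OF P b]] small(2)[OF P b] less.prems by blast
   have 2: "((\<lambda>n. m n b) \<longlongrightarrow> (\<Prod>i\<in>b. E i)) F" if b: "b \<in> P" for b proof -
    have "((\<lambda>n. inverse (c n) * (c n * (m n b - ?e n b)) + ?e n b) \<longlongrightarrow> 0 * pterm q E b + (\<Prod>i\<in>b. E i)) F"
     by (intro tendsto_add tendsto_mult c0 1[OF b] limE small(2)[OF P b])
    moreover have "eventually (\<lambda>n. inverse (c n) * (c n * (m n b - ?e n b)) + ?e n b = m n b) F"
     using cne by eventually_elim (simp add: mult.assoc[symmetric])
    ultimately show ?thesis by (simp add: tendsto_cong)
   qed
   have "((\<lambda>n. c n * ((\<Prod>b\<in>P. m n b) - (\<Prod>b\<in>P. ?e n b))) \<longlongrightarrow>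
     (\<Sum>b\<in>P. pterm q E b * (\<Prod>b'\<in>P - {b}. \<Prod>i\<in>b'. E i))) F"
    by (rule scaled_prod_diff_tendsto[where u = "\<lambda>b n. m n b" and v = "\<lambda>b n. ?e n b", OF fP 1 2 limE[OF small(2)[OF P]]])
   moreover have "(\<Sum>b\<in>P. pterm q E b * (\<Prod>b'\<in>P - {b}. \<Prod>i\<in>b'. E i)) = ?l P"
    by (intro sum.cong refl) (use Eprod P in simp)
   ultimately show ?thesis by simp
  qed
  \<comment> \<open>Subtracting the vanishing cumulant of the means turns every product of moments
    into a difference to which the scale can be applied.\<close>
  have key: "c n * (m n B - ?e n B) = c n * set_cumulant B (m n)
    - (\<Sum>P\<in>?Q - {{B}}. ?m P * (c n * ((\<Prod>b\<in>P. m n b) - (\<Prod>b\<in>P. ?e n b))))" for n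
  proof -
   have "set_cumulant B (m n) = (\<Sum>P\<in>?Q. ?m P * ((\<Prod>b\<in>P. m n b) - (\<Prod>b\<in>P. ?e n b)))"
    unfolding right_diff_distrib sum_subtractf ez set_cumulant_def by simp
   also have "... = (m n B - ?e n B) + (\<Sum>P\<in>?Q - {{B}}. ?m P * ((\<Prod>b\<in>P. m n b) - (\<Prod>b\<in>P. ?e n b)))"
    by (subst sum.remove[OF finQ topQ]) simp
   finally have "set_cumulant B (m n) = (m n B - ?e n B) + (\<Sum>P\<in>?Q - {{B}}. ?m P * ((\<Prod>b\<in>P. m n b) - (\<Prod>b\<in>P. ?e n b)))" .
   moreover have "(\<Sum>P\<in>?Q - {{B}}. ?m P * (c n * ((\<Prod>b\<in>P. m n b) - (\<Prod>b\<in>P. ?e n b))))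
     = c n * (\<Sum>P\<in>?Q - {{B}}. ?m P * ((\<Prod>b\<in>P. m n b) - (\<Prod>b\<in>P. ?e n b)))"
    unfolding sum_distrib_left by (intro sum.cong refl) (simp only: mult.left_commute)
   ultimately show ?thesis by (simp add: ring_distribs)
  qed
  let ?k = "if card B = 2 then q B else 0"
  have k: "((\<lambda>n. c n * set_cumulant B (m n)) \<longlongrightarrow> ?k) F"
   using H2[OF less.prems] H3[OF less.prems] True by (cases "card B = 2") simp_all
  have "((\<lambda>n. c n * (m n B - ?e n B)) \<longlongrightarrow> ?k - (\<Sum>P\<in>?Q - {{B}}. ?m P * ?l P)) F"
   unfolding key by (intro tendsto_diff k tendsto_sum tendsto_mult tendsto_const lim)
  moreover have "?k = pterm q E B + (\<Sum>P\<in>?Q - {{B}}. ?m P * ?l P)" proof -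
   have "?k = (\<Sum>P\<in>?Q. ?m P * ?l P)" by (rule sum_partition_pair_terms[OF fB True, symmetric])
   also have "... = ?m {B} * ?l {B} + (\<Sum>P\<in>?Q - {{B}}. ?m P * ?l P)" by (rule sum.remove[OF finQ topQ])
   finally show ?thesis by simp
  qed
  ultimately show ?thesis by simp
 qed
qed

section \<open>Asymptotics of matrix cumulants\<close>

abbreviation eps :: "nat => complex" where
 "eps N \<equiv> inverse (of_nat N)"

abbreviation sq :: "nat => complex" where
 "sq N \<equiv> of_nat N ^ 2"

text \<open>What is used about matrices here: the inversion formula, bounded moments, covariances of
  order N^(-2) and third cumulants of smaller order than that. Disjoint preserved index sets play
  the role of separate faces.\<close>

locale cumulant_system =
 fixes F :: "nat filter" and A :: "int set"
  and E c :: "int set => (int => int) => nat => complex"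
 assumes index_set_A: "ix_set A" and inverse_tendsto: "(eps \<longlongrightarrow> 0) F"
  and eventually_pos: "eventually (\<lambda>N. 0 < N) F"
  and moment_eq: "I \<subseteq> A ==> eventually (\<lambda>N. \<forall>\<pi>\<in>PM I.
   E I \<pi> N = (\<Sum>\<rho>\<in>PM I. eps N ^ defect I \<pi> \<rho> * c I \<rho> N)) F"
  and moment_bdd: "I \<subseteq> A ==> \<pi> \<in> PM I ==> bdd F (E I \<pi>)"
  and cov_bdd: "I \<union> J \<subseteq> A ==> I \<inter> J = {} ==> \<pi> \<in> PM (I \<union> J) ==> sstable I \<pi> ==>
   bdd F (\<lambda>N. of_nat N ^ 2 * (E (I \<union> J) \<pi> N - E I (res I \<pi>) N * E J (res J \<pi>) N))"
  and third_tendsto: "I \<union> J \<union> K \<subseteq> A ==> I \<inter> J = {} ==> I \<inter> K = {} ==> J \<inter> K = {} ==> \<pi> \<in> PM (I \<union> J \<union> K) ==>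
   sstable I \<pi> ==> sstable J \<pi> ==>
   ((\<lambda>N. of_nat N ^ 2 * (E (I \<union> J \<union> K) \<pi> N
     - E (I \<union> J) (res (I \<union> J) \<pi>) N * E K (res K \<pi>) N
     - E (I \<union> K) (res (I \<union> K) \<pi>) N * E J (res J \<pi>) N
     - E (J \<union> K) (res (J \<union> K) \<pi>) N * E I (res I \<pi>) N
     + 2 * (E I (res I \<pi>) N * E J (res J \<pi>) N * E K (res K \<pi>) N))) \<longlongrightarrow> 0) F"


lemma (in cumulant_system) ix_A: "I \<subseteq> A ==> ix_set I"
 using index_set_A by (rule ix_subset)

lemma (in cumulant_system) weight_tendsto:
 "((\<lambda>N. eps N ^ d) \<longlongrightarrow> (0 :: complex) ^ d) F" by (intro tendsto_power inverse_tendsto)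

lemma (in cumulant_system) cumulant_bdd:
 assumes "I \<subseteq> A" "\<pi> \<in> PM I" shows "bdd F (c I \<pi>)"
proof -
 have "bdd F (\<lambda>N. \<Sum>s\<in>PM I. eps N ^ defect I r s * c I s N)" if "r \<in> PM I" for r
 proof (rule bdd_cong[OF _ moment_bdd[OF assms(1) that]])
  show "eventually (\<lambda>N. E I r N = (\<Sum>s\<in>PM I. eps N ^ defect I r s * c I s N)) F"
   using moment_eq[OF assms(1)] by eventually_elim (use that in blast)
 qed
 thus ?thesis by (rule perturbed_unitriangular_bdd[where a = "\<lambda>\<pi> r. 0 ^ defect I \<pi> r" and
    b = "\<lambda>N \<pi> r. eps N ^ defect I \<pi> r" and u = "\<lambda>N r. c I r N",
    OF unitriangular_defect[OF ix_A[OF assms(1)] subset_refl] weight_tendsto _ assms(2)])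
qed

lemma (in cumulant_system) scaled_weight:
 assumes "2 \<le> d" "0 < N" shows "of_nat N ^ 2 * eps N ^ d = (eps N ^ (d - 2) :: complex)"
proof -
 obtain k where "d = 2 + k" using assms(1) le_Suc_ex by blast
 thus ?thesis using assms(2) by (simp add: power_add power2_eq_square field_simps)
qed

text \<open>As the defect is additive, a product of two moments expands with the weights of the
  joint moment, over the premaps that preserve I.\<close>

lemma (in cumulant_system) moment_prod:
 assumes "I \<union> J \<subseteq> A" "I \<inter> J = {}"
 shows "eventually (\<lambda>N. \<forall>\<pi>\<in>PM (I \<union> J). sstable I \<pi> \<longrightarrow>
   E I (res I \<pi>) N * E J (res J \<pi>) N = (\<Sum>R | R \<in> PM (I \<union> J) \<and> sstable I R.
     eps N ^ defect (I \<union> J) \<pi> R * (c I (res I R) N * c J (res J R) N))) F"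
proof -
 have sub: "I \<subseteq> A" "J \<subseteq> A" using assms(1) by blast+
 have ix: "ix_set (I \<union> J)" using ix_A[OF assms(1)] .
 show ?thesis using moment_eq[OF sub(1)] moment_eq[OF sub(2)] proof eventually_elim
  case (elim N)
  show ?case proof (intro ballI impI)
   fix \<pi> assume \<pi>: "\<pi> \<in> PM (I \<union> J)" "sstable I \<pi>"
   have r: "res I \<pi> \<in> PM I" "res J \<pi> \<in> PM J"
    using res_PM[OF \<pi>(1) ix _ \<pi>(2)] res_PM[OF \<pi>(1) ix _ stable_other[OF \<pi>(1) ix assms(2) \<pi>(2)]] by blast+
   have "E I (res I \<pi>) N * E J (res J \<pi>) N = (\<Sum>R\<in>PM I. eps N ^ defect I (res I \<pi>) R * c I R N)
     * (\<Sum>s\<in>PM J. eps N ^ defect J (res J \<pi>) s * c J s N)" using bspec[OF elim(1) r(1)] bspec[OF elim(2) r(2)] by simp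
   also have "... = (\<Sum>R\<in>PM I. \<Sum>s\<in>PM J. (eps N ^ defect I (res I \<pi>) R * c I R N)
     * (eps N ^ defect J (res J \<pi>) s * c J s N))" by (rule sum_product)
   also have "... = (\<Sum>R | R \<in> PM (I \<union> J) \<and> sstable I R.
     (eps N ^ defect I (res I \<pi>) (res I R) * c I (res I R) N)
     * (eps N ^ defect J (res J \<pi>) (res J R) * c J (res J R) N))" by (rule sum_PM_prod[OF ix assms(2)])
   also have "... = (\<Sum>R | R \<in> PM (I \<union> J) \<and> sstable I R.
     eps N ^ defect (I \<union> J) \<pi> R * (c I (res I R) N * c J (res J R) N))"
   proof (intro sum.cong refl)
    fix R assume "R \<in> {R. R \<in> PM (I \<union> J) \<and> sstable I R}"
    hence R: "R \<in> PM (I \<union> J)" "sstable I R" by simp_all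
    show "(eps N ^ defect I (res I \<pi>) (res I R) * c I (res I R) N)
     * (eps N ^ defect J (res J \<pi>) (res J R) * c J (res J R) N)
     = eps N ^ defect (I \<union> J) \<pi> R * (c I (res I R) N * c J (res J R) N)"
     unfolding defect_Un[OF \<pi>(1) R(1) ix assms(2) \<pi>(2) R(2)] by (simp add: power_add mult_ac)
   qed
   finally show "E I (res I \<pi>) N * E J (res J \<pi>) N = (\<Sum>R | R \<in> PM (I \<union> J) \<and> sstable I R.
     eps N ^ defect (I \<union> J) \<pi> R * (c I (res I R) N * c J (res J R) N))" .
  qed
 qed
qed

definition (in cumulant_system) K2 :: "int set => int set => (int => int) => nat => complex" where
 "K2 I J \<pi> N = c (I \<union> J) \<pi> N - c I (res I \<pi>) N * c J (res J \<pi>) N"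

text \<open>Subtracting the expansions leaves \<open>K2\<close> on premaps preserving I. The other
  premaps join I and J and have defect at least 2, so the factor N^2 only lowers their
  exponent.\<close>

lemma (in cumulant_system) covariance_eq:
 assumes "I \<union> J \<subseteq> A" "I \<inter> J = {}"
 shows "eventually (\<lambda>N. \<forall>\<pi>\<in>PM (I \<union> J). sstable I \<pi> \<longrightarrow>
   of_nat N ^ 2 * (E (I \<union> J) \<pi> N - E I (res I \<pi>) N * E J (res J \<pi>) N) =
    (\<Sum>r | r \<in> PM (I \<union> J) \<and> sstable I r.
      eps N ^ defect (I \<union> J) \<pi> r * (of_nat N ^ 2 * K2 I J r N))
   + (\<Sum>r | r \<in> PM (I \<union> J) \<and> \<not> sstable I r.
      eps N ^ (defect (I \<union> J) \<pi> r - 2) * c (I \<union> J) r N)) F"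
 using moment_eq[OF assms(1)] moment_prod[OF assms] eventually_pos
proof eventually_elim
 case (elim N)
 have ix: "ix_set (I \<union> J)" using ix_A[OF assms(1)] .
 show ?case proof (intro ballI impI)
  fix \<pi> assume \<pi>: "\<pi> \<in> PM (I \<union> J)" "sstable I \<pi>"
  let ?T = "{r. r \<in> PM (I \<union> J) \<and> sstable I r}"
  let ?U = "{r. r \<in> PM (I \<union> J) \<and> \<not> sstable I r}"
  let ?w = "\<lambda>r. eps N ^ defect (I \<union> J) \<pi> r :: complex"
  have "PM (I \<union> J) = ?T \<union> ?U" "?T \<inter> ?U = {}" by blast+
  hence "(\<Sum>r\<in>PM (I \<union> J). ?w r * c (I \<union> J) r N) = (\<Sum>r\<in>?T. ?w r * c (I \<union> J) r N) + (\<Sum>r\<in>?U. ?w r * c (I \<union> J) r N)"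
   using finite_PM[OF ix] by (metis (no_types, lifting) finite_Un sum.union_disjoint)
  hence "E (I \<union> J) \<pi> N - E I (res I \<pi>) N * E J (res J \<pi>) N =
    (\<Sum>r\<in>?T. ?w r * K2 I J r N) + (\<Sum>r\<in>?U. ?w r * c (I \<union> J) r N)"
   using bspec[OF elim(1) \<pi>(1)] mp[OF bspec[OF elim(2) \<pi>(1)] \<pi>(2)] by (simp add: K2_def right_diff_distrib sum_subtractf)
  hence "of_nat N ^ 2 * (E (I \<union> J) \<pi> N - E I (res I \<pi>) N * E J (res J \<pi>) N) =
    (\<Sum>r\<in>?T. ?w r * (of_nat N ^ 2 * K2 I J r N)) + (\<Sum>r\<in>?U. of_nat N ^ 2 * ?w r * c (I \<union> J) r N)"
   by (simp add: distrib_left sum_distrib_left mult_ac)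
  moreover have "of_nat N ^ 2 * ?w r = eps N ^ (defect (I \<union> J) \<pi> r - 2)" if "r \<in> ?U" for r proof -
   have r: "r \<in> PM (I \<union> J)" "\<not> sstable I r" using that by simp_all
   have "2 \<le> defect (I \<union> J) \<pi> r" by (rule defect_joined[OF \<pi>(1) r(1) ix Un_upper1 Un_upper2 assms(2) \<pi>(2)
       stable_other[OF \<pi>(1) ix assms(2) \<pi>(2)] not_stable_joined[OF r]])
   thus ?thesis using elim(3) by (rule scaled_weight)
  qed
  ultimately show "of_nat N ^ 2 * (E (I \<union> J) \<pi> N - E I (res I \<pi>) N * E J (res J \<pi>) N) =
    (\<Sum>r\<in>?T. ?w r * (of_nat N ^ 2 * K2 I J r N))
   + (\<Sum>r\<in>?U. eps N ^ (defect (I \<union> J) \<pi> r - 2) * c (I \<union> J) r N)" by simp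
 qed
qed

text \<open>The terms joining I and J are bounded and go to the other side; the system restricted to
  premaps preserving I is still unitriangular.\<close>

lemma (in cumulant_system) K2_bdd:
 assumes "I \<union> J \<subseteq> A" "I \<inter> J = {}" "\<pi> \<in> PM (I \<union> J)" "sstable I \<pi>"
 shows "bdd F (\<lambda>N. of_nat N ^ 2 * K2 I J \<pi> N)" proof -
 let ?T = "{r. r \<in> PM (I \<union> J) \<and> sstable I r}"
 let ?U = "{r. r \<in> PM (I \<union> J) \<and> \<not> sstable I r}"
 have T: "?T \<subseteq> PM (I \<union> J)" by blast
 have "bdd F (\<lambda>N. \<Sum>s\<in>?T. eps N ^ defect (I \<union> J) r s * (of_nat N ^ 2 * K2 I J s N))" if r: "r \<in> ?T" for r
 proof (rule bdd_cong)
  let ?u = "\<lambda>N. \<Sum>s\<in>?U. eps N ^ (defect (I \<union> J) r s - 2) * c (I \<union> J) s N"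
  have "bdd F ?u" by (intro bdd_sum bdd_mult bdd_tendsto[OF weight_tendsto] cumulant_bdd[OF assms(1)]) simp
  thus "bdd F (\<lambda>N. of_nat N ^ 2 * (E (I \<union> J) r N - E I (res I r) N * E J (res J r) N) - ?u N)"
   using r by (intro bdd_diff cov_bdd[OF assms(1,2)]) simp_all
  show "eventually (\<lambda>N. of_nat N ^ 2 * (E (I \<union> J) r N - E I (res I r) N * E J (res J r) N) - ?u N =
    (\<Sum>s\<in>?T. eps N ^ defect (I \<union> J) r s * (of_nat N ^ 2 * K2 I J s N))) F" using covariance_eq[OF assms(1,2)]
  proof eventually_elim
   case (elim N)
   have "r \<in> PM (I \<union> J)" "sstable I r" using r by simp_all
   from mp[OF bspec[OF elim this(1)] this(2)] show ?case by simp
  qed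
 qed
 moreover have "\<pi> \<in> ?T" using assms(3,4) by simp
 ultimately show ?thesis by (rule perturbed_unitriangular_bdd[where a = "\<lambda>\<pi> r. 0 ^ defect (I \<union> J) \<pi> r" and
    b = "\<lambda>N \<pi> r. eps N ^ defect (I \<union> J) \<pi> r" and u = "\<lambda>N r. of_nat N ^ 2 * K2 I J r N",
    OF unitriangular_defect[OF ix_A[OF assms(1)] T] weight_tendsto])
qed

lemma (in cumulant_system) scaled_bdd_tendsto_zero:
 assumes "bdd F (\<lambda>N. of_nat N ^ 2 * f N)" shows "(f \<longlongrightarrow> 0) F"
proof -
 have "((\<lambda>N. eps N ^ 2 * (of_nat N ^ 2 * f N)) \<longlongrightarrow> 0) F"
  by (rule tendsto_zero_mult_bdd[OF _ assms]) (use weight_tendsto[of 2] in simp)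
 moreover have "eventually (\<lambda>N. eps N ^ 2 * (of_nat N ^ 2 * f N) = f N) F"
  using eventually_pos by eventually_elim (simp add: field_simps)
 ultimately show ?thesis by (rule Lim_transform_eventually)
qed

lemma (in cumulant_system) K2_tendsto_zero:
 assumes "I \<union> J \<subseteq> A" "I \<inter> J = {}" "\<pi> \<in> PM (I \<union> J)" "sstable I \<pi>"
 shows "((\<lambda>N. K2 I J \<pi> N) \<longlongrightarrow> 0) F" by (rule scaled_bdd_tendsto_zero[OF K2_bdd[OF assms]])

text \<open>The third cumulant of the family c, if I, J and K are preserved. For other premaps the
  indicators keep only the products that make sense; in this form the third-moment combination
  expands as one sum over all premaps of the union.\<close>

definition (in cumulant_system) K3 :: "int set => int set => int set => (int => int) => nat => complex" where
 "K3 I J K \<rho> N = c (I \<union> J \<union> K) \<rho> N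
   - of_bool (sstable K \<rho>) * (c (I \<union> J) (res (I \<union> J) \<rho>) N * c K (res K \<rho>) N)
   - of_bool (sstable J \<rho>) * (c (I \<union> K) (res (I \<union> K) \<rho>) N * c J (res J \<rho>) N)
   - of_bool (sstable I \<rho>) * (c (J \<union> K) (res (J \<union> K) \<rho>) N * c I (res I \<rho>) N)
   + of_bool (sstable I \<rho> \<and> sstable J \<rho>) *
    (2 * (c I (res I \<rho>) N * c J (res J \<rho>) N * c K (res K \<rho>) N))"

text \<open>The expansion over all premaps, with stability as an indicator, so that it can be
  combined termwise with the others in \<open>K3\<close>.\<close>

lemma (in cumulant_system) moment_prod':
 assumes "I \<union> J \<subseteq> A" "I \<inter> J = {}" "Z = I \<union> J"
 shows "eventually (\<lambda>N. \<forall>\<pi>\<in>PM Z. sstable J \<pi> \<longrightarrow>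
   E I (res I \<pi>) N * E J (res J \<pi>) N = (\<Sum>r\<in>PM Z.
     eps N ^ defect Z \<pi> r * (of_bool (sstable J r) * (c I (res I r) N * c J (res J r) N)))) F"
proof -
 have JI: "J \<union> I \<subseteq> A" "J \<inter> I = {}" "J \<union> I = Z" using assms by blast+
 have ix: "ix_set (I \<union> J)" using ix_A[OF assms(1)] .
 show ?thesis using moment_prod[OF JI(1,2)] unfolding JI(3) proof eventually_elim
  case (elim N)
  show ?case proof (intro ballI impI)
   fix \<pi> assume \<pi>: "\<pi> \<in> PM Z" "sstable J \<pi>"
   have "E I (res I \<pi>) N * E J (res J \<pi>) N = (\<Sum>r | r \<in> PM Z \<and> sstable J r.
     eps N ^ defect Z \<pi> r * (c J (res J r) N * c I (res I r) N))"
    using mp[OF bspec[OF elim \<pi>(1)] \<pi>(2)] by (simp add: mult.commute)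
   also have "... = (\<Sum>r | r \<in> PM Z \<and> sstable J r.
     eps N ^ defect Z \<pi> r * (of_bool (sstable J r) * (c I (res I r) N * c J (res J r) N)))"
    by (intro sum.cong refl) (simp add: mult.commute)
   also have "... = (\<Sum>r\<in>PM Z.
     eps N ^ defect Z \<pi> r * (of_bool (sstable J r) * (c I (res I r) N * c J (res J r) N)))"
    using ix unfolding assms(3) by (intro sum.mono_neutral_left finite_PM) auto
   finally show "E I (res I \<pi>) N * E J (res J \<pi>) N = (\<Sum>r\<in>PM Z.
     eps N ^ defect Z \<pi> r * (of_bool (sstable J r) * (c I (res I r) N * c J (res J r) N)))" .
  qed
 qed
qed

lemma stable_join:
 assumes "sstable I \<pi>" "sstable J \<pi>" shows "sstable (I \<union> J) \<pi>"
 using assms unfolding stable_def signed_set_Un by blast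

lemma (in cumulant_system) moment_prod3:
 assumes "I \<union> J \<union> K \<subseteq> A" "I \<inter> J = {}" "I \<inter> K = {}" "J \<inter> K = {}"
 shows "eventually (\<lambda>N. \<forall>\<pi>\<in>PM (I \<union> J \<union> K). sstable I \<pi> \<and> sstable J \<pi> \<longrightarrow>
   E I (res I \<pi>) N * E J (res J \<pi>) N * E K (res K \<pi>) N = (\<Sum>R\<in>PM (I \<union> J \<union> K).
     eps N ^ defect (I \<union> J \<union> K) \<pi> R * (of_bool (sstable I R \<and> sstable J R) *
     (c I (res I R) N * c J (res J R) N * c K (res K R) N)))) F"
proof -
 let ?Z = "I \<union> J \<union> K"
 have sub: "I \<union> J \<subseteq> A" "K \<subseteq> A" using assms(1) by blast+
 have ix: "ix_set ?Z" using ix_A[OF assms(1)] .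
 have d: "(I \<union> J) \<inter> K = {}" using assms by blast
 show ?thesis using moment_prod[OF sub(1) assms(2)] moment_eq[OF sub(2)] proof eventually_elim
  case (elim N)
  let ?x = "inverse (of_nat N) :: complex"
  show ?case proof (intro ballI impI)
   fix \<pi> assume \<pi>: "\<pi> \<in> PM ?Z" "sstable I \<pi> \<and> sstable J \<pi>"
   have sIJ: "sstable (I \<union> J) \<pi>" using \<pi>(2) stable_join by blast
   have r: "res (I \<union> J) \<pi> \<in> PM (I \<union> J)" "res K \<pi> \<in> PM K"
    using res_PM[OF \<pi>(1) ix _ sIJ] res_PM[OF \<pi>(1) ix _ stable_other[OF \<pi>(1) ix d sIJ]] by blast+
   have st: "sstable I (res (I \<union> J) \<pi>)" using \<pi>(2) stable_res[of I "I \<union> J" \<pi>] by simp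
   have rr: "res I (res (I \<union> J) y) = res I y" "res J (res (I \<union> J) y) = res J y" for y by (rule res_res, blast)+
   let ?f = "\<lambda>R s. (?x ^ defect (I \<union> J) (res (I \<union> J) \<pi>) R * (of_bool (sstable I R) * (c I (res I R) N * c J (res J R) N)))
     * (?x ^ defect K (res K \<pi>) s * c K s N)"
   have "E I (res I \<pi>) N * E J (res J \<pi>) N = (\<Sum>R | R \<in> PM (I \<union> J) \<and> sstable I R.
     ?x ^ defect (I \<union> J) (res (I \<union> J) \<pi>) R * (c I (res I R) N * c J (res J R) N))"
    using mp[OF bspec[OF elim(1) r(1)] st] unfolding rr .
   also have "... = (\<Sum>R | R \<in> PM (I \<union> J) \<and> sstable I R.
     ?x ^ defect (I \<union> J) (res (I \<union> J) \<pi>) R * (of_bool (sstable I R) * (c I (res I R) N * c J (res J R) N)))"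
    by (intro sum.cong refl) simp
   also have "... = (\<Sum>R\<in>PM (I \<union> J).
     ?x ^ defect (I \<union> J) (res (I \<union> J) \<pi>) R * (of_bool (sstable I R) * (c I (res I R) N * c J (res J R) N)))"
    using ix by (intro sum.mono_neutral_left finite_PM) auto
   finally have "E I (res I \<pi>) N * E J (res J \<pi>) N * E K (res K \<pi>) N = (\<Sum>R\<in>PM (I \<union> J). \<Sum>s\<in>PM K. ?f R s)"
    using bspec[OF elim(2) r(2)] by (simp only: sum_product)
   also have "... = (\<Sum>R | R \<in> PM ?Z \<and> sstable (I \<union> J) R. ?f (res (I \<union> J) R) (res K R))"
    by (rule sum_PM_prod[OF ix d])
   also have "... = (\<Sum>R | R \<in> PM ?Z \<and> sstable (I \<union> J) R.
     ?x ^ defect ?Z \<pi> R * (of_bool (sstable I R \<and> sstable J R) *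
     (c I (res I R) N * c J (res J R) N * c K (res K R) N)))"
   proof (intro sum.cong refl)
    fix R assume "R \<in> {R. R \<in> PM ?Z \<and> sstable (I \<union> J) R}"
    hence R: "R \<in> PM ?Z" "sstable (I \<union> J) R" by simp_all
    have rP: "res (I \<union> J) R \<in> PM (I \<union> J)" using res_PM[OF R(1) ix _ R(2)] by blast
    have iIJ: "ix_set (I \<union> J)" using ix by simp
    have s1: "sstable I (res (I \<union> J) R) = sstable I R" by (rule stable_res) blast
    have s2: "sstable J (res (I \<union> J) R) = sstable J R" by (rule stable_res) blast
    have "sstable I R \<longrightarrow> sstable J R" using stable_other[OF rP iIJ assms(2)] unfolding s1 s2 by blast
    hence "of_bool (sstable I R) = (of_bool (sstable I R \<and> sstable J R) :: complex)" by auto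
    thus "?f (res (I \<union> J) R) (res K R) = ?x ^ defect ?Z \<pi> R * (of_bool (sstable I R \<and> sstable J R) *
     (c I (res I R) N * c J (res J R) N * c K (res K R) N))"
     unfolding defect_Un[OF \<pi>(1) R(1) ix d sIJ R(2)] rr s1 by (simp add: power_add mult_ac)
   qed
   also have "... = (\<Sum>R\<in>PM ?Z. ?x ^ defect ?Z \<pi> R * (of_bool (sstable I R \<and> sstable J R) *
     (c I (res I R) N * c J (res J R) N * c K (res K R) N)))" using ix stable_join by (intro sum.mono_neutral_left finite_PM) auto
   finally show "E I (res I \<pi>) N * E J (res J \<pi>) N * E K (res K \<pi>) N = (\<Sum>R\<in>PM ?Z.
     ?x ^ defect ?Z \<pi> R * (of_bool (sstable I R \<and> sstable J R) *
     (c I (res I R) N * c J (res J R) N * c K (res K R) N)))" .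
  qed
 qed
qed

text \<open>If one face is preserved, the other two are joined: the weight is at most N^(-2) and
  multiplies a bounded N^2 \<open>K2\<close>. If none is preserved, some face is joined to both
  others and the weight is at most N^(-4).\<close>

lemma (in cumulant_system) K3_unstable_tendsto:
 assumes A: "I \<union> J \<union> K \<subseteq> A" and d: "I \<inter> J = {}" "I \<inter> K = {}" "J \<inter> K = {}"
  and \<pi>: "\<pi> \<in> PM (I \<union> J \<union> K)" "sstable I \<pi>" "sstable J \<pi>"
  and r: "r \<in> PM (I \<union> J \<union> K)" "\<not> (sstable I r \<and> sstable J r)"
 shows "((\<lambda>N. of_nat N ^ 2 * (eps N ^ defect (I \<union> J \<union> K) \<pi> r * K3 I J K r N)) \<longlongrightarrow> 0) F"
proof -
 let ?Z = "I \<union> J \<union> K" and ?d = "defect (I \<union> J \<union> K) \<pi> r"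
 have ix: "ix_set ?Z" using ix_A[OF A] .
 have Z: "?Z = (I \<union> J) \<union> K" "?Z = (I \<union> K) \<union> J" "?Z = (J \<union> K) \<union> I" "?Z = K \<union> (I \<union> J)" "?Z = J \<union> (I \<union> K)" "?Z = I \<union> (J \<union> K)" by blast+
 have dd: "(I \<union> J) \<inter> K = {}" "(I \<union> K) \<inter> J = {}" "(J \<union> K) \<inter> I = {}"  "K \<inter> (I \<union> J) = {}" "J \<inter> (I \<union> K) = {}" "I \<inter> (J \<union> K) = {}" using d by blast+
 have \<pi>K: "sstable K \<pi>" using stable_other[of \<pi> "I \<union> J" K] \<pi> ix dd(1) stable_join by blast
 have sub: "I \<subseteq> ?Z" "J \<subseteq> ?Z" "K \<subseteq> ?Z" by blast+
 have cb: "bdd F (\<lambda>N. c ?Z r N)" by (rule cumulant_bdd[OF A r(1)])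
 have lim_K2: "((\<lambda>N. of_nat N ^ 2 * (eps N ^ ?d * K2 X Y r N)) \<longlongrightarrow> 0) F"
  if "2 \<le> ?d" "?Z = X \<union> Y" "X \<inter> Y = {}" "sstable X r" for X Y
 proof -
  have XY: "X \<union> Y \<subseteq> A" "r \<in> PM (X \<union> Y)" using A r(1) that(2) by simp_all
  have "((\<lambda>N. eps N ^ ?d * (of_nat N ^ 2 * K2 X Y r N)) \<longlongrightarrow> 0) F"
   by (rule tendsto_zero_mult_bdd[OF _ K2_bdd[OF XY(1) that(3) XY(2) that(4)]])
    (use weight_tendsto[of ?d] that(1) in \<open>simp add: power_0_left\<close>)
  thus ?thesis by (simp add: mult_ac)
 qed
 have sUn: "sstable X r" if "?Z = Y \<union> X" "Y \<inter> X = {}" "sstable Y r" for X Y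
  by (rule stable_other[OF _ _ that(2,3)]) (use that(1) r(1) ix in simp_all)
 have K3_eq: "K3 I J K r = (\<lambda>N. c ?Z r N
   - of_bool (sstable K r) * (c (I \<union> J) (res (I \<union> J) r) N * c K (res K r) N)
   - of_bool (sstable J r) * (c (I \<union> K) (res (I \<union> K) r) N * c J (res J r) N)
   - of_bool (sstable I r) * (c (J \<union> K) (res (J \<union> K) r) N * c I (res I r) N))"
  using r(2) by (simp add: K3_def fun_eq_iff)
 \<comment> \<open>Two preserved faces force the third to be preserved, so here at most one
   is.\<close>
 have two: "sstable I r" "sstable J r"
  if "sstable X r" "sstable Y r" "(X = I \<and> Y = J) \<or> (X = I \<and> Y = K) \<or> (X = J \<and> Y = K)" for X Y
  using that sUn[OF Z(2) dd(2)] sUn[OF Z(3) dd(3)] stable_join by blast+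
 have joinI: "joined r I J \<or> joined r I K" if "\<not> sstable I r"
  using not_stable_joined[of r I "J \<union> K"] that r(1) unfolding Z(6) joined_Un by blast
 have joinJ: "joined r J I \<or> joined r J K" if "\<not> sstable J r"
  using not_stable_joined[of r J "I \<union> K"] that r(1) unfolding Z(5) joined_Un by blast
 have joinK: "joined r K I \<or> joined r K J" if "\<not> sstable K r"
  using not_stable_joined[of r K "I \<union> J"] that r(1) unfolding Z(4) joined_Un by blast
 have dIJ: "2 \<le> ?d" if "joined r I J" using defect_joined[OF \<pi>(1) r(1) ix sub(1,2) d(1) \<pi>(2,3) that] .
 have dIK: "2 \<le> ?d" if "joined r I K" using defect_joined[OF \<pi>(1) r(1) ix sub(1,3) d(2) \<pi>(2) \<pi>K that] .
 have dJK: "2 \<le> ?d" if "joined r J K" using defect_joined[OF \<pi>(1) r(1) ix sub(2,3) d(3) \<pi>(3) \<pi>K that] .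
 have d2: "2 \<le> ?d" using r(2) joinI joinJ dIJ dIK dJK joined_sym[of r J I] by blast
 consider (K) "sstable K r" | (J) "sstable J r" | (I) "sstable I r"
  | (none) "\<not> sstable I r" "\<not> sstable J r" "\<not> sstable K r" by blast
 thus ?thesis proof cases
  case K
  hence n: "\<not> sstable I r" "\<not> sstable J r" using two r(2) by blast+
  have "K3 I J K r = K2 (I \<union> J) K r" unfolding K3_eq using K n by (simp add: K2_def fun_eq_iff)
  thus ?thesis using lim_K2[OF d2 Z(1) dd(1) sUn[OF Z(4) dd(4) K]] by simp
 next
  case J
  hence n: "\<not> sstable I r" "\<not> sstable K r" using two r(2) by blast+
  have "K3 I J K r = K2 (I \<union> K) J r" unfolding K3_eq using J n Z(2) by (simp add: K2_def fun_eq_iff)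
  thus ?thesis using lim_K2[OF d2 Z(2) dd(2) sUn[OF Z(5) dd(5) J]] by simp
 next
  case I
  hence n: "\<not> sstable J r" "\<not> sstable K r" using two r(2) by blast+
  have "K3 I J K r = K2 (J \<union> K) I r" unfolding K3_eq using I n Z(3) by (simp add: K2_def fun_eq_iff)
  thus ?thesis using lim_K2[OF d2 Z(3) dd(3) sUn[OF Z(6) dd(6) I]] by simp
 next
  case none
  have e: "K3 I J K r = (\<lambda>N. c ?Z r N)" unfolding K3_eq using none by simp
  have JI: "J \<inter> I = {}" "K \<inter> I = {}" "K \<inter> J = {}" using d by blast+
  consider "joined r I J" "joined r I K" | "joined r J I" "joined r J K" | "joined r K I" "joined r K J"
   using joinI[OF none(1)] joinJ[OF none(2)] joinK[OF none(3)] joined_sym[of r I J] joined_sym[of r J I]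
    joined_sym[of r I K] joined_sym[of r K I] joined_sym[of r J K] joined_sym[of r K J] by blast
  hence d4: "4 \<le> ?d" proof cases
   case 1
   show ?thesis by (rule defect_joined2[OF \<pi>(1) r(1) ix sub(1,2,3) d(1,2,3) \<pi>(2,3) \<pi>K 1])
  next
   case 2
   show ?thesis by (rule defect_joined2[OF \<pi>(1) r(1) ix sub(2,1,3) JI(1) d(3,2) \<pi>(3,2) \<pi>K 2])
  next
   case 3
   show ?thesis by (rule defect_joined2[OF \<pi>(1) r(1) ix sub(3,1,2) JI(2,3) d(1) \<pi>K \<pi>(2,3) 3])
  qed
  have "((\<lambda>N. eps N ^ (?d - 2) * c ?Z r N) \<longlongrightarrow> 0) F"
   by (rule tendsto_zero_mult_bdd[OF _ cb]) (use weight_tendsto[of "?d - 2"] d4 in \<open>simp add: power_0_left\<close>)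
  moreover have "eventually (\<lambda>N. eps N ^ (?d - 2) * c ?Z r N =
    of_nat N ^ 2 * (eps N ^ ?d * c ?Z r N)) F" using eventually_pos by eventually_elim (simp add: scaled_weight[OF d2, symmetric])
  ultimately show ?thesis unfolding e by (rule Lim_transform_eventually)
 qed
qed

text \<open>Premaps joining faces contribute nothing in the limit, so the scaled \<open>K3\<close>
  of the others solves a perturbed unitriangular system whose right-hand side tends to zero.\<close>

lemma (in cumulant_system) K3_tendsto:
 assumes A: "I \<union> J \<union> K \<subseteq> A" and d: "I \<inter> J = {}" "I \<inter> K = {}" "J \<inter> K = {}"
  and \<pi>: "\<pi> \<in> PM (I \<union> J \<union> K)" "sstable I \<pi>" "sstable J \<pi>"
 shows "((\<lambda>N. of_nat N ^ 2 * K3 I J K \<pi> N) \<longlongrightarrow> 0) F" proof -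
 let ?Z = "I \<union> J \<union> K"
 let ?T = "{r. r \<in> PM ?Z \<and> (sstable I r \<and> sstable J r)}"
 let ?U = "{r. r \<in> PM ?Z \<and> \<not> (sstable I r \<and> sstable J r)}"
 have ix: "ix_set ?Z" using ix_A[OF A] .
 have T: "?T \<subseteq> PM ?Z" by blast
 have Z: "(I \<union> J) \<union> K \<subseteq> A" "(I \<union> K) \<union> J \<subseteq> A" "(J \<union> K) \<union> I \<subseteq> A" using A by blast+
 have Z': "?Z = (I \<union> J) \<union> K" "?Z = (I \<union> K) \<union> J" "?Z = (J \<union> K) \<union> I" by blast+
 have dd: "(I \<union> J) \<inter> K = {}" "(I \<union> K) \<inter> J = {}" "(J \<union> K) \<inter> I = {}" using d by blast+
 have "((\<lambda>N. \<Sum>s\<in>?T. eps N ^ defect ?Z r s * (of_nat N ^ 2 * K3 I J K s N)) \<longlongrightarrow> 0) F"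
  if rT: "r \<in> ?T" for r
 proof -
  have r: "r \<in> PM ?Z" "sstable I r" "sstable J r" using rT by simp_all
  have rK: "sstable K r" using stable_other[of r "I \<union> J" K] r ix dd(1) stable_join by blast
  let ?k = "\<lambda>N. of_nat N ^ 2 * (E ?Z r N
     - E (I \<union> J) (res (I \<union> J) r) N * E K (res K r) N
     - E (I \<union> K) (res (I \<union> K) r) N * E J (res J r) N
     - E (J \<union> K) (res (J \<union> K) r) N * E I (res I r) N
     + 2 * (E I (res I r) N * E J (res J r) N * E K (res K r) N))"
  let ?w = "\<lambda>N s. eps N ^ defect ?Z r s :: complex"
  have "((\<lambda>N. ?k N - (\<Sum>s\<in>?U. of_nat N ^ 2 * (?w N s * K3 I J K s N))) \<longlongrightarrow> 0 - (\<Sum>s\<in>?U. 0)) F"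
   by (intro tendsto_diff tendsto_sum third_tendsto[OF A d r] K3_unstable_tendsto[OF A d r]) simp_all
  hence "((\<lambda>N. ?k N - (\<Sum>s\<in>?U. of_nat N ^ 2 * (?w N s * K3 I J K s N))) \<longlongrightarrow> 0) F" by simp
  moreover have "eventually (\<lambda>N. ?k N - (\<Sum>s\<in>?U. of_nat N ^ 2 * (?w N s * K3 I J K s N)) =
    (\<Sum>s\<in>?T. ?w N s * (of_nat N ^ 2 * K3 I J K s N))) F"
   using moment_eq[OF A] moment_prod'[OF Z(1) dd(1) Z'(1)] moment_prod'[OF Z(2) dd(2) Z'(2)]
    moment_prod'[OF Z(3) dd(3) Z'(3)] moment_prod3[OF A d]
  proof eventually_elim
   case (elim N)
   let ?v = "\<lambda>s. ?w N s"
   have e: "E ?Z r N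
     - E (I \<union> J) (res (I \<union> J) r) N * E K (res K r) N
     - E (I \<union> K) (res (I \<union> K) r) N * E J (res J r) N
     - E (J \<union> K) (res (J \<union> K) r) N * E I (res I r) N
     + 2 * (E I (res I r) N * E J (res J r) N * E K (res K r) N) = (\<Sum>s\<in>PM ?Z. ?v s * K3 I J K s N)"
    unfolding bspec[OF elim(1) r(1)] mp[OF bspec[OF elim(2) r(1)] rK] mp[OF bspec[OF elim(3) r(1)] r(3)]
     mp[OF bspec[OF elim(4) r(1)] r(2)] mp[OF bspec[OF elim(5) r(1)] conjI[OF r(2,3)]]
     sum_subtractf[symmetric] sum_distrib_left sum.distrib[symmetric] by (intro sum.cong refl) (simp add: K3_def algebra_simps)
   have "PM ?Z = ?T \<union> ?U" by blast
   hence "(\<Sum>s\<in>PM ?Z. ?v s * K3 I J K s N) = (\<Sum>s\<in>?T \<union> ?U. ?v s * K3 I J K s N)" by simp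
   also have "... = (\<Sum>s\<in>?T. ?v s * K3 I J K s N) + (\<Sum>s\<in>?U. ?v s * K3 I J K s N)"
    by (rule sum.union_disjoint) (use finite_PM[OF ix] in auto)
   finally show ?case unfolding e by (simp add: distrib_left sum_distrib_left mult_ac)
  qed
  ultimately show ?thesis by (rule Lim_transform_eventually)
 qed
 moreover have "\<pi> \<in> ?T" using \<pi> by simp
 ultimately show ?thesis by (rule perturbed_unitriangular_tendsto_zero[where a = "\<lambda>\<pi> r. 0 ^ defect ?Z \<pi> r" and
    b = "\<lambda>N \<pi> r. eps N ^ defect ?Z \<pi> r" and u = "\<lambda>N r. of_nat N ^ 2 * K3 I J K r N",
    OF unitriangular_defect[OF ix T] weight_tendsto])
qed

text \<open>N^2 \<open>K3\<close> is exactly the deviation of N^2 \<open>K2\<close> from the Leibniz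
  rule in its first argument.\<close>

lemma (in cumulant_system) K2_derivation:
 assumes A: "I \<union> J \<union> K \<subseteq> A" and d: "I \<inter> J = {}" "I \<inter> K = {}" "J \<inter> K = {}"
  and \<pi>: "\<pi> \<in> PM (I \<union> J \<union> K)" "sstable I \<pi>" "sstable J \<pi>"
 shows "((\<lambda>N. of_nat N ^ 2 * K2 (I \<union> J) K \<pi> N - (of_nat N ^ 2 * K2 I K (res (I \<union> K) \<pi>) N * c J (res J \<pi>) N
   + of_nat N ^ 2 * K2 J K (res (J \<union> K) \<pi>) N * c I (res I \<pi>) N)) \<longlongrightarrow> 0) F"
proof -
 have ix: "ix_set (I \<union> J \<union> K)" using ix_A[OF A] .
 have "sstable K \<pi>" using stable_other[of \<pi> "I \<union> J" K] \<pi> ix d stable_join by blast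
 moreover have "res I (res (I \<union> K) \<pi>) = res I \<pi>" "res K (res (I \<union> K) \<pi>) = res K \<pi>"
  "res J (res (J \<union> K) \<pi>) = res J \<pi>" "res K (res (J \<union> K) \<pi>) = res K \<pi>" by (rule res_res, blast)+
 ultimately have "of_nat N ^ 2 * K3 I J K \<pi> N = of_nat N ^ 2 * K2 (I \<union> J) K \<pi> N
   - (of_nat N ^ 2 * K2 I K (res (I \<union> K) \<pi>) N * c J (res J \<pi>) N
   + of_nat N ^ 2 * K2 J K (res (J \<union> K) \<pi>) N * c I (res I \<pi>) N)" for N
  using \<pi>(2,3) by (simp add: K3_def K2_def algebra_simps)
 thus ?thesis using K3_tendsto[OF A d \<pi>] by simp
qed

section \<open>Covariances and third moments from pair corrections\<close>

lemma tendsto_mult_diff: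
 fixes c :: "'n => complex"
 assumes "((\<lambda>n. c n * (u n - u' n)) \<longlongrightarrow> a) F" "((\<lambda>n. c n * (v n - v' n)) \<longlongrightarrow> b) F"
  and "(u' \<longlongrightarrow> U) F" "(v \<longlongrightarrow> V) F"
 shows "((\<lambda>n. c n * (u n * v n - u' n * v' n)) \<longlongrightarrow> a * V + U * b) F" proof -
 have e: "c n * (u n * v n - u' n * v' n) = c n * (u n - u' n) * v n + u' n * (c n * (v n - v' n))" for n by (simp add: algebra_simps)
 show ?thesis unfolding e by (intro tendsto_add tendsto_mult assms)
qed

text \<open>A pair of factors meets at most two of the three sets. Whether it lies in one set or
  meets two of them, its coefficients cancel by inclusion-exclusion.\<close>

lemma pair_term_third:
 assumes "finite B" "finite C" "finite D" "B \<inter> C = {}" "B \<inter> D = {}" "C \<inter> D = {}"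
 shows "pterm q E (B \<union> C \<union> D)
   - (pterm q E (B \<union> C) * prod E D + prod E (B \<union> C) * pterm q E D)
   - (pterm q E (B \<union> D) * prod E C + prod E (B \<union> D) * pterm q E C)
   - (pterm q E (C \<union> D) * prod E B + prod E (C \<union> D) * pterm q E B)
   + 2 * ((pterm q E B * prod E C + prod E B * pterm q E C) * prod E D + prod E (B \<union> C) * pterm q E D) = 0"
proof -
 let ?Y = "B \<union> C \<union> D"
 let ?s = "\<lambda>X. \<Sum>T\<in>pairs_in ?Y. of_bool (T \<subseteq> X) * (q T * (\<Prod>i\<in>?Y - T. E i))"
 have fY: "finite ?Y" using assms(1-3) by simp
 have s: "pterm q E X * prod E X' = ?s X" if "X \<union> X' = ?Y" "X \<inter> X' = {}" for X X' proof -
  have "?Y - X = X'" "X \<subseteq> ?Y" using that by blast+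
  thus ?thesis using pair_term_mult[OF fY, of X q E] by simp
 qed
 have u: "prod E (B \<union> C) = prod E B * prod E C" "prod E (B \<union> D) = prod E B * prod E D"
  "prod E (C \<union> D) = prod E C * prod E D" using assms by (simp_all add: prod.union_disjoint)
 have t: "pterm q E ?Y = ?s ?Y" using s[of ?Y "{}"] by simp
 have 1: "pterm q E (B \<union> C) * prod E D = ?s (B \<union> C)" "pterm q E (B \<union> D) * prod E C = ?s (B \<union> D)"
  "pterm q E (C \<union> D) * prod E B = ?s (C \<union> D)" using assms(4-6) by (intro s; blast)+
 have 2: "pterm q E D * (prod E B * prod E C) = ?s D" "pterm q E C * (prod E B * prod E D) = ?s C"
  "pterm q E B * (prod E C * prod E D) = ?s B" unfolding u[symmetric] using assms(4-6) by (intro s; blast)+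
 have "?s ?Y - ?s (B \<union> C) - ?s (B \<union> D) - ?s (C \<union> D) + ?s B + ?s C + ?s D = 0"
  unfolding sum.distrib[symmetric] sum_subtractf[symmetric]
 proof (rule sum.neutral, rule ballI)
  fix T assume "T \<in> pairs_in ?Y"
  then obtain x y where T: "T = {x, y}" "x \<noteq> y" "x \<in> ?Y" "y \<in> ?Y" unfolding pairs_in_def by (auto simp: card_2_iff)
  have "of_bool (T \<subseteq> ?Y) - of_bool (T \<subseteq> B \<union> C) - of_bool (T \<subseteq> B \<union> D) - of_bool (T \<subseteq> C \<union> D)
    + of_bool (T \<subseteq> B) + of_bool (T \<subseteq> C) + of_bool (T \<subseteq> D) = (0 :: complex)"
   using T(3,4) assms(4-6) unfolding T(1) by (auto simp: of_bool_def disjoint_iff)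
  hence "(of_bool (T \<subseteq> ?Y) - of_bool (T \<subseteq> B \<union> C) - of_bool (T \<subseteq> B \<union> D) - of_bool (T \<subseteq> C \<union> D)
    + of_bool (T \<subseteq> B) + of_bool (T \<subseteq> C) + of_bool (T \<subseteq> D)) * (q T * (\<Prod>i\<in>?Y - T. E i)) = 0" by simp
  thus "of_bool (T \<subseteq> ?Y) * (q T * (\<Prod>i\<in>?Y - T. E i))
    - of_bool (T \<subseteq> B \<union> C) * (q T * (\<Prod>i\<in>?Y - T. E i)) - of_bool (T \<subseteq> B \<union> D) * (q T * (\<Prod>i\<in>?Y - T. E i))
    - of_bool (T \<subseteq> C \<union> D) * (q T * (\<Prod>i\<in>?Y - T. E i)) + of_bool (T \<subseteq> B) * (q T * (\<Prod>i\<in>?Y - T. E i))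
    + of_bool (T \<subseteq> C) * (q T * (\<Prod>i\<in>?Y - T. E i)) + of_bool (T \<subseteq> D) * (q T * (\<Prod>i\<in>?Y - T. E i)) = 0"
   by (simp only: ring_distribs)
 qed
 thus ?thesis unfolding t 1 u using 2 by (simp add: algebra_simps)
qed

text \<open>Every product of moments is compared with the product of means. In the third-order
  combination the means cancel as 1 - 3 + 2, and the corrections by
  \<open>pair_term_third\<close>.\<close>

lemma third_moment_tendsto:
 fixes m :: "'n => 'i set => complex" and c :: "'n => complex"
 assumes ex: "\<And>X. X \<subseteq> A ==> ((\<lambda>n. c n * (m n X - (\<Prod>i\<in>X. m n {i}))) \<longlongrightarrow> pterm q E X) F"
  and H1: "\<And>i. i \<in> A ==> ((\<lambda>n. m n {i}) \<longlongrightarrow> E i) F"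
  and lim: "\<And>X. X \<subseteq> A ==> ((\<lambda>n. m n X) \<longlongrightarrow> prod E X) F"
  and fin: "finite A" and sub: "B \<subseteq> A" "C \<subseteq> A" "D \<subseteq> A"
  and d: "B \<inter> C = {}" "B \<inter> D = {}" "C \<inter> D = {}"
 shows "((\<lambda>n. c n * (m n (B \<union> C \<union> D) - m n (B \<union> C) * m n D - m n (B \<union> D) * m n C - m n (C \<union> D) * m n B
   + 2 * (m n B * m n C * m n D))) \<longlongrightarrow> 0) F"
  "((\<lambda>n. c n * (m n (B \<union> C) - m n B * m n C)) \<longlongrightarrow>
    pterm q E (B \<union> C) - (pterm q E B * prod E C + prod E B * pterm q E C)) F"
proof -
 let ?e = "\<lambda>X n. \<Prod>i\<in>X. m n {i}"
 have fB: "finite B" "finite C" "finite D" using sub fin finite_subset by blast+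
 have le: "((\<lambda>n. ?e X n) \<longlongrightarrow> prod E X) F" if "X \<subseteq> A" for X
  by (intro tendsto_prod H1) (use that in blast)
 have eU: "?e (X \<union> Y) n = ?e X n * ?e Y n" if "X \<inter> Y = {}" "finite X" "finite Y" for X Y n
  using that by (simp add: prod.union_disjoint)
 have two: "((\<lambda>n. c n * (m n X * m n Y - ?e X n * ?e Y n)) \<longlongrightarrow> pterm q E X * prod E Y + prod E X * pterm q E Y) F"
  if "X \<subseteq> A" "Y \<subseteq> A" for X Y
  by (rule tendsto_mult_diff[OF ex[OF that(1)] ex[OF that(2)] le[OF that(1)] lim[OF that(2)]])
 have "((\<lambda>n. c n * (m n (B \<union> C) - ?e (B \<union> C) n) - c n * (m n B * m n C - ?e B n * ?e C n)) \<longlongrightarrow>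
   pterm q E (B \<union> C) - (pterm q E B * prod E C + prod E B * pterm q E C)) F"
  by (intro tendsto_diff ex two sub) (use sub in blast)
 thus "((\<lambda>n. c n * (m n (B \<union> C) - m n B * m n C)) \<longlongrightarrow>
    pterm q E (B \<union> C) - (pterm q E B * prod E C + prod E B * pterm q E C)) F"
  unfolding eU[OF d(1) fB(1,2)] by (simp add: algebra_simps)
 have 3: "((\<lambda>n. c n * (m n B * m n C * m n D - ?e B n * ?e C n * ?e D n)) \<longlongrightarrow>
   (pterm q E B * prod E C + prod E B * pterm q E C) * prod E D + (prod E B * prod E C) * pterm q E D) F"
  by (rule tendsto_mult_diff[OF two[OF sub(1,2)] ex[OF sub(3)] tendsto_mult[OF le[OF sub(1)] le[OF sub(2)]] lim[OF sub(3)]])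
 have uBC: "prod E (B \<union> C) = prod E B * prod E C" using d fB by (simp add: prod.union_disjoint)
 have dd: "(B \<union> C) \<inter> D = {}" "(B \<union> D) \<inter> C = {}" "(C \<union> D) \<inter> B = {}" using d by blast+
 have "((\<lambda>n. c n * (m n (B \<union> C \<union> D) - ?e (B \<union> C \<union> D) n)
   - c n * (m n (B \<union> C) * m n D - ?e (B \<union> C) n * ?e D n)
   - c n * (m n (B \<union> D) * m n C - ?e (B \<union> D) n * ?e C n)
   - c n * (m n (C \<union> D) * m n B - ?e (C \<union> D) n * ?e B n)
   + 2 * (c n * (m n B * m n C * m n D - ?e B n * ?e C n * ?e D n))) \<longlongrightarrow>
   pterm q E (B \<union> C \<union> D)
   - (pterm q E (B \<union> C) * prod E D + prod E (B \<union> C) * pterm q E D)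
   - (pterm q E (B \<union> D) * prod E C + prod E (B \<union> D) * pterm q E C)
   - (pterm q E (C \<union> D) * prod E B + prod E (C \<union> D) * pterm q E B)
   + 2 * ((pterm q E B * prod E C + prod E B * pterm q E C) * prod E D + (prod E B * prod E C) * pterm q E D)) F"
  by (intro tendsto_add tendsto_diff tendsto_mult tendsto_const ex two 3 sub) (use sub in blast)+
 hence "((\<lambda>n. c n * (m n (B \<union> C \<union> D) - ?e (B \<union> C \<union> D) n)
   - c n * (m n (B \<union> C) * m n D - ?e (B \<union> C) n * ?e D n)
   - c n * (m n (B \<union> D) * m n C - ?e (B \<union> D) n * ?e C n)
   - c n * (m n (C \<union> D) * m n B - ?e (C \<union> D) n * ?e B n)
   + 2 * (c n * (m n B * m n C * m n D - ?e B n * ?e C n * ?e D n))) \<longlongrightarrow> 0) F"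
  using pair_term_third[OF fB d, of q E] unfolding uBC by simp
 moreover have "?e (B \<union> C \<union> D) n = ?e B n * ?e C n * ?e D n" "?e (B \<union> C) n = ?e B n * ?e C n"
  "?e (B \<union> D) n = ?e B n * ?e D n" "?e (C \<union> D) n = ?e C n * ?e D n" for n
  using eU dd d fB by (simp_all add: prod.union_disjoint)
 ultimately show "((\<lambda>n. c n * (m n (B \<union> C \<union> D) - m n (B \<union> C) * m n D - m n (B \<union> D) * m n C - m n (C \<union> D) * m n B
   + 2 * (m n B * m n C * m n D))) \<longlongrightarrow> 0) F" by (simp add: algebra_simps)
qed

lemma set_cumulant_pair:
 assumes "a \<noteq> b" shows "set_cumulant {a, b} m = m {a, b} - m {a} * m {b}"
proof -
 let ?g = "\<lambda>P. (- 1) ^ (card P - 1) * fact (card P - 1) * (\<Prod>B\<in>P. m B)"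
 have part: "partition_on {b} Q \<longleftrightarrow> Q = {{b}}" for Q :: "'a set set" proof
  assume Q: "partition_on {b} Q"
  have "B = {b}" if "B \<in> Q" for B proof -
   have "B \<subseteq> {b}" "B \<noteq> {}" using Q that by (auto simp: partition_on_def)
   thus ?thesis by blast
  qed
  moreover have "Q \<noteq> {}" using Q by (auto simp: partition_on_def)
  ultimately show "Q = {{b}}" by blast
 next
  assume "Q = {{b}}"
  thus "partition_on {b} Q" using partition_on_space[of "{b}"] by simp
 qed
 have S: "(SIGMA Q : {Q. partition_on {b} Q}. insert {} Q) = {({{b}}, {}), ({{b}}, {b})}" unfolding part by auto
 have "set_cumulant {a, b} m = (\<Sum>z\<in>{({{b}}, {}), ({{b}}, {b})}. ?g (case z of (Q, B) => insert (insert a B) (Q - {B})))"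
  unfolding set_cumulant_def S[symmetric] by (rule sum.reindex_bij_betw[OF bij_betw_partition_insert, symmetric]) (use assms in simp)
 also have "... = ?g {{a}, {b}} + ?g {{a, b}}" proof -
  have "{{b}} - {{}} = {{b}}" by auto
  thus ?thesis by simp
 qed
 also have "... = m {a, b} - m {a} * m {b}" using assms by simp
 finally show ?thesis .
qed

section \<open>The system of a family with a second-order limit\<close>

text \<open>The word of a cycle as read in \<open>tr_perm\<close>. It is attached to the full
  premap, so that all restrictions share it (\<open>slot_word_res\<close>).\<close>

definition slot_word :: "(int => int) => int set => int list" where
 "slot_word \<pi> B = support \<pi> (Min (abs ` B))"

lemma slot_word_res:
 assumes "\<pi> \<in> PM Z" "ix_set Z" "J \<subseteq> Z" "sstable J \<pi>" "B \<in> pos_cycles J (res J \<pi>)"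
 shows "slot_word (res J \<pi>) B = slot_word \<pi> B" proof -
 have ix: "ix_set J" using assms(2,3) by (rule ix_subset)
 have r: "res J \<pi> \<in> PM J" by (rule res_PM[OF assms(1-4)])
 have "B \<subseteq> pm J" using cycle_blocks_block(1)[OF PM_permutes[OF r] PM_perm[OF r ix] finite_pm[OF ix]] assms(5)
  by (simp add: pos_cycles_def)
 hence m: "Min (abs ` B) \<in> pm J" using assms(5) by (auto simp: pos_cycles_def)
 have "support \<pi> (Min (abs ` B)) = support (res J \<pi>) (Min (abs ` B))"
  by (rule support_cong[where A = "pm J", OF _ assms(4) m]) (simp add: res_apply)
 thus ?thesis by (simp add: slot_word_def)
qed

lemma support_subset:
 assumes "\<pi> permutes S" "x \<in> S" shows "set (support \<pi> x) \<subseteq> S"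
proof -
 have "(\<pi> ^^ n) x \<in> S" for n by (induction n) (use assms permutes_in_image[OF assms(1)] in simp_all)
 thus ?thesis by auto
qed

lemma slot_word_in_lists:
 assumes "\<pi> \<in> PM Z" "ix_set Z" "B \<in> pos_cycles Z \<pi>" shows "slot_word \<pi> B \<in> lists (pm Z)"
proof -
 have "B \<subseteq> pm Z"
  using cycle_blocks_block(1)[OF PM_permutes[OF assms(1)] PM_perm[OF assms(1,2)] finite_pm[OF assms(2)]] assms(3)
  by (simp add: pos_cycles_def)
 hence "Min (abs ` B) \<in> pm Z" using assms(3) by (auto simp: pos_cycles_def)
 thus ?thesis unfolding slot_word_def using support_subset[OF PM_permutes[OF assms(1)], of "Min (abs ` B)"]
  by (simp add: in_lists_conv_set subset_iff)
qed

lemma pos_cycles_res_subset: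
 assumes "\<pi> \<in> PM Z" "ix_set Z" "J \<subseteq> Z" "sstable J \<pi>"
 shows "pos_cycles J (res J \<pi>) \<subseteq> pos_cycles Z \<pi>"
 unfolding pos_cycles_def cycle_blocks_res[OF assms(4)] using signed_set_mono[OF assms(3)] by (auto simp: cycle_blocks_def)

lemma along_le: "along D \<le> sequentially"
 by simp

lemma eventually_along: "eventually (\<lambda>N. N \<in> D) (along D)"
 by (simp add: eventually_inf_principal)

lemma inverse_tendsto_along: "(eps \<longlongrightarrow> 0) (along D)"
 using lim_inverse_n by (rule tendsto_mono[OF along_le])

text \<open>Brings words into the algebra for which the decay of higher cumulants is
  assumed.\<close>

lemma word_mat_in_generated_algebra:
 assumes "w \<in> lists L" shows "(\<lambda>N u. word_mat N (\<lambda>k. X' k N u) w) \<in> generated_algebra (X' ` L)" using assms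
proof (induction w)
 case Nil
 show ?case using generated_algebra.one[of "X' ` L"] by (simp add: word_mat_def)
next
 case (Cons k w)
 have "X' k \<in> generated_algebra (X' ` L)" using Cons.hyps(1) by (intro generated_algebra.gen) simp
 from generated_algebra.mult[OF this Cons.IH] show ?case by (simp add: word_mat_def)
qed

lemma second_order_limitD:
 assumes "has_real_second_order_limit D M n X tp \<phi>\<^sub>1 \<phi>\<^sub>2 x"
 defines "W \<equiv> \<lambda>w N u. ntr (word_mat N (signed transpose_mat (\<lambda>j. X j N u)) w)"
 shows "w \<in> lists (pm {1..int n}) ==>
   ((\<lambda>N. LINT u|M N. W w N u) \<longlongrightarrow> \<phi>\<^sub>1 (prod_list (map (signed tp x) w))) (along D)"
  "w \<in> lists (pm {1..int n}) ==> w' \<in> lists (pm {1..int n}) ==>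
   ((\<lambda>N. of_nat N ^ 2 * joint_cumulant (M N) [W w N, W w' N])
    \<longlongrightarrow> \<phi>\<^sub>2 (prod_list (map (signed tp x) w)) (prod_list (map (signed tp x) w'))) (along D)"
  "ws \<in> lists (lists (pm {1..int n})) ==> length ws > 2 ==>
   ((\<lambda>N. of_nat N ^ length ws * joint_cumulant (M N) (map (\<lambda>w. W w N) ws)) \<longlongrightarrow> 0) (along D)"
proof -
 let ?L = "pm {1..int n}"
 let ?X = "\<lambda>k N u. signed transpose_mat (\<lambda>j. X j N u) k"
 note h = assms(1)[unfolded has_real_second_order_limit_def Let_def]
 show "((\<lambda>N. LINT u|M N. W w N u) \<longlongrightarrow> \<phi>\<^sub>1 (prod_list (map (signed tp x) w))) (along D)" if "w \<in> lists ?L"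
  using conjunct1[OF h] that unfolding W_def by blast
 show "((\<lambda>N. of_nat N ^ 2 * joint_cumulant (M N) [W w N, W w' N])
    \<longlongrightarrow> \<phi>\<^sub>2 (prod_list (map (signed tp x) w)) (prod_list (map (signed tp x) w'))) (along D)"
  if "w \<in> lists ?L" "w' \<in> lists ?L" using conjunct1[OF conjunct2[OF h]] that unfolding W_def by blast
 assume ws: "ws \<in> lists (lists ?L)" "length ws > 2"
 let ?Y = "\<lambda>w N u. word_mat N (\<lambda>k. ?X k N u) w"
 have "map ?Y ws \<in> lists (generated_algebra (?X ` ?L))"
  using ws(1) word_mat_in_generated_algebra[of _ ?L ?X] by (auto simp: in_lists_conv_set)
 moreover have "length (map ?Y ws) > 2" using ws(2) by simp
 ultimately have "((\<lambda>N. of_nat N ^ length (map ?Y ws) * joint_cumulant (M N) (map (\<lambda>Y u. ntr (Y N u)) (map ?Y ws))) \<longlongrightarrow> 0) (along D)"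
  using conjunct2[OF conjunct2[OF h]] by blast
 thus "((\<lambda>N. of_nat N ^ length ws * joint_cumulant (M N) (map (\<lambda>w. W w N) ws)) \<longlongrightarrow> 0) (along D)"
  by (simp add: W_def comp_def)
qed

text \<open>The factors of a moment are normalised traces of words, so
  \<open>moment_expansion\<close> applies at scale N^2: cumulants of order s > 2 are o(N^(-s)) and
  hence negligible against N^(-2).\<close>

lemma moment_slots:
 fixes X :: "nat => nat => 'w => complex mat"
 assumes lim: "has_real_second_order_limit D M n X tp \<phi>\<^sub>1 \<phi>\<^sub>2 x"
  and prob: "\<And>N. N \<in> D ==> prob_space (M N)"
  and Z: "ix_set Z" "Z \<subseteq> {1..int n}" and \<pi>: "\<pi> \<in> PM Z"
 defines "T \<equiv> \<lambda>B N w. ntr (word_mat N (signed transpose_mat (\<lambda>j. X j N w)) (slot_word \<pi> B))"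
 defines "m \<equiv> \<lambda>N B. LINT w|M N. (\<Prod>i\<in>B. T i N w)"
 obtains q E where
  "\<And>X. X \<subseteq> pos_cycles Z \<pi> ==> ((\<lambda>N. of_nat N ^ 2 * (m N X - (\<Prod>i\<in>X. m N {i}))) \<longlongrightarrow> pterm q E X) (along D)"
  "\<And>i. i \<in> pos_cycles Z \<pi> ==> ((\<lambda>N. m N {i}) \<longlongrightarrow> E i) (along D)"
  "\<And>X. X \<subseteq> pos_cycles Z \<pi> ==> ((\<lambda>N. m N X) \<longlongrightarrow> prod E X) (along D)"
proof -
 let ?A = "pos_cycles Z \<pi>" and ?F = "along D"
 define E where "E = (\<lambda>B. \<phi>\<^sub>1 (prod_list (map (signed tp x) (slot_word \<pi> B))))"
 \<comment> \<open>The pair of cycles is unordered, so its limit is selected by a choice operator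
   instead of being written with \<open>\<phi>\<^sub>2\<close>, whose arguments are ordered.\<close>
 define q where "q = (\<lambda>S. SOME l. ((\<lambda>N. of_nat N ^ 2 * set_cumulant S (m N)) \<longlongrightarrow> l) ?F)"
 have fin: "finite ?A" by (rule finite_pos_cycles[OF Z(1)])
 have inL: "slot_word \<pi> B \<in> lists (pm {1..int n})" if "B \<in> ?A" for B
  using slot_word_in_lists[OF \<pi> Z(1) that] signed_set_mono[OF Z(2)] by (auto simp: in_lists_conv_set)
 note L = second_order_limitD[OF lim]
 have pos: "eventually (\<lambda>N. of_nat N ^ 2 \<noteq> (0 :: complex)) ?F"
  using filter_leD[OF along_le eventually_gt_at_top[of 0]] by eventually_elim simp
 have c0: "((\<lambda>N. inverse (of_nat N ^ 2 :: complex)) \<longlongrightarrow> 0) ?F"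
  using tendsto_power[OF inverse_tendsto_along, of 2] by (simp add: power_inverse)
 have m0: "eventually (\<lambda>N. m N {} = 1) ?F" using eventually_along proof eventually_elim
  case (elim N)
  interpret prob_space "M N" using prob[OF elim] .
  show ?case by (simp add: m_def prob_space)
 qed
 have H1: "((\<lambda>N. m N {i}) \<longlongrightarrow> E i) ?F" if "i \<in> ?A" for i
  using L(1)[OF inL[OF that]] by (simp add: m_def T_def E_def)
 have H2: "((\<lambda>N. of_nat N ^ 2 * set_cumulant S (m N)) \<longlongrightarrow> q S) ?F" if S: "S \<subseteq> ?A" "card S = 2" for S
 proof -
  obtain a b where ab: "S = {a, b}" "a \<noteq> b" using S(2) by (auto simp: card_2_iff)
  have jc: "joint_cumulant (M N) [T a N, T b N] = set_cumulant S (m N)" for N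
   using joint_cumulant_eq_set_cumulant[of "[a, b]" "M N" "\<lambda>i. T i N"] ab by (simp add: m_def)
  have "((\<lambda>N. of_nat N ^ 2 * joint_cumulant (M N) [T a N, T b N]) \<longlongrightarrow>
    \<phi>\<^sub>2 (prod_list (map (signed tp x) (slot_word \<pi> a))) (prod_list (map (signed tp x) (slot_word \<pi> b)))) ?F"
   unfolding T_def by (rule L(2)[OF inL inL]) (use S ab in \<open>simp_all\<close>)
  thus ?thesis unfolding jc q_def by (rule someI)
 qed
 have H3: "((\<lambda>N. of_nat N ^ 2 * set_cumulant S (m N)) \<longlongrightarrow> 0) ?F" if S: "S \<subseteq> ?A" "card S > 2" for S
 proof -
  obtain xs where xs: "distinct xs" "set xs = S" using finite_distinct_list[OF finite_subset[OF S(1) fin]] by blast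
  have len: "length xs = card S" using distinct_card[OF xs(1)] xs(2) by simp
  let ?ws = "map (slot_word \<pi>) xs"
  have "?ws \<in> lists (lists (pm {1..int n}))" using xs(2) S(1) inL by (auto simp: in_lists_conv_set)
  from L(3)[OF this] have "((\<lambda>N. of_nat N ^ card S * joint_cumulant (M N) (map (\<lambda>i. T i N) xs)) \<longlongrightarrow> 0) ?F"
   using S(2) len by (simp add: T_def comp_def)
  hence k: "((\<lambda>N. of_nat N ^ card S * set_cumulant S (m N)) \<longlongrightarrow> 0) ?F"
   unfolding m_def joint_cumulant_eq_set_cumulant[OF xs(1), where T = "\<lambda>i. T i _"] xs(2) .
  obtain d where d: "card S = 2 + d" using le_Suc_ex[OF less_imp_le[OF S(2)]] by blast
  have "((\<lambda>N. eps N ^ d * (of_nat N ^ card S * set_cumulant S (m N))) \<longlongrightarrow> 0 ^ d * 0) ?F"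
   by (intro tendsto_mult tendsto_power inverse_tendsto_along k)
  hence "((\<lambda>N. eps N ^ d * (of_nat N ^ card S * set_cumulant S (m N))) \<longlongrightarrow> 0) ?F" by simp
  moreover have "eventually (\<lambda>N. eps N ^ d * (of_nat N ^ card S * set_cumulant S (m N)) = of_nat N ^ 2 * set_cumulant S (m N)) ?F"
   using filter_leD[OF along_le eventually_gt_at_top[of 0]]
  proof eventually_elim
   case (elim N)
   have "eps N ^ d * (of_nat N ^ card S * z) = (of_nat N * inverse (of_nat N)) ^ d * of_nat N ^ 2 * z" for z :: complex
    unfolding d power_add power_mult_distrib by (simp only: mult_ac)
   thus ?case using elim by simp
  qed
  ultimately show ?thesis by (rule Lim_transform_eventually)
 qed
 have ex: "((\<lambda>N. of_nat N ^ 2 * (m N X - (\<Prod>i\<in>X. m N {i}))) \<longlongrightarrow> pterm q E X) ?F" if "X \<subseteq> ?A" for X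
  by (rule moment_expansion[where m = m and c = "\<lambda>N. of_nat N ^ 2" and A = ?A, OF fin c0 pos m0 H1 H2 H3 that])
 have limX: "((\<lambda>N. m N X) \<longlongrightarrow> prod E X) ?F" if X: "X \<subseteq> ?A" for X proof -
  have "((\<lambda>N. inverse (of_nat N ^ 2) * (of_nat N ^ 2 * (m N X - (\<Prod>i\<in>X. m N {i}))) + (\<Prod>i\<in>X. m N {i}))
    \<longlongrightarrow> 0 * pterm q E X + prod E X) ?F"
   by (intro tendsto_add tendsto_mult c0 ex[OF X] tendsto_prod H1) (use X in blast)
  hence "((\<lambda>N. inverse (of_nat N ^ 2) * (of_nat N ^ 2 * (m N X - (\<Prod>i\<in>X. m N {i}))) + (\<Prod>i\<in>X. m N {i})) \<longlongrightarrow> prod E X) ?F"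
   by simp
  moreover have "eventually (\<lambda>N. inverse (of_nat N ^ 2) * (of_nat N ^ 2 * (m N X - (\<Prod>i\<in>X. m N {i}))) + (\<Prod>i\<in>X. m N {i}) = m N X) ?F"
   using pos by eventually_elim (simp add: mult.assoc[symmetric])
  ultimately show ?thesis by (rule Lim_transform_eventually)
 qed
 show thesis by (rule that[OF ex H1 limX])
qed

lemma moment_res:
 assumes "\<pi> \<in> PM Z" "ix_set Z" "J \<subseteq> Z" "sstable J \<pi>"
 shows "tr_perm N J (res J \<pi>) Y = (\<Prod>B\<in>pos_cycles J (res J \<pi>). ntr (word_mat N (signed transpose_mat Y) (slot_word \<pi> B)))"
 unfolding tr_perm_def slot_word_def[symmetric] by (intro prod.cong refl) (simp only: slot_word_res[OF assms])

lemma moment_self: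
 "tr_perm N Z \<pi> Y = (\<Prod>B\<in>pos_cycles Z \<pi>. ntr (word_mat N (signed transpose_mat Y) (slot_word \<pi> B)))"
 unfolding tr_perm_def slot_word_def ..

text \<open>Disjoint preserved index sets split the positive cycles of one premap, so all the
  moments involved belong to subfamilies of a single family of traces.\<close>

lemma matrix_cumulant_system:
 fixes X :: "nat => nat => 'w => complex mat"
 assumes lim: "has_real_second_order_limit D M n X tp \<phi>\<^sub>1 \<phi>\<^sub>2 x"
  and prob: "\<And>N. N \<in> D ==> prob_space (M N)" shows "cumulant_system (along D) {1..int n}
  (\<lambda>I \<pi> N. LINT w|M N. tr_perm N I \<pi> (\<lambda>k. X k N w)) (\<lambda>I R N. matrix_cumulant (M N) N I R (\<lambda>k. X k N))"
proof
 show ixA: "ix_set {1..int n}" by (simp add: ix_set_def)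
 show "(eps \<longlongrightarrow> 0) (along D)" by (rule inverse_tendsto_along)
 show pos: "eventually (\<lambda>N. 0 < N) (along D)" by (rule filter_leD[OF along_le eventually_gt_at_top])
 let ?E = "\<lambda>I \<pi> N. LINT w|M N. tr_perm N I \<pi> (\<lambda>k. X k N w)"
 fix I :: "int set" assume I: "I \<subseteq> {1..int n}"
 have ix: "ix_set I" using ixA I by (rule ix_subset)
 show "eventually (\<lambda>N. \<forall>\<pi>\<in>PM I. ?E I \<pi> N = (\<Sum>R\<in>PM I. eps N ^ defect I \<pi> R * matrix_cumulant (M N) N I R (\<lambda>k. X k N))) (along D)"
  using filter_leD[OF along_le eventually_loops_matrix_injective[OF ix]] pos
 proof eventually_elim
  case (elim N)
  have inj: "\<forall>R\<in>PM I. u R = 0" if "\<And>\<pi>. \<pi> \<in> PM I ==> (\<Sum>R\<in>PM I. real N ^ loops I \<pi> R * u R) = 0"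
   for u :: "(int => int) => real" using spec[OF elim(1), of u] that by blast
  show ?case by (intro ballI moment_eq_sum_matrix_cumulant[OF ix elim(2) inj])
 qed
 show "bdd (along D) (?E I \<pi>)" if \<pi>: "\<pi> \<in> PM I" for \<pi> proof -
  let ?m = "\<lambda>N B. LINT w|M N. (\<Prod>i\<in>B. ntr (word_mat N (signed transpose_mat (\<lambda>j. X j N w)) (slot_word \<pi> i)))"
  obtain q e where "\<And>S. S \<subseteq> pos_cycles I \<pi> ==> ((\<lambda>N. ?m N S) \<longlongrightarrow> prod e S) (along D)"
   by (rule moment_slots[OF lim prob ix I \<pi>]) (assumption, blast)
  from bdd_tendsto[OF this[OF subset_refl]] show ?thesis unfolding moment_self .
 qed
next
 let ?E = "\<lambda>I \<pi> N. LINT w|M N. tr_perm N I \<pi> (\<lambda>k. X k N w)"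
 have ixA: "ix_set {1..int n}" by (simp add: ix_set_def)
 fix I J :: "int set" and \<pi>
 assume IJ: "I \<union> J \<subseteq> {1..int n}" "I \<inter> J = {}" and \<pi>: "\<pi> \<in> PM (I \<union> J)" "sstable I \<pi>"
 have ix: "ix_set (I \<union> J)" using ixA IJ(1) by (rule ix_subset)
 let ?m = "\<lambda>N B. LINT w|M N. (\<Prod>i\<in>B. ntr (word_mat N (signed transpose_mat (\<lambda>j. X j N w)) (slot_word \<pi> i)))"
 let ?A = "pos_cycles (I \<union> J) \<pi>"
 obtain q e where
  L: "\<And>X. X \<subseteq> ?A ==> ((\<lambda>N. of_nat N ^ 2 * (?m N X - (\<Prod>i\<in>X. ?m N {i}))) \<longlongrightarrow> pterm q e X) (along D)"
  "\<And>i. i \<in> ?A ==> ((\<lambda>N. ?m N {i}) \<longlongrightarrow> e i) (along D)"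
  "\<And>X. X \<subseteq> ?A ==> ((\<lambda>N. ?m N X) \<longlongrightarrow> prod e X) (along D)"
  by (rule moment_slots[OF lim prob ix IJ(1) \<pi>(1)]) (assumption, blast)
 have stJ: "sstable J \<pi>" by (rule stable_other[OF \<pi>(1) ix IJ(2) \<pi>(2)])
 note r = moment_res[OF \<pi>(1) ix Un_upper1 \<pi>(2)] moment_res[OF \<pi>(1) ix Un_upper2 stJ]
 note u = pos_cycles_Un[OF \<pi>(1) ix IJ(2) \<pi>(2)]
 note sub = pos_cycles_res_subset[OF \<pi>(1) ix Un_upper1 \<pi>(2)] pos_cycles_res_subset[OF \<pi>(1) ix Un_upper2 stJ]
 show "bdd (along D) (\<lambda>N. of_nat N ^ 2 * (?E (I \<union> J) \<pi> N - ?E I (res I \<pi>) N * ?E J (res J \<pi>) N))"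
  unfolding r unfolding moment_self u(1)
  using third_moment_tendsto(2)[where m = ?m and c = "\<lambda>N. of_nat N ^ 2" and A = ?A and D = "{}", OF L finite_pos_cycles[OF ix] sub empty_subsetI u(2)]
  by (intro bdd_tendsto) simp
next
 let ?E = "\<lambda>I \<pi> N. LINT w|M N. tr_perm N I \<pi> (\<lambda>k. X k N w)"
 have ixA: "ix_set {1..int n}" by (simp add: ix_set_def)
 fix I J K :: "int set" and \<pi>
 assume A: "I \<union> J \<union> K \<subseteq> {1..int n}" and d: "I \<inter> J = {}" "I \<inter> K = {}" "J \<inter> K = {}"
  and \<pi>: "\<pi> \<in> PM (I \<union> J \<union> K)" "sstable I \<pi>" "sstable J \<pi>"
 let ?Z = "I \<union> J \<union> K"
 have ix: "ix_set ?Z" using ixA A by (rule ix_subset)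
 let ?m = "\<lambda>N B. LINT w|M N. (\<Prod>i\<in>B. ntr (word_mat N (signed transpose_mat (\<lambda>j. X j N w)) (slot_word \<pi> i)))"
 let ?A = "pos_cycles ?Z \<pi>"
 obtain q e where
  L: "\<And>X. X \<subseteq> ?A ==> ((\<lambda>N. of_nat N ^ 2 * (?m N X - (\<Prod>i\<in>X. ?m N {i}))) \<longlongrightarrow> pterm q e X) (along D)"
  "\<And>i. i \<in> ?A ==> ((\<lambda>N. ?m N {i}) \<longlongrightarrow> e i) (along D)"
  "\<And>X. X \<subseteq> ?A ==> ((\<lambda>N. ?m N X) \<longlongrightarrow> prod e X) (along D)"
  by (rule moment_slots[OF lim prob ix A \<pi>(1)]) (assumption, blast)
 have dd: "(I \<union> J) \<inter> K = {}" using d by blast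
 have st2: "sstable (I \<union> J) \<pi>" using \<pi>(2,3) by (rule stable_join)
 have stK: "sstable K \<pi>" by (rule stable_other[OF \<pi>(1) ix dd st2])
 note st3 = stable_join[OF \<pi>(2) stK] stable_join[OF \<pi>(3) stK]
 have s: "I \<subseteq> ?Z" "J \<subseteq> ?Z" "K \<subseteq> ?Z" "I \<union> J \<subseteq> ?Z" "I \<union> K \<subseteq> ?Z" "J \<union> K \<subseteq> ?Z" by blast+
 note r = moment_res[OF \<pi>(1) ix s(1) \<pi>(2)] moment_res[OF \<pi>(1) ix s(2) \<pi>(3)] moment_res[OF \<pi>(1) ix s(3) stK]
  moment_res[OF \<pi>(1) ix s(4) st2] moment_res[OF \<pi>(1) ix s(5) st3(1)] moment_res[OF \<pi>(1) ix s(6) st3(2)]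
 note sub = pos_cycles_res_subset[OF \<pi>(1) ix s(1) \<pi>(2)] pos_cycles_res_subset[OF \<pi>(1) ix s(2) \<pi>(3)] pos_cycles_res_subset[OF \<pi>(1) ix s(3) stK]
 have two: "pos_cycles (X \<union> Y) (res (X \<union> Y) \<pi>) = pos_cycles X (res X \<pi>) \<union> pos_cycles Y (res Y \<pi>)"
  "pos_cycles X (res X \<pi>) \<inter> pos_cycles Y (res Y \<pi>) = {}"
  if XY: "X \<union> Y \<subseteq> ?Z" "X \<inter> Y = {}" "sstable X \<pi>" "sstable Y \<pi>" for X Y
 proof -
  have rP: "res (X \<union> Y) \<pi> \<in> PM (X \<union> Y)" by (rule res_PM[OF \<pi>(1) ix XY(1) stable_join[OF XY(3,4)]])
  have iX: "ix_set (X \<union> Y)" using ix XY(1) by (rule ix_subset)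
  have sX: "sstable X (res (X \<union> Y) \<pi>)" using XY(3) stable_res[of X "X \<union> Y" \<pi>] by simp
  have rr: "res X (res (X \<union> Y) \<pi>) = res X \<pi>" "res Y (res (X \<union> Y) \<pi>) = res Y \<pi>" by (rule res_res, blast)+
  show "pos_cycles (X \<union> Y) (res (X \<union> Y) \<pi>) = pos_cycles X (res X \<pi>) \<union> pos_cycles Y (res Y \<pi>)"
   "pos_cycles X (res X \<pi>) \<inter> pos_cycles Y (res Y \<pi>) = {}" using pos_cycles_Un[OF rP iX XY(2) sX] unfolding rr by blast+
 qed
 note u = two[OF s(4) d(1) \<pi>(2,3)] two[OF s(5) d(2) \<pi>(2) stK] two[OF s(6) d(3) \<pi>(3) stK]
 have top: "?A = pos_cycles I (res I \<pi>) \<union> pos_cycles J (res J \<pi>) \<union> pos_cycles K (res K \<pi>)"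
  using pos_cycles_Un(1)[OF \<pi>(1) ix dd st2] unfolding u(1) .
 show "((\<lambda>N. of_nat N ^ 2 * (?E ?Z \<pi> N
     - ?E (I \<union> J) (res (I \<union> J) \<pi>) N * ?E K (res K \<pi>) N
     - ?E (I \<union> K) (res (I \<union> K) \<pi>) N * ?E J (res J \<pi>) N
     - ?E (J \<union> K) (res (J \<union> K) \<pi>) N * ?E I (res I \<pi>) N
     + 2 * (?E I (res I \<pi>) N * ?E J (res J \<pi>) N * ?E K (res K \<pi>) N))) \<longlongrightarrow> 0) (along D)"
  unfolding r unfolding moment_self unfolding top u(1,3,5)
  by (rule third_moment_tendsto(1)[where m = ?m and c = "\<lambda>N. of_nat N ^ 2" and A = ?A, OF L finite_pos_cycles[OF ix] sub u(2,4,6)])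
qed

section \<open>Classification of the leading terms\<close>

lemma stable_Int: "stable A f ==> stable B f ==> stable (A \<inter> B) f"
 unfolding stable_def by blast

lemma stable_Un: "stable A f ==> stable B f ==> stable (A \<union> B) f"
 unfolding stable_def by blast

text \<open>The premap through which cumulants of permutations are defined: \<sigma> on the positive
  points, its mirrored inverse on the negative ones.\<close>

definition dbl :: "(int => int) => int => int" where
 "dbl \<sigma> = \<sigma> \<circ> uminus \<circ> pinv \<sigma> \<circ> uminus"

lemma permutes_pos:
 assumes "s permutes A" "ix_set A" "0 \<le> x" shows "0 \<le> s x"
proof (cases "x \<in> A")
 case True
 hence "s x \<in> A" using permutes_in_image[OF assms(1)] by simp
 thus ?thesis using assms(2) by (force simp: ix_set_def)
next
 case False
 thus ?thesis using assms(3) permutes_not_in[OF assms(1)] by simp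
qed

lemma dbl_nonneg:
 assumes "s permutes A" "ix_set A" "0 \<le> x" shows "dbl s x = s x"
proof -
 have "- x \<notin> A" using assms(2,3) by (force simp: ix_set_def)
 hence "pinv s (- x) = - x" by (rule permutes_not_in[OF permutes_inv[OF assms(1)]])
 thus ?thesis by (simp add: dbl_def)
qed

lemma dbl_neg:
 assumes "s permutes A" "ix_set A" "0 \<le> x" shows "dbl s (- x) = - pinv s x"
proof -
 have "0 \<le> pinv s x" by (rule permutes_pos[OF permutes_inv[OF assms(1)] assms(2,3)])
 hence "- pinv s x \<notin> A" using assms(2) by (force simp: ix_set_def)
 hence "s (- pinv s x) = - pinv s x" by (rule permutes_not_in[OF assms(1)])
 thus ?thesis by (simp add: dbl_def)
qed

lemma ix_nonneg: "ix_set A ==> x \<in> A ==> 0 \<le> x"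
 by (force simp: ix_set_def)

lemma stable_dbl:
 assumes "s permutes A" "ix_set A" shows "stable A (dbl s)" "stable (uminus ` A) (dbl s)"
proof -
 show "stable A (dbl s)" unfolding stable_def proof (rule image_subsetI)
  fix x assume "x \<in> A"
  thus "dbl s x \<in> A" using dbl_nonneg[OF assms ix_nonneg[OF assms(2)]] permutes_in_image[OF assms(1)] by simp
 qed
 show "stable (uminus ` A) (dbl s)" unfolding stable_def proof (rule image_subsetI)
  fix x assume "x \<in> uminus ` A"
  then obtain y where y: "x = - y" "y \<in> A" by blast
  thus "dbl s x \<in> uminus ` A"
   using dbl_neg[OF assms ix_nonneg[OF assms(2) y(2)]] permutes_in_image[OF permutes_inv[OF assms(1)]] by simp
 qed
qed

lemma index_set_neg:
 assumes "ix_set A" "x \<in> A" shows "- x \<notin> A"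
proof
 assume "- x \<in> A"
 hence "0 < x" "0 < - x" using assms unfolding ix_set_def by blast+
 thus False by simp
qed

lemma neg_notin_index_set:
 assumes "ix_set A" "x \<in> A" shows "x \<notin> uminus ` A"
proof
 assume "x \<in> uminus ` A"
 hence "- x \<in> A" by auto
 thus False using index_set_neg[OF assms] by simp
qed

lemma dbl_PM:
 assumes "s permutes A" "ix_set A" shows "dbl s \<in> PM A"
proof (rule PM_I)
 have b: "bij s" "bij (pinv s)" using permutes_bij assms(1) permutes_inv[OF assms(1)] by blast+
 have u: "bij (uminus :: int => int)" by (rule bij_uminus)
 have bd: "bij (dbl s)" unfolding dbl_def by (intro bij_comp u b)
 have fix': "dbl s x = x" if "x \<notin> pm A" for x proof (cases "0 \<le> x")
  case True
  have "x \<notin> A" using that by (simp add: signed_set_def)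
  thus ?thesis using dbl_nonneg[OF assms True] permutes_not_in[OF assms(1)] by simp
 next
  case False
  have "- x \<notin> A" using that by (force simp: signed_set_def)
  hence "pinv s (- x) = - x" by (rule permutes_not_in[OF permutes_inv[OF assms(1)]])
  thus ?thesis using dbl_neg[OF assms, of "- x"] False by simp
 qed
 show "dbl s permutes pm A" unfolding permutes_def using fix' bd[unfolded bij_iff] by blast
 show "dbl s (- dbl s (- k)) = k" for k unfolding dbl_def by (simp add: permutes_inverses[OF assms(1)])
 fix k assume "k \<in> pm A"
 then consider "k \<in> A" | "k \<in> uminus ` A" by (auto simp: signed_set_def)
 thus "- k \<notin> orbit (dbl s) k" proof cases
  case 1
  hence "- k \<notin> A" by (rule index_set_neg[OF assms(2)])
  thus ?thesis using stable_orbit[OF stable_dbl(1)[OF assms] 1] by blast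
 next
  case 2
  hence "- k \<in> A" by force
  hence "- k \<notin> uminus ` A" by (rule neg_notin_index_set[OF assms(2)])
  thus ?thesis using stable_orbit[OF stable_dbl(2)[OF assms] 2] by blast
 qed
qed

lemma perm_restrict_dbl:
 assumes "s permutes A" "ix_set A" shows "perm_restrict (dbl s) A = s"
proof
 fix x
 show "perm_restrict (dbl s) A x = s x" using dbl_nonneg[OF assms ix_nonneg[OF assms(2)], of x] permutes_not_in[OF assms(1), of x]
  by (simp add: perm_restrict_def)
qed

lemma inj_on_dbl: "ix_set A ==> inj_on dbl {s. s permutes A}"
 by (rule inj_on_inverseI[where g = "\<lambda>r. perm_restrict r A"]) (simp add: perm_restrict_dbl)

lemma orbit_dbl:
 assumes "s permutes A" "ix_set A" "x \<in> A" shows "orbit (dbl s) x = orbit s x"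
 using orbit_perm_restrict[OF stable_dbl(1)[OF assms(1,2)] assms(3)] unfolding perm_restrict_dbl[OF assms(1,2)] by (rule sym)

lemma support_dbl:
 assumes "s permutes A" "ix_set A" "x \<in> A" shows "support (dbl s) x = support s x"
 by (rule support_cong[OF dbl_nonneg[OF assms(1,2) ix_nonneg[OF assms(2)]] stable_dbl(1)[OF assms(1,2)] assms(3)])

text \<open>No cycle of a doubled permutation through a point of \<open>pm A\<close> mixes signs, so
  the positive cycles are those of s itself.\<close>

lemma pos_cycles_dbl:
 assumes "s permutes A" "ix_set A" shows "pos_cycles A (dbl s) = cycle_blocks A s"
proof -
 note P = dbl_PM[OF assms]
 note bl = cycle_blocks_block[OF PM_permutes[OF P] PM_perm[OF P assms(2)] finite_pm[OF assms(2)]]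
 have o: "orbit (dbl s) x \<in> cycle_blocks (pm A) (dbl s)" if "x \<in> pm A" for x using that by (simp add: cycle_blocks_def)
 have 1: "Min (abs ` orbit (dbl s) x) \<in> orbit (dbl s) x" if x: "x \<in> A" for x proof -
  have xs: "x \<in> pm A" using x by (simp add: signed_set_def)
  have "orbit (dbl s) x \<subseteq> A" by (rule stable_orbit[OF stable_dbl(1)[OF assms] x])
  hence e: "abs ` orbit (dbl s) x = orbit (dbl s) x" using ix_nonneg[OF assms(2)] by (force simp: image_iff)
  show ?thesis unfolding e by (rule Min_in[OF bl(3)[OF o[OF xs]] bl(2)[OF o[OF xs]]])
 qed
 have 2: "Min (abs ` orbit (dbl s) x) \<notin> orbit (dbl s) x" if x: "x \<in> uminus ` A" for x proof
  assume "Min (abs ` orbit (dbl s) x) \<in> orbit (dbl s) x"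
  hence m: "Min (abs ` orbit (dbl s) x) \<in> uminus ` A" using stable_orbit[OF stable_dbl(2)[OF assms] x] by blast
  have xs: "x \<in> pm A" using x by (simp add: signed_set_def)
  have "Min (abs ` orbit (dbl s) x) \<in> abs ` orbit (dbl s) x" using bl(2,3)[OF o[OF xs]] by simp
  hence "0 \<le> Min (abs ` orbit (dbl s) x)" by force
  thus False using m assms(2) by (force simp: ix_set_def)
 qed
 have "pos_cycles A (dbl s) = orbit (dbl s) ` A" unfolding pos_cycles_def cycle_blocks_def proof (intro equalityI subsetI)
  fix B assume "B \<in> {B \<in> orbit (dbl s) ` pm A. Min (abs ` B) \<in> B}"
  then obtain x where x: "B = orbit (dbl s) x" "x \<in> pm A" "Min (abs ` orbit (dbl s) x) \<in> orbit (dbl s) x" by blast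
  hence "x \<in> A" using 2[of x] by (auto simp: signed_set_def)
  thus "B \<in> orbit (dbl s) ` A" using x(1) by simp
 next
  fix B assume "B \<in> orbit (dbl s) ` A"
  thus "B \<in> {B \<in> orbit (dbl s) ` pm A. Min (abs ` B) \<in> B}" using 1 by (auto simp: signed_set_def)
 qed
 also have "... = orbit s ` A" by (rule image_cong[OF refl orbit_dbl[OF assms]])
 finally show ?thesis by (simp add: cycle_blocks_def)
qed

text \<open>The positive points contribute the cycles of t s^(-1), the negative ones, after
  negation, those of t^(-1) s. Commutation and inversion identify both counts with that of s^(-1)
  t.\<close>

lemma loops_dbl:
 assumes "s permutes A" "t permutes A" "ix_set A" shows "loops A (dbl t) (dbl s) = num_cycles A (pinv s \<circ> t)"
proof -
 note P = dbl_PM[OF assms(1,3)] dbl_PM[OF assms(2,3)]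
 note st = stable_dbl[OF assms(1,3)] stable_dbl[OF assms(2,3)]
 note pr = perm_restrict_dbl[OF assms(1,3)] perm_restrict_dbl[OF assms(2,3)]
 have fA: "finite A" using assms(3) by (rule ix_finite)
 have b: "bij (dbl s)" "bij (dbl t)" using P PM_bij by blast+
 let ?g = "dbl t \<circ> pinv (dbl s)"
 have sg: "stable A ?g" "stable (uminus ` A) ?g"
  using stable_comp[OF st(3) stable_pinv[OF st(1) b(1) fA]] stable_comp[OF st(4) stable_pinv[OF st(2) b(1)]] fA by blast+
 have pg: "permutation ?g"
  by (rule perm_perm[OF permutes_compose[OF permutes_inv[OF PM_permutes[OF P(1)]] PM_permutes[OF P(2)]] finite_pm[OF assms(3)]])
 have d: "A \<inter> uminus ` A = {}" using neg_notin_index_set[OF assms(3)] by blast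
 have A: "num_cycles A ?g = num_cycles A (t \<circ> pinv s)" using num_cycles_perm_restrict[OF sg(1)]
  unfolding perm_restrict_comp_stable[OF stable_pinv[OF st(1) b(1) fA]] pr(2) pinv_perm_restrict[OF st(1) b(1) fA, symmetric] pr(1)
  by (rule sym)
 have e: "?g (- y) = - (pinv (dbl t) \<circ> dbl s) y" for y using PM_pinv[OF P(1), of "- y"] PM_pinv[OF P(2), of "dbl s y"] by simp
 have "num_cycles (uminus ` A) ?g = num_cycles A (pinv (dbl t) \<circ> dbl s)"
  by (rule num_cycles_map[where h = "uminus :: int => int" and f = "pinv (dbl t) \<circ> dbl s" and g = ?g, OF e]) (rule injI, simp)
 also have "... = num_cycles A (pinv t \<circ> s)"
  using num_cycles_perm_restrict[OF stable_comp[OF stable_pinv[OF st(3) b(2) fA] st(1)]]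
  unfolding perm_restrict_comp_stable[OF st(1)] pr(1) pinv_perm_restrict[OF st(3) b(2) fA, symmetric] pr(2) by (rule sym)
 also have "... = num_cycles A (pinv (pinv t \<circ> s))"
  by (rule num_cycles_inv[symmetric], rule perm_perm[OF permutes_compose[OF assms(1) permutes_inv[OF assms(2)]] fA])
 also have "pinv (pinv t \<circ> s) = pinv s \<circ> t"
  by (rule inv_unique_comp) (simp_all add: fun_eq_iff permutes_inverses[OF assms(1)] permutes_inverses[OF assms(2)])
 finally have B: "num_cycles (uminus ` A) ?g = num_cycles A (pinv s \<circ> t)" .
 have "num_cycles (pm A) ?g = num_cycles A (pinv s \<circ> t) + num_cycles A (pinv s \<circ> t)"
  unfolding signed_set_def num_cycles_Un[OF sg d fA finite_imageI[OF fA] pg] A B num_cycles_comp_commute[OF assms(2)] ..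
 thus ?thesis by (simp add: loops_def)
qed

text \<open>On doubled permutations the defect is the usual genus deficiency of s relative to
  t.\<close>

lemma defect_dbl:
 assumes "s permutes A" "t permutes A" "ix_set A"
 shows "defect A (dbl t) (dbl s) + num_cycles A (pinv s \<circ> t) + num_cycles A s = card A + num_cycles A t"
 using defect_eq[OF dbl_PM[OF assms(2,3)] dbl_PM[OF assms(1,3)] assms(3)]
 unfolding loops_dbl[OF assms] pos_cycles_dbl[OF assms(1,3)] pos_cycles_dbl[OF assms(2,3)] num_cycles_def .

text \<open>Once the positive points are preserved, the premap relation determines the negative
  side.\<close>

lemma stable_imp_dbl:
 assumes "r \<in> PM A" "ix_set A" "stable A r"
 obtains S where "S permutes A" "r = dbl S" proof
 have fA: "finite A" using assms(2) by (rule ix_finite)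
 have b: "bij r" using PM_bij[OF assms(1)] .
 let ?s = "perm_restrict r A"
 show s: "?s permutes A" by (rule perm_restrict_permutes[OF assms(3) bij_is_inj[OF b] fA])
 show "r = dbl ?s" proof
  fix x
  show "r x = dbl ?s x" proof (cases "0 \<le> x")
   case True
   have "r x = x" if "x \<notin> A" proof (rule permutes_not_in[OF PM_permutes[OF assms(1)]])
    show "x \<notin> pm A" unfolding in_signed_set[OF assms(2)] using that True by simp
   qed
   thus ?thesis unfolding dbl_nonneg[OF s assms(2) True] by (simp add: perm_restrict_def)
  next
   case False
   have "r x = x" if "- x \<notin> A" proof (rule permutes_not_in[OF PM_permutes[OF assms(1)]])
    show "x \<notin> pm A" unfolding in_signed_set[OF assms(2)] using that False by simp
   qed
   moreover have "- pinv r (- x) = r x" unfolding PM_pinv[OF assms(1)] by simp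
   ultimately show ?thesis using dbl_neg[OF s assms(2), of "- x"] False
    unfolding pinv_perm_restrict[OF assms(3) b fA] by (simp add: perm_restrict_def)
  qed
 qed
qed

lemma index_set_interval [simp]: "0 < a ==> ix_set {a..b}"
 by (simp add: ix_set_def)

text \<open>Defect zero keeps r inside cycles of the doubled long cycle, each of constant sign. So r
  is itself doubled, and the defect equation becomes the noncrossing count n + 1.\<close>

lemma defect_zero_tau1:
 assumes "n \<ge> 1"
 defines "A \<equiv> {1..int n}" shows "{r \<in> PM A. defect A (dbl (tau1 n)) r = 0} = dbl ` S_nc n" proof -
 have ix: "ix_set A" by (simp add: A_def)
 have tA: "tau1 n permutes A" unfolding A_def by (rule tau1_permutes)
 have c: "card A = n" "num_cycles A (tau1 n) = 1" using tau1_in_S_nc(2)[OF assms(1)] by (simp_all add: A_def num_cycles_def)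
 have e: "defect A (dbl (tau1 n)) (dbl S) = 0 \<longleftrightarrow> S \<in> S_nc n" if "S permutes A" for S
  using defect_dbl[OF that tA ix] that unfolding c by (auto simp: S_nc_def A_def)
 have "r \<in> dbl ` S_nc n" if r: "r \<in> PM A" "defect A (dbl (tau1 n)) r = 0" for r proof -
  have "stable A r" unfolding stable_def proof (rule image_subsetI)
   fix x assume "x \<in> A"
   thus "r x \<in> A" using defect_zero_refines[OF dbl_PM[OF tA ix] r(1) ix r(2)] stable_orbit[OF stable_dbl(1)[OF tA ix]] by blast
  qed
  then obtain S where s: "S permutes A" "r = dbl S" by (rule stable_imp_dbl[OF r(1) ix])
  thus ?thesis using e[OF s(1)] r(2) by simp
 qed
 moreover have "dbl S \<in> PM A \<and> defect A (dbl (tau1 n)) (dbl S) = 0" if s: "S \<in> S_nc n" for S proof -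
  have p: "S permutes A" using s by (simp add: S_nc_def A_def)
  show ?thesis using e[OF p] dbl_PM[OF p ix] s by simp
 qed
 ultimately show ?thesis by (intro equalityI subsetI) (simp, elim imageE, simp)
qed

text \<open>As for one circle, r is doubled. In addition its cycles lie inside those of
  \<open>tau2\<close>, which is the refinement required in the disc case.\<close>

lemma defect_zero_tau2:
 assumes "p \<ge> 1" "q \<ge> 1"
 defines "A \<equiv> {1..int (p + q)}" shows "{r \<in> PM A. defect A (dbl (tau2 p q)) r = 0} = dbl ` S_disc_nc p q" proof -
 let ?t = "tau2 p q"
 have ix: "ix_set A" by (simp add: A_def)
 have tA: "?t permutes A" unfolding A_def by (rule tau2_permutes)
 have "{1..int p} \<noteq> {int p + 1..int (p + q)}" using assms(1) by auto
 hence c: "card A = p + q" "num_cycles A ?t = 2"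
  using tau2_cycles(3)[OF assms(1,2)] by (simp_all add: A_def num_cycles_def del: of_nat_add)
 have e: "defect A (dbl ?t) (dbl S) = 0 \<longleftrightarrow> num_cycles A S + num_cycles A (pinv S \<circ> ?t) = p + q + 2"
  if "S permutes A" for S using defect_dbl[OF that tA ix] unfolding c by linarith
 have "r \<in> dbl ` S_disc_nc p q" if r: "r \<in> PM A" "defect A (dbl ?t) r = 0" for r proof -
  note ref = defect_zero_refines[OF dbl_PM[OF tA ix] r(1) ix r(2)]
  have "stable A r" unfolding stable_def proof (rule image_subsetI)
   fix x assume "x \<in> A"
   thus "r x \<in> A" using ref stable_orbit[OF stable_dbl(1)[OF tA ix]] by blast
  qed
  then obtain S where s: "S permutes A" "r = dbl S" by (rule stable_imp_dbl[OF r(1) ix])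
  have pt: "permutation ?t" and fA: "finite A" using perm_perm[OF tA] by (simp_all add: A_def)
  have step: "S y \<in> orbit ?t y" if "y \<in> A" for y
   using ref[of y] dbl_nonneg[OF s(1) ix ix_nonneg[OF ix that]] orbit_dbl[OF tA ix that] s(2) by simp
  have "orbit S x \<subseteq> orbit ?t x" if x: "x \<in> A" for x proof (rule stable_orbit[OF _ permutation_self_in_orbit[OF pt]])
   show "stable (orbit ?t x) S" unfolding stable_def proof (rule image_subsetI)
    fix y assume y: "y \<in> orbit ?t x"
    have yA: "y \<in> A" using permutes_orbit_subset[OF tA x] y by blast
    have "orbit ?t y = orbit ?t x" by (rule orbit_cyclic_eq3[OF cyclic_on_orbit'[OF pt] y])
    thus "S y \<in> orbit ?t x" using step[OF yA] by simp
   qed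
  qed
  hence "refines A (cycle_blocks A S) (cycle_blocks A ?t)"
   unfolding refines_def using partition_on_cycle_blocks[OF s(1) fA] partition_on_cycle_blocks[OF tA fA]
   by (auto simp: cycle_blocks_def)
  hence "S \<in> S_disc_nc p q" using e[OF s(1)] s r(2) unfolding S_disc_nc_def A_def by simp
  thus ?thesis using s(2) by blast
 qed
 moreover have "dbl S \<in> PM A \<and> defect A (dbl ?t) (dbl S) = 0" if s: "S \<in> S_disc_nc p q" for S proof -
  have p: "S permutes A" "num_cycles A S + num_cycles A (pinv S \<circ> ?t) = p + q + 2" using s by (simp_all add: S_disc_nc_def A_def)
  show ?thesis using e[OF p(1)] dbl_PM[OF p(1) ix] p(2) by simp
 qed
 ultimately show ?thesis by (intro equalityI subsetI) (simp, elim imageE, simp)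
qed

text \<open>If two pairs of cycles are joined by another premap without becoming a single joint orbit, then
 that premap respects the relative orientation in which it joins them.\<close>

lemma stable_two_cycles:
 assumes P: "\<pi> \<in> PM I" "r \<in> PM I" and ix: "ix_set I"
  and I: "pm I = orbit \<pi> a \<union> orbit \<pi> b \<union> (orbit \<pi> (- a) \<union> orbit \<pi> (- b))"
  and two: "2 \<le> card (joint_orbits I \<pi> r)"
  and x: "x \<in> orbit \<pi> a" "r x \<in> orbit \<pi> b \<or> r (- x) \<in> orbit \<pi> (- b)"
 shows "stable (orbit \<pi> a \<union> orbit \<pi> b) r" proof (rule ccontr)
 let ?L = "linked (graph \<pi> \<union> graph r)"
 note pp = PM_perm[OF P(1) ix] PM_perm[OF P(2) ix]
 have L\<pi>: "y \<in> orbit \<pi> z ==> ?L `` {y} = ?L `` {z}" for y z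
  using linked_orbit[OF pp(1), of "graph r" y] linked_orbit[OF pp(1), of "graph r" z]
   orbit_cyclic_eq3[OF cyclic_on_orbit'[OF pp(1)], of y z] by simp
 have Lr: "?L `` {r y} = ?L `` {y}" for y proof -
  have "(y, r y) \<in> ?L" by (rule linked_base) (simp add: graph_def)
  thus ?thesis using linked_class_eq by metis
 qed
 have Lrn: "?L `` {- r y} = ?L `` {- y}" for y using Lr[of "- r y"] PM_neg[OF P(2), of "- y"] by simp
 have neg: "- y \<in> orbit \<pi> (- z)" if "y \<in> orbit \<pi> z" for y z
  unfolding PM_orbit_neg[OF P(1) ix] using that by (rule imageI)
 \<comment> \<open>The link at x and its mirror image place a with b, and -a with -b, in common
   joint orbits.\<close>
 have ab: "?L `` {a} = ?L `` {b}" "?L `` {- a} = ?L `` {- b}" proof -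
  have xa: "?L `` {x} = ?L `` {a}" "?L `` {- x} = ?L `` {- a}" using L\<pi>[OF x(1)] L\<pi>[OF neg[OF x(1)]] by simp_all
  have "?L `` {x} = ?L `` {b} \<and> ?L `` {- x} = ?L `` {- b}" using x(2) proof
   assume h: "r x \<in> orbit \<pi> b"
   show ?thesis using L\<pi>[OF h] L\<pi>[OF neg[OF h]] Lr[of x] Lrn[of x] by simp
  next
   assume h: "r (- x) \<in> orbit \<pi> (- b)"
   show ?thesis using L\<pi>[OF h] L\<pi>[OF neg[OF h]] Lr[of "- x"] Lrn[of "- x"] by simp
  qed
  thus "?L `` {a} = ?L `` {b}" "?L `` {- a} = ?L `` {- b}" using xa by simp_all
 qed
 assume "\<not> stable (orbit \<pi> a \<union> orbit \<pi> b) r"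
 then obtain z where z: "z \<in> orbit \<pi> a \<union> orbit \<pi> b" "r z \<notin> orbit \<pi> a \<union> orbit \<pi> b"
  unfolding stable_def by blast
 have "z \<in> pm I" unfolding I using z(1) by blast
 hence "r z \<in> pm I" using PM_in[OF P(2)] by simp
 hence "r z \<in> orbit \<pi> (- a) \<union> orbit \<pi> (- b)" using z(2) unfolding I by blast
 hence "?L `` {r z} = ?L `` {- a}" using L\<pi>[of "r z" "- a"] L\<pi>[of "r z" "- b"] ab by fastforce
 moreover have "?L `` {z} = ?L `` {a}" using L\<pi>[of z a] L\<pi>[of z b] ab z(1) by fastforce
 \<comment> \<open>A step into the opposite orientation links a with -a as well, which leaves a
   single joint orbit.\<close>
 ultimately have aa: "?L `` {- a} = ?L `` {a}" using Lr[of z] by simp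
 have one: "?L `` {y} = ?L `` {a}" if y: "y \<in> pm I" for y proof -
  consider "y \<in> orbit \<pi> a" | "y \<in> orbit \<pi> b" | "y \<in> orbit \<pi> (- a)" | "y \<in> orbit \<pi> (- b)"
   using y unfolding I by blast
  thus ?thesis by cases (use L\<pi> ab aa in \<open>simp_all\<close>)
 qed
 have "joint_orbits I \<pi> r \<subseteq> {?L `` {a}}" unfolding joint_orbits_def components_def using one by blast
 hence "card (joint_orbits I \<pi> r) \<le> card {?L `` {a}}" by (rule card_mono[rotated]) simp
 thus False using two by simp
qed

section \<open>Odd relabellings of the signed indices\<close>

definition odd_bij :: "(int => int) => bool" where
 "odd_bij F \<longleftrightarrow> bij F \<and> (\<forall>x. F (- x) = - F x)"

lemma odd_bijD: "odd_bij F ==> bij F" "odd_bij F ==> F (- x) = - F x"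
 by (simp_all add: odd_bij_def)

definition relabel :: "(int => int) => (int => int) => int => int" where
 "relabel F \<rho> = F \<circ> \<rho> \<circ> pinv F"

lemma relabel_apply: "bij F ==> relabel F r (F x) = F (r x)"
 by (simp add: relabel_def bij_is_inj)

lemma relabel_orbit: "bij F ==> orbit (relabel F r) (F x) = F ` orbit r x"
 by (rule orbit_map) (rule relabel_apply)

lemma relabel_support: "bij F ==> support (relabel F r) (F x) = map F (support r x)"
 by (rule support_map[where g = "relabel F r" and h = F and f = r and x = x, OF relabel_apply bij_is_inj])

lemma odd_bij_pinv:
 assumes "odd_bij F" shows "odd_bij (pinv F)" unfolding odd_bij_def
proof (intro conjI allI)
 show "bij (pinv F)" by (rule bij_imp_bij_inv[OF odd_bijD(1)[OF assms]])
 fix x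
 have "F (- pinv F x) = - x" unfolding odd_bijD(2)[OF assms] surj_f_inv_f[OF bij_is_surj[OF odd_bijD(1)[OF assms]]] ..
 thus "pinv F (- x) = - pinv F x" using inv_f_f[OF bij_is_inj[OF odd_bijD(1)[OF assms]], of "- pinv F x"] by simp
qed

lemma relabel_pinv:
 assumes "bij F" shows "relabel (pinv F) (relabel F r) = r" "relabel F (relabel (pinv F) r) = r"
 using assms by (simp_all add: relabel_def fun_eq_iff inv_inv_eq bij_is_inj bij_is_surj surj_f_inv_f)

lemma stable_relabel:
 assumes "bij F" shows "stable (F ` S) (relabel F r) \<longleftrightarrow> stable S r"
 unfolding stable_def image_image relabel_apply[OF assms] image_subset_iff inj_image_mem_iff[OF bij_is_inj[OF assms]] ..

lemma relabel_PM:
 assumes F: "odd_bij F" "F ` pm A = pm B" and r: "r \<in> PM A" shows "relabel F r \<in> PM B"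
proof (rule PM_I)
 note b = odd_bijD(1)[OF F(1)] and neg = odd_bijD(2)[OF F(1)]
 have m: "F x \<in> pm B \<longleftrightarrow> x \<in> pm A" for x
  unfolding F(2)[symmetric] by (rule inj_image_mem_iff[OF bij_is_inj[OF b]])
 have bb: "bij (relabel F r)" unfolding relabel_def by (intro bij_comp bij_imp_bij_inv b PM_bij[OF r])
 have ex: "\<exists>x. k = F x" for k using bij_is_surj[OF b] by (metis surjD)
 have "relabel F r k = k" if "k \<notin> pm B" for k proof -
  obtain x where x: "k = F x" using ex by blast
  hence "x \<notin> pm A" using that m by simp
  thus ?thesis unfolding x relabel_apply[OF b] using permutes_not_in[OF PM_permutes[OF r]] by simp
 qed
 thus "relabel F r permutes pm B" unfolding permutes_def using bb[unfolded bij_iff] by blast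
 fix k
 obtain x where x: "k = F x" using ex by blast
 show "relabel F r (- relabel F r (- k)) = k" unfolding x neg[symmetric] relabel_apply[OF b] PM_neg[OF r] ..
 show "- k \<notin> orbit (relabel F r) k" if k: "k \<in> pm B"
  unfolding x neg[symmetric] relabel_orbit[OF b] inj_image_mem_iff[OF bij_is_inj[OF b]] using PM_no_flip[OF r] k unfolding x m .
qed

text \<open>Oddness makes relabelling commute with negation, so pairs of cycles, loops and hence the
  defect are preserved.\<close>

lemma relabel_defect:
 assumes F: "odd_bij F" "F ` pm A = pm B" and ix: "ix_set A" "ix_set B" and P: "\<pi> \<in> PM A" "r \<in> PM A"
 shows "defect B (relabel F \<pi>) (relabel F r) = defect A \<pi> r" proof -
 note b = odd_bijD(1)[OF F(1)] and neg = odd_bijD(2)[OF F(1)]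
 note Q = relabel_PM[OF F P(1)] relabel_PM[OF F P(2)]
 have "card (pm B) = card (pm A)" unfolding F(2)[symmetric] by (rule card_image[OF inj_on_subset[OF bij_is_inj[OF b] subset_UNIV]])
 hence c: "card B = card A" unfolding card_signed_set[OF ix(1)] card_signed_set[OF ix(2)] by simp
 have n: "card (pos_cycles B (relabel F v)) = card (pos_cycles A v)" if s: "v \<in> PM A" for v
  using num_cycles_PM[OF relabel_PM[OF F s] ix(2)] num_cycles_PM[OF s ix(1)]
   num_cycles_map[where h = F and f = v and g = "relabel F v" and S = "pm A", OF relabel_apply[OF b] bij_is_inj[OF b]]
  unfolding F(2) by simp
 have e: "(relabel F \<pi> \<circ> pinv (relabel F r)) (F y) = F ((\<pi> \<circ> pinv r) y)" for y
  using PM_pinv[OF Q(2), of "F y"] PM_pinv[OF P(2), of y] neg[of y] neg[of "r (- y)"] relabel_apply[OF b, of r "- y"]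
   relabel_apply[OF b, of \<pi> "- r (- y)"] by simp
 have "loops B (relabel F \<pi>) (relabel F r) = loops A \<pi> r" unfolding loops_def F(2)[symmetric]
  using num_cycles_map[where h = F and f = "\<pi> \<circ> pinv r" and g = "relabel F \<pi> \<circ> pinv (relabel F r)" and S = "pm A", OF e bij_is_inj[OF b]]
  by simp
 thus ?thesis unfolding defect_def c n[OF P(1)] n[OF P(2)] by simp
qed

lemma bij_betw_relabel:
 assumes F: "odd_bij F" "F ` pm A = pm B" shows "bij_betw (relabel F) (PM A) (PM B)"
proof (rule bij_betw_byWitness[where f' = "relabel (pinv F)"])
 note b = odd_bijD(1)[OF F(1)]
 have G: "pinv F ` pm B = pm A" unfolding F(2)[symmetric] image_image using bij_is_inj[OF b] by simp
 show "\<forall>r\<in>PM A. relabel (pinv F) (relabel F r) = r" "\<forall>r\<in>PM B. relabel F (relabel (pinv F) r) = r"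
  by (simp_all add: relabel_pinv[OF b])
 show "relabel F ` PM A \<subseteq> PM B" using relabel_PM[OF F] by blast
 show "relabel (pinv F) ` PM B \<subseteq> PM A" using relabel_PM[OF odd_bij_pinv[OF F(1)] G] by blast
qed

text \<open>The intertwining has to be checked on positive points only; the premap relation
  transfers it to the negative ones.\<close>

lemma relabel_dbl_eq:
 assumes F: "odd_bij F" "F ` pm A = pm I" and ix: "ix_set A"
  and t: "t permutes A" and \<pi>: "\<pi> \<in> PM I" and step: "\<And>x. x \<in> A ==> F (t x) = \<pi> (F x)"
 shows "relabel F (dbl t) = \<pi>" proof
 fix k
 note b = odd_bijD(1)[OF F(1)] and neg = odd_bijD(2)[OF F(1)]
 obtain x where x: "k = F x" using bij_is_surj[OF b] by (metis surjD)
 consider "x \<in> A" | z where "x = - z" "z \<in> A" | "x \<notin> pm A" by (auto simp: signed_set_def)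
 thus "relabel F (dbl t) k = \<pi> k" proof cases
  case 1
  thus ?thesis unfolding x relabel_apply[OF b] using dbl_nonneg[OF t ix ix_nonneg[OF ix]] step by simp
 next
  case (2 z)
  have w: "pinv t z \<in> A" "t (pinv t z) = z"
   using 2(2) permutes_in_image[OF permutes_inv[OF t]] permutes_inverses(1)[OF t] by simp_all
  have "\<pi> (- F z) = - F (pinv t z)" using step[OF w(1)] w(2) PM_neg[OF \<pi>, of "- F (pinv t z)"] by simp
  thus ?thesis unfolding x relabel_apply[OF b] 2(1) using dbl_neg[OF t ix ix_nonneg[OF ix 2(2)]] neg by simp
 next
  case 3
  hence "F x \<notin> pm I" unfolding F(2)[symmetric] inj_image_mem_iff[OF bij_is_inj[OF b]] .
  thus ?thesis unfolding x relabel_apply[OF b] using permutes_not_in[OF PM_permutes[OF \<pi>]]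
    permutes_not_in[OF PM_permutes[OF dbl_PM[OF t ix]] 3] by simp
 qed
qed

lemma support_step:
 assumes "permutation f" "i < length (support f a)" shows "f (support f a ! i) = support f a ! (Suc i mod length (support f a))"
proof -
 define L where "L = least_power f a"
 have L: "(f ^^ L) a = a" "0 < L" unfolding L_def using least_power_of_permutation[OF assms(1)] by blast+
 have i: "i < L" using assms(2) by (simp add: L_def)
 have n: "support f a ! j = (f ^^ j) a" if "j < L" for j using that by (simp add: L_def)
 have len: "length (support f a) = L" by (simp add: L_def)
 show ?thesis proof (cases "Suc i < L")
  case True
  thus ?thesis unfolding len using n[OF i] n[OF True] by simp
 next
  case False
  hence "Suc i = L" using i by simp
  thus ?thesis unfolding len using n[OF i] n[OF L(2)] L(1) by (metis funpow.simps(1,2) comp_apply id_apply mod_self)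
 qed
qed

section \<open>Annular premaps and their two orientations\<close>

lemma tau2_apply:
 assumes "p \<ge> 1" "q \<ge> 1" shows "x \<in> {1..int p} ==> tau2 p q x = (if x = int p then 1 else x + 1)"
  "x \<in> {int p + 1..int (p + q)} ==> tau2 p q x = (if x = int (p + q) then int p + 1 else x + 1)"
proof -
 have pt: "permutation (tau2 p q)" by (rule perm_perm[OF tau2_permutes]) simp
 have gen: "tau2 p q x = (if x = v then u else x + 1)" if s: "support (tau2 p q) u = [u..v]" and x: "x \<in> {u..v}" for u v x proof -
  let ?i = "nat (x - u)"
  have len: "length [u..v] = nat (v - u + 1)" by simp
  have i: "?i < length [u..v]" using x by auto
  have xi: "[u..v] ! ?i = x" using x by (subst nth_upto) auto
  have "tau2 p q x = [u..v] ! (Suc ?i mod nat (v - u + 1))" using support_step[OF pt, of ?i u] i xi unfolding s len by simp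
  also have "... = (if x = v then u else x + 1)" proof (cases "x = v")
   case True
   hence "Suc ?i = nat (v - u + 1)" using x by auto
   thus ?thesis using True x by (simp add: nth_upto)
  next
   case False
   hence "Suc ?i < nat (v - u + 1)" using x by auto
   thus ?thesis using False x by (subst mod_less) (auto simp: nth_upto)
  qed
  finally show ?thesis .
 qed
 show "x \<in> {1..int p} ==> tau2 p q x = (if x = int p then 1 else x + 1)" by (rule gen[OF tau2_cycles(1)[OF assms]])
 show "x \<in> {int p + 1..int (p + q)} ==> tau2 p q x = (if x = int (p + q) then int p + 1 else x + 1)"
  by (rule gen[OF tau2_cycles(2)[OF assms]])
qed

text \<open>The reversal of the second circle, which accounts for the terms with transposes.\<close>

definition flip :: "nat => nat => int => int" where
 "flip p q x = (if int p < x \<and> x \<le> int (p + q) then x - int (2 * p + q + 1)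
   else if - int (p + q) \<le> x \<and> x < - int p then x + int (2 * p + q + 1) else x)"

lemma flip_flip [simp]: "flip p q (flip p q x) = x"
 by (simp add: flip_def)

lemma flip_uminus: "flip p q (- x) = - flip p q x"
 by (auto simp: flip_def)

lemma odd_bij_flip: "odd_bij (flip p q)"
 unfolding odd_bij_def using flip_uminus by (auto intro!: o_bij[of "flip p q"])

lemma pinv_flip: "pinv (flip p q) = flip p q"
 by (rule inv_unique_comp) (simp_all add: fun_eq_iff)

lemma flip_image:
 "flip p q ` {int p + 1..int (p + q)} = uminus ` {int p + 1..int (p + q)}"
 "flip p q ` {1..int p} = {1..int p}" "flip p q ` (uminus ` {1..int p}) = uminus ` {1..int p}"
 "flip p q ` (uminus ` {int p + 1..int (p + q)}) = {int p + 1..int (p + q)}"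
proof -
 show 1: "flip p q ` {int p + 1..int (p + q)} = uminus ` {int p + 1..int (p + q)}" proof (intro equalityI subsetI)
  fix x assume "x \<in> flip p q ` {int p + 1..int (p + q)}"
  thus "x \<in> uminus ` {int p + 1..int (p + q)}" by (auto simp: flip_def image_uminus_atLeastAtMost)
 next
  fix x assume "x \<in> uminus ` {int p + 1..int (p + q)}"
  hence "x = flip p q (x + int (2 * p + q + 1))" "x + int (2 * p + q + 1) \<in> {int p + 1..int (p + q)}"
   by (auto simp: flip_def image_uminus_atLeastAtMost)
  thus "x \<in> flip p q ` {int p + 1..int (p + q)}" by (rule image_eqI)
 qed
 show "flip p q ` {1..int p} = {1..int p}" "flip p q ` (uminus ` {1..int p}) = uminus ` {1..int p}" by (auto simp: flip_def image_iff)
 have "flip p q ` (flip p q ` {int p + 1..int (p + q)}) = {int p + 1..int (p + q)}" by (simp add: image_image)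
 thus "flip p q ` (uminus ` {int p + 1..int (p + q)}) = {int p + 1..int (p + q)}" unfolding 1 .
qed

lemma interval_split: "{1..int (p + q)} = {1..int p} \<union> {int p + 1..int (p + q)}"
 by auto

lemma flip_signed_set: "flip p q ` pm {1..int (p + q)} = pm {1..int (p + q)}"
 "flip p q ` pm {1..int p} = pm {1..int p}" unfolding signed_set_def interval_split image_Un flip_image by blast+

text \<open>Reversing the second circle and changing signs there each invert its direction, so
  together they preserve the doubled two-circle permutation.\<close>

lemma relabel_flip_dbl_tau2:
 assumes "p \<ge> 1" "q \<ge> 1" shows "relabel (flip p q) (dbl (tau2 p q)) = dbl (tau2 p q)"
proof (rule relabel_dbl_eq[OF odd_bij_flip flip_signed_set(1)])
 let ?A = "{1..int (p + q)}" and ?t = "tau2 p q"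
 show ix: "ix_set ?A" by simp
 show tA: "?t permutes ?A" by (rule tau2_permutes)
 show "dbl ?t \<in> PM ?A" by (rule dbl_PM[OF tA ix])
 fix x assume "x \<in> ?A"
 then consider "x \<in> {1..int p}" | "x \<in> {int p + 1..int (p + q)}" unfolding interval_split by blast
 thus "flip p q (?t x) = dbl ?t (flip p q x)" proof cases
  case 1
  hence "flip p q x = x" "flip p q (?t x) = ?t x" using tau2_apply(1)[OF assms 1] by (auto simp: flip_def)
  thus ?thesis using dbl_nonneg[OF tA ix, of x] 1 by simp
 next
  case 2
  \<comment> \<open>The end points p + 1 and p + q have sum c, so x \<mapsto> c - x reverses the
    second interval.\<close>
  define c where "c = int (2 * p + q + 1)"
  have t: "?t x \<in> {int p + 1..int (p + q)}" using tau2_apply(2)[OF assms 2] 2 assms by auto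
  have f: "flip p q x = - (c - x)" "flip p q (?t x) = - (c - ?t x)" using 2 t by (simp_all add: flip_def c_def)
  have "c - ?t x \<in> {int p + 1..int (p + q)}" using t by (auto simp: c_def)
  hence "?t (c - ?t x) = c - x" using tau2_apply(2)[OF assms] tau2_apply(2)[OF assms 2] 2 by (auto simp: c_def)
  hence i: "pinv ?t (c - x) = c - ?t x" using permutes_inverses(2)[OF tA] by metis
  have n: "0 \<le> c - x" using 2 by (simp add: c_def)
  show ?thesis unfolding f dbl_neg[OF tA ix n] i ..
 qed
qed

lemma stable_dbl_iff:
 assumes "s permutes A" "ix_set A" "J \<subseteq> A" shows "sstable J (dbl s) \<longleftrightarrow> stable J s"
proof
 assume st: "sstable J (dbl s)"
 show "stable J s" unfolding stable_def proof (rule image_subsetI)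
  fix x assume x: "x \<in> J"
  have n: "0 \<le> x" using ix_nonneg[OF assms(2)] assms(3) x by blast
  have "x \<in> pm J" using x by (simp add: signed_set_def)
  hence "s x \<in> pm J" using stableD[OF st] dbl_nonneg[OF assms(1,2) n] by metis
  moreover have "0 \<le> s x" by (rule permutes_pos[OF assms(1,2) n])
  ultimately show "s x \<in> J" unfolding in_signed_set[OF ix_subset[OF assms(2,3)]] by simp
 qed
next
 assume st: "stable J s"
 have fin: "finite J" using ix_finite[OF ix_subset[OF assms(2,3)]] .
 have st': "stable J (pinv s)" by (rule stable_pinv[OF st permutes_bij[OF assms(1)] fin])
 show "sstable J (dbl s)" unfolding stable_def proof (rule image_subsetI)
  fix x assume "x \<in> pm J"
  then consider "x \<in> J" | y where "x = - y" "y \<in> J" by (auto simp: signed_set_def)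
  thus "dbl s x \<in> pm J" proof cases
   case 1
   hence "0 \<le> x" using ix_nonneg[OF assms(2)] assms(3) by blast
   thus ?thesis using dbl_nonneg[OF assms(1,2)] stableD[OF st 1] by (simp add: signed_set_def)
  next
   case (2 y)
   hence "0 \<le> y" using ix_nonneg[OF assms(2)] assms(3) by blast
   thus ?thesis using dbl_neg[OF assms(1,2)] stableD[OF st' 2(2)] 2(1) by (simp add: signed_set_def)
  qed
 qed
qed

text \<open>A cycle meeting both intervals exists exactly when the first interval is not preserved.
  The count p + q, two below the disc value, means defect 2.\<close>

lemma S_ann_nc_iff:
 assumes "p \<ge> 1" "q \<ge> 1" "s permutes {1..int (p + q)}"
 defines "A \<equiv> {1..int (p + q)}"
 shows "s \<in> S_ann_nc p q \<longleftrightarrow> \<not> sstable {1..int p} (dbl s) \<and> defect A (dbl (tau2 p q)) (dbl s) = 2"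
proof -
 let ?t = "tau2 p q"
 have ix: "ix_set A" by (simp add: A_def)
 have tA: "?t permutes A" unfolding A_def by (rule tau2_permutes)
 have sA: "s permutes A" using assms(3) by (simp add: A_def)
 have ps: "permutation s" by (rule perm_perm[OF sA ix_finite[OF ix]])
 have "{1..int p} \<noteq> {int p + 1..int (p + q)}" using assms(1) by auto
 hence c: "card A = p + q" "num_cycles A ?t = 2"
  using tau2_cycles(3)[OF assms(1,2)] by (simp_all add: A_def num_cycles_def del: of_nat_add)
 have e: "defect A (dbl ?t) (dbl s) = 2 \<longleftrightarrow> num_cycles A s + num_cycles A (pinv s \<circ> ?t) = p + q"
  using defect_dbl[OF sA tA ix] unfolding c by linarith
 have sub: "{1..int p} \<subseteq> A" by (auto simp: A_def)
 have "stable {1..int p} s \<longleftrightarrow> \<not> (\<exists>C\<in>cycle_blocks A s. C \<inter> {1..int p} \<noteq> {} \<and> C \<inter> {int p + 1..int (p + q)} \<noteq> {})"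
 proof
  assume st: "stable {1..int p} s"
  show "\<not> (\<exists>C\<in>cycle_blocks A s. C \<inter> {1..int p} \<noteq> {} \<and> C \<inter> {int p + 1..int (p + q)} \<noteq> {})"
  proof
   assume "\<exists>C\<in>cycle_blocks A s. C \<inter> {1..int p} \<noteq> {} \<and> C \<inter> {int p + 1..int (p + q)} \<noteq> {}"
   then obtain C x y where C: "C \<in> cycle_blocks A s" "x \<in> C" "x \<in> {1..int p}" "y \<in> C" "y \<in> {int p + 1..int (p + q)}" by blast
   have "C = orbit s x" using cycle_blocks_block(4)[OF sA ps ix_finite[OF ix] C(1,2)] by simp
   hence "y \<in> {1..int p}" using stable_orbit[OF st C(3)] C(4) by blast
   thus False using C(5) by simp
  qed
 next
  assume no: "\<not> (\<exists>C\<in>cycle_blocks A s. C \<inter> {1..int p} \<noteq> {} \<and> C \<inter> {int p + 1..int (p + q)} \<noteq> {})"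
  show "stable {1..int p} s" unfolding stable_def proof (rule image_subsetI)
   fix x assume x: "x \<in> {1..int p}"
   have xA: "x \<in> A" using x sub by blast
   have "orbit s x \<in> cycle_blocks A s" using xA by (simp add: cycle_blocks_def)
   moreover have "x \<in> orbit s x" "s x \<in> orbit s x" by (rule permutation_self_in_orbit[OF ps], rule orbit.base)
   ultimately have "s x \<notin> {int p + 1..int (p + q)}" using no x by blast
   moreover have "s x \<in> A" using permutes_in_image[OF sA] xA by simp
   ultimately show "s x \<in> {1..int p}" by (simp add: A_def)
  qed
 qed
 thus ?thesis using e stable_dbl_iff[OF sA ix sub] sA unfolding S_ann_nc_def by (simp add: A_def)
qed

text \<open>With defect 2 at least two joint orbits remain, so a joining premap respects one
  relative orientation of the circles. If it is the given one, the premap is a doubled permutation;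
  otherwise \<open>flip\<close> makes it so.\<close>

lemma defect_two_tau2:
 assumes "p \<ge> 1" "q \<ge> 1"
 defines "A \<equiv> {1..int (p + q)}" shows "{r \<in> PM A. \<not> sstable {1..int p} r \<and> defect A (dbl (tau2 p q)) r = 2}
   = dbl ` S_ann_nc p q \<union> (\<lambda>S. relabel (flip p q) (dbl S)) ` S_ann_nc p q" (is "?U = _")
  "dbl ` S_ann_nc p q \<inter> (\<lambda>S. relabel (flip p q) (dbl S)) ` S_ann_nc p q = {}"
proof -
 let ?t = "tau2 p q" and ?F = "flip p q" and ?P = "{1..int p}" and ?Q = "{int p + 1..int (p + q)}"
 have ix: "ix_set A" by (simp add: A_def)
 have tA: "?t permutes A" unfolding A_def by (rule tau2_permutes)
 note tP = dbl_PM[OF tA ix]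
 have bF: "bij ?F" by (rule odd_bijD(1)[OF odd_bij_flip])
 have FA: "?F ` pm A = pm A" unfolding A_def by (rule flip_signed_set)
 have AU: "A = ?P \<union> ?Q" unfolding A_def by (rule interval_split)
 have sA: "pm A = ?P \<union> ?Q \<union> (uminus ` ?P \<union> uminus ` ?Q)" by (simp add: signed_set_def AU image_Un Un_ac)
 have rU: "relabel ?F r \<in> ?U" if "r \<in> ?U" for r proof -
  have r: "r \<in> PM A" "\<not> sstable ?P r" "defect A (dbl ?t) r = 2" using that by simp_all
  have "defect A (dbl ?t) (relabel ?F r) = 2"
   using relabel_defect[OF odd_bij_flip FA ix ix tP r(1)] r(3) relabel_flip_dbl_tau2[OF assms(1,2)] by simp
  moreover have "\<not> sstable ?P (relabel ?F r)" using stable_relabel[OF bF, of "pm ?P" r] r(2) unfolding flip_signed_set(2) by simp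
  ultimately show ?thesis using relabel_PM[OF odd_bij_flip FA r(1)] by simp
 qed
 have rr: "relabel ?F (relabel ?F r) = r" for r using relabel_pinv(1)[OF bF] unfolding pinv_flip .
 have dU: "dbl S \<in> ?U" if "S \<in> S_ann_nc p q" for S proof -
  have s: "S permutes A" using that by (simp add: S_ann_nc_def A_def)
  show ?thesis using dbl_PM[OF s ix] S_ann_nc_iff[OF assms(1,2) s[unfolded A_def]] that unfolding A_def by simp
 qed
 have Ud: "r \<in> dbl ` S_ann_nc p q" if r: "r \<in> ?U" and st: "stable A r" for r proof -
  obtain S where s: "S permutes A" "r = dbl S" by (rule stable_imp_dbl[OF _ ix st]) (use r in auto)
  thus ?thesis using S_ann_nc_iff[OF assms(1,2) s(1)[unfolded A_def]] r unfolding A_def by simp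
 qed
 have UU: "r \<in> dbl ` S_ann_nc p q \<union> (\<lambda>S. relabel ?F (dbl S)) ` S_ann_nc p q" if U: "r \<in> ?U" for r proof -
  have r: "r \<in> PM A" "\<not> sstable ?P r" "defect A (dbl ?t) r = 2" using U by simp_all
  have "?P \<noteq> ?Q" using assms(1) by auto
  hence "card (pos_cycles A (dbl ?t)) = 2" unfolding pos_cycles_dbl[OF tA ix] unfolding A_def tau2_cycles(3)[OF assms(1,2)] by simp
  hence two: "2 \<le> card (joint_orbits A (dbl ?t) r)" using defect_ge[OF tP r(1) ix] r(3) by simp
  have pt: "permutation ?t" by (rule perm_perm[OF tA ix_finite[OF ix]])
  have m: "1 \<in> A" "int p + 1 \<in> A" using assms(1,2) by (simp_all add: A_def)
  have set_eq: "orbit ?t u = set (support ?t u)" for u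
   using support_set[OF pt] orbit_altdef_permutation[OF pt] by (auto simp: image_def)
  have o: "orbit (dbl ?t) 1 = ?P" "orbit (dbl ?t) (int p + 1) = ?Q"
   unfolding orbit_dbl[OF tA ix m(1)] orbit_dbl[OF tA ix m(2)] set_eq tau2_cycles(1,2)[OF assms(1,2)] by simp_all
  note o' = PM_orbit_neg[OF tP ix, of 1, unfolded o] PM_orbit_neg[OF tP ix, of "int p + 1", unfolded o]
  obtain x where x: "x \<in> pm ?P" "r x \<notin> pm ?P" using r(2) unfolding stable_def by blast
  have "x \<in> pm A" using x(1) signed_set_mono[of ?P A] AU by blast
  hence "r x \<in> pm A" unfolding PM_in[OF r(1)] .
  hence rx: "r x \<in> ?Q \<union> uminus ` ?Q" using x(2) unfolding sA unfolding signed_set_def by blast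
  have 1: "stable (?P \<union> ?Q) r" if "y \<in> ?P" "r y \<in> ?Q \<or> r (- y) \<in> uminus ` ?Q" for y
   using stable_two_cycles[OF tP r(1) ix _ two, of 1 "int p + 1" y] that unfolding o o' sA by simp
  have 2: "stable (?P \<union> uminus ` ?Q) r" if "y \<in> ?P" "r y \<in> uminus ` ?Q \<or> r (- y) \<in> ?Q" for y
   using stable_two_cycles[OF tP r(1) ix _ two, of 1 "- (int p + 1)" y] that unfolding o o' sA minus_minus by (simp add: Un_ac)
  have "stable (?P \<union> ?Q) r \<or> stable (?P \<union> uminus ` ?Q) r" proof (cases "x \<in> ?P")
   case True
   thus ?thesis using 1[OF True] 2[OF True] rx by blast
  next
   case False
   hence "- x \<in> ?P" using x(1) by (force simp: signed_set_def)
   thus ?thesis using 1[of "- x"] 2[of "- x"] rx unfolding minus_minus by blast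
  qed
  thus ?thesis proof
   assume "stable (?P \<union> ?Q) r"
   thus ?thesis using Ud[OF U] unfolding AU by blast
  next
   assume "stable (?P \<union> uminus ` ?Q) r"
   hence "stable (?F ` (?P \<union> uminus ` ?Q)) (relabel ?F r)" unfolding stable_relabel[OF bF] .
   hence "stable A (relabel ?F r)" unfolding AU image_Un flip_image .
   hence "relabel ?F r \<in> dbl ` S_ann_nc p q" by (rule Ud[OF rU[OF U]])
   then obtain S where "S \<in> S_ann_nc p q" "relabel ?F r = dbl S" by blast
   hence "r = relabel ?F (dbl S)" "S \<in> S_ann_nc p q" using rr[of r] by simp_all
   thus ?thesis by blast
  qed
 qed
 show "?U = dbl ` S_ann_nc p q \<union> (\<lambda>S. relabel ?F (dbl S)) ` S_ann_nc p q" proof (intro equalityI subsetI)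
  fix r assume "r \<in> dbl ` S_ann_nc p q \<union> (\<lambda>S. relabel ?F (dbl S)) ` S_ann_nc p q"
  thus "r \<in> ?U" using dU rU by blast
 qed (rule UU)
 \<comment> \<open>A premap of both kinds would preserve the positive points and also their image
   under \<open>flip\<close>. The intersection is the first circle, and likewise for the negatives,
   so nothing would be joined.\<close>
 show "dbl ` S_ann_nc p q \<inter> (\<lambda>S. relabel ?F (dbl S)) ` S_ann_nc p q = {}" proof (rule ccontr)
  assume "dbl ` S_ann_nc p q \<inter> (\<lambda>S. relabel ?F (dbl S)) ` S_ann_nc p q \<noteq> {}"
  then obtain S S' where s: "S \<in> S_ann_nc p q" "S' \<in> S_ann_nc p q" "dbl S = relabel ?F (dbl S')" by blast
  have sp: "S permutes A" "S' permutes A" using s(1,2) by (simp_all add: S_ann_nc_def A_def)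
  have a: "stable (?P \<union> ?Q) (dbl S)" "stable (uminus ` ?P \<union> uminus ` ?Q) (dbl S)"
   using stable_dbl[OF sp(1) ix] unfolding AU image_Un by simp_all
  have "stable (?F ` (?P \<union> ?Q)) (dbl S)" "stable (?F ` (uminus ` ?P \<union> uminus ` ?Q)) (dbl S)"
   unfolding s(3) stable_relabel[OF bF] using stable_dbl[OF sp(2) ix] unfolding AU image_Un by blast+
  hence b: "stable (?P \<union> uminus ` ?Q) (dbl S)" "stable (uminus ` ?P \<union> ?Q) (dbl S)"
   unfolding image_Un flip_image by simp_all
  have d: "(?P \<union> ?Q) \<inter> (?P \<union> uminus ` ?Q) = ?P" "(uminus ` ?P \<union> uminus ` ?Q) \<inter> (uminus ` ?P \<union> ?Q) = uminus ` ?P"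
   by auto
  have "stable ?P (dbl S)" "stable (uminus ` ?P) (dbl S)" using stable_Int[OF a(1) b(1)] stable_Int[OF a(2) b(2)] unfolding d .
  hence "sstable ?P (dbl S)" unfolding signed_set_def by (rule stable_Un)
  thus False using dU[OF s(1)] by simp
 qed
qed

section \<open>One or two arbitrary cycles brought to standard form\<close>

lemma odd_extension:
 assumes A: "ix_set A" "ix_set B" and f: "bij_betw (\<lambda>x. \<bar>f x\<bar>) A B"
 obtains F where "odd_bij F" "\<And>x. x \<in> A ==> F x = f x" "F ` pm A = pm B" proof -
 have fin: "finite A" "finite B" using A ix_finite by blast+
 have "card A = card B" using bij_betw_same_card[OF f] .
 hence "card (B - A) = card (A - B)" using card_Diff_subset_Int[of B A] card_Diff_subset_Int[of A B] fin by (simp add: Int_commute)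
 hence "\<exists>h. bij_betw h (B - A) (A - B)" by (rule finite_same_card_bij[OF finite_Diff[OF fin(2)] finite_Diff[OF fin(1)]])
 \<comment> \<open>A and B need not coincide; h completes the bijection to a permutation of their
   union, which is extended by the identity.\<close>
 then obtain h where h: "bij_betw h (B - A) (A - B)" ..
 define Q where "Q x = (if x \<in> A then \<bar>f x\<bar> else if x \<in> B then h x else x)" for x
 have 1: "bij_betw Q A B" by (rule bij_betw_cong[THEN iffD1, OF _ f]) (simp add: Q_def)
 have 2: "bij_betw Q (B - A) (A - B)" by (rule bij_betw_cong[THEN iffD1, OF _ h]) (simp add: Q_def)
 have "bij_betw Q (A \<union> (B - A)) (B \<union> (A - B))" by (rule bij_betw_combine[OF 1 2]) blast
 hence "bij_betw Q (A \<union> B) (A \<union> B)" by (simp add: Un_commute)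
 hence Q: "Q permutes (A \<union> B)" by (rule bij_imp_permutes) (simp add: Q_def)
 have ixU: "ix_set (A \<union> B)" using A by simp
 have Q0: "Q 0 = 0" using permutes_not_in[OF Q] ixU by (force simp: ix_set_def)
 have Qn: "0 \<le> Q \<bar>x\<bar>" for x by (rule permutes_pos[OF Q ixU]) simp
 \<comment> \<open>Signs are kept apart from absolute values. On A the sign is never 0, because B
   contains only positive indices.\<close>
 define s where "s k = (if k \<in> A then sgn (f k) else 1)" for k :: int
 have fnz: "f k \<noteq> 0" if "k \<in> A" for k proof -
  have "\<bar>f k\<bar> \<in> B" using bij_betwE[OF f] that by blast
  thus ?thesis using A(2) by (auto simp: ix_set_def)
 qed
 have s: "\<bar>s k\<bar> = 1" for k using fnz by (simp add: s_def abs_sgn_eq)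
 define F where "F x = sgn x * (s \<bar>x\<bar> * Q \<bar>x\<bar>)" for x
 have neg: "F (- x) = - F x" for x by (simp add: F_def)
 have absF: "\<bar>F x\<bar> = Q \<bar>x\<bar>" for x
  using s[of "\<bar>x\<bar>"] Qn[of x] Q0 by (cases "x = 0") (simp_all add: F_def abs_mult abs_sgn_eq)
 have inj: "inj F" proof (rule injI)
  fix x y assume e: "F x = F y"
  hence "Q \<bar>x\<bar> = Q \<bar>y\<bar>" using absF by metis
  hence xy: "\<bar>x\<bar> = \<bar>y\<bar>" using permutes_inj[OF Q] by (simp add: inj_eq)
  show "x = y" proof (rule ccontr)
   assume ne: "x \<noteq> y"
   hence "x = - y" using xy by linarith
   hence "F y = 0" using e neg[of y] by simp
   hence "Q \<bar>y\<bar> = Q 0" using absF[of y] Q0 by simp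
   hence "y = 0" using permutes_inj[OF Q] by (simp add: inj_eq)
   thus False using ne xy by simp
  qed
 qed
 have surj: "surj F" unfolding surj_def proof
  fix y
  have n: "0 \<le> pinv Q \<bar>y\<bar>" by (rule permutes_pos[OF permutes_inv[OF Q] ixU]) simp
  have "\<bar>F (pinv Q \<bar>y\<bar>)\<bar> = \<bar>y\<bar>" unfolding absF abs_of_nonneg[OF n] by (rule permutes_inverses(1)[OF Q])
  hence "y = F (pinv Q \<bar>y\<bar>) \<or> y = F (- pinv Q \<bar>y\<bar>)" unfolding neg by linarith
  thus "\<exists>x. y = F x" by blast
 qed
 have odd: "odd_bij F" using inj surj neg by (simp add: odd_bij_def bij_def)
 have val: "F x = f x" if "x \<in> A" for x proof -
  have "0 < x" using A(1) that by (simp add: ix_set_def)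
  thus ?thesis using that by (simp add: F_def s_def Q_def sgn_mult_abs)
 qed
 have "F ` pm A \<subseteq> pm B" proof (rule image_subsetI)
  fix x assume "x \<in> pm A"
  hence "\<bar>x\<bar> \<in> A" unfolding in_signed_set[OF A(1)] .
  hence "Q \<bar>x\<bar> \<in> B" using bij_betwE[OF 1] by blast
  thus "F x \<in> pm B" unfolding in_signed_set[OF A(2)] absF .
 qed
 moreover have "card (F ` pm A) = card (pm B)"
  using card_image[OF inj_on_subset[OF inj subset_UNIV]] \<open>card A = card B\<close> by (simp add: card_signed_set A)
 ultimately have "F ` pm A = pm B" by (intro card_subset_eq[OF finite_pm[OF A(2)]])
 thus thesis using that[of F] odd val by blast
qed

lemma odd_relabeling:
 assumes ix: "ix_set I" and d: "distinct (map abs cs)" and I: "abs ` set cs = I"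
 obtains F where "odd_bij F" "map F [1..int (length cs)] = cs" "F ` pm {1..int (length cs)} = pm I" proof -
 let ?n = "length cs" and ?f = "entry cs"
 note m = map_entry[of cs]
 have e: "(\<lambda>i. \<bar>?f i\<bar>) ` {1..int ?n} = I"
  using arg_cong[OF m, of "\<lambda>l. abs ` set l"] unfolding I set_map image_image set_upto .
 have "card ((\<lambda>i. \<bar>?f i\<bar>) ` {1..int ?n}) = card {1..int ?n}"
  unfolding e I[symmetric] using distinct_card[OF d] by simp
 hence "inj_on (\<lambda>i. \<bar>?f i\<bar>) {1..int ?n}" by (rule eq_card_imp_inj_on[rotated]) simp
 hence b: "bij_betw (\<lambda>i. \<bar>?f i\<bar>) {1..int ?n} I" using e by (simp add: bij_betw_def)
 obtain F where F: "odd_bij F" "\<And>x. x \<in> {1..int ?n} ==> F x = ?f x" "F ` pm {1..int ?n} = pm I"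
  by (rule odd_extension[OF index_set_interval ix b]) simp_all
 have "map F [1..int ?n] = map ?f [1..int ?n]" by (rule map_cong[OF refl F(2)]) simp
 hence "map F [1..int ?n] = cs" unfolding m .
 thus thesis by (rule that[OF F(1) _ F(3)])
qed

text \<open>If F carries one cycle word to another, it carries successors to successors, including
  the step from the last letter back to the first.\<close>

lemma support_intertwine:
 assumes "permutation \<pi>" "permutation t" "map F (support t s) = support \<pi> a" "x \<in> set (support t s)"
 shows "F (t x) = \<pi> (F x)" proof -
 obtain i where i: "i < length (support t s)" "x = support t s ! i" using assms(4) unfolding in_set_conv_nth by blast
 define L where "L = length (support t s)"
 have L: "length (support \<pi> a) = L" unfolding assms(3)[symmetric] L_def by simp
 have n: "support \<pi> a ! j = F (support t s ! j)" if "j < L" for j unfolding assms(3)[symmetric] using that by (simp add: L_def)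
 have iL: "i < L" "Suc i mod L < L" using i(1) by (simp_all add: L_def)
 have "t x = support t s ! (Suc i mod L)" unfolding i(2) L_def by (rule support_step[OF assms(2) i(1)])
 moreover have "\<pi> (support \<pi> a ! i) = support \<pi> a ! (Suc i mod L)"
  using support_step[OF assms(1), of i a] iL(1) unfolding L by blast
 ultimately show ?thesis using n[OF iL(1)] n[OF iL(2)] unfolding i(2) by metis
qed

lemma set_support: "permutation f ==> set (support f a) = orbit f a"
 using support_set[of f a] orbit_altdef_permutation[of f a] by (auto simp: image_def)

lemma abs_inj_on_orbit:
 assumes "\<pi> \<in> PM I" "ix_set I" "a \<in> pm I" shows "inj_on abs (orbit \<pi> a)"
proof (rule inj_onI)
 fix x y assume x: "x \<in> orbit \<pi> a" and y: "y \<in> orbit \<pi> a" and e: "\<bar>x\<bar> = \<bar>y\<bar>"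
 note pp = PM_perm[OF assms(1,2)]
 have o: "orbit \<pi> y = orbit \<pi> a" by (rule orbit_cyclic_eq3[OF cyclic_on_orbit'[OF pp] y])
 have "y \<in> pm I" using permutes_orbit_subset[OF PM_permutes[OF assms(1)] assms(3)] y by blast
 hence "- y \<notin> orbit \<pi> a" using PM_no_flip[OF assms(1)] o by metis
 hence "x \<noteq> - y" using x by blast
 thus "x = y" using e by linarith
qed

lemma distinct_abs_support:
 assumes "\<pi> \<in> PM I" "ix_set I" "a \<in> pm I" shows "distinct (map abs (support \<pi> a))"
proof -
 note pp = PM_perm[OF assms(1,2)]
 define cs where "cs = support \<pi> a"
 have "distinct cs" "set cs = orbit \<pi> a" unfolding cs_def by (rule cycle_of_permutation[OF pp], rule set_support[OF pp])
 thus ?thesis unfolding cs_def[symmetric] distinct_map using abs_inj_on_orbit[OF assms] by simp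
qed

text \<open>Labelling the letters of the cycle by 1 to n turns the premap into the doubled long
  cycle, whose defect-zero premaps are listed by \<open>S_nc\<close>.\<close>

lemma relabel_one_cycle:
 assumes "\<pi> \<in> PM I" "ix_set I" "a \<in> pm I" "abs ` orbit \<pi> a = I"
 defines "n \<equiv> length (support \<pi> a)"
 obtains F where "odd_bij F" "map F [1..int n] = support \<pi> a" "F ` pm {1..int n} = pm I"
  "n \<ge> 1" "relabel F (dbl (tau1 n)) = \<pi>"
proof -
 note pp = PM_perm[OF assms(1,2)]
 note d = distinct_abs_support[OF assms(1,2,3)]
 have s: "abs ` set (support \<pi> a) = I" unfolding set_support[OF pp] by (rule assms(4))
 obtain F where F: "odd_bij F" "map F [1..int n] = support \<pi> a" "F ` pm {1..int n} = pm I"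
  unfolding n_def by (rule odd_relabeling[OF assms(2) d s])
 have "a \<in> set (support \<pi> a)" unfolding set_support[OF pp] by (rule permutation_self_in_orbit[OF pp])
 hence "support \<pi> a \<noteq> []" by force
 hence n: "n \<ge> 1" unfolding n_def by (metis One_nat_def Suc_leI length_greater_0_conv)
 have pt: "permutation (tau1 n)" by (rule perm_perm[OF tau1_permutes]) simp
 have m: "map F (support (tau1 n) 1) = support \<pi> a" unfolding tau1_in_S_nc(3)[OF n] by (rule F(2))
 have "F (tau1 n x) = \<pi> (F x)" if "x \<in> {1..int n}" for x
  by (rule support_intertwine[OF pp pt m]) (unfold tau1_in_S_nc(3)[OF n], use that in simp)
 hence "relabel F (dbl (tau1 n)) = \<pi>" by (intro relabel_dbl_eq[OF F(1,3) _ tau1_permutes assms(1)]) simp_all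
 thus thesis by (rule that[OF F n])
qed

text \<open>The two words are placed side by side. The starting points a and b also fix the relative
  orientation of the two circles.\<close>

lemma relabel_two_cycles:
 assumes "\<pi> \<in> PM (I \<union> J)" "ix_set (I \<union> J)" "I \<inter> J = {}" "a \<in> pm I" "abs ` orbit \<pi> a = I"
  "b \<in> pm J" "abs ` orbit \<pi> b = J"
 defines "p \<equiv> length (support \<pi> a)" and "q \<equiv> length (support \<pi> b)"
 obtains F where "odd_bij F" "map F [1..int p] = support \<pi> a" "map F [int p + 1..int (p + q)] = support \<pi> b"
  "F ` pm {1..int (p + q)} = pm (I \<union> J)" "F ` pm {1..int p} = pm I"
  "p \<ge> 1" "q \<ge> 1" "relabel F (dbl (tau2 p q)) = \<pi>"
proof -
 note pp = PM_perm[OF assms(1,2)]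
 have ab: "a \<in> pm (I \<union> J)" "b \<in> pm (I \<union> J)" using assms(4,6) by (simp_all add: signed_set_Un)
 have "set (map abs (support \<pi> a)) = I" "set (map abs (support \<pi> b)) = J"
  unfolding set_map[of abs] set_support[OF pp] by (rule assms(5,7))+
 hence d: "distinct (map abs (support \<pi> a @ support \<pi> b))" unfolding map_append[of abs] distinct_append
  using distinct_abs_support[OF assms(1,2) ab(1)] distinct_abs_support[OF assms(1,2) ab(2)] assms(3) by (simp only:)
 have s: "abs ` set (support \<pi> a @ support \<pi> b) = I \<union> J" unfolding set_append image_Un set_support[OF pp] assms(5,7) ..
 have len: "length (support \<pi> a @ support \<pi> b) = p + q" by (simp add: p_def q_def)
 obtain F where F: "odd_bij F" "map F [1..int (p + q)] = support \<pi> a @ support \<pi> b" "F ` pm {1..int (p + q)} = pm (I \<union> J)"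
  by (rule odd_relabeling[OF assms(2) d s, unfolded len])
 have "a \<in> set (support \<pi> a)" "b \<in> set (support \<pi> b)" unfolding set_support[OF pp] by (rule permutation_self_in_orbit[OF pp])+
 hence "support \<pi> a \<noteq> []" "support \<pi> b \<noteq> []" by force+
 hence pq: "p \<ge> 1" "q \<ge> 1" unfolding p_def q_def by (metis One_nat_def Suc_leI length_greater_0_conv)+
 have "[1..int (p + q)] = [1..int p] @ [int p + 1..int (p + q)]" using upto_split2[of 1 "int p" "int (p + q)"] pq by simp
 hence "map F [1..int p] @ map F [int p + 1..int (p + q)] = support \<pi> a @ support \<pi> b"
  using F(2) unfolding map_append[symmetric] by simp
 hence m: "map F [1..int p] = support \<pi> a" "map F [int p + 1..int (p + q)] = support \<pi> b"
  by (simp_all add: append_eq_append_conv p_def)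
 have pt: "permutation (tau2 p q)" by (rule perm_perm[OF tau2_permutes]) simp
 have m': "map F (support (tau2 p q) 1) = support \<pi> a" "map F (support (tau2 p q) (int p + 1)) = support \<pi> b"
  unfolding tau2_cycles(1,2)[OF pq] by (rule m)+
 have st: "F (tau2 p q x) = \<pi> (F x)" if xpq: "x \<in> {1..int (p + q)}" for x proof -
  consider "x \<in> set (support (tau2 p q) 1)" | "x \<in> set (support (tau2 p q) (int p + 1))"
   using xpq unfolding tau2_cycles(1,2)[OF pq] set_upto interval_split by blast
  thus ?thesis by cases (rule support_intertwine[OF pp pt m'(1)], assumption, rule support_intertwine[OF pp pt m'(2)], assumption)
 qed
 have r: "relabel F (dbl (tau2 p q)) = \<pi>" by (intro relabel_dbl_eq[OF F(1,3) _ tau2_permutes assms(1)] st) simp_all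
 have "F ` {1..int p} = orbit \<pi> a" using arg_cong[OF m(1), of set] unfolding set_support[OF pp] set_map[of F] set_upto .
 hence "abs ` F ` {1..int p} = I" using assms(5) by simp
 have ixI: "ix_set I" using assms(2) by simp
 have F1: "F ` {1..int p} \<subseteq> pm I" proof (rule image_subsetI)
  fix x assume "x \<in> {1..int p}"
  hence "\<bar>F x\<bar> \<in> I" using \<open>abs ` F ` {1..int p} = I\<close> by blast
  thus "F x \<in> pm I" unfolding in_signed_set[OF ixI] .
 qed
 have "F ` pm {1..int p} \<subseteq> pm I" proof (rule image_subsetI)
  fix x assume "x \<in> pm {1..int p}"
  hence "x \<in> {1..int p} \<or> x \<in> uminus ` {1..int p}" by (simp only: signed_set_def Un_iff)
  thus "F x \<in> pm I" proof
   assume "x \<in> uminus ` {1..int p}"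
   then obtain y where y: "x = - y" "y \<in> {1..int p}" by blast
   hence "F y \<in> pm I" using F1 by blast
   thus ?thesis unfolding y(1) odd_bijD(2)[OF F(1)] by simp
  qed (use F1 in blast)
 qed
 moreover have "card (F ` pm {1..int p}) = card (pm I)" proof -
  have "card I = p"
   using card_image[OF abs_inj_on_orbit[OF assms(1,2) ab(1)]] length_support[OF pp, of a] unfolding assms(5) p_def by simp
  thus ?thesis using card_image[OF inj_on_subset[OF bij_is_inj[OF odd_bijD(1)[OF F(1)]] subset_UNIV], of "pm {1..int p}"]
   by (simp add: card_signed_set ixI)
 qed
 ultimately have FI: "F ` pm {1..int p} = pm I" by (intro card_subset_eq[OF finite_pm[OF ixI]])
 show thesis by (rule that[OF F(1) m F(3) FI pq r])
qed

section \<open>Words along a cycle\<close>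

lemma support_rotate:
 assumes "permutation f" shows "support f (f a) = rotate1 (support f a)"
proof (rule nth_equalityI)
 define L where "L = least_power f a"
 have L: "(f ^^ L) a = a" "0 < L" unfolding L_def using least_power_of_permutation[OF assms(1)] by blast+
 have "length (support f (f a)) = length (support f a)" unfolding length_support[OF assms] permutation_orbit_step[OF assms] ..
 moreover have lenL: "length (support f a) = L" by (simp add: L_def)
 ultimately have len: "length (support f (f a)) = L" by simp
 show "length (support f (f a)) = length (rotate1 (support f a))" unfolding length_rotate1 len lenL ..
 fix i assume "i < length (support f (f a))"
 hence i: "i < L" unfolding len .
 have n: "support f a ! j = (f ^^ j) a" if "j < L" for j using that by (simp add: L_def)
 have "least_power f (f a) = L" using len by simp
 hence "support f (f a) ! i = (f ^^ i) (f a)" using i by simp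
 also have "... = (f ^^ (Suc i mod L)) a" proof (cases "Suc i < L")
  case True
  thus ?thesis by (simp add: funpow_swap1)
 next
  case False
  hence e: "Suc i = L" using i by simp
  have "(f ^^ i) (f a) = (f ^^ Suc i) a" by (simp add: funpow_swap1)
  thus ?thesis unfolding e mod_self by (simp add: L(1))
 qed
 also have "... = support f a ! (Suc i mod L)" by (rule n[symmetric]) (use L(2) in simp)
 also have "... = rotate1 (support f a) ! i" by (rule nth_rotate1[of i "support f a", unfolded lenL, OF i, symmetric])
 finally show "support f (f a) ! i = rotate1 (support f a) ! i" .
qed

text \<open>The mirrored cycle runs backwards with changed signs. Plain reversal would begin with
  the last letter, so the word is rotated once to begin at -a.\<close>

lemma support_uminus:
 assumes "\<pi> \<in> PM I" "ix_set I" shows "support \<pi> (- a) = map uminus (rev (rotate1 (support \<pi> a)))"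
proof (rule nth_equalityI)
 note pp = PM_perm[OF assms]
 define L where "L = least_power \<pi> a"
 have L: "(\<pi> ^^ L) a = a" "0 < L" unfolding L_def using least_power_of_permutation[OF pp] by blast+
 have lenL: "length (support \<pi> a) = L" by (simp add: L_def)
 have "card (uminus ` orbit \<pi> a) = card (orbit \<pi> a)" by (rule card_image) (simp add: inj_on_def)
 hence len: "length (support \<pi> (- a)) = L"
  unfolding length_support[OF pp] PM_orbit_neg[OF assms] using lenL[unfolded length_support[OF pp]] by simp
 show "length (support \<pi> (- a)) = length (map uminus (rev (rotate1 (support \<pi> a))))"
  unfolding length_map[of uminus] length_rev length_rotate1 len lenL ..
 fix i assume "i < length (support \<pi> (- a))"
 hence i: "i < L" unfolding len .
 have n: "support \<pi> a ! j = (\<pi> ^^ j) a" if "j < L" for j using that by (simp add: L_def)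
 \<comment> \<open>After k steps and a change of sign, k further steps lead to the mirror image of
   the starting point.\<close>
 have back': "(\<pi> ^^ k) (- (\<pi> ^^ k) b) = - b" for k b proof (induction k)
  case (Suc k)
  have "(\<pi> ^^ Suc k) (- (\<pi> ^^ Suc k) b) = (\<pi> ^^ k) (\<pi> (- \<pi> ((\<pi> ^^ k) b)))" by (simp add: funpow_swap1)
  thus ?case using PM_neg[OF assms(1), of "- (\<pi> ^^ k) b"] Suc by simp
 qed simp
 have "least_power \<pi> (- a) = L" using len by simp
 hence l: "support \<pi> (- a) ! i = (\<pi> ^^ i) (- a)" using i by simp
 have "(\<pi> ^^ i) ((\<pi> ^^ (L - i)) a) = a" using L(1) i by (simp add: funpow_add[symmetric, THEN fun_cong, unfolded comp_apply])
 hence 1: "(\<pi> ^^ i) (- a) = - (\<pi> ^^ (L - i)) a" using back'[of i "(\<pi> ^^ (L - i)) a"] by simp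
 have "(\<pi> ^^ (L - i)) a = support \<pi> a ! ((L - i) mod L)" proof (cases "i = 0")
  case True
  thus ?thesis using L n[of 0] by simp
 next
  case False
  thus ?thesis using L n[of "L - i"] i by simp
 qed
 moreover have "rev (rotate1 (support \<pi> a)) ! i = support \<pi> a ! ((L - i) mod L)" proof -
  have j: "L - Suc i < length (support \<pi> a)" unfolding lenL using i by simp
  have "rev (rotate1 (support \<pi> a)) ! i = rotate1 (support \<pi> a) ! (L - Suc i)"
   using rev_nth[of i "rotate1 (support \<pi> a)"] i unfolding length_rotate1 lenL by blast
  also have "... = support \<pi> a ! (Suc (L - Suc i) mod L)" using nth_rotate1[OF j] unfolding lenL .
  also have "Suc (L - Suc i) = L - i" using i by simp
  finally show ?thesis .
 qed
 moreover have "map uminus (rev (rotate1 (support \<pi> a))) ! i = - (rev (rotate1 (support \<pi> a)) ! i)"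
  by (rule nth_map) (simp only: length_rev length_rotate1 lenL i)
 ultimately show "support \<pi> (- a) ! i = map uminus (rev (rotate1 (support \<pi> a))) ! i" unfolding l 1 by simp
qed

lemma (in real_second_order_ncps) tp_one: "tp 1 = 1"
 using tp_mult[of "tp 1" 1] by (simp add: tp_tp)

lemma (in real_second_order_ncps) tp_prod_list: "tp (prod_list zs) = prod_list (rev (map tp zs))"
 by (induction zs) (simp_all add: tp_one tp_mult)

lemma prod_list_rotate1:
 assumes "\<And>a b. f (a * b) = f (b * a)" shows "f (prod_list (rotate1 zs)) = f (prod_list zs)"
 using assms[of "prod_list (tl zs)" "hd zs"] by (cases zs) simp_all

text \<open>A new starting point on the cycle is absorbed by traciality; passing to the mirror cycle
  transposes the word, which f does not see. Traces start at the smallest absolute value while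
  relabellings start anywhere, so both freedoms occur.\<close>

lemma (in real_second_order_ncps) trace_word_invariant:
 assumes f: "\<And>a b. f (a * b) = f (b * a)" "\<And>a. f (tp a) = f a" and \<pi>: "\<pi> \<in> PM I" "ix_set I" and x: "x \<in> pm I"
  and X: "\<And>k. k \<in> pm I ==> X (- k) = tp (X k)" and y: "y \<in> orbit \<pi> x \<or> - y \<in> orbit \<pi> x"
 shows "f (prod_list (map X (support \<pi> y))) = f (prod_list (map X (support \<pi> x)))" proof -
 note pp = PM_perm[OF \<pi>]
 have rot: "f (prod_list (map X (support \<pi> z))) = f (prod_list (map X (support \<pi> x)))" if "z \<in> orbit \<pi> x" for z
  using that
 proof induction
  case base
  show ?case unfolding support_rotate[OF pp] rotate1_map[symmetric] by (rule prod_list_rotate1[where f = f, OF f(1)])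
 next
  case (step z)
  show ?case unfolding support_rotate[OF pp, of z] rotate1_map[symmetric] prod_list_rotate1[where f = f, OF f(1)] by (rule step.IH)
 qed
 have neg: "f (prod_list (map X (support \<pi> (- z)))) = f (prod_list (map X (support \<pi> z)))" if z: "z \<in> pm I" for z proof -
  define w where "w = rotate1 (support \<pi> z)"
  have w: "set w \<subseteq> pm I" unfolding w_def set_rotate1 by (rule support_subset[OF PM_permutes[OF \<pi>(1)] z])
  have "map X (map uminus (rev w)) = rev (map tp (map X w))" unfolding rev_map map_map using w X by (intro map_cong) auto
  hence "f (prod_list (map X (support \<pi> (- z)))) = f (tp (prod_list (map X w)))"
   unfolding support_uminus[OF \<pi>] w_def[symmetric] tp_prod_list by simp
  also have "... = f (prod_list (map X w))" by (rule f(2))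
  also have "... = f (prod_list (map X (support \<pi> z)))"
   unfolding w_def rotate1_map[symmetric] by (rule prod_list_rotate1[where f = f, OF f(1)])
  finally show ?thesis .
 qed
 show ?thesis proof (cases "y \<in> orbit \<pi> x")
  case False
  hence m: "- y \<in> orbit \<pi> x" using y by blast
  hence "- y \<in> pm I" using permutes_orbit_subset[OF PM_permutes[OF \<pi>(1)] x] by blast
  hence "f (prod_list (map X (support \<pi> y))) = f (prod_list (map X (support \<pi> (- y))))"
   using neg[of "- y"] by (simp only: minus_minus)
  thus ?thesis using rot[OF m] by simp
 qed (rule rot)
qed

section \<open>Transversals of the cycle pairs\<close>

text \<open>A choice of one starting point on each mirrored pair of cycles, with the orientation
  left free. Unlike the selection of positive cycles, this notion is carried along by odd
  relabellings.\<close>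

definition transv :: "int set => (int => int) => int set => bool" where
 "transv I \<pi> R \<longleftrightarrow> R \<subseteq> pm I \<and> (\<Union>a\<in>R. abs ` orbit \<pi> a) = I \<and>
   disjoint_family_on (\<lambda>a. abs ` orbit \<pi> a) R"

lemma signed_set_abs: "pm (abs ` S) = S \<union> uminus ` S" for S :: "int set"
proof (intro equalityI subsetI)
 fix x assume "x \<in> pm (abs ` S)"
 then obtain y where y: "y \<in> S" "x = \<bar>y\<bar> \<or> x = - \<bar>y\<bar>" by (auto simp: signed_set_def)
 hence "x = y \<or> x = - y" by linarith
 thus "x \<in> S \<union> uminus ` S" using y(1) by blast
next
 fix x assume "x \<in> S \<union> uminus ` S"
 then obtain y where y: "y \<in> S" "x = y \<or> x = - y" by blast
 hence "x = \<bar>y\<bar> \<or> x = - \<bar>y\<bar>" by linarith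
 thus "x \<in> pm (abs ` S)" using y(1) by (auto simp: signed_set_def)
qed

lemma cycle_idx:
 assumes "\<pi> \<in> PM I" "ix_set I" "a \<in> pm I"
 shows "abs ` orbit \<pi> a \<subseteq> I" "sstable (abs ` orbit \<pi> a) \<pi>" "a \<in> pm (abs ` orbit \<pi> a)"
  "abs ` orbit \<pi> a \<noteq> {}"
proof -
 note pp = PM_perm[OF assms(1,2)]
 have "x \<in> orbit \<pi> a ==> x \<in> pm I" for x
  using permutes_orbit_subset[OF PM_permutes[OF assms(1)] assms(3)] by blast
 thus "abs ` orbit \<pi> a \<subseteq> I" unfolding in_signed_set[OF assms(2)] by blast
 have st: "stable (orbit \<pi> b) \<pi>" for b unfolding stable_def by (rule image_subsetI) (rule orbit.step)
 show "sstable (abs ` orbit \<pi> a) \<pi>"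
  unfolding signed_set_abs PM_orbit_neg[OF assms(1,2), symmetric] by (rule stable_Un[OF st st])
 have a: "a \<in> orbit \<pi> a" by (rule permutation_self_in_orbit[OF pp])
 show "a \<in> pm (abs ` orbit \<pi> a)" unfolding signed_set_abs using a by blast
 show "abs ` orbit \<pi> a \<noteq> {}" using a by blast
qed

lemma trans_in: "transv I \<pi> R ==> a \<in> R ==> a \<in> pm I"
 by (auto simp: transv_def)

lemma finite_transversal: "transv I \<pi> R ==> ix_set I ==> finite R"
 unfolding transv_def using finite_subset finite_pm by blast

lemma transversal_sub:
 assumes "transv I \<pi> R" "\<pi> \<in> PM K" "ix_set K" "R' \<subseteq> R" "I \<subseteq> K"
 shows "transv (\<Union>a\<in>R'. abs ` orbit \<pi> a) \<pi> R'" unfolding transv_def proof (intro conjI refl)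
 show "R' \<subseteq> pm (\<Union>a\<in>R'. abs ` orbit \<pi> a)" proof
  fix a assume a: "a \<in> R'"
  hence "a \<in> pm I" using assms(1,4) trans_in by blast
  hence "a \<in> pm K" by (rule subsetD[OF signed_set_mono[OF assms(5)]])
  hence s: "a \<in> pm (abs ` orbit \<pi> a)" by (rule cycle_idx(3)[OF assms(2,3)])
  have "abs ` orbit \<pi> a \<subseteq> (\<Union>a\<in>R'. abs ` orbit \<pi> a)" using a by (rule UN_upper)
  thus "a \<in> pm (\<Union>a\<in>R'. abs ` orbit \<pi> a)" using s by (rule subsetD[OF signed_set_mono])
 qed
 show "disjoint_family_on (\<lambda>a. abs ` orbit \<pi> a) R'" using assms(1,4) unfolding transv_def disjoint_family_on_def by blast
qed

lemma transversal_stable: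
 assumes "transv I \<pi> R" "\<pi> \<in> PM K" "ix_set K" "R' \<subseteq> R" "I \<subseteq> K"
 shows "sstable (\<Union>a\<in>R'. abs ` orbit \<pi> a) \<pi>" unfolding stable_def proof (rule image_subsetI)
 fix x assume "x \<in> pm (\<Union>a\<in>R'. abs ` orbit \<pi> a)"
 then obtain a where a: "a \<in> R'" "x \<in> pm (abs ` orbit \<pi> a)" by (auto simp: signed_set_def)
 have "a \<in> pm I" using a(1) assms(1,4) trans_in by blast
 hence "a \<in> pm K" by (rule subsetD[OF signed_set_mono[OF assms(5)]])
 hence s: "\<pi> x \<in> pm (abs ` orbit \<pi> a)" using stableD[OF cycle_idx(2)[OF assms(2,3)] a(2)] by blast
 have "abs ` orbit \<pi> a \<subseteq> (\<Union>a\<in>R'. abs ` orbit \<pi> a)" using a(1) by (rule UN_upper)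
 thus "\<pi> x \<in> pm (\<Union>a\<in>R'. abs ` orbit \<pi> a)" using s by (rule subsetD[OF signed_set_mono])
qed

lemma transversal_res:
 assumes "transv I \<pi> R" "sstable I \<pi>" shows "transv I (res I \<pi>) R"
proof -
 have "orbit (res I \<pi>) a = orbit \<pi> a" if "a \<in> R" for a by (rule orbit_res[OF assms(2) trans_in[OF assms(1) that]])
 thus ?thesis using assms(1) unfolding transv_def disjoint_family_on_def by simp
qed

lemma transversal_cycle:
 assumes "\<pi> \<in> PM I" "ix_set I" "a \<in> pm I" shows "transv (abs ` orbit \<pi> a) \<pi> {a}"
 using cycle_idx(3)[OF assms] by (simp add: transv_def disjoint_family_on_def)

lemma transversal_Diff:
 assumes "transv I \<pi> R" "a \<in> R" shows "(\<Union>b\<in>R - {a}. abs ` orbit \<pi> b) = I - abs ` orbit \<pi> a"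
 using assms unfolding transv_def disjoint_family_on_def by blast

lemma support_res:
 assumes "sstable J \<pi>" "a \<in> pm J" shows "support (res J \<pi>) a = support \<pi> a"
 by (rule support_cong[where A = "pm J", OF _ assms, symmetric]) (simp add: res_apply)

lemma odd_bij_abs:
 assumes "odd_bij F" shows "\<bar>F x\<bar> = \<bar>F \<bar>x\<bar>\<bar>"
 using odd_bijD(2)[OF assms, of x] by (cases "0 \<le> x") simp_all

lemma transversal_relabel:
 assumes "transv A \<pi> R" "odd_bij F" "ix_set A" shows "transv ((\<lambda>x. \<bar>F x\<bar>) ` A) (relabel F \<pi>) (F ` R)"
proof -
 note b = odd_bijD(1)[OF assms(2)]
 let ?f = "\<lambda>x. \<bar>F x\<bar>"
 have abs_im: "abs ` F ` S = ?f ` abs ` S" for S unfolding image_image using odd_bij_abs[OF assms(2)] by simp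
 have inj: "x = y" if "0 \<le> x" "0 \<le> y" "?f x = ?f y" for x y proof -
  have "F x = F y \<or> F x = F (- y)" using that(3) unfolding odd_bijD(2)[OF assms(2)] by linarith
  hence "x = y \<or> x = - y" using bij_is_inj[OF b] by (simp add: inj_eq)
  thus ?thesis using that(1,2) by linarith
 qed
 have o: "abs ` orbit (relabel F \<pi>) (F a) = ?f ` abs ` orbit \<pi> a" for a unfolding relabel_orbit[OF b] by (rule abs_im)
 have "F ` R \<subseteq> pm (?f ` A)" proof (rule image_subsetI)
  fix a assume "a \<in> R"
  hence "\<bar>a\<bar> \<in> A" using trans_in[OF assms(1)] in_signed_set[OF assms(3)] by blast
  hence "\<bar>F a\<bar> \<in> ?f ` A" using odd_bij_abs[OF assms(2), of a] by simp
  thus "F a \<in> pm (?f ` A)" unfolding signed_set_def by (cases "0 \<le> F a") force+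
 qed
 moreover have "(\<Union>a\<in>F ` R. abs ` orbit (relabel F \<pi>) a) = ?f ` A" proof -
  have "(\<Union>a\<in>F ` R. abs ` orbit (relabel F \<pi>) a) = ?f ` (\<Union>a\<in>R. abs ` orbit \<pi> a)"
   unfolding image_UN UN_simps(10) o ..
  thus ?thesis using assms(1) by (simp add: transv_def)
 qed
 moreover have "disjoint_family_on (\<lambda>a. abs ` orbit (relabel F \<pi>) a) (F ` R)" unfolding disjoint_family_on_def
 proof (intro ballI impI)
  fix u v assume "u \<in> F ` R" "v \<in> F ` R" "u \<noteq> v"
  then obtain a c where ac: "u = F a" "v = F c" "a \<in> R" "c \<in> R" "a \<noteq> c" by blast
  have d: "abs ` orbit \<pi> a \<inter> abs ` orbit \<pi> c = {}"
   using assms(1) ac(3,4,5) unfolding transv_def disjoint_family_on_def by blast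
  show "abs ` orbit (relabel F \<pi>) u \<inter> abs ` orbit (relabel F \<pi>) v = {}" proof (rule ccontr)
   assume "abs ` orbit (relabel F \<pi>) u \<inter> abs ` orbit (relabel F \<pi>) v \<noteq> {}"
   then obtain x y where "x \<in> abs ` orbit \<pi> a" "y \<in> abs ` orbit \<pi> c" "?f x = ?f y" unfolding ac(1,2) o by blast
   hence "x = y" using inj[of x y] by force
   thus False using d \<open>x \<in> abs ` orbit \<pi> a\<close> \<open>y \<in> abs ` orbit \<pi> c\<close> by blast
  qed
 qed
 ultimately show ?thesis by (simp add: transv_def)
qed

lemma transversal_dbl:
 assumes "s permutes A" "ix_set A" "\<C> \<subseteq> cycle_blocks A s"
 shows "transv (\<Union>\<C>) (dbl s) (Min ` \<C>)" "inj_on Min \<C>"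
  "\<And>C. C \<in> \<C> ==> Min C \<in> C" "\<And>C. C \<in> \<C> ==> orbit (dbl s) (Min C) = C"
  "\<And>C. C \<in> \<C> ==> C \<subseteq> A"
proof -
 have fA: "finite A" by (rule ix_finite[OF assms(2)])
 have ps: "permutation s" by (rule perm_perm[OF assms(1) fA])
 note bl = cycle_blocks_block[OF assms(1) ps fA]
 show CA: "C \<subseteq> A" if "C \<in> \<C>" for C using bl(1) assms(3) that by blast
 show m: "Min C \<in> C" if "C \<in> \<C>" for C using bl(2,3)[of C] assms(3) that by (intro Min_in) blast+
 show o: "orbit (dbl s) (Min C) = C" if "C \<in> \<C>" for C
  using orbit_dbl[OF assms(1,2), of "Min C"] CA[OF that] m[OF that] bl(4)[of C "Min C"] assms(3) that by blast
 show inj: "inj_on Min \<C>" by (rule inj_onI) (metis o)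
 have a: "abs ` C = C" if "C \<in> \<C>" for C using CA[OF that] ix_nonneg[OF assms(2)] by (force simp: image_iff)
 have "Min ` \<C> \<subseteq> pm (\<Union>\<C>)" using m by (force simp: signed_set_def)
 moreover have "(\<Union>a\<in>Min ` \<C>. abs ` orbit (dbl s) a) = \<Union>\<C>" by (simp add: o a)
 moreover have "disjoint_family_on (\<lambda>a. abs ` orbit (dbl s) a) (Min ` \<C>)" unfolding disjoint_family_on_def
 proof (intro ballI impI)
  fix u v assume "u \<in> Min ` \<C>" "v \<in> Min ` \<C>" "u \<noteq> v"
  then obtain C D where CD: "C \<in> \<C>" "D \<in> \<C>" "u = Min C" "v = Min D" "C \<noteq> D" by blast
  have "C \<inter> D = {}" proof (rule ccontr)
   assume "C \<inter> D \<noteq> {}"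
   then obtain x where "x \<in> C" "x \<in> D" by blast
   hence "C = D" using bl(4)[of C x] bl(4)[of D x] CD(1,2) assms(3) by blast
   thus False using CD(5) by simp
  qed
  thus "abs ` orbit (dbl s) u \<inter> abs ` orbit (dbl s) v = {}" unfolding CD(3,4) o[OF CD(1)] o[OF CD(2)] a[OF CD(1)] a[OF CD(2)] .
 qed
 ultimately show "transv (\<Union>\<C>) (dbl s) (Min ` \<C>)" by (simp add: transv_def)
qed

lemma entry_map_upto: "i \<in> {1..int n} ==> entry (map f [1..int n]) i = f i"
 unfolding entry_def by (subst nth_map) (auto simp: nth_upto)

text \<open>A single mirrored pair has one positive member, which may pass through a or through -a;
  the disjunction records which.\<close>

lemma one_cycle_pos_cycles:
 assumes "\<pi> \<in> PM I" "ix_set I" "a \<in> pm I" "abs ` orbit \<pi> a = I"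
 obtains B where "pos_cycles I \<pi> = {B}" "Min (abs ` B) \<in> orbit \<pi> a \<or> - Min (abs ` B) \<in> orbit \<pi> a" proof -
 note pp = PM_perm[OF assms(1,2)]
 have s: "pm I = orbit \<pi> a \<union> uminus ` orbit \<pi> a" using signed_set_abs[of "orbit \<pi> a"] unfolding assms(4) .
 have o: "orbit \<pi> x = orbit \<pi> a \<or> orbit \<pi> x = uminus ` orbit \<pi> a" if x: "x \<in> pm I" for x proof -
  consider "x \<in> orbit \<pi> a" | "x \<in> orbit \<pi> (- a)" using x unfolding s PM_orbit_neg[OF assms(1,2)] by blast
  thus ?thesis unfolding PM_orbit_neg[OF assms(1,2), symmetric] by cases (use orbit_cyclic_eq3[OF cyclic_on_orbit'[OF pp]] in blast)+
 qed
 have na: "- a \<in> pm I" using assms(3) by simp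
 have bl: "cycle_blocks (pm I) \<pi> = {orbit \<pi> a, uminus ` orbit \<pi> a}" unfolding cycle_blocks_def
 proof (intro equalityI subsetI)
  fix B assume "B \<in> {orbit \<pi> a, uminus ` orbit \<pi> a}"
  thus "B \<in> orbit \<pi> ` pm I" unfolding PM_orbit_neg[OF assms(1,2), symmetric] using assms(3) na by blast
 qed (use o in blast)
 have oa: "orbit \<pi> a \<in> cycle_blocks (pm I) \<pi>" unfolding bl by simp
 have uu: "uminus ` uminus ` orbit \<pi> a = orbit \<pi> a" by (simp add: image_image)
 have sub: "pos_cycles I \<pi> \<subseteq> {orbit \<pi> a, uminus ` orbit \<pi> a}" unfolding pos_cycles_def bl by blast
 have mB: "B \<in> pos_cycles I \<pi> ==> Min (abs ` B) \<in> B" for B by (simp add: pos_cycles_def)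
 show thesis proof (cases "orbit \<pi> a \<in> pos_cycles I \<pi>")
  case True
  hence "uminus ` orbit \<pi> a \<notin> pos_cycles I \<pi>" using pos_cycles_cases[OF assms(1,2) oa] by blast
  hence "pos_cycles I \<pi> = {orbit \<pi> a}" using True sub by blast
  thus thesis by (rule that) (use mB[OF True] in blast)
 next
  case False
  hence t: "uminus ` orbit \<pi> a \<in> pos_cycles I \<pi>" using pos_cycles_cases[OF assms(1,2) oa] by blast
  hence "pos_cycles I \<pi> = {uminus ` orbit \<pi> a}" using False sub by blast
  thus thesis by (rule that) (use mB[OF t] in force)
 qed
qed

section \<open>Limits of matrix cumulants\<close>

text \<open>Adds the values of the limits for one and for two cycles, with words read on positive
  cycles. \<open>one_cycle_moment\<close> and \<open>two_cycle_covariance\<close> free them from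
  that choice.\<close>

locale limit_system = cumulant_system F A E c + real_second_order_ncps scale tp \<phi>\<^sub>1 \<phi>\<^sub>2
 for F :: "nat filter" and A :: "int set" and E c :: "int set => (int => int) => nat => complex"
  and scale :: "complex => 'a::ring_1 => 'a" and tp :: "'a => 'a"
  and \<phi>\<^sub>1 :: "'a => complex" and \<phi>\<^sub>2 :: "'a => 'a => complex" +
 fixes X :: "int => 'a"
 assumes X_uminus: "k \<in> pm A ==> X (- k) = tp (X k)"
  and moment_limit: "I \<subseteq> A ==> \<pi> \<in> PM I ==> pos_cycles I \<pi> = {B} ==>
   (E I \<pi> \<longlongrightarrow> \<phi>\<^sub>1 (prod_list (map X (slot_word \<pi> B)))) F"
  and covariance_limit: "I \<union> J \<subseteq> A ==> I \<inter> J = {} ==> \<pi> \<in> PM (I \<union> J) ==> sstable I \<pi> ==>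
   pos_cycles I (res I \<pi>) = {B} ==> pos_cycles J (res J \<pi>) = {C} ==>
   ((\<lambda>N. of_nat N ^ 2 * (E (I \<union> J) \<pi> N - E I (res I \<pi>) N * E J (res J \<pi>) N)) \<longlongrightarrow>
    \<phi>\<^sub>2 (prod_list (map X (slot_word \<pi> B))) (prod_list (map X (slot_word \<pi> C)))) F"

lemma (in limit_system) X_uminus': "I \<subseteq> A ==> k \<in> pm I ==> X (- k) = tp (X k)"
 using X_uminus signed_set_mono by blast

lemma (in limit_system) one_cycle_moment:
 assumes "I \<subseteq> A" "\<pi> \<in> PM I" "a \<in> pm I" "abs ` orbit \<pi> a = I"
 shows "(E I \<pi> \<longlongrightarrow> \<phi>\<^sub>1 (prod_list (map X (support \<pi> a)))) F" proof -
 have ix: "ix_set I" by (rule ix_A[OF assms(1)])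
 obtain B where B: "pos_cycles I \<pi> = {B}" "Min (abs ` B) \<in> orbit \<pi> a \<or> - Min (abs ` B) \<in> orbit \<pi> a"
  by (rule one_cycle_pos_cycles[OF assms(2) ix assms(3,4)])
 have "\<phi>\<^sub>1 (prod_list (map X (support \<pi> (Min (abs ` B))))) = \<phi>\<^sub>1 (prod_list (map X (support \<pi> a)))"
  by (rule trace_word_invariant[where f = \<phi>\<^sub>1 and X = X, OF phi1_tracial phi1_tp assms(2) ix assms(3) X_uminus'[OF assms(1)] B(2)])
 thus ?thesis using moment_limit[OF assms(1,2) B(1)] unfolding slot_word_def by simp
qed

lemma (in limit_system) two_cycle_covariance:
 assumes "I \<union> J \<subseteq> A" "I \<inter> J = {}" "\<pi> \<in> PM (I \<union> J)"
  and a: "a \<in> pm I" "abs ` orbit \<pi> a = I" and b: "b \<in> pm J" "abs ` orbit \<pi> b = J"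
 shows "((\<lambda>N. of_nat N ^ 2 * (E (I \<union> J) \<pi> N - E I (res I \<pi>) N * E J (res J \<pi>) N)) \<longlongrightarrow>
    \<phi>\<^sub>2 (prod_list (map X (support \<pi> a))) (prod_list (map X (support \<pi> b)))) F"
proof -
 have ix: "ix_set (I \<union> J)" by (rule ix_A[OF assms(1)])
 have ab: "a \<in> pm (I \<union> J)" "b \<in> pm (I \<union> J)" using a(1) b(1) by (simp_all add: signed_set_Un)
 have st: "sstable I \<pi>" "sstable J \<pi>"
  using cycle_idx(2)[OF assms(3) ix ab(1)] cycle_idx(2)[OF assms(3) ix ab(2)] unfolding a(2) b(2) .
 have r: "res I \<pi> \<in> PM I" "res J \<pi> \<in> PM J"
  using res_PM[OF assms(3) ix Un_upper1 st(1)] res_PM[OF assms(3) ix Un_upper2 st(2)] .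
 have ixs: "ix_set I" "ix_set J" using ix by simp_all
 have o: "orbit (res I \<pi>) a = orbit \<pi> a" "orbit (res J \<pi>) b = orbit \<pi> b"
  using orbit_res[OF st(1) a(1)] orbit_res[OF st(2) b(1)] .
 obtain B where B: "pos_cycles I (res I \<pi>) = {B}" "Min (abs ` B) \<in> orbit \<pi> a \<or> - Min (abs ` B) \<in> orbit \<pi> a"
  by (rule one_cycle_pos_cycles[OF r(1) ixs(1) a(1), unfolded o(1), OF a(2)])
 obtain C where C: "pos_cycles J (res J \<pi>) = {C}" "Min (abs ` C) \<in> orbit \<pi> b \<or> - Min (abs ` C) \<in> orbit \<pi> b"
  by (rule one_cycle_pos_cycles[OF r(2) ixs(2) b(1), unfolded o(2), OF b(2)])
 have "\<phi>\<^sub>2 (prod_list (map X (support \<pi> (Min (abs ` B))))) (prod_list (map X (support \<pi> (Min (abs ` C)))))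
   = \<phi>\<^sub>2 (prod_list (map X (support \<pi> a))) (prod_list (map X (support \<pi> (Min (abs ` C)))))"
  by (rule trace_word_invariant[where f = "\<lambda>u. \<phi>\<^sub>2 u _" and X = X, OF phi2_tracial_left phi2_tp_left assms(3) ix ab(1) X_uminus'[OF assms(1)] B(2)])
 also have "... = \<phi>\<^sub>2 (prod_list (map X (support \<pi> a))) (prod_list (map X (support \<pi> b)))"
  by (rule trace_word_invariant[where f = "\<lambda>u. \<phi>\<^sub>2 _ u" and X = X, OF phi2_tracial_right phi2_tp_right assms(3) ix ab(2) X_uminus'[OF assms(1)] C(2)])
 finally show ?thesis using covariance_limit[OF assms(1-3) st(1) B(1) C(1)] unfolding slot_word_def by simp
qed

definition (in limit_system) ccum :: "(int => int) => int => complex" where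
 "ccum \<pi> a = free_cumulant \<phi>\<^sub>1 (map X (support \<pi> a))"

lemma (in limit_system) cycle_cumulant_res:
 "sstable J \<pi> ==> a \<in> pm J ==> ccum (res J \<pi>) a = ccum \<pi> a"
 unfolding ccum_def by (simp only: support_res)

lemma relabel_word:
 assumes "odd_bij G" "s permutes {1..int n}" "C \<in> cycle_blocks {1..int n} s" shows "map X (support (relabel G (dbl s)) (G (Min C)))
  = map (entry (map (\<lambda>i. X (G i)) [1..int n])) (support s (Min C))"
proof -
 have ix: "ix_set {1..int n}" by simp
 have C: "Min C \<in> C" "C \<subseteq> {1..int n}" using transversal_dbl(3,5)[OF assms(2) ix, of "{C}" C] assms(3) by simp_all
 hence m: "Min C \<in> {1..int n}" by blast
 have "map X (support (relabel G (dbl s)) (G (Min C))) = map (\<lambda>i. X (G i)) (support s (Min C))"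
  unfolding relabel_support[OF odd_bijD(1)[OF assms(1)]] support_dbl[OF assms(2) ix m] by simp
 also have "... = map (entry (map (\<lambda>i. X (G i)) [1..int n])) (support s (Min C))" proof (rule map_cong[OF refl])
  fix i assume "i \<in> set (support s (Min C))"
  hence "i \<in> {1..int n}" using support_subset[OF assms(2) m] by blast
  thus "X (G i) = entry (map (\<lambda>i. X (G i)) [1..int n]) i" using entry_map_upto[of i n "\<lambda>i. X (G i)"] by simp
 qed
 finally show ?thesis .
qed

lemma (in limit_system) prod_cycle_cumulant_relabel:
 assumes "odd_bij G" "s permutes {1..int n}" "\<C> \<subseteq> cycle_blocks {1..int n} s"
 shows "(\<Prod>a\<in>G ` Min ` \<C>. ccum (relabel G (dbl s)) a)
  = (\<Prod>C\<in>\<C>. free_cumulant \<phi>\<^sub>1 (map (entry (map (\<lambda>i. X (G i)) [1..int n])) (support s (Min C))))"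
proof -
 have inj: "inj_on Min \<C>" by (rule transversal_dbl(2)[OF assms(2) index_set_interval assms(3)]) simp
 have "inj_on G (Min ` \<C>)" by (rule inj_on_subset[OF bij_is_inj[OF odd_bijD(1)[OF assms(1)]] subset_UNIV])
 hence "(\<Prod>a\<in>G ` Min ` \<C>. ccum (relabel G (dbl s)) a) = (\<Prod>C\<in>\<C>. ccum (relabel G (dbl s)) (G (Min C)))"
  using inj by (simp add: prod.reindex)
 also have "... = (\<Prod>C\<in>\<C>. free_cumulant \<phi>\<^sub>1 (map (entry (map (\<lambda>i. X (G i)) [1..int n])) (support s (Min C))))"
  unfolding ccum_def
  by (intro prod.cong refl arg_cong[where f = "free_cumulant \<phi>\<^sub>1"] relabel_word assms(1,2)) (use assms(3) in blast)
 finally show ?thesis .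
qed

lemma abs_image_relabel:
 assumes "odd_bij G" "G ` pm B = pm I" "ix_set B" "ix_set I" shows "(\<lambda>x. \<bar>G x\<bar>) ` B = I"
proof (intro equalityI subsetI)
 fix y assume "y \<in> (\<lambda>x. \<bar>G x\<bar>) ` B"
 then obtain x where x: "x \<in> B" "y = \<bar>G x\<bar>" by blast
 hence "G x \<in> pm I" unfolding assms(2)[symmetric] by (simp add: signed_set_def)
 thus "y \<in> I" unfolding in_signed_set[OF assms(4)] x(2) .
next
 fix y assume y: "y \<in> I"
 hence "y \<in> G ` pm B" unfolding assms(2) by (simp add: signed_set_def)
 then obtain x where x: "x \<in> pm B" "y = G x" by blast
 have "\<bar>x\<bar> \<in> B" using x(1) in_signed_set[OF assms(3)] by blast
 moreover have "y = \<bar>G \<bar>x\<bar>\<bar>" using odd_bij_abs[OF assms(1), of x] x(2) ix_nonneg[OF assms(4) y] by simp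
 ultimately show "y \<in> (\<lambda>x. \<bar>G x\<bar>) ` B" by blast
qed

lemma relabel_Collect:
 assumes "odd_bij G" "G ` pm B = pm I" shows "{r \<in> PM I. P r} = relabel G ` {r \<in> PM B. P (relabel G r)}"
proof -
 have "relabel G ` PM B = PM I" using bij_betw_relabel[OF assms] by (simp add: bij_betw_def)
 hence "{r \<in> PM I. P r} = {r \<in> relabel G ` PM B. P r}" by (simp only:)
 also have "... = relabel G ` {r \<in> PM B. P (relabel G r)}" by blast
 finally show ?thesis .
qed

lemma inj_on_relabel_dbl:
 assumes "odd_bij G" "ix_set B" "S \<subseteq> {v. v permutes B}" shows "inj_on (\<lambda>v. relabel G (dbl v)) S"
proof (rule inj_onI)
 fix v t assume s: "v \<in> S" "t \<in> S" and e: "relabel G (dbl v) = relabel G (dbl t)"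
 have "dbl v = dbl t" using arg_cong[OF e, of "relabel (pinv G)"] unfolding relabel_pinv[OF odd_bijD(1)[OF assms(1)]] .
 thus "v = t" using inj_onD[OF inj_on_dbl[OF assms(2)]] s assms(3) by blast
qed

text \<open>Since \<open>K2\<close> tends to zero, cumulants become multiplicative over preserved
  sets: one cycle is split off, and both parts have fewer indices.\<close>

lemma (in limit_system) several_cycles_tendsto:
 assumes IH: "\<And>J \<pi> R. card J < card I ==> J \<subseteq> A ==> \<pi> \<in> PM J ==> transv J \<pi> R ==> R \<noteq> {} ==>
   (c J \<pi> \<longlongrightarrow> (\<Prod>a\<in>R. ccum \<pi> a)) F"
  and I: "I \<subseteq> A" "\<pi> \<in> PM I" "transv I \<pi> R" "a \<in> R" "abs ` orbit \<pi> a \<noteq> I"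
 shows "(c I \<pi> \<longlongrightarrow> (\<Prod>a\<in>R. ccum \<pi> a)) F" proof -
 have ix: "ix_set I" by (rule ix_A[OF I(1)])
 have fin: "finite R" "finite I" by (rule finite_transversal[OF I(3) ix], rule ix_finite[OF ix])
 let ?J = "abs ` orbit \<pi> a" and ?K = "\<Union>b\<in>R - {a}. abs ` orbit \<pi> b"
 have a: "a \<in> pm I" by (rule trans_in[OF I(3,4)])
 note ci = cycle_idx[OF I(2) ix a]
 have K: "?K = I - ?J" by (rule transversal_Diff[OF I(3,4)])
 have sub: "?J \<subseteq> I" "?K \<subseteq> I" using ci(1) K by blast+
 have JK: "?J \<union> ?K = I" "?J \<inter> ?K = {}" using K sub(1) by blast+
 have less: "card ?J < card I" "card ?K < card I" using I(5) sub(1) K ci(4) fin(2) by (intro psubset_card_mono; blast)+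
 have stK: "sstable ?K \<pi>" by (rule transversal_stable[OF I(3,2) ix _ subset_refl]) blast
 have tK: "transv ?K \<pi> (R - {a})" by (rule transversal_sub[OF I(3,2) ix _ subset_refl]) blast
 have ne: "R - {a} \<noteq> {}" using JK I(5) by auto
 have 1: "(c ?J (res ?J \<pi>) \<longlongrightarrow> (\<Prod>b\<in>{a}. ccum (res ?J \<pi>) b)) F"
  by (rule IH[OF less(1) subset_trans[OF sub(1) I(1)] res_PM[OF I(2) ix sub(1) ci(2)]
    transversal_res[OF transversal_cycle[OF I(2) ix a] ci(2)]]) simp
 have 2: "(c ?K (res ?K \<pi>) \<longlongrightarrow> (\<Prod>b\<in>R - {a}. ccum (res ?K \<pi>) b)) F"
  by (rule IH[OF less(2) subset_trans[OF sub(2) I(1)] res_PM[OF I(2) ix sub(2) stK] transversal_res[OF tK stK] ne])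
 have e: "ccum (res ?J \<pi>) a = ccum \<pi> a" by (rule cycle_cumulant_res[OF ci(2,3)])
 have e': "(\<Prod>b\<in>R - {a}. ccum (res ?K \<pi>) b) = (\<Prod>b\<in>R - {a}. ccum \<pi> b)"
  by (intro prod.cong refl cycle_cumulant_res[OF stK trans_in[OF tK]])
 have k: "((\<lambda>N. K2 ?J ?K \<pi> N) \<longlongrightarrow> 0) F"
  by (rule K2_tendsto_zero[OF _ JK(2) _ ci(2)]) (unfold JK(1), rule I(1), rule I(2))
 have "((\<lambda>N. K2 ?J ?K \<pi> N + c ?J (res ?J \<pi>) N * c ?K (res ?K \<pi>) N) \<longlongrightarrow>
   0 + ccum \<pi> a * (\<Prod>b\<in>R - {a}. ccum \<pi> b)) F"
  using 1 2 unfolding e' by (intro tendsto_add k tendsto_mult) (simp_all add: e)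
 thus ?thesis unfolding K2_def JK(1) prod.remove[OF fin(1) I(4)] by simp
qed

text \<open>For a single cycle in standard form the limiting moment relation is a sum over
  \<open>S_nc\<close>. All its terms except the cycle itself have several cycles and are known,
  which reproduces the recursion of \<open>free_cumulant\<close>.\<close>

theorem (in limit_system) cumulant_tendsto:
 assumes "I \<subseteq> A" "\<pi> \<in> PM I" "transv I \<pi> R" "R \<noteq> {}"
 shows "(c I \<pi> \<longlongrightarrow> (\<Prod>a\<in>R. ccum \<pi> a)) F" using assms
proof (induction "card I" arbitrary: I \<pi> R rule: less_induct)
 case less
 note IA = less.prems(1) and P = less.prems(2) and T = less.prems(3)
 have ix: "ix_set I" by (rule ix_A[OF IA])
 \<comment> \<open>The index set is still I, but splitting off a cycle refers only to smaller sets,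
   so the induction hypothesis suffices.\<close>
 have several: "(c I \<pi>' \<longlongrightarrow> (\<Prod>a\<in>R'. ccum \<pi>' a)) F"
  if "\<pi>' \<in> PM I" "transv I \<pi>' R'" "b \<in> R'" "abs ` orbit \<pi>' b \<noteq> I" for \<pi>' R' b
 proof (rule several_cycles_tendsto[OF _ IA that])
  fix J u S
  assume "card J < card I" "J \<subseteq> A" "u \<in> PM J" "transv J u S" "S \<noteq> {}"
  thus "(c J u \<longlongrightarrow> (\<Prod>a\<in>S. ccum u a)) F" by (rule less.hyps)
 qed
 obtain a where a: "a \<in> R" using less.prems(4) by blast
 show ?case proof (cases "abs ` orbit \<pi> a = I")
  case False
  thus ?thesis by (rule several[OF P T a])
 next
  case True
  have aI: "a \<in> pm I" by (rule trans_in[OF T a])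
  have R: "R = {a}" proof -
   have "b = a" if b: "b \<in> R" for b proof (rule ccontr)
    assume "b \<noteq> a"
    hence "abs ` orbit \<pi> b \<inter> I = {}" using T a b unfolding transv_def disjoint_family_on_def True[symmetric] by blast
    thus False using cycle_idx(1,4)[OF P ix trans_in[OF T b]] by blast
   qed
   thus ?thesis using a by blast
  qed
  define n where "n = length (support \<pi> a)"
  obtain G where G: "odd_bij G" "map G [1..int n] = support \<pi> a" "G ` pm {1..int n} = pm I"
   "n \<ge> 1" "relabel G (dbl (tau1 n)) = \<pi>" unfolding n_def by (rule relabel_one_cycle[OF P ix aI True])
  define h where "h v = relabel G (dbl v)" for v
  define xs where "xs = map X (support \<pi> a)"
  have xs: "xs = map (\<lambda>i. X (G i)) [1..int n]" unfolding xs_def G(2)[symmetric] by simp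
  have len: "length xs = n" unfolding xs by simp
  have ixn: "ix_set {1..int n}" by simp
  have Sn: "S_nc n \<subseteq> {v. v permutes {1..int n}}" by (auto simp: S_nc_def)
  have inj: "inj_on h (S_nc n)" unfolding h_def by (rule inj_on_relabel_dbl[OF G(1) ixn Sn])
  have tP: "dbl (tau1 n) \<in> PM {1..int n}" by (rule dbl_PM[OF tau1_permutes ixn])
  have Z: "{u \<in> PM I. defect I \<pi> u = 0} = h ` S_nc n" proof -
   have "{u \<in> PM {1..int n}. defect I \<pi> (relabel G u) = 0} = {u \<in> PM {1..int n}. defect {1..int n} (dbl (tau1 n)) u = 0}"
    using relabel_defect[OF G(1,3) ixn ix tP] unfolding G(5) by auto
   thus ?thesis unfolding relabel_Collect[OF G(1,3)] defect_zero_tau1[OF G(4)] by (simp add: image_image h_def)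
  qed
  have t: "tau1 n \<in> S_nc n" "h (tau1 n) = \<pi>" using tau1_in_S_nc(1)[OF G(4)] G(5) by (simp_all add: h_def)
  let ?w = "\<lambda>u N. eps N ^ defect I \<pi> u :: complex"
  let ?k = "\<lambda>v. \<Prod>C\<in>cycle_blocks {1..int n} v. free_cumulant \<phi>\<^sub>1 (map (entry xs) (support v (Min C)))"
  have fin: "finite (PM I)" by (rule finite_PM[OF ix])
  have split: "(\<Sum>u\<in>PM I. f u) = f \<pi> + ((\<Sum>v\<in>S_nc n - {tau1 n}. f (h v)) + (\<Sum>u | u \<in> PM I \<and> defect I \<pi> u \<noteq> 0. f u))"
   for f :: "(int => int) => complex"
  proof -
   have "(\<Sum>u\<in>PM I. f u) = (\<Sum>u | u \<in> PM I \<and> defect I \<pi> u = 0. f u) + (\<Sum>u | u \<in> PM I \<and> defect I \<pi> u \<noteq> 0. f u)"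
   proof -
    have "PM I - {u \<in> PM I. defect I \<pi> u = 0} = {u \<in> PM I. defect I \<pi> u \<noteq> 0}" by auto
    thus ?thesis using sum.subset_diff[OF _ fin, of "{u \<in> PM I. defect I \<pi> u = 0}" f] by (simp add: add.commute)
   qed
   also have "(\<Sum>u | u \<in> PM I \<and> defect I \<pi> u = 0. f u) = (\<Sum>v\<in>S_nc n. f (h v))"
    unfolding Z by (rule sum.reindex_cong[OF inj refl refl])
   also have "... = f \<pi> + (\<Sum>v\<in>S_nc n - {tau1 n}. f (h v))" unfolding sum.remove[OF finite_S_nc t(1)] t(2) ..
   finally show ?thesis by (simp add: add.assoc)
  qed
  have zero: "((\<lambda>N. \<Sum>u | u \<in> PM I \<and> defect I \<pi> u \<noteq> 0. ?w u N * c I u N) \<longlongrightarrow> 0) F"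
  proof (rule tendsto_null_sum)
   fix u assume r: "u \<in> {u \<in> PM I. defect I \<pi> u \<noteq> 0}"
   have "(?w u \<longlongrightarrow> 0) F" using weight_tendsto[of "defect I \<pi> u"] r by (simp add: zero_power)
   thus "((\<lambda>N. ?w u N * c I u N) \<longlongrightarrow> 0) F"
    by (rule tendsto_zero_mult_bdd) (rule cumulant_bdd[OF IA], use r in simp)
  qed
  have nc: "((\<lambda>N. ?w (h v) N * c I (h v) N) \<longlongrightarrow> ?k v) F" if s: "v \<in> S_nc n - {tau1 n}" for v proof -
   have sp: "v permutes {1..int n}" using s Sn by blast
   have "h v \<in> {u \<in> PM I. defect I \<pi> u = 0}" unfolding Z using s by blast
   hence hs: "h v \<in> PM I" "defect I \<pi> (h v) = 0" by simp_all
   let ?B = "cycle_blocks {1..int n} v" and ?R = "G ` Min ` cycle_blocks {1..int n} v"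
   note td = transversal_dbl[OF sp ixn subset_refl]
   have UB: "\<Union>?B = {1..int n}" using partition_on_cycle_blocks[OF sp] by (simp add: partition_on_def)
   have tr: "transv I (h v) ?R" using transversal_relabel[OF td(1) G(1)] abs_image_relabel[OF G(1,3) ixn ix] unfolding UB h_def by simp
   have "1 \<in> \<Union>?B" unfolding UB using G(4) by simp
   then obtain C where C: "C \<in> ?B" by blast
   \<comment> \<open>A noncrossing permutation other than the long cycle has no cycle of length n,
     which places it in the case of several cycles.\<close>
   have ne: "abs ` orbit (h v) (G (Min C)) \<noteq> I" proof
    assume e: "abs ` orbit (h v) (G (Min C)) = I"
    have m: "Min C \<in> {1..int n}" using td(3,5)[OF C] by blast
    have "orbit (h v) (G (Min C)) = G ` C" unfolding h_def relabel_orbit[OF odd_bijD(1)[OF G(1)]] td(4)[OF C] ..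
    hence "card I \<le> card C" unfolding e[symmetric] using finite_subset[OF td(5)[OF C]] by (simp add: image_image card_image_le)
    moreover have "card C < n" using S_nc_cycle_length[OF s C] length_support_Min[OF sp _ C] by simp
    moreover have "card I = n"
     using card_image[OF inj_on_subset[OF bij_is_inj[OF odd_bijD(1)[OF G(1)]] subset_UNIV], of "pm {1..int n}"]
     unfolding G(3) card_signed_set[OF ix] card_signed_set[OF ixn] by simp
    ultimately show False by simp
   qed
   have "(c I (h v) \<longlongrightarrow> (\<Prod>a\<in>?R. ccum (h v) a)) F" by (rule several[OF hs(1) tr _ ne]) (use C in blast)
   thus ?thesis unfolding hs(2) unfolding h_def prod_cycle_cumulant_relabel[OF G(1) sp subset_refl] xs[symmetric] by simp
  qed
  have "((\<lambda>N. E I \<pi> N - ((\<Sum>v\<in>S_nc n - {tau1 n}. ?w (h v) N * c I (h v) N)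
    + (\<Sum>u | u \<in> PM I \<and> defect I \<pi> u \<noteq> 0. ?w u N * c I u N)))
   \<longlongrightarrow> \<phi>\<^sub>1 (prod_list xs) - ((\<Sum>v\<in>S_nc n - {tau1 n}. ?k v) + 0)) F" unfolding xs_def[symmetric]
   by (intro tendsto_diff tendsto_add tendsto_sum nc zero one_cycle_moment[OF IA P aI True, folded xs_def])
  moreover have "\<phi>\<^sub>1 (prod_list xs) - ((\<Sum>v\<in>S_nc n - {tau1 n}. ?k v) + 0) = (\<Prod>a\<in>R. ccum \<pi> a)" proof -
   have "ccum \<pi> a = free_cumulant \<phi>\<^sub>1 xs" unfolding ccum_def xs_def ..
   thus ?thesis unfolding R using free_cumulant.simps[of \<phi>\<^sub>1 xs] unfolding len by simp
  qed
  moreover have "eventually (\<lambda>N. E I \<pi> N - ((\<Sum>v\<in>S_nc n - {tau1 n}. ?w (h v) N * c I (h v) N)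
    + (\<Sum>u | u \<in> PM I \<and> defect I \<pi> u \<noteq> 0. ?w u N * c I u N)) = c I \<pi> N) F" using moment_eq[OF IA]
  proof eventually_elim
   case (elim N)
   have "E I \<pi> N = (\<Sum>u\<in>PM I. ?w u N * c I u N)" using elim P by blast
   thus ?case unfolding split[of "\<lambda>u. ?w u N * c I u N"] by (simp add: defect_self[OF P ix])
  qed
  ultimately show ?thesis by (simp only: Lim_transform_eventually)
 qed
qed

section \<open>The scaled covariance as a derivation in each argument\<close>

lemma (in cumulant_system) K2_commute: "K2 I J \<pi> N = K2 J I \<pi> N"
 by (simp add: K2_def Un_commute mult.commute)

text \<open>The derivation rule iterated over the cycles of I: one cycle a carries the second-order
  limit g a, the others their first-order limits.\<close>

lemma (in limit_system) K2_tendsto_union: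
 assumes IJ: "I \<union> J \<subseteq> A" "I \<inter> J = {}" and \<pi>: "\<pi> \<in> PM (I \<union> J)" "transv I \<pi> R"
  and g: "\<And>a. a \<in> R ==> ((\<lambda>N. of_nat N ^ 2 * K2 (abs ` orbit \<pi> a) J (res (abs ` orbit \<pi> a \<union> J) \<pi>) N) \<longlongrightarrow> g a) F"
  and S: "finite S" "S \<noteq> {}" "S \<subseteq> R"
 defines "U \<equiv> \<lambda>S. \<Union>a\<in>S. abs ` orbit \<pi> a"
 shows "((\<lambda>N. of_nat N ^ 2 * K2 (U S) J (res (U S \<union> J) \<pi>) N)
   \<longlongrightarrow> (\<Sum>a\<in>S. g a * (\<Prod>b\<in>S - {a}. ccum \<pi> b))) F" using S
proof (induction S rule: finite_ne_induct)
 case (singleton a)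
 thus ?case using g[of a] by (simp add: U_def)
next
 case (insert a S)
 have ix: "ix_set (I \<union> J)" by (rule ix_A[OF IJ(1)])
 have aR: "a \<in> R" "S \<subseteq> R" using insert.prems by blast+
 have UI: "U T \<subseteq> I" if "T \<subseteq> R" for T using \<pi>(2) that unfolding U_def transv_def by blast
 have Ua: "U {a} = abs ` orbit \<pi> a" by (simp add: U_def)
 have Ui: "U (insert a S) = U {a} \<union> U S" by (simp add: U_def)
 have st: "sstable (U T) \<pi>" if "T \<subseteq> R" for T unfolding U_def by (rule transversal_stable[OF \<pi>(2,1) ix that]) blast
 have tr: "transv (U T) \<pi> T" if "T \<subseteq> R" for T unfolding U_def by (rule transversal_sub[OF \<pi>(2,1) ix that]) blast
 have stI: "sstable I \<pi>" using st[OF subset_refl] \<pi>(2) by (simp add: U_def transv_def)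
 have stJ: "sstable J \<pi>" by (rule stable_other[OF \<pi>(1) ix IJ(2) stI])
 have aS: "{a} \<subseteq> R" using aR by simp
 have d: "U {a} \<inter> U S = {}" proof -
  have dfo: "disjoint_family_on (\<lambda>a. abs ` orbit \<pi> a) R" using \<pi>(2) by (simp add: transv_def)
  have "abs ` orbit \<pi> a \<inter> abs ` orbit \<pi> b = {}" if b: "b \<in> S" for b proof -
   have "b \<in> R" "a \<noteq> b" using b aR(2) insert.hyps(3) by blast+
   thus ?thesis by (rule disjoint_family_onD[OF dfo aR(1)])
  qed
  thus ?thesis unfolding Ua by (auto simp: U_def)
 qed
 have sub: "U {a} \<subseteq> I" "U S \<subseteq> I" using UI[OF aS] UI[OF aR(2)] .
 let ?Z = "U {a} \<union> U S \<union> J"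
 have ZA: "?Z \<subseteq> A" "?Z \<subseteq> I \<union> J" using sub IJ(1) by blast+
 have dJ: "U {a} \<inter> J = {}" "U S \<inter> J = {}" using sub IJ(2) by blast+
 have stZ: "sstable ?Z \<pi>" by (intro stable_join st aS aR(2) stJ)
 have Z: "res ?Z \<pi> \<in> PM ?Z" by (rule res_PM[OF \<pi>(1) ix ZA(2) stZ])
 have sZ: "U {a} \<subseteq> ?Z" "U S \<subseteq> ?Z" "U {a} \<union> J \<subseteq> ?Z" "U S \<union> J \<subseteq> ?Z" by blast+
 have st1: "sstable (U {a}) (res ?Z \<pi>)" "sstable (U S) (res ?Z \<pi>)"
  unfolding stable_res[OF sZ(1)] stable_res[OF sZ(2)] by (rule st[OF aS], rule st[OF aR(2)])
 have lim: "(c (U T) (res (U T) \<pi>) \<longlongrightarrow> (\<Prod>b\<in>T. ccum \<pi> b)) F" if T: "T \<subseteq> R" "T \<noteq> {}" for T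
 proof -
  have s: "U T \<subseteq> I \<union> J" "U T \<subseteq> A" using UI[OF T(1)] IJ(1) by blast+
  have "(c (U T) (res (U T) \<pi>) \<longlongrightarrow> (\<Prod>b\<in>T. ccum (res (U T) \<pi>) b)) F"
   by (rule cumulant_tendsto[OF s(2) res_PM[OF \<pi>(1) ix s(1) st[OF T(1)]] transversal_res[OF tr[OF T(1)] st[OF T(1)]] T(2)])
  moreover have "(\<Prod>b\<in>T. ccum (res (U T) \<pi>) b) = (\<Prod>b\<in>T. ccum \<pi> b)"
   by (intro prod.cong refl cycle_cumulant_res[OF st[OF T(1)] trans_in[OF tr[OF T(1)]]])
  ultimately show ?thesis by simp
 qed
 let ?P = "\<lambda>S. \<Prod>b\<in>S. ccum \<pi> b"
 note deriv = K2_derivation[OF ZA(1) d dJ Z st1, unfolded res_res[OF sZ(1)] res_res[OF sZ(2)] res_res[OF sZ(3)] res_res[OF sZ(4)]]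
 have "((\<lambda>N. (of_nat N ^ 2 * K2 (U {a} \<union> U S) J (res ?Z \<pi>) N
    - (of_nat N ^ 2 * K2 (U {a}) J (res (U {a} \<union> J) \<pi>) N * c (U S) (res (U S) \<pi>) N
     + of_nat N ^ 2 * K2 (U S) J (res (U S \<union> J) \<pi>) N * c (U {a}) (res (U {a}) \<pi>) N))
   + (of_nat N ^ 2 * K2 (U {a}) J (res (U {a} \<union> J) \<pi>) N * c (U S) (res (U S) \<pi>) N
     + of_nat N ^ 2 * K2 (U S) J (res (U S \<union> J) \<pi>) N * c (U {a}) (res (U {a}) \<pi>) N))
   \<longlongrightarrow> 0 + (g a * ?P S + (\<Sum>b\<in>S. g b * ?P (S - {b})) * ?P {a})) F"
  by (intro tendsto_add tendsto_mult deriv insert.IH[OF aR(2)] lim aS aR(2) insert.hyps(2))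
   (use g[OF aR(1)] in \<open>simp_all only: Ua insert_not_empty not_False_eq_True\<close>)
 moreover have "(\<Sum>b\<in>insert a S. g b * ?P (insert a S - {b})) = 0 + (g a * ?P S + (\<Sum>b\<in>S. g b * ?P (S - {b})) * ?P {a})"
 proof -
  have e: "?P (insert a S - {b}) = ?P (S - {b}) * ?P {a}" if b: "b \<in> S" for b proof -
   have "insert a S - {b} = insert a (S - {b})" using b insert.hyps(3) by blast
   thus ?thesis using insert.hyps(1,3) by (simp add: mult.commute)
  qed
  have "(\<Sum>b\<in>S. g b * ?P (insert a S - {b})) = (\<Sum>b\<in>S. g b * ?P (S - {b}) * ?P {a})"
   by (intro sum.cong refl) (simp only: e mult.assoc)
  moreover have "insert a S - {a} = S" using insert.hyps(3) by blast
  ultimately show ?thesis using insert.hyps(1,3) by (simp add: sum_distrib_right)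
 qed
 ultimately show ?case unfolding Ui by simp
qed

lemma (in limit_system) K2_tendsto_left:
 assumes IJ: "I \<union> J \<subseteq> A" "I \<inter> J = {}" and \<pi>: "\<pi> \<in> PM (I \<union> J)" "transv I \<pi> R" "R \<noteq> {}"
  and g: "\<And>a. a \<in> R ==> ((\<lambda>N. of_nat N ^ 2 * K2 (abs ` orbit \<pi> a) J (res (abs ` orbit \<pi> a \<union> J) \<pi>) N) \<longlongrightarrow> g a) F"
 shows "((\<lambda>N. of_nat N ^ 2 * K2 I J \<pi> N) \<longlongrightarrow> (\<Sum>a\<in>R. g a * (\<Prod>b\<in>R - {a}. ccum \<pi> b))) F"
proof -
 have "finite R" by (rule finite_transversal[OF \<pi>(2) ix_A]) (use IJ in blast)
 note this \<pi>(3) subset_refl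
 moreover have "(\<Union>a\<in>R. abs ` orbit \<pi> a) = I" using \<pi>(2) by (simp add: transv_def)
 ultimately show ?thesis using K2_tendsto_union[OF IJ \<pi>(1,2) g, of R] by (simp add: res_self[OF \<pi>(1)])
qed

text \<open>The rule is used in each argument, the second time through the symmetry of
  \<open>K2\<close>. One cycle on each side remains marked.\<close>

lemma (in limit_system) K2_tendsto_pairs:
 assumes IJ: "I \<union> J \<subseteq> A" "I \<inter> J = {}" and \<pi>: "\<pi> \<in> PM (I \<union> J)"
  and R: "transv I \<pi> R" "R \<noteq> {}" and S: "transv J \<pi> S" "S \<noteq> {}"
  and h: "\<And>a b. a \<in> R ==> b \<in> S ==>
   ((\<lambda>N. of_nat N ^ 2 * K2 (abs ` orbit \<pi> a) (abs ` orbit \<pi> b) (res (abs ` orbit \<pi> a \<union> abs ` orbit \<pi> b) \<pi>) N) \<longlongrightarrow> h a b) F"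
 shows "((\<lambda>N. of_nat N ^ 2 * K2 I J \<pi> N) \<longlongrightarrow>
  (\<Sum>a\<in>R. (\<Sum>b\<in>S. h a b * (\<Prod>d\<in>S - {b}. ccum \<pi> d)) * (\<Prod>d\<in>R - {a}. ccum \<pi> d))) F"
proof (rule K2_tendsto_left[OF IJ \<pi> R])
 fix a assume a: "a \<in> R"
 have ix: "ix_set (I \<union> J)" by (rule ix_A[OF IJ(1)])
 have aI: "a \<in> pm (I \<union> J)" using trans_in[OF R(1) a] by (simp add: signed_set_Un)
 let ?K = "abs ` orbit \<pi> a"
 have K: "?K \<subseteq> I" using R(1) a by (auto simp: transv_def)
 have stK: "sstable ?K \<pi>" by (rule cycle_idx(2)[OF \<pi> ix aI])
 have stJ: "sstable J \<pi>" using transversal_stable[OF S(1) \<pi> ix subset_refl] S(1) by (simp add: transv_def)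
 let ?r = "res (J \<union> ?K) \<pi>"
 have sub: "J \<union> ?K \<subseteq> A" "J \<inter> ?K = {}" "J \<union> ?K \<subseteq> I \<union> J" using K IJ by blast+
 have st: "sstable (J \<union> ?K) \<pi>" by (rule stable_join[OF stJ stK])
 have r: "?r \<in> PM (J \<union> ?K)" by (rule res_PM[OF \<pi> ix sub(3) st])
 have m: "b \<in> pm (J \<union> ?K)" if "b \<in> S" for b using trans_in[OF S(1) that] by (simp add: signed_set_Un)
 have o: "orbit ?r b = orbit \<pi> b" if "b \<in> S" for b by (rule orbit_res[OF st m[OF that]])
 have cc: "ccum ?r b = ccum \<pi> b" if "b \<in> S" for b by (rule cycle_cumulant_res[OF st m[OF that]])
 have tS: "transv J ?r S" using S(1) o unfolding transv_def disjoint_family_on_def by simp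
 have "((\<lambda>N. of_nat N ^ 2 * K2 J ?K ?r N) \<longlongrightarrow> (\<Sum>b\<in>S. h a b * (\<Prod>d\<in>S - {b}. ccum ?r d))) F"
 proof (rule K2_tendsto_left[OF sub(1,2) r tS S(2)])
  fix b assume b: "b \<in> S"
  have s: "abs ` orbit \<pi> b \<union> ?K \<subseteq> J \<union> ?K" using S(1) b by (auto simp: transv_def)
  have "((\<lambda>N. of_nat N ^ 2 * K2 (abs ` orbit \<pi> b) ?K (res (abs ` orbit \<pi> b \<union> ?K) \<pi>) N) \<longlongrightarrow> h a b) F"
   using h[OF a b] by (simp only: K2_commute[of ?K] Un_commute[of ?K])
  thus "((\<lambda>N. of_nat N ^ 2 * K2 (abs ` orbit ?r b) ?K (res (abs ` orbit ?r b \<union> ?K) ?r) N) \<longlongrightarrow> h a b) F"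
   unfolding o[OF b] res_res[OF s] .
 qed
 moreover have "(\<Sum>b\<in>S. h a b * (\<Prod>d\<in>S - {b}. ccum ?r d)) = (\<Sum>b\<in>S. h a b * (\<Prod>d\<in>S - {b}. ccum \<pi> d))"
  by (intro sum.cong refl arg_cong2[where f = "(*)"] prod.cong) (simp add: cc)
 ultimately show "((\<lambda>N. of_nat N ^ 2 * K2 ?K J (res (?K \<union> J) \<pi>) N) \<longlongrightarrow> (\<Sum>b\<in>S. h a b * (\<Prod>d\<in>S - {b}. ccum \<pi> d))) F"
  by (simp only: K2_commute[of J] Un_commute[of J])
qed

section \<open>Marked pairs of cycles\<close>

lemma S_disc_nc_cycles:
 assumes "p \<ge> 1" "q \<ge> 1" "s \<in> S_disc_nc p q" "C \<in> cycle_blocks {1..int (p + q)} s"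
 shows "C \<subseteq> {1..int p} \<or> C \<subseteq> {int p + 1..int (p + q)}"
 using assms(3,4) unfolding S_disc_nc_def refines_def tau2_cycles(3)[OF assms(1,2)] by blast

lemma cycle_blocks_disjoint:
 assumes "s permutes S" "finite S" "C \<in> cycle_blocks S s" "D \<in> cycle_blocks S s" "x \<in> C" "x \<in> D" shows "C = D"
 using cycle_blocks_block(4)[OF assms(1) perm_perm[OF assms(1,2)] assms(2,3,5)]
  cycle_blocks_block(4)[OF assms(1) perm_perm[OF assms(1,2)] assms(2,4,6)] by simp

lemma union_not_block:
 assumes "s permutes S" "finite S" "C \<in> cycle_blocks S s" "D \<in> cycle_blocks S s" "C \<inter> D = {}"
 shows "C \<union> D \<notin> cycle_blocks S s" proof
 assume u: "C \<union> D \<in> cycle_blocks S s"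
 note bl = cycle_blocks_block[OF assms(1) perm_perm[OF assms(1,2)] assms(2)]
 obtain x y where x: "x \<in> C" "y \<in> D" using bl(2)[OF assms(3)] bl(2)[OF assms(4)] by blast
 have "C \<union> D = C" by (rule cycle_blocks_disjoint[OF assms(1,2) u assms(3) UnI1[OF x(1)] x(1)])
 moreover have "C \<union> D = D" by (rule cycle_blocks_disjoint[OF assms(1,2) u assms(4) UnI2[OF x(2)] x(2)])
 ultimately show False using x(1) assms(5) by blast
qed

text \<open>The permutation and the two marked cycles determine the partition, since all other
  blocks must be cycles.\<close>

lemma PS'_form:
 assumes "p \<ge> 1" "q \<ge> 1" "S \<in> S_disc_nc p q"
 defines "A \<equiv> {1..int (p + q)}" and "P \<equiv> {1..int p}" and "Q \<equiv> {int p + 1..int (p + q)}"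
 assumes CD: "C \<in> cycle_blocks A S" "D \<in> cycle_blocks A S" "C \<subseteq> P" "D \<subseteq> Q"
 defines "\<U> \<equiv> insert (C \<union> D) (cycle_blocks A S - {C, D})"
 shows "(\<U>, S) \<in> PS' p q" "nontrivial_block \<U> S = C \<union> D"
  "\<And>\<V>. (\<V>, S) \<in> PS' p q ==> nontrivial_block \<V> S = C \<union> D ==> \<V> = \<U>"
proof -
 have s: "S permutes A" using assms(3) by (simp add: S_disc_nc_def A_def)
 have fA: "finite A" by (simp add: A_def)
 have PQ: "P \<inter> Q = {}" by (auto simp: P_def Q_def)
 have d: "C \<inter> D = {}" using CD(3,4) PQ by blast
 note bl = cycle_blocks_block[OF s perm_perm[OF s fA] fA]
 have part: "partition_on A (cycle_blocks A S)" by (rule partition_on_cycle_blocks[OF s fA])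
 have UA: "\<Union>(cycle_blocks A S) = A" using part by (simp add: partition_on_def)
 note dj = cycle_blocks_disjoint[OF s fA]
 have nb: "C \<union> D \<notin> cycle_blocks A S" by (rule union_not_block[OF s fA CD(1,2) d])
 have "\<Union>\<U> = A" proof -
  have "\<Union>\<U> = \<Union>(cycle_blocks A S)" unfolding \<U>_def using CD(1,2) by blast
  thus ?thesis unfolding UA .
 qed
 have dis: "E \<inter> (C \<union> D) = {}" if "E \<in> cycle_blocks A S - {C, D}" for E
  using dj[of E C] dj[of E D] CD(1,2) that by blast
 have part': "partition_on A \<U>" proof (rule partition_onI)
  show "disjnt E E'" if "E \<in> \<U>" "E' \<in> \<U>" "E \<noteq> E'" for E E' proof -
   have "E \<inter> E' = {}" if "E \<in> cycle_blocks A S" "E' \<in> cycle_blocks A S" "E \<noteq> E'" for E E' using dj that by blast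
   thus ?thesis using that dis unfolding \<U>_def disjnt_def by blast
  qed
  show "{} \<notin> \<U>" unfolding \<U>_def using bl(2) CD(1) by blast
 qed (rule \<open>\<Union>\<U> = A\<close>)
 have ref: "refines A (cycle_blocks A S) \<U>" unfolding refines_def proof (intro conjI part part' ballI)
  fix E assume "E \<in> cycle_blocks A S"
  hence "E \<in> \<U> \<or> E \<subseteq> C \<union> D" unfolding \<U>_def by blast
  thus "\<exists>Y\<in>\<U>. E \<subseteq> Y" unfolding \<U>_def by blast
 qed
 have "C \<union> D \<in> \<U>" "\<U> - {C \<union> D} \<subseteq> cycle_blocks A S" unfolding \<U>_def by blast+
 thus "(\<U>, S) \<in> PS' p q" unfolding PS'_def mem_Collect_eq prod.case using assms(3) ref CD unfolding A_def P_def Q_def by blast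
 show "nontrivial_block \<U> S = C \<union> D" unfolding nontrivial_block_def \<open>\<Union>\<U> = A\<close>
  by (rule the_equality) (use nb in \<open>auto simp: \<U>_def\<close>)
 fix \<V> assume V: "(\<V>, S) \<in> PS' p q" "nontrivial_block \<V> S = C \<union> D"
 have Vref: "refines A (cycle_blocks A S) \<V>" using V(1) by (simp add: PS'_def A_def)
 hence Vpart: "partition_on A \<V>" by (simp add: refines_def)
 obtain C' D' where C'D': "C' \<in> cycle_blocks A S" "D' \<in> cycle_blocks A S" "C' \<subseteq> P" "D' \<subseteq> Q" "C' \<union> D' \<in> \<V>"
  "\<V> - {C' \<union> D'} \<subseteq> cycle_blocks A S"
  using V(1) unfolding PS'_def mem_Collect_eq prod.case A_def P_def Q_def by blast
 have nb': "C' \<union> D' \<notin> cycle_blocks A S" by (rule union_not_block[OF s fA C'D'(1,2)]) (use C'D'(3,4) PQ in blast)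
 have "\<Union>\<V> = A" using Vpart by (simp add: partition_on_def)
 hence "nontrivial_block \<V> S = C' \<union> D'" unfolding nontrivial_block_def by (intro the_equality) (use nb' C'D'(5,6) in auto)
 hence e: "C' \<union> D' = C \<union> D" using V(2) by simp
 have V': "C \<union> D \<in> \<V>" "\<V> - {C \<union> D} \<subseteq> cycle_blocks A S" using C'D'(5,6) unfolding e .
 have disV: "E \<inter> E' = {}" if "E \<in> \<V>" "E' \<in> \<V>" "E \<noteq> E'" for E E'
  using Vpart that unfolding partition_on_def pairwise_def disjnt_def by blast
 obtain x y where xy: "x \<in> C" "y \<in> D" using bl(2)[OF CD(1)] bl(2)[OF CD(2)] by blast
 show "\<V> = \<U>" proof (intro equalityI subsetI)
  fix E assume E: "E \<in> \<V>"
  show "E \<in> \<U>" proof (cases "E = C \<union> D")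
   case False
   hence "E \<inter> (C \<union> D) = {}" using disV[OF E V'(1)] by blast
   hence "E \<noteq> C" "E \<noteq> D" using xy by blast+
   thus ?thesis using V'(2) E False unfolding \<U>_def by blast
  qed (simp add: \<U>_def)
 next
  fix E assume "E \<in> \<U>"
  then consider "E = C \<union> D" | "E \<in> cycle_blocks A S - {C, D}" unfolding \<U>_def by blast
  thus "E \<in> \<V>" proof cases
   case 2
   then obtain Y where Y: "Y \<in> \<V>" "E \<subseteq> Y" using Vref unfolding refines_def by blast
   obtain z where z: "z \<in> E" using bl(2)[of E] 2 by blast
   have "Y \<noteq> C \<union> D" using dis[OF 2] Y(2) z by blast
   hence "Y \<in> cycle_blocks A S" using V'(2) Y(1) by blast
   hence "E = Y" using dj[of E Y z] 2 z Y(2) by blast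
   thus ?thesis using Y(1) by simp
  qed (simp add: V'(1))
 qed
qed

text \<open>Partitioned permutations are replaced by permutations with a marked cycle in each
  circle, the form that the derivation rule produces.\<close>

lemma sum_PS':
 fixes \<Phi> :: "int set => (int => int) => complex"
 assumes "p \<ge> 1" "q \<ge> 1"
 defines "A \<equiv> {1..int (p + q)}" and "P \<equiv> {1..int p}" and "Q \<equiv> {int p + 1..int (p + q)}"
 shows "(\<Sum>(\<U>, S)\<in>PS' p q - {({A}, tau2 p q)}. \<Phi> (nontrivial_block \<U> S) S)
  = (\<Sum>S\<in>S_disc_nc p q - {tau2 p q}. \<Sum>C | C \<in> cycle_blocks A S \<and> C \<subseteq> P. \<Sum>D | D \<in> cycle_blocks A S \<and> D \<subseteq> Q. \<Phi> (C \<union> D) S)"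
proof -
 have fA: "finite A" by (simp add: A_def)
 have PQ: "P \<inter> Q = {}" by (auto simp: P_def Q_def)
 let ?b1 = "\<lambda>S. {C. C \<in> cycle_blocks A S \<and> C \<subseteq> P}" and ?b2 = "\<lambda>S. {D. D \<in> cycle_blocks A S \<and> D \<subseteq> Q}"
 have fb: "finite (?b1 S)" "finite (?b2 S)" for S using fA by (simp_all add: cycle_blocks_def)
 have fS: "finite (S_disc_nc p q - {tau2 p q})"
  by (rule finite_Diff, rule finite_subset[OF _ finite_permutations[OF fA]]) (auto simp: S_disc_nc_def A_def)
 have sub: "(C \<union> D) \<inter> P = C" "(C \<union> D) \<inter> Q = D" if "C \<subseteq> P" "D \<subseteq> Q" for C D using that PQ by blast+
 have "(\<Sum>S\<in>S_disc_nc p q - {tau2 p q}. \<Sum>C\<in>?b1 S. \<Sum>D\<in>?b2 S. \<Phi> (C \<union> D) S)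
   = (\<Sum>(S, C, D)\<in>(SIGMA S : S_disc_nc p q - {tau2 p q}. ?b1 S \<times> ?b2 S). \<Phi> (C \<union> D) S)"
  using fS fb by (simp add: sum.Sigma sum.cartesian_product split_def)
 also have "... = (\<Sum>(\<U>, S)\<in>PS' p q - {({A}, tau2 p q)}. \<Phi> (nontrivial_block \<U> S) S)"
 proof (rule sum.reindex_bij_witness[where
    i = "\<lambda>(\<U>, S). (S, nontrivial_block \<U> S \<inter> P, nontrivial_block \<U> S \<inter> Q)" and
    j = "\<lambda>(S, C, D). (insert (C \<union> D) (cycle_blocks A S - {C, D}), S)"])
  fix z assume "z \<in> (SIGMA S : S_disc_nc p q - {tau2 p q}. ?b1 S \<times> ?b2 S)"
  then obtain S C D where z: "z = (S, C, D)" and s: "S \<in> S_disc_nc p q" "S \<noteq> tau2 p q"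
   and CD: "C \<in> cycle_blocks A S" "D \<in> cycle_blocks A S" "C \<subseteq> P" "D \<subseteq> Q" by blast
  note f = PS'_form[OF assms(1,2) s(1), folded A_def P_def Q_def, OF CD]
  show "(case case z of (S, C, D) => (insert (C \<union> D) (cycle_blocks A S - {C, D}), S) of
    (\<U>, S) => (S, nontrivial_block \<U> S \<inter> P, nontrivial_block \<U> S \<inter> Q)) = z"
   unfolding z prod.case f(2) sub[OF CD(3,4)] ..
  show "(case z of (S, C, D) => (insert (C \<union> D) (cycle_blocks A S - {C, D}), S)) \<in> PS' p q - {({A}, tau2 p q)}"
   unfolding z prod.case using f(1) s(2) by simp
  show "(case case z of (S, C, D) => (insert (C \<union> D) (cycle_blocks A S - {C, D}), S) of
    (\<U>, S) => \<Phi> (nontrivial_block \<U> S) S) = (case z of (S, C, D) => \<Phi> (C \<union> D) S)"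
   unfolding z prod.case f(2) ..
 next
  fix y assume y: "y \<in> PS' p q - {({A}, tau2 p q)}"
  obtain \<U> S where U: "y = (\<U>, S)" by (cases y) simp
  have PS: "(\<U>, S) \<in> PS' p q" and ne: "\<not> (\<U> = {A} \<and> S = tau2 p q)" using y unfolding U by auto
  have s: "S \<in> S_disc_nc p q" using PS by (simp add: PS'_def)
  obtain C D where CD: "C \<in> cycle_blocks A S" "D \<in> cycle_blocks A S" "nontrivial_block \<U> S = C \<union> D"
   "nontrivial_block \<U> S \<inter> P = C" "nontrivial_block \<U> S \<inter> Q = D" "C \<subseteq> P" "D \<subseteq> Q" "C \<union> D \<in> \<U>"
   using nontrivial_block_PS'[OF PS] unfolding A_def P_def Q_def by metis
  note f = PS'_form(3)[OF assms(1,2) s, folded A_def P_def Q_def, OF CD(1,2,6,7) PS CD(3)]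
  show "(case case y of (\<U>, S) => (S, nontrivial_block \<U> S \<inter> P, nontrivial_block \<U> S \<inter> Q) of
    (S, C, D) => (insert (C \<union> D) (cycle_blocks A S - {C, D}), S)) = y" unfolding U prod.case CD(4,5) f[symmetric] ..
  \<comment> \<open>Over \<open>tau2\<close> there is only one choice of marked cycles, and it gives
    the one-block partition. So removing the top index is the same as removing
    \<open>tau2\<close>.\<close>
  have "S \<noteq> tau2 p q" proof
   assume t: "S = tau2 p q"
   have b: "cycle_blocks A S = {P, Q}" unfolding t A_def P_def Q_def by (rule tau2_cycles(3)[OF assms(1,2)])
   have "P \<noteq> {}" "Q \<noteq> {}" using assms(1,2) by (auto simp: P_def Q_def)
   hence "C = P" "D = Q" using CD(1,2,6,7) PQ unfolding b by blast+
   moreover have "A = P \<union> Q" unfolding A_def P_def Q_def by (rule interval_split)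
   ultimately have "\<U> = {A}" using f unfolding b by simp
   thus False using ne t by blast
  qed
  thus "(case y of (\<U>, S) => (S, nontrivial_block \<U> S \<inter> P, nontrivial_block \<U> S \<inter> Q)) \<in>
    (SIGMA S : S_disc_nc p q - {tau2 p q}. ?b1 S \<times> ?b2 S)" unfolding U prod.case CD(4,5) using s CD(1,2,6,7) by simp
 qed
 finally show ?thesis by simp
qed


section \<open>Second-order limits\<close>

lemma (in limit_system) weighted_tendsto_zero:
 assumes "\<And>R. R \<in> T ==> d R \<noteq> 0" "\<And>R. R \<in> T ==> bdd F (f R)"
 shows "((\<lambda>N. \<Sum>R\<in>T. eps N ^ d R * f R N) \<longlongrightarrow> 0) F" proof (rule tendsto_null_sum)
 fix R assume r: "R \<in> T"
 have "((\<lambda>N. eps N ^ d R :: complex) \<longlongrightarrow> 0) F"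
  using weight_tendsto[of "d R"] assms(1)[OF r] by (simp add: zero_power)
 thus "((\<lambda>N. eps N ^ d R * f R N) \<longlongrightarrow> 0) F" by (rule tendsto_zero_mult_bdd) (rule assms(2)[OF r])
qed

lemma odd_bij_comp: "odd_bij F ==> odd_bij G ==> odd_bij (F \<circ> G)"
 unfolding odd_bij_def by (simp add: bij_comp)

lemma relabel_comp:
 assumes "bij F" "bij G" shows "relabel F (relabel G r) = relabel (F \<circ> G) r"
 unfolding relabel_def o_inv_distrib[OF assms] by (simp only: comp_assoc)

lemma sum_reindex_pairs:
 fixes h :: "'b => 'b => complex" and k :: "'b => complex"
 assumes "inj_on u \<C>" "inj_on u \<D>"
 shows "(\<Sum>a\<in>u ` \<C>. (\<Sum>b\<in>u ` \<D>. h a b * (\<Prod>d\<in>u ` \<D> - {b}. k d)) * (\<Prod>d\<in>u ` \<C> - {a}. k d))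
  = (\<Sum>C\<in>\<C>. (\<Sum>D\<in>\<D>. h (u C) (u D) * (\<Prod>d\<in>\<D> - {D}. k (u d))) * (\<Prod>d\<in>\<C> - {C}. k (u d)))"
proof -
 have e: "(\<Prod>d\<in>u ` \<E> - {u E}. k d) = (\<Prod>d\<in>\<E> - {E}. k (u d))" if "inj_on u \<E>" "E \<in> \<E>" for \<E> E
 proof -
  have "u ` \<E> - {u E} = u ` (\<E> - {E})" using that by (auto simp: inj_on_def)
  moreover have "inj_on u (\<E> - {E})" using that(1) by (rule inj_on_subset) blast
  ultimately show ?thesis by (simp add: prod.reindex)
 qed
 show ?thesis unfolding sum.reindex[OF assms(1)] sum.reindex[OF assms(2)] comp_def
  by (intro sum.cong refl arg_cong2[where f = "(*)"] e assms)
qed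

text \<open>The derivation rule on both circles gives a sum over marked pairs of cycles. As v
  differs from \<open>tau2\<close>, a marked pair covers fewer than p + q indices, so its limit is
  already known.\<close>

lemma (in limit_system) pair_limit_S_disc:
 assumes IJ: "I \<union> J \<subseteq> A" "I \<inter> J = {}" and pq: "p \<ge> 1" "q \<ge> 1" and v: "v \<in> S_disc_nc p q" "v \<noteq> tau2 p q"
  and G: "odd_bij G" "G ` pm {1..int (p + q)} = pm (I \<union> J)" "G ` pm {1..int p} = pm I"
  and IH: "\<And>I J \<pi> a b. card (I \<union> J) < p + q ==> I \<union> J \<subseteq> A ==> I \<inter> J = {} ==> \<pi> \<in> PM (I \<union> J) ==>
   a \<in> pm I ==> abs ` orbit \<pi> a = I ==> b \<in> pm J ==> abs ` orbit \<pi> b = J ==>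
   ((\<lambda>N. of_nat N ^ 2 * K2 I J \<pi> N) \<longlongrightarrow>
    second_order_free_cumulant \<phi>\<^sub>1 tp \<phi>\<^sub>2 (map X (support \<pi> a)) (map X (support \<pi> b))) F"
 defines "zs \<equiv> map (\<lambda>i. X (G i)) [1..int (p + q)]" and "B \<equiv> {1..int (p + q)}"
 defines "k \<equiv> \<lambda>C. free_cumulant \<phi>\<^sub>1 (map (entry zs) (support v (Min C)))"
 shows "((\<lambda>N. of_nat N ^ 2 * K2 I J (relabel G (dbl v)) N) \<longlongrightarrow>
  (\<Sum>C | C \<in> cycle_blocks B v \<and> C \<subseteq> {1..int p}. \<Sum>D | D \<in> cycle_blocks B v \<and> D \<subseteq> {int p + 1..int (p + q)}.
    free_cumulant_perm \<phi>\<^sub>1 (B - (C \<union> D)) v zs *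
    second_order_free_cumulant \<phi>\<^sub>1 tp \<phi>\<^sub>2 (map (entry zs) (support v (Min C))) (map (entry zs) (support v (Min D))))) F"
proof -
 let ?P = "{1..int p}" and ?Q = "{int p + 1..int (p + q)}" and ?g = "relabel G (dbl v)"
 let ?\<C> = "{C. C \<in> cycle_blocks B v \<and> C \<subseteq> ?P}" and ?\<D> = "{D. D \<in> cycle_blocks B v \<and> D \<subseteq> ?Q}"
 let ?u = "\<lambda>C. G (Min C)"
 let ?sofc = "second_order_free_cumulant \<phi>\<^sub>1 tp \<phi>\<^sub>2"
 have ix: "ix_set (I \<union> J)" by (rule ix_A[OF IJ(1)])
 have ixB: "ix_set B" "ix_set ?P" "ix_set ?Q" by (simp_all add: B_def)
 have s: "v permutes B" using v(1) by (simp add: S_disc_nc_def B_def)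
 have fB: "finite B" by (simp add: B_def)
 have ps: "permutation v" by (rule perm_perm[OF s fB])
 note bl = cycle_blocks_block[OF s ps fB] and dj = cycle_blocks_disjoint[OF s fB]
 have PQ: "?P \<inter> ?Q = {}" by auto
 have part: "\<Union>(cycle_blocks B v) = B" using partition_on_cycle_blocks[OF s fB] by (simp add: partition_on_def)
 have CD: "C \<subseteq> ?P \<or> C \<subseteq> ?Q" if "C \<in> cycle_blocks B v" for C
  using S_disc_nc_cycles[OF pq v(1)] that unfolding B_def by blast
 have BPQ: "B = ?P \<union> ?Q" unfolding B_def by (rule interval_split)
 have UP: "\<Union>?\<C> = ?P" "\<Union>?\<D> = ?Q" proof -
  have "x \<in> \<Union>?\<C>" if x: "x \<in> ?P" for x proof -
   have "x \<in> B" using x unfolding BPQ by blast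
   hence "x \<in> \<Union>(cycle_blocks B v)" unfolding part .
   then obtain C where C: "C \<in> cycle_blocks B v" "x \<in> C" by blast
   hence "C \<subseteq> ?P" using CD[OF C(1)] x PQ by blast
   thus ?thesis using C by blast
  qed
  thus "\<Union>?\<C> = ?P" by blast
  have "x \<in> \<Union>?\<D>" if x: "x \<in> ?Q" for x proof -
   have "x \<in> B" using x unfolding BPQ by blast
   hence "x \<in> \<Union>(cycle_blocks B v)" unfolding part .
   then obtain C where C: "C \<in> cycle_blocks B v" "x \<in> C" by blast
   hence "C \<subseteq> ?Q" using CD[OF C(1)] x PQ by blast
   thus ?thesis using C by blast
  qed
  thus "\<Union>?\<D> = ?Q" by blast
 qed
 note b = odd_bijD(1)[OF G(1)]
 have injG: "inj_on G T" for T by (rule inj_on_subset[OF bij_is_inj[OF b] subset_UNIV])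
 have sub: "?\<C> \<subseteq> cycle_blocks B v" "?\<D> \<subseteq> cycle_blocks B v" by blast+
 note tC = transversal_dbl[OF s ixB(1) sub(1)] and tD = transversal_dbl[OF s ixB(1) sub(2)]
 have ixIJ: "ix_set I" "ix_set J" using ix by simp_all
 have GQ: "G ` pm ?Q = pm J" proof -
  have "pm ?Q = pm B - pm ?P" using signed_set_disjoint[OF ixB(2,3) PQ] unfolding BPQ signed_set_Un by blast
  hence "G ` pm ?Q = pm (I \<union> J) - pm I"
   using image_set_diff[OF bij_is_inj[OF b], of "pm B" "pm ?P"] G(2,3) unfolding B_def by simp
  thus ?thesis using signed_set_disjoint[OF ixIJ IJ(2)] unfolding signed_set_Un by blast
 qed
 have aI: "(\<lambda>x. \<bar>G x\<bar>) ` ?P = I" "(\<lambda>x. \<bar>G x\<bar>) ` ?Q = J"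
  by (rule abs_image_relabel[OF G(1,3) ixB(2) ixIJ(1)], rule abs_image_relabel[OF G(1) GQ ixB(3) ixIJ(2)])
 have R: "transv I ?g (G ` Min ` ?\<C>)" using transversal_relabel[OF tC(1) G(1)] ixB(2) unfolding UP(1) aI(1) by blast
 have S: "transv J ?g (G ` Min ` ?\<D>)" using transversal_relabel[OF tD(1) G(1)] ixB(3) unfolding UP(2) aI(2) by blast
 have g: "?g \<in> PM (I \<union> J)" by (rule relabel_PM[OF G(1,2) dbl_PM[OF s[unfolded B_def]]]) simp
 have "1 \<in> \<Union>?\<C>" "int p + 1 \<in> \<Union>?\<D>" unfolding UP using pq by simp_all
 hence ne: "G ` Min ` ?\<C> \<noteq> {}" "G ` Min ` ?\<D> \<noteq> {}" by blast+
 have oC: "orbit ?g (?u C) = G ` C" if "C \<in> cycle_blocks B v" for C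
  unfolding relabel_orbit[OF b] using transversal_dbl(4)[OF s ixB(1) subset_refl that] by simp
 have w: "map X (support ?g (?u C)) = map (entry zs) (support v (Min C))" if "C \<in> cycle_blocks B v" for C
  unfolding zs_def by (rule relabel_word[OF G(1) s[unfolded B_def] that[unfolded B_def]])
 have lim: "((\<lambda>N. of_nat N ^ 2 * K2 (abs ` orbit ?g x) (abs ` orbit ?g y) (res (abs ` orbit ?g x \<union> abs ` orbit ?g y) ?g) N) \<longlongrightarrow>
   ?sofc (map X (support ?g x)) (map X (support ?g y))) F" if xy: "x \<in> G ` Min ` ?\<C>" "y \<in> G ` Min ` ?\<D>" for x y
 proof -
  obtain C D where C: "x = ?u C" "C \<in> cycle_blocks B v" "C \<subseteq> ?P" and D: "y = ?u D" "D \<in> cycle_blocks B v" "D \<subseteq> ?Q"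
   using xy by blast
  let ?J1 = "abs ` orbit ?g x" and ?J2 = "abs ` orbit ?g y"
  have x: "x \<in> pm I" "y \<in> pm J" using trans_in[OF R xy(1)] trans_in[OF S xy(2)] .
  hence x': "x \<in> pm (I \<union> J)" "y \<in> pm (I \<union> J)" by (simp_all add: signed_set_Un)
  have J1: "?J1 \<subseteq> I" "?J2 \<subseteq> J" using R S xy unfolding transv_def by blast+
  have J: "?J1 \<union> ?J2 \<subseteq> A" "?J1 \<inter> ?J2 = {}" "?J1 \<union> ?J2 \<subseteq> I \<union> J" using J1 IJ by blast+
  note c1 = cycle_idx[OF g ix x'(1)] and c2 = cycle_idx[OF g ix x'(2)]
  have st: "sstable (?J1 \<union> ?J2) ?g" by (rule stable_join[OF c1(2) c2(2)])
  have m: "x \<in> pm (?J1 \<union> ?J2)" "y \<in> pm (?J1 \<union> ?J2)" using c1(3) c2(3) unfolding signed_set_Un by blast+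
  let ?r = "res (?J1 \<union> ?J2) ?g"
  have o: "orbit ?r x = orbit ?g x" "orbit ?r y = orbit ?g y" by (rule orbit_res[OF st m(1)], rule orbit_res[OF st m(2)])
  have "card (?J1 \<union> ?J2) \<le> card C + card D" proof -
   have "card ?J1 \<le> card C" "card ?J2 \<le> card D"
    unfolding C(1) D(1) oC[OF C(2)] oC[OF D(2)] image_image using bl(3)[OF C(2)] bl(3)[OF D(2)] by (simp_all add: card_image_le)
   thus ?thesis using card_Un_le[of ?J1 ?J2] by linarith
  qed
  \<comment> \<open>The bound behind the termination of the second-order recursion also drives this
    induction.\<close>
  also have "... < p + q" proof -
   note f = PS'_form[OF pq v(1), folded B_def, OF C(2) D(2) C(3) D(3)]
   have "(insert (C \<union> D) (cycle_blocks B v - {C, D}), v) \<in> PS' p q - {({{1..int (p + q)}}, tau2 p q)}"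
    using f(1) v(2) by simp
   from PS'_cycle_length[OF this] have "length (support v (Min ((C \<union> D) \<inter> ?P))) + length (support v (Min ((C \<union> D) \<inter> ?Q))) < p + q"
    unfolding f(2) .
   moreover have "(C \<union> D) \<inter> ?P = C" "(C \<union> D) \<inter> ?Q = D" using C(3) D(3) PQ by blast+
   ultimately show ?thesis using length_support_Min[OF s fB C(2)] length_support_Min[OF s fB D(2)] by simp
  qed
  finally have "((\<lambda>N. of_nat N ^ 2 * K2 ?J1 ?J2 ?r N) \<longlongrightarrow> ?sofc (map X (support ?r x)) (map X (support ?r y))) F"
   by (intro IH J(1,2) res_PM[OF g ix J(3) st] c1(3) c2(3)) (simp_all only: o)
  thus ?thesis unfolding support_res[OF st m(1)] support_res[OF st m(2)] .
 qed
 have inj: "inj_on ?u ?\<C>" "inj_on ?u ?\<D>" using comp_inj_on[OF tC(2) injG] comp_inj_on[OF tD(2) injG] by (simp_all add: comp_def)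
 have img: "G ` Min ` \<E> = ?u ` \<E>" for \<E> by (simp add: image_image)
 have "((\<lambda>N. of_nat N ^ 2 * K2 I J ?g N) \<longlongrightarrow>
  (\<Sum>x\<in>?u ` ?\<C>. (\<Sum>y\<in>?u ` ?\<D>. ?sofc (map X (support ?g x)) (map X (support ?g y)) * (\<Prod>d\<in>?u ` ?\<D> - {y}. ccum ?g d))
   * (\<Prod>d\<in>?u ` ?\<C> - {x}. ccum ?g d))) F"
  using K2_tendsto_pairs[where h = "\<lambda>x y. ?sofc (map X (support ?g x)) (map X (support ?g y))", OF IJ g R ne(1) S ne(2) lim]
  unfolding img .
 moreover have "(\<Sum>C\<in>?\<C>. (\<Sum>D\<in>?\<D>. ?sofc (map X (support ?g (?u C))) (map X (support ?g (?u D))) * (\<Prod>d\<in>?\<D> - {D}. ccum ?g (?u d)))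
   * (\<Prod>d\<in>?\<C> - {C}. ccum ?g (?u d)))
  = (\<Sum>C\<in>?\<C>. \<Sum>D\<in>?\<D>. free_cumulant_perm \<phi>\<^sub>1 (B - (C \<union> D)) v zs *
    ?sofc (map (entry zs) (support v (Min C))) (map (entry zs) (support v (Min D))))"
 proof (intro sum.cong refl)
  fix C assume C: "C \<in> ?\<C>"
  have cc: "ccum ?g (?u d) = k d" if "d \<in> cycle_blocks B v" for d unfolding ccum_def w[OF that] k_def ..
  have "?sofc (map X (support ?g (?u C))) (map X (support ?g (?u D))) * (\<Prod>d\<in>?\<D> - {D}. ccum ?g (?u d))
    * (\<Prod>d\<in>?\<C> - {C}. ccum ?g (?u d))
   = free_cumulant_perm \<phi>\<^sub>1 (B - (C \<union> D)) v zs * ?sofc (map (entry zs) (support v (Min C))) (map (entry zs) (support v (Min D)))"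
   if D: "D \<in> ?\<D>" for D
  proof -
   have CB: "C \<in> cycle_blocks B v" "D \<in> cycle_blocks B v" using C D by simp_all
   \<comment> \<open>The cycles outside the marked pair are the remaining cycles of both circles, so
     the two products of first-order cumulants combine into one.\<close>
   have blk: "cycle_blocks (B - (C \<union> D)) v = (?\<C> - {C}) \<union> (?\<D> - {D})" proof (intro equalityI subsetI)
    fix E assume "E \<in> cycle_blocks (B - (C \<union> D)) v"
    then obtain x where x: "x \<in> B" "x \<notin> C" "x \<notin> D" "E = orbit v x" by (auto simp: cycle_blocks_def)
    have "E \<in> cycle_blocks B v" using x(1,4) by (simp add: cycle_blocks_def)
    moreover have "x \<in> E" unfolding x(4) by (rule permutation_self_in_orbit[OF ps])
    ultimately show "E \<in> (?\<C> - {C}) \<union> (?\<D> - {D})" using CD[of E] x(2,3) by blast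
   next
    fix E assume E: "E \<in> (?\<C> - {C}) \<union> (?\<D> - {D})"
    hence EB: "E \<in> cycle_blocks B v" by blast
    obtain x where x: "x \<in> E" using bl(2)[OF EB] by blast
    have "E \<noteq> C" proof
     assume e: "E = C"
     hence "C \<subseteq> ?Q" using E by blast
     thus False using C x PQ unfolding e by blast
    qed
    moreover have "E \<noteq> D" proof
     assume e: "E = D"
     hence "D \<subseteq> ?P" using E by blast
     thus False using D x PQ unfolding e by blast
    qed
    ultimately have "x \<notin> C" "x \<notin> D" using dj[OF EB CB(1) x] dj[OF EB CB(2) x] by blast+
    moreover have "x \<in> B" using bl(1)[OF EB] x by blast
    moreover have "orbit v x = E" by (rule bl(4)[OF EB x])
    ultimately show "E \<in> cycle_blocks (B - (C \<union> D)) v" unfolding cycle_blocks_def by blast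
   qed
   have f: "finite ?\<C>" "finite ?\<D>" using fB by (simp_all add: cycle_blocks_def)
   have d: "(?\<C> - {C}) \<inter> (?\<D> - {D}) = {}" proof (rule ccontr)
    assume "(?\<C> - {C}) \<inter> (?\<D> - {D}) \<noteq> {}"
    then obtain E where E: "E \<in> cycle_blocks B v" "E \<subseteq> ?P" "E \<subseteq> ?Q" by blast
    hence "E = {}" using PQ by blast
    thus False using bl(2)[OF E(1)] by simp
   qed
   have "free_cumulant_perm \<phi>\<^sub>1 (B - (C \<union> D)) v zs = (\<Prod>d\<in>?\<C> - {C}. k d) * (\<Prod>d\<in>?\<D> - {D}. k d)"
    unfolding free_cumulant_perm_def blk k_def[symmetric] using f d by (intro prod.union_disjoint) simp_all
   moreover have "(\<Prod>d\<in>?\<C> - {C}. ccum ?g (?u d)) = (\<Prod>d\<in>?\<C> - {C}. k d)"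
    "(\<Prod>d\<in>?\<D> - {D}. ccum ?g (?u d)) = (\<Prod>d\<in>?\<D> - {D}. k d)" by (intro prod.cong refl cc; blast)+
   ultimately show ?thesis unfolding w[OF CB(1)] w[OF CB(2)] by (simp only: mult_ac)
  qed
  thus "(\<Sum>D\<in>?\<D>. ?sofc (map X (support ?g (?u C))) (map X (support ?g (?u D))) * (\<Prod>d\<in>?\<D> - {D}. ccum ?g (?u d)))
   * (\<Prod>d\<in>?\<C> - {C}. ccum ?g (?u d))
   = (\<Sum>D\<in>?\<D>. free_cumulant_perm \<phi>\<^sub>1 (B - (C \<union> D)) v zs *
     ?sofc (map (entry zs) (support v (Min C))) (map (entry zs) (support v (Min D))))"
   unfolding sum_distrib_right by (rule sum.cong[OF refl])
 qed
 ultimately show ?thesis unfolding sum_reindex_pairs[OF inj] by simp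
qed

text \<open>In the covariance relation for two standard circles the surviving terms are
  \<open>K2\<close> on disc permutations, known by induction except for the top one, and cumulants
  of annular premaps in both orientations, known at first order. Solving for the top term reproduces
  the recursion of the second-order free cumulant.\<close>

theorem (in limit_system) pair_cumulant_tendsto:
 assumes "I \<union> J \<subseteq> A" "I \<inter> J = {}" "\<pi> \<in> PM (I \<union> J)"
  "a \<in> pm I" "abs ` orbit \<pi> a = I" "b \<in> pm J" "abs ` orbit \<pi> b = J"
 shows "((\<lambda>N. of_nat N ^ 2 * K2 I J \<pi> N) \<longlongrightarrow>
  second_order_free_cumulant \<phi>\<^sub>1 tp \<phi>\<^sub>2 (map X (support \<pi> a)) (map X (support \<pi> b))) F" using assms
proof (induction "card (I \<union> J)" arbitrary: I J \<pi> a b rule: less_induct)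
 case less
 note IJ = less.prems(1,2) and P = less.prems(3) and a = less.prems(4,5) and b = less.prems(6,7)
 have ix: "ix_set (I \<union> J)" by (rule ix_A[OF IJ(1)])
 have ab: "a \<in> pm (I \<union> J)" "b \<in> pm (I \<union> J)" using a(1) b(1) by (simp_all add: signed_set_Un)
 define p q where "p = length (support \<pi> a)" and "q = length (support \<pi> b)"
 define B where "B = {1..int (p + q)}"
 obtain G where G: "odd_bij G" "map G [1..int p] = support \<pi> a" "map G [int p + 1..int (p + q)] = support \<pi> b"
  "G ` pm {1..int (p + q)} = pm (I \<union> J)" "G ` pm {1..int p} = pm I"
  "p \<ge> 1" "q \<ge> 1" "relabel G (dbl (tau2 p q)) = \<pi>" unfolding p_def q_def by (rule relabel_two_cycles[OF P ix IJ(2) a b])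
 note pq = G(6,7) and bG = odd_bijD(1)[OF G(1)]
 let ?H = "G \<circ> flip p q" and ?t = "tau2 p q"
 define h where "h S = relabel G (dbl S)" for S
 define h' where "h' S = relabel ?H (dbl S)" for S
 define xs ys where "xs = map X (support \<pi> a)" and "ys = map X (support \<pi> b)"
 define zs where "zs = map (\<lambda>i. X (G i)) [1..int (p + q)]"
 have upto: "[1..int (p + q)] = [1..int p] @ [int p + 1..int (p + q)]" using upto_split2[of 1 "int p" "int (p + q)"] pq by simp
 have xs: "xs = map (\<lambda>i. X (G i)) [1..int p]" "ys = map (\<lambda>i. X (G i)) [int p + 1..int (p + q)]"
  unfolding xs_def ys_def G(2,3)[symmetric] by simp_all
 have len: "length xs = p" "length ys = q" unfolding xs by simp_all
 have zs: "zs = xs @ ys" unfolding zs_def xs upto by simp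
 \<comment> \<open>Composing the labelling with \<open>flip\<close> reads the second word backwards
   and transposed, as the second annular sum requires.\<close>
 have zs': "map (\<lambda>i. X (?H i)) [1..int (p + q)] = xs @ rev (map tp ys)" proof -
  have 1: "map (\<lambda>i. X (?H i)) [1..int p] = xs" unfolding xs by (rule map_cong[OF refl]) (simp add: flip_def)
  have 2: "map (\<lambda>i. X (?H i)) [int p + 1..int (p + q)] = rev (map tp ys)" proof (rule nth_equalityI)
   show "length (map (\<lambda>i. X (?H i)) [int p + 1..int (p + q)]) = length (rev (map tp ys))" unfolding xs by simp
   fix i assume "i < length (map (\<lambda>i. X (?H i)) [int p + 1..int (p + q)])"
   hence i: "i < q" by simp
   let ?m = "int (p + q) - int i"
   have m: "?m \<in> {int p + 1..int (p + q)}" using i by simp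
   have u: "[int p + 1..int (p + q)] ! j = int p + 1 + int j" if "j < q" for j by (rule nth_upto) (use that in simp)
   have "map (\<lambda>i. X (?H i)) [int p + 1..int (p + q)] ! i = X (G (flip p q (int p + 1 + int i)))" using i u[OF i] by simp
   also have "flip p q (int p + 1 + int i) = - ?m" using i by (simp add: flip_def)
   also have "X (G (- ?m)) = tp (X (G ?m))" unfolding odd_bijD(2)[OF G(1)] proof (rule X_uminus'[OF IJ(1)])
    have "?m \<in> pm {1..int (p + q)}" using m by (simp add: signed_set_def)
    thus "G ?m \<in> pm (I \<union> J)" unfolding G(4)[symmetric] by (rule imageI)
   qed
   also have "?m = [int p + 1..int (p + q)] ! (q - Suc i)" using u[of "q - Suc i"] i by simp
   also have "tp (X (G ([int p + 1..int (p + q)] ! (q - Suc i)))) = map tp ys ! (q - Suc i)" unfolding xs using i by simp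
   also have "... = rev (map tp ys) ! i" using rev_nth[of i "map tp ys"] i len(2) by simp
   finally show "map (\<lambda>i. X (?H i)) [int p + 1..int (p + q)] ! i = rev (map tp ys) ! i" .
  qed
  show ?thesis unfolding upto map_append 1 2 ..
 qed
 have ixB: "ix_set B" "B = {1..int (p + q)}" by (simp_all add: B_def)
 have tB: "?t permutes B" unfolding B_def by (rule tau2_permutes)
 have tP: "dbl ?t \<in> PM B" by (rule dbl_PM[OF tB ixB(1)])
 have GB: "G ` pm B = pm (I \<union> J)" unfolding B_def by (rule G(4))
 have HB: "?H ` pm B = pm (I \<union> J)" unfolding image_comp[symmetric] B_def flip_signed_set by (rule G(4))
 have oH: "odd_bij ?H" by (rule odd_bij_comp[OF G(1) odd_bij_flip])
 have cIJ: "card (I \<union> J) = p + q" using card_image[OF inj_on_subset[OF bij_is_inj[OF bG] subset_UNIV], of "pm B"]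
  unfolding GB card_signed_set[OF ix] card_signed_set[OF ixB(1)] by (simp add: B_def)
 have def: "defect (I \<union> J) \<pi> (relabel G v) = defect B (dbl ?t) v" if "v \<in> PM B" for v
  using relabel_defect[OF G(1) GB ixB(1) ix tP that] unfolding G(8) .
 have stab: "sstable I (relabel G v) \<longleftrightarrow> sstable {1..int p} v" for v
  unfolding G(5)[symmetric] by (rule stable_relabel[OF bG])
 have Sd: "S_disc_nc p q \<subseteq> {S. S permutes B}" "S_ann_nc p q \<subseteq> {S. S permutes B}"
  by (auto simp: S_disc_nc_def S_ann_nc_def B_def)
 have injh: "inj_on h (S_disc_nc p q)" "inj_on h (S_ann_nc p q)" "inj_on h' (S_ann_nc p q)"
  unfolding h_def h'_def by (intro inj_on_relabel_dbl[OF _ ixB(1)] G(1) oH Sd)+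
 have sdisc: "sstable {1..int p} (dbl S)" if s: "S \<in> S_disc_nc p q" for S proof -
  have sp: "S permutes B" using s Sd by blast
  have ps: "permutation S" by (rule perm_perm[OF sp ix_finite[OF ixB(1)]])
  have sub: "{1..int p} \<subseteq> B" by (auto simp: B_def)
  show ?thesis unfolding stable_dbl_iff[OF sp ixB(1) sub] unfolding stable_def proof (rule image_subsetI)
   fix x assume x: "x \<in> {1..int p}"
   have o: "orbit S x \<in> cycle_blocks {1..int (p + q)} S" using x sub unfolding B_def cycle_blocks_def by blast
   have "x \<in> orbit S x" "S x \<in> orbit S x" by (rule permutation_self_in_orbit[OF ps], rule orbit.base)
   thus "S x \<in> {1..int p}" using S_disc_nc_cycles[OF pq s o] x by auto
  qed
 qed
 have Z1: "{v \<in> PM (I \<union> J). defect (I \<union> J) \<pi> v = 0} = h ` S_disc_nc p q" proof -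
  have "{v \<in> PM B. defect (I \<union> J) \<pi> (relabel G v) = 0} = {v \<in> PM B. defect B (dbl ?t) v = 0}" using def by auto
  thus ?thesis unfolding relabel_Collect[OF G(1) GB] using defect_zero_tau2[OF pq] unfolding B_def by (simp add: image_image h_def)
 qed
 have Z2: "{v \<in> PM (I \<union> J). \<not> sstable I v \<and> defect (I \<union> J) \<pi> v = 2} = h ` S_ann_nc p q \<union> h' ` S_ann_nc p q"
 proof -
  have "{v \<in> PM B. \<not> sstable I (relabel G v) \<and> defect (I \<union> J) \<pi> (relabel G v) = 2}
    = {v \<in> PM B. \<not> sstable {1..int p} v \<and> defect B (dbl ?t) v = 2}" using def stab by auto
  thus ?thesis unfolding relabel_Collect[OF G(1) GB] using defect_two_tau2(1)[OF pq] unfolding B_def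
   by (simp add: image_image image_Un h_def h'_def relabel_comp[OF bG odd_bijD(1)[OF odd_bij_flip]])
 qed
 have disj: "h ` S_ann_nc p q \<inter> h' ` S_ann_nc p q = {}" proof -
  have injr: "inj (relabel G)" by (rule inj_on_inverseI[where g = "relabel (pinv G)"]) (rule relabel_pinv(1)[OF bG])
  have "h ` S_ann_nc p q \<inter> h' ` S_ann_nc p q
    = relabel G ` (dbl ` S_ann_nc p q \<inter> (\<lambda>S. relabel (flip p q) (dbl S)) ` S_ann_nc p q)"
   unfolding image_Int[OF injr] image_image h_def h'_def relabel_comp[OF bG odd_bijD(1)[OF odd_bij_flip]] ..
  thus ?thesis unfolding defect_two_tau2(2)[OF pq] by simp
 qed
 have t: "?t \<in> S_disc_nc p q" "h ?t = \<pi>" using tau2_in_PS'(1)[OF pq] G(8) by (simp_all add: PS'_def h_def)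
 have fin: "finite (PM (I \<union> J))" by (rule finite_PM[OF ix])
 have finS: "finite (S_disc_nc p q)" "finite (S_ann_nc p q)"
  using finite_subset[OF Sd(1) finite_permutations] finite_subset[OF Sd(2) finite_permutations] ix_finite[OF ixB(1)] by blast+
 have stI: "sstable I \<pi>" using cycle_idx(2)[OF P ix ab(1)] unfolding a(2) .
 let ?D = "\<lambda>v. defect (I \<union> J) \<pi> v"
 have hst: "h S \<in> PM (I \<union> J)" "sstable I (h S)" "?D (h S) = 0" if "S \<in> S_disc_nc p q" for S proof -
  have "h S \<in> {v \<in> PM (I \<union> J). defect (I \<union> J) \<pi> v = 0}" unfolding Z1 using that by blast
  thus "h S \<in> PM (I \<union> J)" "?D (h S) = 0" by simp_all
  show "sstable I (h S)" unfolding h_def stab by (rule sdisc[OF that])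
 qed
 let ?T1 = "{v \<in> PM (I \<union> J). sstable I v \<and> ?D v \<noteq> 0}"
 let ?T2 = "{v \<in> PM (I \<union> J). \<not> sstable I v \<and> ?D v \<noteq> 2}"
 have split1: "(\<Sum>v | v \<in> PM (I \<union> J) \<and> sstable I v. f v)
   = f \<pi> + ((\<Sum>S\<in>S_disc_nc p q - {?t}. f (h S)) + (\<Sum>v\<in>?T1. f v))" for f :: "(int => int) => complex"
 proof -
  have e: "{v. v \<in> PM (I \<union> J) \<and> sstable I v} = h ` S_disc_nc p q \<union> ?T1" proof (intro equalityI subsetI)
   fix v assume r: "v \<in> {v. v \<in> PM (I \<union> J) \<and> sstable I v}"
   thus "v \<in> h ` S_disc_nc p q \<union> ?T1" unfolding Z1[symmetric] by blast
  next
   fix v assume "v \<in> h ` S_disc_nc p q \<union> ?T1"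
   thus "v \<in> {v. v \<in> PM (I \<union> J) \<and> sstable I v}" using hst by blast
  qed
  have d: "h ` S_disc_nc p q \<inter> ?T1 = {}" unfolding Z1[symmetric] by blast
  have fT: "finite ?T1" using fin by simp
  have "(\<Sum>v | v \<in> PM (I \<union> J) \<and> sstable I v. f v) = (\<Sum>S\<in>S_disc_nc p q. f (h S)) + (\<Sum>v\<in>?T1. f v)"
   unfolding e sum.union_disjoint[OF finite_imageI[OF finS(1)] fT d] sum.reindex[OF injh(1)] comp_def ..
  thus ?thesis unfolding sum.remove[OF finS(1) t(1)] t(2) by (simp add: add.assoc)
 qed
 have split2: "(\<Sum>v | v \<in> PM (I \<union> J) \<and> \<not> sstable I v. f v)
   = (\<Sum>S\<in>S_ann_nc p q. f (h S)) + (\<Sum>S\<in>S_ann_nc p q. f (h' S)) + (\<Sum>v\<in>?T2. f v)" for f :: "(int => int) => complex"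
 proof -
  let ?V = "{v \<in> PM (I \<union> J). \<not> sstable I v \<and> ?D v = 2}"
  have e: "{v. v \<in> PM (I \<union> J) \<and> \<not> sstable I v} = ?V \<union> ?T2" by blast
  have d: "?V \<inter> ?T2 = {}" by blast
  have fT: "finite ?V" "finite ?T2" using fin by simp_all
  show ?thesis unfolding e sum.union_disjoint[OF fT d]
   unfolding Z2 sum.union_disjoint[OF finite_imageI[OF finS(2)] finite_imageI[OF finS(2)] disj] sum.reindex[OF injh(2)] sum.reindex[OF injh(3)] comp_def ..
 qed
 let ?w = "\<lambda>d N. eps N ^ d :: complex"
 let ?K = "\<lambda>v N. of_nat N ^ 2 * K2 I J v N"
 let ?sofc = "second_order_free_cumulant \<phi>\<^sub>1 tp \<phi>\<^sub>2"
 let ?L = "\<lambda>S. \<Sum>C | C \<in> cycle_blocks B S \<and> C \<subseteq> {1..int p}. \<Sum>D | D \<in> cycle_blocks B S \<and> D \<subseteq> {int p + 1..int (p + q)}.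
    free_cumulant_perm \<phi>\<^sub>1 (B - (C \<union> D)) S zs * ?sofc (map (entry zs) (support S (Min C))) (map (entry zs) (support S (Min D)))"
 have zero1: "((\<lambda>N. \<Sum>v\<in>?T1. ?w (?D v) N * ?K v N) \<longlongrightarrow> 0) F"
  by (rule weighted_tendsto_zero[where d = ?D and f = ?K]) (simp, rule K2_bdd[OF IJ], simp_all)
 \<comment> \<open>Defect at least 2 has to be known first: for a smaller defect the natural
   subtraction would give 0 as well.\<close>
 have "?D v - 2 \<noteq> 0" if "v \<in> ?T2" for v proof -
  have stJ: "sstable J \<pi>" by (rule stable_other[OF P ix IJ(2) stI])
  have "joined v I J" by (rule not_stable_joined) (use that in auto)
  hence "2 \<le> ?D v" using defect_joined[OF P _ ix Un_upper1 Un_upper2 IJ(2) stI stJ] that by blast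
  thus ?thesis using that by simp
 qed
 hence zero2: "((\<lambda>N. \<Sum>v\<in>?T2. ?w (?D v - 2) N * c (I \<union> J) v N) \<longlongrightarrow> 0) F"
  by (rule weighted_tendsto_zero[where d = "\<lambda>v. ?D v - 2" and f = "c (I \<union> J)"]) (assumption, rule cumulant_bdd[OF IJ(1)], simp)
 have disc: "((\<lambda>N. ?w (?D (h S)) N * ?K (h S) N) \<longlongrightarrow> ?L S) F" if s: "S \<in> S_disc_nc p q - {?t}" for S
 proof -
  have s': "S \<in> S_disc_nc p q" "S \<noteq> ?t" using s by simp_all
  have "((\<lambda>N. ?K (h S) N) \<longlongrightarrow> ?L S) F" unfolding h_def zs_def B_def
  proof (rule pair_limit_S_disc[OF IJ pq s' G(1,4,5)])
   fix I' J' \<pi>' a' b'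
   assume "card (I' \<union> J') < p + q" "I' \<union> J' \<subseteq> A" "I' \<inter> J' = {}" "\<pi>' \<in> PM (I' \<union> J')"
    "a' \<in> pm I'" "abs ` orbit \<pi>' a' = I'" "b' \<in> pm J'" "abs ` orbit \<pi>' b' = J'"
   thus "((\<lambda>N. of_nat N ^ 2 * K2 I' J' \<pi>' N) \<longlongrightarrow> ?sofc (map X (support \<pi>' a')) (map X (support \<pi>' b'))) F"
    unfolding cIJ[symmetric] by (rule less.hyps)
  qed
  thus ?thesis using hst(3)[OF s'(1)] by simp
 qed
 have ann: "((\<lambda>N. ?w (?D (relabel G' (dbl S)) - 2) N * c (I \<union> J) (relabel G' (dbl S)) N)
   \<longlongrightarrow> free_cumulant_perm \<phi>\<^sub>1 B S (map (\<lambda>i. X (G' i)) [1..int (p + q)])) F"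
  if s: "S \<in> S_ann_nc p q" and G': "odd_bij G'" "G' ` pm B = pm (I \<union> J)"
   and two: "relabel G' (dbl S) \<in> h ` S_ann_nc p q \<union> h' ` S_ann_nc p q" for S G'
 proof -
  have r: "relabel G' (dbl S) \<in> PM (I \<union> J)" "?D (relabel G' (dbl S)) = 2" using two unfolding Z2[symmetric] by simp_all
  have sp: "S permutes B" using s Sd by blast
  have fB: "finite B" by (rule ix_finite[OF ixB(1)])
  let ?R = "G' ` Min ` cycle_blocks B S"
  have UB: "\<Union>(cycle_blocks B S) = B" using partition_on_cycle_blocks[OF sp fB] by (simp add: partition_on_def)
  have tr: "transv (I \<union> J) (relabel G' (dbl S)) ?R"
   using transversal_relabel[OF transversal_dbl(1)[OF sp ixB(1) subset_refl] G'(1)] ixB(1)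
   unfolding UB abs_image_relabel[OF G' ixB(1) ix] by blast
  have "1 \<in> B" using pq by (simp add: B_def)
  hence ne: "?R \<noteq> {}" by (auto simp: cycle_blocks_def)
  have "(c (I \<union> J) (relabel G' (dbl S)) \<longlongrightarrow> (\<Prod>x\<in>?R. ccum (relabel G' (dbl S)) x)) F"
   by (rule cumulant_tendsto[OF IJ(1) r(1) tr ne])
  thus ?thesis
   using prod_cycle_cumulant_relabel[OF G'(1) sp[unfolded B_def] subset_refl] unfolding r(2) free_cumulant_perm_def B_def by simp
 qed
 have ann1: "((\<lambda>N. ?w (?D (h S) - 2) N * c (I \<union> J) (h S) N) \<longlongrightarrow> free_cumulant_perm \<phi>\<^sub>1 B S (xs @ ys)) F"
  if s: "S \<in> S_ann_nc p q" for S using ann[OF s G(1) GB] s unfolding h_def[symmetric] zs_def[symmetric] zs by blast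
 have ann2: "((\<lambda>N. ?w (?D (h' S) - 2) N * c (I \<union> J) (h' S) N) \<longlongrightarrow> free_cumulant_perm \<phi>\<^sub>1 B S (xs @ rev (map tp ys))) F"
  if s: "S \<in> S_ann_nc p q" for S using ann[OF s oH HB] s unfolding h'_def[symmetric] zs' by blast
 have cov: "((\<lambda>N. of_nat N ^ 2 * (E (I \<union> J) \<pi> N - E I (res I \<pi>) N * E J (res J \<pi>) N)) \<longlongrightarrow> \<phi>\<^sub>2 (prod_list xs) (prod_list ys)) F"
  unfolding xs_def ys_def by (rule two_cycle_covariance[OF IJ P a b])
 let ?X1 = "\<lambda>N. (\<Sum>S\<in>S_disc_nc p q - {?t}. ?w (?D (h S)) N * ?K (h S) N) + (\<Sum>v\<in>?T1. ?w (?D v) N * ?K v N)"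
 let ?X2 = "\<lambda>N. (\<Sum>S\<in>S_ann_nc p q. ?w (?D (h S) - 2) N * c (I \<union> J) (h S) N)
   + (\<Sum>S\<in>S_ann_nc p q. ?w (?D (h' S) - 2) N * c (I \<union> J) (h' S) N) + (\<Sum>v\<in>?T2. ?w (?D v - 2) N * c (I \<union> J) v N)"
 let ?cov = "\<lambda>N. of_nat N ^ 2 * (E (I \<union> J) \<pi> N - E I (res I \<pi>) N * E J (res J \<pi>) N)"
 have L1: "(?X1 \<longlongrightarrow> (\<Sum>S\<in>S_disc_nc p q - {?t}. ?L S) + 0) F" by (intro tendsto_add tendsto_sum disc zero1)
 have L2: "(?X2 \<longlongrightarrow> (\<Sum>S\<in>S_ann_nc p q. free_cumulant_perm \<phi>\<^sub>1 B S (xs @ ys))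
   + (\<Sum>S\<in>S_ann_nc p q. free_cumulant_perm \<phi>\<^sub>1 B S (xs @ rev (map tp ys))) + 0) F"
  by (intro tendsto_add tendsto_sum ann1 ann2 zero2)
 have L: "((\<lambda>N. ?cov N - ?X1 N - ?X2 N) \<longlongrightarrow> \<phi>\<^sub>2 (prod_list xs) (prod_list ys) - ((\<Sum>S\<in>S_disc_nc p q - {?t}. ?L S) + 0)
   - ((\<Sum>S\<in>S_ann_nc p q. free_cumulant_perm \<phi>\<^sub>1 B S (xs @ ys))
   + (\<Sum>S\<in>S_ann_nc p q. free_cumulant_perm \<phi>\<^sub>1 B S (xs @ rev (map tp ys))) + 0)) F"
  by (rule tendsto_diff[OF tendsto_diff[OF cov L1] L2])
 have ev: "eventually (\<lambda>N. ?cov N - ?X1 N - ?X2 N = ?K \<pi> N) F" using covariance_eq[OF IJ] proof eventually_elim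
  case (elim N)
  have "?cov N = (?w (?D \<pi>) N * ?K \<pi> N + ?X1 N) + ?X2 N" using mp[OF bspec[OF elim P] stI]
   unfolding split1[of "\<lambda>v. ?w (?D v) N * ?K v N"] split2[of "\<lambda>v. ?w (?D v - 2) N * c (I \<union> J) v N"] .
  thus ?case using defect_self[OF P ix] by simp
 qed
 define \<Phi> where "\<Phi> U S = free_cumulant_perm \<phi>\<^sub>1 (B - U) S zs *
   ?sofc (map (entry zs) (support S (Min (U \<inter> {1..int p})))) (map (entry zs) (support S (Min (U \<inter> {int p + 1..int (p + q)}))))" for U S
 have \<Phi>: "(\<Sum>(\<U>, S)\<in>PS' p q - {({{1..int (p + q)}}, tau2 p q)}. \<Phi> (nontrivial_block \<U> S) S) = (\<Sum>S\<in>S_disc_nc p q - {?t}. ?L S)"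
  unfolding sum_PS'[OF pq] unfolding B_def
 proof (intro sum.cong refl)
  fix S C D
  assume "C \<in> {C. C \<in> cycle_blocks {1..int (p + q)} S \<and> C \<subseteq> {1..int p}}"
   "D \<in> {D. D \<in> cycle_blocks {1..int (p + q)} S \<and> D \<subseteq> {int p + 1..int (p + q)}}"
  hence "C \<subseteq> {1..int p}" "D \<subseteq> {int p + 1..int (p + q)}" by simp_all
  hence "(C \<union> D) \<inter> {1..int p} = C" "(C \<union> D) \<inter> {int p + 1..int (p + q)} = D" by fastforce+
  thus "\<Phi> (C \<union> D) S = free_cumulant_perm \<phi>\<^sub>1 ({1..int (p + q)} - (C \<union> D)) S zs
    * ?sofc (map (entry zs) (support S (Min C))) (map (entry zs) (support S (Min D)))" unfolding \<Phi>_def B_def by (simp only:)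
 qed
 have sofc: "?sofc xs ys = \<phi>\<^sub>2 (prod_list xs) (prod_list ys)
   - (\<Sum>S\<in>S_ann_nc p q. free_cumulant_perm \<phi>\<^sub>1 B S (xs @ ys))
   - (\<Sum>S\<in>S_ann_nc p q. free_cumulant_perm \<phi>\<^sub>1 B S (xs @ rev (map tp ys)))
   - (\<Sum>S\<in>S_disc_nc p q - {?t}. ?L S)"
  unfolding \<Phi>[symmetric] unfolding \<Phi>_def zs B_def second_order_free_cumulant.simps[of \<phi>\<^sub>1 tp \<phi>\<^sub>2 xs ys] len Let_def ..
 have "\<phi>\<^sub>2 (prod_list xs) (prod_list ys) - ((\<Sum>S\<in>S_disc_nc p q - {?t}. ?L S) + 0)
   - ((\<Sum>S\<in>S_ann_nc p q. free_cumulant_perm \<phi>\<^sub>1 B S (xs @ ys))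
   + (\<Sum>S\<in>S_ann_nc p q. free_cumulant_perm \<phi>\<^sub>1 B S (xs @ rev (map tp ys))) + 0) = ?sofc xs ys"
  unfolding sofc by simp
 hence "(?K \<pi> \<longlongrightarrow> ?sofc xs ys) F" using Lim_transform_eventually[OF L ev] by (simp only:)
 thus ?case unfolding xs_def ys_def .
qed

section \<open>From the limit system to the two-vertex cumulant\<close>

lemma res_dbl:
 assumes "s permutes A" "ix_set A" "J \<subseteq> A" "s' permutes J" "\<And>x. x \<in> J ==> s' x = s x"
 shows "res J (dbl s) = dbl s'" proof
 fix x
 have ix: "ix_set J" using assms(2,3) by (rule ix_subset)
 consider "x \<in> J" | y where "x = - y" "y \<in> J" | "x \<notin> pm J" by (auto simp: signed_set_def)
 thus "res J (dbl s) x = dbl s' x" proof cases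
  case 1
  hence "0 \<le> x" by (rule ix_nonneg[OF ix])
  thus ?thesis using dbl_nonneg[OF assms(1,2)] dbl_nonneg[OF assms(4) ix] assms(5)[OF 1] 1 by (simp add: res_apply signed_set_def)
 next
  case (2 y)
  have y: "0 \<le> y" using 2(2) by (rule ix_nonneg[OF ix])
  have "pinv s' y \<in> J" using permutes_in_image[OF permutes_inv[OF assms(4)]] 2(2) by simp
  hence "s (pinv s' y) = y" using assms(5) permutes_inverses(1)[OF assms(4)] by metis
  hence "pinv s y = pinv s' y" using permutes_inverses(2)[OF assms(1)] by metis
  thus ?thesis using dbl_neg[OF assms(1,2) y] dbl_neg[OF assms(4) ix y] 2 by (simp add: res_apply signed_set_def)
 next
  case 3
  thus ?thesis using permutes_not_in[OF PM_permutes[OF dbl_PM[OF assms(4) ix]] 3] by (simp add: res_apply)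
 qed
qed

text \<open>The two single-circle cumulants belong to the restrictions of the doubled two-circle
  permutation, so the two-vertex cumulant is a value of \<open>K2\<close>.\<close>

lemma two_vertex_cumulant_eq:
 assumes "p \<ge> 1" "q \<ge> 1"
 defines "t \<equiv> dbl (tau2 p q)" and "I \<equiv> {1..int p}" and "J \<equiv> {int p + 1..int (p + q)}"
 shows "two_vertex_cumulant M N p q Y = matrix_cumulant M N (I \<union> J) t Y
  - matrix_cumulant M N I (res I t) Y * matrix_cumulant M N J (res J t) Y"
proof -
 let ?c = "cycle_of_list [int p + 1..int (p + q)]"
 have ix: "ix_set {1..int (p + q)}" by simp
 have sub: "I \<subseteq> {1..int (p + q)}" "J \<subseteq> {1..int (p + q)}" by (auto simp: I_def J_def)
 have cJ: "?c permutes J" using cycle_permutes[of "[int p + 1..int (p + q)]"] by (simp add: J_def)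
 have tI: "tau1 p permutes I" unfolding I_def by (rule tau1_permutes)
 have IJ: "I \<inter> J = {}" by (auto simp: I_def J_def)
 have "tau1 p x = tau2 p q x" if "x \<in> I" for x proof -
  have "x \<notin> J" using that IJ by blast
  hence "?c x = x" by (rule permutes_not_in[OF cJ])
  thus ?thesis by (simp add: tau1_def tau2_def)
 qed
 hence 1: "res I t = dbl (tau1 p)" unfolding t_def by (rule res_dbl[OF tau2_permutes ix sub(1) tI])
 have "?c x = tau2 p q x" if "x \<in> J" for x proof -
  have "?c x \<in> J" using that permutes_in_image[OF cJ] by simp
  hence "?c x \<notin> I" using IJ by blast
  hence "tau1 p (?c x) = ?c x" by (rule permutes_not_in[OF tI])
  thus ?thesis by (simp add: tau1_def tau2_def)
 qed
 hence 2: "res J t = dbl ?c" unfolding t_def by (rule res_dbl[OF tau2_permutes ix sub(2) cJ])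
 have "I \<union> J = {1..int (p + q)}" unfolding I_def J_def by (rule interval_split[symmetric])
 thus ?thesis unfolding 1 2 unfolding two_vertex_cumulant_def matrix_cumulant_perm_def t_def dbl_def[symmetric] I_def J_def by simp
qed

text \<open>For single cycles on I and J the covariance of the traces is their joint cumulant of
  length two, whose limit is given by the hypothesis.\<close>

lemma matrix_second_order_system:
 fixes X :: "nat => nat => 'w => complex mat" and scale :: "complex => 'a::ring_1 => 'a"
 assumes lim: "has_real_second_order_limit D M n X tp \<phi>\<^sub>1 \<phi>\<^sub>2 x"
  and prob: "\<And>N. N \<in> D ==> prob_space (M N)"
  and ncps: "real_second_order_ncps scale tp \<phi>\<^sub>1 \<phi>\<^sub>2"
 shows "limit_system (along D) {1..int n} (\<lambda>I \<pi> N. LINT w|M N. tr_perm N I \<pi> (\<lambda>k. X k N w))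
  (\<lambda>I r N. matrix_cumulant (M N) N I r (\<lambda>k. X k N)) scale tp \<phi>\<^sub>1 \<phi>\<^sub>2 (signed tp x)"
proof (intro limit_system.intro limit_system_axioms.intro)
 let ?A = "{1..int n}"
 let ?E = "\<lambda>I \<pi> N. LINT w|M N. tr_perm N I \<pi> (\<lambda>k. X k N w)"
 show "cumulant_system (along D) ?A ?E (\<lambda>I r N. matrix_cumulant (M N) N I r (\<lambda>k. X k N))"
  by (rule matrix_cumulant_system[OF lim prob])
 show "real_second_order_ncps scale tp \<phi>\<^sub>1 \<phi>\<^sub>2" by (rule ncps)
 have ixA: "ix_set ?A" by simp
 note L = second_order_limitD[OF lim]
 show "signed tp x (- k) = tp (signed tp x k)" if k: "k \<in> pm ?A" for k proof -
  have "k \<noteq> 0" using k zero_notin_signed_set[OF ixA] by blast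
  thus ?thesis using real_second_order_ncps.tp_tp[OF ncps] by (simp add: signed_def)
 qed
 let ?T = "\<lambda>\<pi> N B w. ntr (word_mat N (signed transpose_mat (\<lambda>k. X k N w)) (slot_word \<pi> B))"
 have wl: "slot_word \<pi> B \<in> lists (pm ?A)" if "\<pi> \<in> PM I" "I \<subseteq> ?A" "B \<in> pos_cycles I \<pi>" for I \<pi> B
  using slot_word_in_lists[OF that(1) ix_subset[OF ixA that(2)] that(3)] signed_set_mono[OF that(2)] by (auto simp: in_lists_conv_set)
 show "(?E I \<pi> \<longlongrightarrow> \<phi>\<^sub>1 (prod_list (map (signed tp x) (slot_word \<pi> B)))) (along D)"
  if I: "I \<subseteq> ?A" "\<pi> \<in> PM I" "pos_cycles I \<pi> = {B}" for I \<pi> B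
  using L(1)[OF wl[OF I(2,1), of B]] I(3) by (simp add: moment_self)
 fix I J \<pi> B C
 assume IJ: "I \<union> J \<subseteq> ?A" "I \<inter> J = {}" and P: "\<pi> \<in> PM (I \<union> J)" "sstable I \<pi>"
  and BC: "pos_cycles I (res I \<pi>) = {B}" "pos_cycles J (res J \<pi>) = {C}"
 have ix: "ix_set (I \<union> J)" by (rule ix_subset[OF ixA IJ(1)])
 have stJ: "sstable J \<pi>" by (rule stable_other[OF P(1) ix IJ(2) P(2)])
 note pc = pos_cycles_Un[OF P(1) ix IJ(2) P(2)]
 have ne: "B \<noteq> C" and U: "pos_cycles (I \<union> J) \<pi> = {B, C}" using pc unfolding BC by auto
 have e1: "tr_perm N I (res I \<pi>) (\<lambda>k. X k N w) = ?T \<pi> N B w" for N w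
  unfolding moment_res[OF P(1) ix Un_upper1 P(2)] BC by simp
 have e2: "tr_perm N J (res J \<pi>) (\<lambda>k. X k N w) = ?T \<pi> N C w" for N w
  unfolding moment_res[OF P(1) ix Un_upper2 stJ] BC by simp
 have e3: "tr_perm N (I \<union> J) \<pi> (\<lambda>k. X k N w) = ?T \<pi> N B w * ?T \<pi> N C w" for N w
  unfolding moment_self U using ne by simp
 have "joint_cumulant (M N) [?T \<pi> N B, ?T \<pi> N C] = ?E (I \<union> J) \<pi> N - ?E I (res I \<pi>) N * ?E J (res J \<pi>) N" for N
  using joint_cumulant_eq_set_cumulant[of "[B, C]" "M N" "?T \<pi> N"] ne unfolding e1 e2 e3 by (simp add: set_cumulant_pair)
 thus "((\<lambda>N. of_nat N ^ 2 * (?E (I \<union> J) \<pi> N - ?E I (res I \<pi>) N * ?E J (res J \<pi>) N)) \<longlongrightarrow>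
   \<phi>\<^sub>2 (prod_list (map (signed tp x) (slot_word \<pi> B))) (prod_list (map (signed tp x) (slot_word \<pi> C)))) (along D)"
  using L(2)[OF wl[OF P(1) IJ(1), of B] wl[OF P(1) IJ(1), of C]] unfolding U by simp
qed

lemma map_signed_upto:
 "map (signed t x) [int a + 1..int (a + b)] = map x [a + 1..<a + b + 1]"
proof (rule nth_equalityI)
 fix i assume "i < length (map (signed t x) [int a + 1..int (a + b)])"
 hence i: "i < b" by simp
 have "[int a + 1..int (a + b)] ! i = int a + 1 + int i" by (rule nth_upto) (use i in simp)
 moreover have "nat (int a + 1 + int i) = a + 1 + i" by simp
 ultimately show "map (signed t x) [int a + 1..int (a + b)] ! i = map x [a + 1..<a + b + 1] ! i"
  using i by (simp add: signed_def del: upt_Suc)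
qed simp

theorem proposition4p19:
  fixes p q :: nat
    and D :: "nat set"
    and M :: "nat \<Rightarrow> 'w measure"
    and X :: "nat \<Rightarrow> nat \<Rightarrow> 'w \<Rightarrow> complex mat"
    and scale :: "complex \<Rightarrow> 'a::ring_1 \<Rightarrow> 'a"
    and tp :: "'a \<Rightarrow> 'a"
    and \<phi>\<^sub>1 :: "'a \<Rightarrow> complex"
    and \<phi>\<^sub>2 :: "'a \<Rightarrow> 'a \<Rightarrow> complex"
    and x :: "nat \<Rightarrow> 'a"
  assumes "p \<ge> 1" and "q \<ge> 1"
    and "infinite D" and "0 \<notin> D"
    and "\<And>N. N \<in> D \<Longrightarrow> prob_space (M N)"
    and "\<And>k N. k \<in> {1..p + q} \<Longrightarrow> N \<in> D \<Longrightarrow> random_matrix (M N) N (X k N)"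
    and "real_second_order_ncps scale tp \<phi>\<^sub>1 \<phi>\<^sub>2"
    and "has_real_second_order_limit D M (p + q) X tp \<phi>\<^sub>1 \<phi>\<^sub>2 x"
  shows "((\<lambda>N. of_nat N ^ 2 * two_vertex_cumulant (M N) N p q (\<lambda>k. X k N))
           \<longlongrightarrow> second_order_free_cumulant \<phi>\<^sub>1 tp \<phi>\<^sub>2 (map x [1..<p + 1]) (map x [p + 1..<p + q + 1]))
         (along D)"
proof -
 let ?A = "{1..int (p + q)}" and ?I = "{1..int p}" and ?J = "{int p + 1..int (p + q)}"
 let ?t = "dbl (tau2 p q)"
 interpret S: limit_system "along D" ?A "\<lambda>I \<pi> N. LINT \<omega>|M N. tr_perm N I \<pi> (\<lambda>k. X k N \<omega>)"
  "\<lambda>I \<rho> N. matrix_cumulant (M N) N I \<rho> (\<lambda>k. X k N)" scale tp \<phi>\<^sub>1 \<phi>\<^sub>2 "signed tp x"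
  by (rule matrix_second_order_system[OF assms(8,5,7)])
 have ix: "ix_set ?A" by simp
 have m: "1 \<in> ?A" "int p + 1 \<in> ?A" "1 \<in> ?I" "int p + 1 \<in> ?J" using assms(1,2) by simp_all
 have U: "?I \<union> ?J = ?A" by (rule interval_split[symmetric])
 have P: "?t \<in> PM (?I \<union> ?J)" unfolding U by (rule dbl_PM[OF tau2_permutes ix])
 have pt: "permutation (tau2 p q)" by (rule perm_perm[OF tau2_permutes]) simp
 have s: "support ?t 1 = [1..int p]" "support ?t (int p + 1) = [int p + 1..int (p + q)]"
  using support_dbl[OF tau2_permutes ix m(1)] support_dbl[OF tau2_permutes ix m(2)] tau2_cycles(1,2)[OF assms(1,2)] by simp_all
 have "orbit ?t 1 = ?I" "orbit ?t (int p + 1) = ?J"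
  unfolding orbit_dbl[OF tau2_permutes ix m(1)] orbit_dbl[OF tau2_permutes ix m(2)] set_support[OF pt, symmetric]
   tau2_cycles(1,2)[OF assms(1,2)] by simp_all
 hence o: "abs ` orbit ?t 1 = ?I" "abs ` orbit ?t (int p + 1) = ?J" by (force simp: image_iff)+
 have w: "map (signed tp x) (support ?t 1) = map x [1..<p + 1]" "map (signed tp x) (support ?t (int p + 1)) = map x [p + 1..<p + q + 1]"
  unfolding s using map_signed_upto[of tp x 0 p] map_signed_upto[of tp x p q] by simp_all
 have "((\<lambda>N. of_nat N ^ 2 * S.K2 ?I ?J ?t N) \<longlongrightarrow>
   second_order_free_cumulant \<phi>\<^sub>1 tp \<phi>\<^sub>2 (map (signed tp x) (support ?t 1)) (map (signed tp x) (support ?t (int p + 1)))) (along D)"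
 proof (rule S.pair_cumulant_tendsto[OF _ _ P _ o(1) _ o(2)])
  show "?I \<union> ?J \<subseteq> ?A" unfolding U ..
  show "?I \<inter> ?J = {}" by auto
  show "1 \<in> pm ?I" "int p + 1 \<in> pm ?J" using m(3,4) by (simp_all add: signed_set_def)
 qed
 thus ?thesis unfolding w S.K2_def two_vertex_cumulant_eq[OF assms(1,2)] .
qed

end
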